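(* There is an absolute constant $C>0$ such that for every integer $n\ge 1$ and every real $x$ with $0\le x\le n/8$, \[ |f_n(x)|\le C\,(1+\log^2 n)\, n^{1/4}(1+x)^{-1/4}. \]
   Context: The Fourier transform is $\widehat{f}(\xi)=\int_{-\infty}^{\infty}f(x)e^{-2\pi i\xi x}\,dx$. For each integer $n\ge 0$, let $b_n^+$ denote the unique even Schwartz function $\mathbb{R}\to\mathbb{R}$ such that $\widehat{b_n^+}=b_n^+$ and $b_n^+(\sqrt{m})=\delta_{n,m}$ for all integers $m\ge 0$ (such a function exists and is unique, by work of Radchenko and Viazovska). The function $x\mapsto b_n^+(\sqrt{x})$, $x\ge 0$, extends (uniquely) to an entire function of exponential type $\pi$; $f_n$ denotes this entire function. In particular $f_n(m)=\delta_{n,m}$ for integers $m\ge 0$. *)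

theory Defs
  imports "HOL-Complex_Analysis.Complex_Analysis"
begin

definition schwartz :: "(real \<Rightarrow> real) \<Rightarrow> bool" where
  "schwartz f \<longleftrightarrow>
     (\<forall>k x. (deriv ^^ k) f differentiable (at x)) \<and>
     (\<forall>j k. bounded (range (\<lambda>x. x ^ j * (deriv ^^ k) f x)))"

definition fourier_transform :: "(real \<Rightarrow> complex) \<Rightarrow> real \<Rightarrow> complex" where
  "fourier_transform f \<xi> =
     (LBINT x. f x * exp (- 2 * complex_of_real pi * \<i> * complex_of_real (\<xi> * x)))"

(* The defining properties of b_n^+. That exactly one such function exists for every n is the
   theorem of Radchenko and Viazovska, so these properties determine b. *)
definition interpolation_basis_plus :: "nat \<Rightarrow> (real \<Rightarrow> real) \<Rightarrow> bool" where
  "interpolation_basis_plus n b \<longleftrightarrow>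
     schwartz b \<and>
     (\<forall>x. b (- x) = b x) \<and>
     fourier_transform (\<lambda>x. complex_of_real (b x)) = (\<lambda>\<xi>. complex_of_real (b \<xi>)) \<and>
     (\<forall>m::nat. b (sqrt (real m)) = (if m = n then 1 else 0))"

(* "Of exponential type tau" in the usual sense of type at most tau. *)
definition entire_exponential_type :: "real \<Rightarrow> (complex \<Rightarrow> complex) \<Rightarrow> bool" where
  "entire_exponential_type \<tau> f \<longleftrightarrow>
     f holomorphic_on UNIV \<and>
     (\<forall>\<epsilon>>0. \<exists>A. \<forall>z. norm (f z) \<le> A * exp ((\<tau> + \<epsilon>) * norm z))"

end

theory Submission
  imports Defs "HOL-Probability.Probability" "HOL-Real_Asymp.Real_Asymp"
begin

text \<open>
  Fix x \<open>\<ge>\<close> 0. On the upper half plane one constructs a 2-periodic holomorphic function F with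
  F(t) + (-it)^(-1/2) F(-1/t) = e(xt) + (-it)^(-1/2) e(-x/t), where e(t) = exp(pi i t), and expands it
  as F(t) = \<open>\<Sum>\<close> c_m e(mt). Restricted to t = ia this says that the functional u \<open>\<mapsto>\<close> u(sqrt x) - \<open>\<Sum>\<close> c_m u(sqrt m)
  kills every Gaussian plus its Fourier transform; by a density argument it kills every even self-dual
  Schwartz function, so b_n(sqrt x) = Re c_n and it remains to bound c_n.

  On the standard fundamental domain of the theta group, F is e(xt) plus a weight 1/2 form times the
  Cauchy transform, in the Hauptmodul W = 16 th3^8 / (th2^4 th4^4), of the defect of periodicity of e(xt);
  elsewhere F is defined by alternating reductions modulo 2 with the functional equation. Each inversion
  contributes O((1+x)^(-1/4)) after weighting by Im^(1/4), so at height y = 1/n the coefficient bound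
  follows from an O((1 + log n)^2) bound for the average number of inversions over a period: an inversion
  with matrix (a,b;c,d) occurs only when Re t lies within 1/(a^2-c^2) of a rational centre, and with
  p = a-c, q = a+c these lengths sum to O(\<open>\<Sum>\<close> 1/|pq|) over |pq| < n.
\<close>

section \<open>Gaussians and Fourier coefficients\<close>

text \<open>Two requirements dictate the kernel. \<open>psi\<close>, the derivative of
  \<open>Wf\<close> divided by \<open>th3\<close>^3, has weight 1/2 and under inversion the sign
  opposite to that of \<open>th3\<close>, so \<open>psi\<close> times any function of
  \<open>Wf\<close> cancels in the functional equation. And since \<open>psi\<close> times
  \<open>th3\<close>^3 is the derivative of \<open>Wf\<close>, the Cauchy kernel has residue 1,
  which repairs the periodicity of e(xt). The pole would lie on a contour along Re = 1, exactly
  where the jump is wanted; hence two contours on either side of that line, placed so that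
  |\<open>Wf\<close> z - w| stays comparable to max(|\<open>Wf\<close> z|, |w|) up to both cusps.
  The exponent 1/4 comes from exp(- pi x s) <= (1+x)^(-1/4) s^(-1/4) for 0 < s <= 1: the loss in s
  is compensated by Im^(1/4), the weight that makes inversion an isometry. A pointwise bound at
  height 1/n would be too weak: near the cusp 1 the number of inversions can be as large as a power
  of n. Only the integral over a period is controlled, and each of the sums over p and q costs one
  logarithm.\<close>

lemma gauss_fourier:
  fixes a \<xi> :: real
  assumes "a > 0"
  shows "(LINT s|lborel. of_real (exp (-(pi*a * s^2))) * exp (2*pi*\<i>*\<xi> * s)) = complex_of_real (exp (-(pi*\<xi>^2/a)) / sqrt a)"
proof -
  \<comment> \<open>With x = c s the Gaussian becomes the standard normal density, so the integral
    is its known characteristic function at t.\<close>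
  define c where "c = sqrt (2*pi*a)"
  have c: "c > 0" "c^2 = 2*pi*a" using assms by (auto simp: c_def)
  define t where "t = 2*pi*\<xi>/c"
  have t2: "t^2/2 = pi*\<xi>^2/a"
    using c assms by (simp add: t_def power_divide power_mult_distrib field_simps power2_eq_square)
  have "complex_of_real (exp (- (t^2) / 2)) = char std_normal_distribution t"
    by (simp add: char_std_normal_distribution)
  also have "\<dots> = (LINT x|lborel. std_normal_density x *\<^sub>R exp (\<i> * (t*x)))"
    unfolding char_def by (subst integral_density) auto
  also have "\<dots> = \<bar>c\<bar> *\<^sub>R (LINT x|lborel. std_normal_density (0 + c*x) *\<^sub>R exp (\<i> * (t*(0+c*x))))"
    using c by (subst lborel_integral_real_affine[where c=c and t=0]) (auto simp: mult_ac)
  also have "(\<lambda>x. std_normal_density (0 + c*x) *\<^sub>R exp (\<i> * (t*(0+c*x)))) =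
     (\<lambda>s. complex_of_real (1/sqrt(2*pi)) * (of_real (exp (-(pi*a * s^2))) * exp (2*pi*\<i>*\<xi> * s)))"
    using c by (auto simp: std_normal_density_def t_def power_mult_distrib scaleR_conv_of_real mult_ac)
  also have "(LINT s|lborel. complex_of_real (1/sqrt(2*pi)) * (of_real (exp (-(pi*a * s^2))) * exp (2*pi*\<i>*\<xi> * s)))
     = complex_of_real (1/sqrt(2*pi)) * (LINT s|lborel. (of_real (exp (-(pi*a * s^2))) * exp (2*pi*\<i>*\<xi> * s)))"
    by simp
  finally have "complex_of_real (exp (- (t^2) / 2)) = complex_of_real (c /sqrt(2*pi)) * (LINT s|lborel. (of_real (exp (-(pi*a * s^2))) * exp (2*pi*\<i>*\<xi> * s)))"
    using c by (simp add: scaleR_conv_of_real mult_ac)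
  moreover have "c / sqrt (2*pi) = sqrt a" by (simp add: c_def real_sqrt_mult)
  ultimately show ?thesis using t2 assms by (simp add: field_simps)
qed

lemma gauss_integrable:
  fixes a :: real
  assumes "a > 0"
  shows "integrable lborel (\<lambda>s. exp (-(pi*a * s^2)))"
proof -
  define \<sigma> where "\<sigma> = sqrt (1/(2*pi*a))"
  have s: "2*\<sigma>^2 = 1/(pi*a)" using assms by (auto simp: \<sigma>_def)
  have "integrable lborel (\<lambda>x. sqrt (2*pi*\<sigma>\<^sup>2) * normal_density 0 \<sigma> x)"
    by (intro integrable_mult_right integrable_normal_density) (use assms in \<open>auto simp: \<sigma>_def\<close>)
  moreover have "(\<lambda>x. sqrt (2*pi*\<sigma>\<^sup>2) * normal_density 0 \<sigma> x) = (\<lambda>s. exp (-(pi*a * s^2)))"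
    using assms s by (auto simp: normal_density_def fun_eq_iff)
  ultimately show ?thesis by simp
qed

lemma gauss_integral:
  fixes a :: real
  assumes "a > 0"
  shows "(LINT s|lborel. exp (-(pi*a * s^2))) = 1 / sqrt a"
proof -
  have "complex_of_real (LINT s|lborel. exp (-(pi*a * s^2))) = complex_of_real (1 / sqrt a)"
    using gauss_fourier[OF assms, of 0] by (simp flip: integral_complex_of_real)
  thus ?thesis using of_real_eq_iff by blast
qed

section \<open>Completeness of the exponentials for continuous periodic functions\<close>

lemma periodic_int:
  fixes D :: "real \<Rightarrow> 'a"
  assumes "\<And>x. D (x+1) = D x"
  shows "D (x + of_int k) = D x"
proof (induction k rule: int_induct[where k=0])
  case base thus ?case by simp
next
  case (step1 i)
  show ?case using assms[of "x + of_int i"] step1 by (simp add: add_ac)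
next
  case (step2 i)
  show ?case using assms[of "x + of_int (i - 1)"] step2 by (simp add: add_ac)
qed

lemma continuous_on_circle_of_periodic:
  fixes D :: "real \<Rightarrow> complex"
  assumes cont: "continuous_on UNIV D" and per: "\<And>x. D (x+1) = D x"
  obtains v where "continuous_on (sphere 0 1) v" "\<And>x. v (exp (2*pi*\<i> * of_real x)) = D x"
proof
  define v where "v = (\<lambda>z. D (Arg z/(2*pi)))"
  note pint = periodic_int[of D, OF per]
  have isC: "isCont D x" for x using cont by (simp add: continuous_on_eq_continuous_at)
  show v_exp: "v (exp (2*pi*\<i> * of_real x)) = D x" for x
  proof -
    obtain k where "Im (2*pi*\<i> * of_real x) - of_int k * (2 * pi) = Arg (exp (2*pi*\<i> * of_real x))"
      using Arg_exp_diff_2pi by blast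
    hence "Arg (exp (2*pi*\<i> * of_real x)) = 2*pi*(x + of_int (-k))" by (simp add: algebra_simps)
    hence "Arg (exp (2*pi*\<i> * of_real x))/(2*pi) = x + of_int (-k)" by simp
    thus ?thesis unfolding v_def using pint by metis
  qed
  \<comment> \<open>\<open>Arg\<close> jumps across the negative axis and \<open>Arg2pi\<close>
    across the positive one. By periodicity both give the same function, so continuity can be
    checked with whichever is continuous at the point.\<close>
  have v_alt: "v z = D (Arg2pi z/(2*pi))" if "norm z = 1" for z
  proof -
    have "z = exp (2*pi*\<i> * of_real (Arg2pi z/(2*pi)))"
      using Arg2pi[of z] that by (simp add: is_Arg_def mult_ac)
    thus ?thesis using v_exp by metis
  qed
  show "continuous_on (sphere 0 1) v"
    unfolding continuous_on_eq_continuous_within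
  proof
    fix z :: complex assume z: "z \<in> sphere 0 1"
    show "continuous (at z within sphere 0 1) v"
    proof (cases "z \<in> \<real>\<^sub>\<le>\<^sub>0")
      case False
      have "isCont (\<lambda>z. D (Arg z/(2*pi))) z"
        by (rule isCont_o2[where g=D, OF _ isC], intro continuous_intros continuous_at_Arg False) auto
      thus ?thesis unfolding v_def using continuous_at_imp_continuous_at_within by blast
    next
      case True
      hence "z \<notin> \<real>\<^sub>\<ge>\<^sub>0" using z
        by (metis dist_0_norm mem_sphere nonneg_Reals_cases nonpos_Reals_cases norm_zero of_real_0 of_real_eq_iff order_antisym zero_neq_one)
      hence "isCont (\<lambda>z. D (Arg2pi z/(2*pi))) z"
        by (intro isCont_o2[where g=D, OF _ isC] continuous_intros continuous_at_Arg2pi) auto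
      hence "continuous (at z within sphere 0 1) (\<lambda>z. D (Arg2pi z/(2*pi)))"
        using continuous_at_imp_continuous_at_within by blast
      thus ?thesis
        by (rule continuous_transform_within[where \<delta>=1]) (use z v_alt in auto)
    qed
  qed
qed

text \<open>Multiplying D by a polynomial in the circle coordinate keeps all Fourier coefficients
  zero, and by Stone-Weierstrass such polynomials approximate the conjugate of D; hence the integral
  of |D|^2 vanishes.\<close>

lemma fourier_complete:
  fixes D :: "real \<Rightarrow> complex"
  assumes cont: "continuous_on UNIV D" and per: "\<And>x. D (x+1) = D x"
    and zero: "\<And>k::int. integral {0..1} (\<lambda>x. D x * exp (2*pi*\<i> * of_int k * of_real x)) = 0"
  shows "D x = 0"
proof -
  obtain v where v: "continuous_on (sphere 0 1) v" "\<And>x. v (exp (2*pi*\<i> * of_real x)) = D x"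
    using continuous_on_circle_of_periodic[OF cont per] by blast
  define E where "E = (\<lambda>(k::int) (x::real). exp (2*pi*\<i> * of_int k * of_real x))"
  define e where "e = (\<lambda>x::real. exp (2*pi*\<i> * of_real x))"
  have E_cont: "continuous_on A (E k)" for A k unfolding E_def by (intro continuous_intros)
  have e_cont: "continuous_on A e" for A unfolding e_def by (intro continuous_intros)
  have comp: "continuous_on {0..1} (\<lambda>x. f (e x))" if "continuous_on UNIV f" for f :: "complex \<Rightarrow> real"
    using that by (rule continuous_on_compose2) (auto intro: e_cont)
  \<comment> \<open>Quantifying over H carries the product case: one factor is absorbed into H
    before the hypothesis for the other is applied.\<close>
  define Q where "Q = (\<lambda>f :: complex \<Rightarrow> real. continuous_on UNIV f \<and> (\<forall>H. continuous_on {0..1} H \<longrightarrow>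
     (\<forall>k. integral {0..1} (\<lambda>x. H x * E k x) = 0) \<longrightarrow> (\<forall>k. integral {0..1} (\<lambda>x. H x * of_real (f (e x)) * E k x) = 0)))"
  have Q: "Q f" if "real_polynomial_function f" for f
    using that
  proof induction
    case (linear f)
    interpret bounded_linear f by fact
    \<comment> \<open>A real linear form on the circle is a combination of e(x) and e(-x), so it
      only shifts the frequency k by one.\<close>
    have fe: "of_real (f (e x)) = (of_real (f 1)/2 - \<i> * of_real (f \<i>)/2) * E 1 x + (of_real (f 1)/2 + \<i> * of_real (f \<i>)/2) * E (-1) x" for x
    proof -
      have "e x = Re (e x) *\<^sub>R 1 + Im (e x) *\<^sub>R \<i>" by (simp add: complex_eq_iff)
      hence "f (e x) = Re (e x) * f 1 + Im (e x) * f \<i>" by (metis add scaleR real_scaleR_def)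
      hence "f (e x) = cos (2*pi*x) * f 1 + sin (2*pi*x) * f \<i>" by (simp add: e_def Re_exp Im_exp)
      moreover have "E 1 x = Complex (cos (2*pi*x)) (sin (2*pi*x))" "E (-1) x = Complex (cos (2*pi*x)) (- sin (2*pi*x))"
        by (auto simp: E_def complex_eq_iff Re_exp Im_exp)
      ultimately show ?thesis by (simp add: complex_eq_iff algebra_simps)
    qed
    have "continuous_on UNIV f" using bounded_linear_axioms linear_continuous_on by blast
    moreover have "integral {0..1} (\<lambda>x. H x * of_real (f (e x)) * E k x) = 0"
      if H: "continuous_on {0..1} H" "\<forall>k. integral {0..1} (\<lambda>x. H x * E k x) = 0" for H k
    proof -
      let ?a = "(of_real (f 1)/2 - \<i> * of_real (f \<i>)/2)" and ?b = "(of_real (f 1)/2 + \<i> * of_real (f \<i>)/2)"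
      have EE: "E k x * E m x = E (k+m) x" for k m x by (simp add: E_def exp_add[symmetric] algebra_simps)
      have E1: "E (k+1) x = E k x * E 1 x" and E2: "E (k-1) x = E k x * E (-1) x" for x
        unfolding EE by simp_all
      have eq: "H x * of_real (f (e x)) * E k x = ?a * (H x * E (k+1) x) + ?b * (H x * E (k-1) x)" for x
        by (simp add: fe E1 E1[unfolded add.commute[of k 1]] E2 algebra_simps)
      have "integral {0..1} (\<lambda>x. H x * of_real (f (e x)) * E k x) = ?a * integral {0..1} (\<lambda>x. H x * E (k+1) x) + ?b * integral {0..1} (\<lambda>x. H x * E (k-1) x)"
        unfolding eq by (subst integral_add) (auto intro!: integrable_continuous_interval continuous_intros H E_cont)
      thus ?thesis using H by simp
    qed
    ultimately show ?case unfolding Q_def by blast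
  next
    case (const c)
    have "(\<lambda>x. H x * of_real c * E k x) = (\<lambda>x. of_real c * (H x * E k x))" for H k by (auto simp: mult_ac)
    thus ?case unfolding Q_def by auto
  next
    case (add f g)
    have "integral {0..1} (\<lambda>x. H x * of_real (f (e x) + g (e x)) * E k x) =
       integral {0..1} (\<lambda>x. H x * of_real (f (e x)) * E k x) + integral {0..1} (\<lambda>x. H x * of_real (g (e x)) * E k x)"
      if "continuous_on {0..1} H" for H k
    proof -
      have cf: "continuous_on {0..1} (\<lambda>x. f (e x))" and cg: "continuous_on {0..1} (\<lambda>x. g (e x))"
        using add.IH unfolding Q_def by (auto intro: comp)
      have c: "(\<lambda>x. H x * of_real (f (e x)) * E k x) integrable_on {0..1}" "(\<lambda>x. H x * of_real (g (e x)) * E k x) integrable_on {0..1}"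
        by (intro integrable_continuous_interval continuous_on_mult continuous_on_of_real cf cg that E_cont)+
      have eq: "H x * of_real (f (e x) + g (e x)) * E k x = H x * of_real (f (e x)) * E k x + H x * of_real (g (e x)) * E k x" for x
        by (simp add: algebra_simps)
      show ?thesis unfolding eq by (rule integral_add[OF c])
    qed
    thus ?case using add.IH unfolding Q_def by (auto intro!: continuous_intros)
  next
    case (mult f g)
    have "integral {0..1} (\<lambda>x. H x * of_real (f (e x) * g (e x)) * E k x) = 0"
      if H: "continuous_on {0..1} H" "\<forall>k. integral {0..1} (\<lambda>x. H x * E k x) = 0" for H k
    proof -
      have c: "continuous_on {0..1} (\<lambda>x. f (e x))" 
        using mult.IH unfolding Q_def by (auto intro: comp)
      have "continuous_on {0..1} (\<lambda>x. H x * of_real (f (e x)))" by (intro continuous_intros c H)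
      moreover have "\<forall>k. integral {0..1} (\<lambda>x. H x * of_real (f (e x)) * E k x) = 0"
        using mult.IH H unfolding Q_def by blast
      ultimately have "integral {0..1} (\<lambda>x. (H x * of_real (f (e x))) * of_real (g (e x)) * E k x) = 0"
        using mult.IH(2) unfolding Q_def by blast
      thus ?thesis by (simp add: mult_ac)
    qed
    thus ?case using mult.IH unfolding Q_def by (auto intro!: continuous_intros)
  qed
  have Dc: "continuous_on A D" for A using cont continuous_on_subset by blast
  have fz: "integral {0..1} (\<lambda>x. D x * of_real (f (e x))) = 0" if "real_polynomial_function f" for f
  proof -
    have "\<forall>k. integral {0..1} (\<lambda>x. D x * E k x) = 0" using zero by (simp add: E_def)
    hence "integral {0..1} (\<lambda>x. D x * of_real (f (e x)) * E 0 x) = 0"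
      using Q[OF that] Dc unfolding Q_def by blast
    thus ?thesis by (simp add: E_def)
  qed
  have fc: "continuous_on {0..1} (\<lambda>x. f (e x))" if "real_polynomial_function f" for f
    using Q[OF that] unfolding Q_def by (auto intro: comp)
  obtain M where M: "\<And>x. x \<in> {0..1} \<Longrightarrow> norm (D x) \<le> M"
  proof -
    have "bounded (D ` {0..1})" by (intro compact_imp_bounded compact_continuous_image Dc) simp
    thus ?thesis using that unfolding bounded_iff by blast
  qed
  have M0: "M \<ge> 0" using order_trans[OF norm_ge_zero M[of 0]] by simp
  have small: "norm (integral {0..1} (\<lambda>x. D x * cnj (D x))) \<le> M * \<epsilon>" if eps: "\<epsilon> > 0" for \<epsilon>
  proof -
    obtain p where p: "real_polynomial_function p" "\<And>x. x \<in> sphere 0 1 \<Longrightarrow> \<bar>Re (v x) - p x\<bar> < \<epsilon>/2"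
      by (rule Stone_Weierstrass_real_polynomial_function[of "sphere 0 1" "\<lambda>x. Re (v x)" "\<epsilon>/2"])
         (use v(1) eps in \<open>auto intro!: continuous_intros\<close>)
    obtain q where q: "real_polynomial_function q" "\<And>x. x \<in> sphere 0 1 \<Longrightarrow> \<bar>Im (v x) - q x\<bar> < \<epsilon>/2"
      by (rule Stone_Weierstrass_real_polynomial_function[of "sphere 0 1" "\<lambda>x. Im (v x)" "\<epsilon>/2"])
         (use v(1) eps in \<open>auto intro!: continuous_intros\<close>)
    have es: "e x \<in> sphere 0 1" for x by (simp add: e_def)
    let ?r = "\<lambda>x. cnj (D x) - (of_real (p (e x)) - \<i> * of_real (q (e x)))"
    have r: "norm (?r x) \<le> \<epsilon>" for x
    proof -
      have "norm (?r x) \<le> \<bar>Re (?r x)\<bar> + \<bar>Im (?r x)\<bar>" by (rule cmod_le)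
      also have "\<dots> = \<bar>Re (D x) - p (e x)\<bar> + \<bar>Im (D x) - q (e x)\<bar>" by (simp)
      also have "\<dots> \<le> \<epsilon>" using p(2)[OF es, of x] q(2)[OF es, of x] v(2)[of x] by (simp add: e_def)
      finally show ?thesis .
    qed
    have 1: "integral {0..1} (\<lambda>x. D x * cnj (D x)) = integral {0..1} (\<lambda>x. D x * ?r x + (D x * of_real (p (e x)) - \<i> * (D x * of_real (q (e x)))))"
      by (intro integral_cong) (simp add: algebra_simps)
    also have "\<dots> = integral {0..1} (\<lambda>x. D x * ?r x) + (integral {0..1} (\<lambda>x. D x * of_real (p (e x))) - \<i> * integral {0..1} (\<lambda>x. (D x * of_real (q (e x)))))"
      by (subst integral_add integral_diff integral_mult_right | intro integrable_continuous_interval continuous_intros Dc fc p q)+ simp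
    also have "\<dots> = integral {0..1} (\<lambda>x. D x * ?r x)" using fz p q by simp
    also have "norm \<dots> \<le> (M*\<epsilon>) * (1 - 0)"
      by (rule integral_bound) (auto intro!: continuous_intros Dc fc p q simp: norm_mult intro!: mult_mono M r M0)
    finally show ?thesis by simp
  qed
  have "norm (integral {0..1} (\<lambda>x. D x * cnj (D x))) \<le> 0"
  proof (rule field_le_epsilon)
    fix \<delta> :: real assume "\<delta> > 0"
    with small[of "\<delta>/(M+1)"] M0 have "norm (integral {0..1} (\<lambda>x. D x * cnj (D x))) \<le> M * (\<delta>/(M+1))" by simp
    also have "\<dots> \<le> \<delta>" using M0 \<open>\<delta> > 0\<close> by (simp add: field_simps)
    finally show "norm (integral {0..1} (\<lambda>x. D x * cnj (D x))) \<le> 0 + \<delta>" by simp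
  qed
  moreover have "integral {0..1} (\<lambda>x. D x * cnj (D x)) = of_real (integral {0..1} (\<lambda>x. (norm (D x))^2))"
  proof -
    have "((\<lambda>x. of_real ((norm (D x))^2)) has_integral complex_of_real (integral {0..1} (\<lambda>x. (norm (D x))^2))) {0..1}"
      by (intro has_integral_of_real integrable_integral integrable_continuous_interval continuous_intros Dc)
    moreover have "D x * cnj (D x) = of_real ((norm (D x))^2)" for x by (rule complex_norm_square[symmetric])
    ultimately show ?thesis by (simp only: integral_unique)
  qed
  ultimately have "integral {0..1} (\<lambda>x. (norm (D x))^2) = 0" by simp
  hence z: "D x = 0" if "x \<in> {0..1}" for x
    by (subst (asm) integral_eq_0_iff) (use that in \<open>auto intro!: continuous_intros Dc\<close>)
  have "D x = D (frac x + of_int \<lfloor>x\<rfloor>)" by (simp add: frac_def)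
  also have "\<dots> = D (frac x)" by (rule periodic_int) (rule per)
  also have "\<dots> = 0" by (rule z) (simp add: frac_ge_0 frac_lt_1 less_imp_le)
  finally show ?thesis .
qed

section \<open>Theta series and Poisson summation\<close>

lemma summable_int_geom:
  assumes "c > 0"
  shows "(\<lambda>n::int. exp (-(c * \<bar>of_int n\<bar>)) :: real) summable_on UNIV"
proof -
  have nat: "(\<lambda>n::nat. exp (-(c * real n))) summable_on UNIV"
  proof (rule norm_summable_imp_summable_on)
    have "summable (\<lambda>n. exp (-c) ^ n)" using assms by (intro summable_geometric) auto
    thus "summable (\<lambda>n. norm (exp (-(c * real n))))" by (simp add: exp_of_nat_mult[symmetric] mult_ac)
  qed
  have A: "(\<lambda>n::int. exp (-(c * \<bar>of_int n\<bar>)) :: real) summable_on {0..}"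
    by (rule summable_on_reindex_bij_betw[THEN iffD1, of int UNIV, OF _ summable_on_cong[THEN iffD1, OF _ nat]])
       (auto simp: bij_betw_def inj_on_def image_def intro: zero_le_imp_eq_int)
  have "(\<lambda>n::int. exp (-(c * \<bar>of_int (-n)\<bar>)) :: real) summable_on {0..}" using A by simp
  hence B: "(\<lambda>n::int. exp (-(c * \<bar>of_int n\<bar>)) :: real) summable_on {..0}"
    by (subst summable_on_reindex_bij_betw[symmetric, of uminus "{0..}"])
       (auto simp: bij_betw_def inj_on_def image_def intro: exI[of _ "- _"] intro!: bexI[of _ "- _"])
  have "{0..} \<union> {..0} = (UNIV :: int set)" by auto
  with summable_on_union[OF A B] show ?thesis by simp
qed

text \<open>From (|n+a| - 1/2)^2 >= 0 the square is at least |n+a| - 1/4, so Gaussian series are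
  dominated by geometric ones, uniformly for bounded shifts.\<close>

lemma gauss_term_le:
  fixes c :: real
  assumes "c \<ge> 0" "\<bar>a\<bar> \<le> R"
  shows "exp (-(c * (of_int n + a)^2)) \<le> exp (c * (R + 1/4)) * exp (-(c * \<bar>of_int n\<bar>))"
proof -
  have "0 \<le> (\<bar>of_int n + a\<bar> - 1/2)^2" by simp
  hence "(of_int n + a)^2 \<ge> \<bar>of_int n + a\<bar> - 1/4"
    by (simp add: power2_diff power_divide)
  hence "(of_int n + a)^2 \<ge> \<bar>of_int n\<bar> - R - 1/4" using assms by linarith
  hence "c * (of_int n + a)^2 \<ge> c * (\<bar>of_int n\<bar> - R - 1/4)" using assms(1) mult_left_mono by blast
  thus ?thesis by (simp add: exp_add[symmetric] algebra_simps)
qed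

lemma gauss_majorant_summable:
  assumes "c > 0"
  shows "(\<lambda>n::int. exp (c * (R + 1/4)) * exp (-(c * \<bar>of_int n\<bar>)) :: real) summable_on UNIV"
  by (intro summable_on_cmult_right summable_int_geom assms)

lemma summable_gauss_int:
  assumes "c > 0"
  shows "(\<lambda>n::int. exp (-(c * (of_int n + a)^2)) :: real) summable_on UNIV"
  by (rule summable_on_comparison_test[OF gauss_majorant_summable[OF assms, of "\<bar>a\<bar>"]])
     (use assms in \<open>auto intro!: gauss_term_le\<close>)

text \<open>The theta constant with characteristics a, b, up to the phase exp(2 pi i a b).\<close>

definition thg :: "real \<Rightarrow> real \<Rightarrow> complex \<Rightarrow> complex" where
  "thg a b \<tau> = (\<Sum>\<^sub>\<infinity>n::int. exp (2*pi*\<i>*b * of_int n) * exp (\<i>*pi*(of_int n + a)^2*\<tau>))"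

lemma norm_thg_term:
  "norm (exp (2*pi*\<i>* of_real b * of_int n) * exp (\<i>*pi*(of_int n + of_real a)^2*\<tau>)) = exp (-(pi * Im \<tau> * (of_int n + a)^2))"
proof -
  have "(of_int n + complex_of_real a)^2 = of_real ((of_int n + a)^2)" by simp
  thus ?thesis by (simp add: norm_mult mult_ac del: of_real_power)
qed

lemma thg_abs_summable:
  assumes "Im \<tau> > 0"
  shows "(\<lambda>n::int. norm (exp (2*pi*\<i>* of_real b * of_int n) * exp (\<i>*pi*(of_int n + of_real a)^2*\<tau>))) summable_on UNIV"
  unfolding norm_thg_term by (rule summable_gauss_int) (use assms in auto)

lemma thg_uniform_limit:
  assumes "\<delta> > 0"
  shows "uniform_limit {\<tau>. Im \<tau> \<ge> \<delta>} (\<lambda>X \<tau>. \<Sum>n\<in>X. exp (2*pi*\<i>* of_real b * of_int n) * exp (\<i>*pi*(of_int n + of_real a)^2*\<tau>)) (thg a b) (finite_subsets_at_top UNIV)"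
  unfolding thg_def
proof (rule Weierstrass_m_test_general)
  show "norm (exp (2*pi*\<i>* of_real b * of_int n) * exp (\<i>*pi*(of_int n + of_real a)^2*\<tau>)) \<le> exp (-(pi*\<delta> * (of_int n + a)^2))"
    if "\<tau> \<in> {\<tau>. Im \<tau> \<ge> \<delta>}" for n \<tau>
    using that unfolding norm_thg_term by (auto intro!: mult_right_mono mult_left_mono)
  show "(\<lambda>n::int. exp (-(pi*\<delta> * (of_int n + a)^2))) summable_on UNIV"
    by (rule summable_gauss_int) (use assms in auto)
qed


lemma holomorphic_thg_at:
  assumes "Im \<tau> > 0"
  shows "thg a b field_differentiable at \<tau>"
proof -
  define \<delta> where "\<delta> = Im \<tau> / 2"
  have d: "\<delta> > 0" "Im \<tau> = 2*\<delta>" using assms by (auto simp: \<delta>_def)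
  have sub: "cball \<tau> \<delta> \<subseteq> {\<tau>. Im \<tau> \<ge> \<delta>}"
  proof
    fix z assume "z \<in> cball \<tau> \<delta>"
    hence "\<bar>Im (z - \<tau>)\<bar> \<le> \<delta>" using abs_Im_le_cmod[of "z-\<tau>"] by (simp add: dist_norm norm_minus_commute)
    thus "z \<in> {\<tau>. Im \<tau> \<ge> \<delta>}" using d by auto
  qed
  obtain g where "continuous_on (cball \<tau> \<delta>) (thg a b)" "thg a b holomorphic_on ball \<tau> \<delta>"
    by (rule holomorphic_uniform_limit[OF _ uniform_limit_on_subset[OF thg_uniform_limit[OF d(1)] sub]])
       (auto intro!: always_eventually continuous_intros holomorphic_intros)
  thus ?thesis using d(1) by (meson centre_in_ball holomorphic_on_imp_differentiable_at open_ball)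
qed

lemma holomorphic_thg [holomorphic_intros]:
  assumes "A \<subseteq> {\<tau>. Im \<tau> > 0}"
  shows "thg a b holomorphic_on A"
  using assms holomorphic_thg_at unfolding holomorphic_on_def
  by (meson field_differentiable_at_within mem_Collect_eq subsetD)

lemma exp_int_2pi: "exp (2 * of_int n * of_real pi * \<i>) = (1::complex)"
  by (auto simp: exp_eq_1 intro!: exI[of _ n])

text \<open>Both sides are continuous and 1-periodic in x, so by \<open>fourier_complete\<close> it
  suffices to compare Fourier coefficients. On the left the translates unfold to the Fourier
  integral of a single Gaussian; on the right the series is integrated term by term.\<close>

lemma gauss_poisson:
  fixes t x :: real
  assumes t: "t > 0"
  shows "thg x 0 (\<i> * t) = of_real (1 / sqrt t) * thg 0 x (\<i> / t)"
proof -
  define P where "P = (\<lambda>x. thg x 0 (\<i> * of_real t))"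
  define Q where "Q = (\<lambda>x. of_real (1 / sqrt t) * thg 0 x (\<i> / of_real t))"
  define p where "p = (\<lambda>(n::int) (x::real). complex_of_real (exp (-(pi*t * (of_int n + x)^2))))"
  define q where "q = (\<lambda>(n::int) (x::real). exp (2*pi*\<i> * of_int n * of_real x) * complex_of_real (exp (-(pi/t * (of_int n)^2))))"
  have p_eq: "exp (2*pi*\<i>* of_real 0 * of_int n) * exp (\<i>*pi*(of_int n + of_real x)^2*(\<i> * of_real t)) = p n x" for n x
  proof -
    have "\<i>*pi*(of_int n + of_real x)^2*(\<i> * of_real t) = complex_of_real (-(pi*t * (of_int n + x)^2))"
      by (simp add: algebra_simps)
    thus ?thesis unfolding p_def by (simp only: exp_of_real) simp
  qed
  have q_eq: "exp (2*pi*\<i>* of_real x * of_int n) * exp (\<i>*pi*(of_int n + of_real 0)^2*(\<i> / of_real t)) = q n x" for n x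
  proof -
    have "\<i>*pi*(of_int n + of_real 0)^2*(\<i> / of_real t) = complex_of_real (-(pi/t * (of_int n)^2))"
      by (simp add: field_simps)
    thus ?thesis unfolding q_def by (simp only: exp_of_real) (simp add: mult_ac)
  qed
  have P_eq: "P x = (\<Sum>\<^sub>\<infinity>n. p n x)" for x unfolding P_def thg_def p_eq ..
  have Q_eq: "Q x = of_real (1 / sqrt t) * (\<Sum>\<^sub>\<infinity>n. q n x)" for x unfolding Q_def thg_def q_eq ..
  have ulP: "uniform_limit {-R..R} (\<lambda>X x. \<Sum>n\<in>X. p n x) P (finite_subsets_at_top UNIV)" for R
    unfolding P_eq[abs_def]
    by (rule Weierstrass_m_test_general[OF _ gauss_majorant_summable[of "pi*t" R]])
       (use t in \<open>auto simp: p_def intro!: gauss_term_le\<close>)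
  have nq: "norm (q n x) = exp (-(pi/t * (of_int n + 0)^2))" for n x by (simp add: q_def norm_mult)
  have ulQ: "uniform_limit UNIV (\<lambda>X x. of_real (1 / sqrt t) * (\<Sum>n\<in>X. q n x)) Q (finite_subsets_at_top UNIV)"
    unfolding Q_eq[abs_def]
    by (intro bounded_linear.uniform_limit[OF bounded_linear_mult_right] Weierstrass_m_test_general[OF _ summable_gauss_int[of "pi/t" 0]])
       (use t nq in auto)
  have contP: "continuous_on {-R..R} P" for R
    by (rule uniform_limit_theorem[OF _ ulP]) (auto simp: p_def intro!: always_eventually continuous_intros)
  have "isCont P x" for x
    using contP[of "\<bar>x\<bar>+1"] by (rule continuous_on_interior) (auto simp: interior_atLeastAtMost_real)
  hence contP: "continuous_on A P" for A by (simp add: continuous_at_imp_continuous_on)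
  have contQ: "continuous_on UNIV Q"
    by (rule uniform_limit_theorem[OF _ ulQ]) (use t in \<open>auto simp: q_def intro!: always_eventually continuous_intros\<close>)
  have perP: "P (x+1) = P x" for x
    unfolding P_eq p_def
    by (rule infsum_reindex_bij_witness[where i="\<lambda>n. n-1" and j="\<lambda>n. n+1"]) (auto simp: algebra_simps)
  have perQ: "Q (x+1) = Q x" for x
  proof -
    have "q n (x+1) = q n x" for n
    proof -
      have "exp (2*pi*\<i> * of_int n * of_real (x+1)) = exp (2*pi*\<i> * of_int n * of_real x) * exp (2 * of_int n * of_real pi * \<i>)"
        unfolding exp_add[symmetric] by (rule arg_cong[where f=exp]) (simp add: algebra_simps)
      also have "exp (2 * of_int n * of_real pi * \<i>) = 1" by (rule exp_int_2pi)
      finally show ?thesis by (simp add: q_def)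
    qed
    thus ?thesis by (simp add: Q_eq)
  qed
  define E where "E = (\<lambda>(k::int) (x::real). exp (2*pi*\<i>* of_int k* of_real x))"
  have E_cont: "continuous_on A (E k)" for A k unfolding E_def by (intro continuous_intros)
  have E_norm: "norm (E k x) = 1" for k x by (simp add: E_def)
  have E_shift: "E k (of_int m + x) = E k x" for k m x
  proof -
    have "E k (of_int m + x) = E k x * exp (2 * of_int (k*m) * of_real pi * \<i>)"
      unfolding E_def exp_add[symmetric] by (rule arg_cong[where f=exp]) (simp add: algebra_simps)
    also have "exp (2 * of_int (k*m) * of_real pi * \<i>) = 1" by (rule exp_int_2pi)
    finally show ?thesis by simp
  qed
  define c where "c = (\<lambda>k::int. complex_of_real (exp (-(pi*(of_int k)^2/t)) / sqrt t))"
  define f where "f = (\<lambda>k (x::real). complex_of_real (exp (-(pi*t*x^2))) * E k x)"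
  have f_cont: "continuous_on A (f k)" for A k unfolding f_def by (intro continuous_intros E_cont)
  have f_int: "integrable lborel (f k)" for k
    by (rule Bochner_Integration.integrable_bound[OF gauss_integrable[OF t]])
       (auto simp: f_def norm_mult E_norm E_def)
  have f_integral: "(LINT x|lborel. f k x) = c k" for k
    using gauss_fourier[OF t, of "of_int k"] by (simp add: f_def c_def E_def mult_ac)
  \<comment> \<open>Half-open ranges of n are used because the intervals from n to n + 1 then tile
    {-M..M} exactly.\<close>
  have fl: "filterlim (\<lambda>M::nat. {-int M..<int M}) (finite_subsets_at_top UNIV) sequentially"
    unfolding filterlim_finite_subsets_at_top
  proof (intro allI impI)
    fix X :: "int set" assume X: "finite X \<and> X \<subseteq> UNIV"
    hence "\<exists>B. \<forall>x\<in>X. \<bar>x\<bar> \<le> B" by (meson bounded_iff finite_imp_bounded finite_int_iff_bounded_le order_refl finite_abs_int_segment abs_le_iff Max_ge finite_imageI imageI)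
    then obtain B where B: "\<And>x. x\<in>X \<Longrightarrow> \<bar>x\<bar> \<le> B" by blast
    show "\<forall>\<^sub>F M in sequentially. finite {- int M..<int M} \<and> X \<subseteq> {- int M..<int M} \<and> {- int M..<int M} \<subseteq> UNIV"
      using eventually_gt_at_top[of "nat B"]
    proof eventually_elim
      case (elim M)
      hence "B < int M" by linarith
      thus ?case using B by force
    qed
  qed
  have int_P: "integral {0..1} (\<lambda>x. P x * E k x) = c k" for k
  proof -
    have "uniform_limit {-1..1} (\<lambda>M x. (\<Sum>n\<in>{-int M..<int M}. p n x)) P sequentially"
      by (rule filterlim_compose[OF ulP[of 1] fl])
    hence ul0: "uniform_limit {0..1} (\<lambda>M x. (\<Sum>n\<in>{-int M..<int M}. p n x)) P sequentially"
      by (rule uniform_limit_on_subset) auto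
    have ul: "uniform_limit {0..1} (\<lambda>M x. (\<Sum>n\<in>{-int M..<int M}. p n x) * E k x) (\<lambda>x. P x * E k x) sequentially"
      using compact_imp_bounded[OF compact_continuous_image[OF contP[of "{0..1}"]]] compact_imp_bounded[OF compact_continuous_image[OF E_cont[of "{0..1}"]]]
      by (intro uniform_lim_mult[OF ul0] uniform_limit_const) auto
    obtain I J where IJ: "\<And>M. ((\<lambda>x. (\<Sum>n\<in>{-int M..<int M}. p n x) * E k x) has_integral I M) {0..1}"
      "((\<lambda>x. P x * E k x) has_integral J) {0..1}" "I \<longlonglongrightarrow> J"
      by (rule uniform_limit_integral[OF ul]) (auto intro!: continuous_intros E_cont simp: p_def)
    have fsh: "p n x * E k x = f k (of_int n + x)" for n x by (simp add: p_def f_def E_shift)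
    have I: "I M = integral {-real M..real M} (f k)" for M
    proof -
      have "((\<lambda>x. \<Sum>n\<in>{-int M..<int M}. f k (of_int n + x)) has_integral (\<Sum>n\<in>{-int M..<int M}. integral {of_int n..of_int n + 1} (f k))) {0..1}"
      proof (intro has_integral_sum)
        fix n assume "n \<in> {-int M..<int M}"
        have "(f k has_integral (integral {of_int n..of_int n + 1} (f k))) {of_int n..of_int n + 1}"
          by (intro integrable_integral integrable_continuous_interval f_cont)
        thus "((\<lambda>x. f k (of_int n + x)) has_integral (integral {of_int n..of_int n + 1} (f k))) {0..1}"
          using has_integral_affinity'[of "f k" _ "of_int n" "of_int n + 1" 1 "of_int n"] by (simp add: add_ac)
      qed auto
      hence "I M = (\<Sum>n\<in>{-int M..<int M}. integral {of_int n..of_int n + 1} (f k))"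
        using IJ(1)[of M] by (simp add: sum_distrib_right fsh has_integral_unique)
      also have "\<dots> = integral {-real M..real M} (f k)"
      proof (induction M)
        case 0 show ?case by simp
      next
        case (Suc M)
        have "{- int (Suc M)..<int (Suc M)} = insert (- int M - 1) (insert (int M) {- int M..<int M})" by auto
        hence "(\<Sum>n\<in>{-int (Suc M)..<int (Suc M)}. integral {of_int n..of_int n + 1} (f k)) =
          integral {-real M-1..-real M} (f k) + (integral {real M..real M + 1} (f k) + integral {-real M..real M} (f k))"
          using Suc by simp
        also have "\<dots> = integral {-real M-1..real M+1} (f k)"
          using Henstock_Kurzweil_Integration.integral_combine[where a="-real M-1" and c="-real M" and b="real M+1" and f="f k"] Henstock_Kurzweil_Integration.integral_combine[where a="-real M" and c="real M" and b="real M+1" and f="f k"]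
          by (simp add: integrable_continuous_interval f_cont add_ac)
        finally have *: "(\<Sum>n\<in>{-int (Suc M)..<int (Suc M)}. integral {of_int n..of_int n + 1} (f k)) =
            integral {-real M-1..real M+1} (f k)" .
        have "-real M - 1 = - real (Suc M)" "real M + 1 = real (Suc M)" by simp_all
        with * show ?case by (simp only:)
      qed
      finally show ?thesis .
    qed
    have "(\<lambda>M. LINT x|lborel. indicator {-real M..real M} x *\<^sub>R f k x) \<longlonglongrightarrow> (LINT x|lborel. f k x)"
    proof (rule integral_dominated_convergence[where w="\<lambda>x. norm (f k x)"])
      show "AE x in lborel. (\<lambda>M. indicator {-real M..real M} x *\<^sub>R f k x) \<longlonglongrightarrow> f k x"
      proof (rule AE_I2)
        fix x :: real
        have "\<forall>\<^sub>F M in sequentially. indicator {-real M..real M} x *\<^sub>R f k x = f k x"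
          using eventually_ge_at_top[of "nat \<lceil>\<bar>x\<bar>\<rceil>"] by eventually_elim (auto simp: indicator_def abs_le_iff nat_le_iff ceiling_le_iff)
        thus "(\<lambda>M. indicator {-real M..real M} x *\<^sub>R f k x) \<longlonglongrightarrow> f k x" by (rule tendsto_eventually)
      qed
    qed (use f_int[of k] in \<open>auto simp: indicator_def\<close>)
    moreover have "(LINT x|lborel. indicator {-real M..real M} x *\<^sub>R f k x) = I M" for M
    proof -
      have "set_integrable lborel {-real M..real M} (f k)" by (rule borel_integrable_atLeastAtMost') (rule f_cont)
      from set_borel_integral_eq_integral(2)[OF this] show ?thesis unfolding I set_lebesgue_integral_def .
    qed
    ultimately have "I \<longlonglongrightarrow> c k" by (simp add: f_integral)
    hence "J = c k" using IJ(3) LIMSEQ_unique by blast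
    thus ?thesis using IJ(2) by blast
  qed
  have int_Q: "integral {0..1} (\<lambda>x. Q x * E k x) = c k" for k
  proof -
    have ul: "uniform_limit {0..1} (\<lambda>X x. of_real (1 / sqrt t) * (\<Sum>n\<in>X. q n x) * E k x) (\<lambda>x. Q x * E k x) (finite_subsets_at_top UNIV)"
      using compact_imp_bounded[OF compact_continuous_image[OF continuous_on_subset[OF contQ, of "{0..1}"]]] compact_imp_bounded[OF compact_continuous_image[OF E_cont[of "{0..1}"]]]
      by (intro uniform_lim_mult uniform_limit_const uniform_limit_on_subset[OF ulQ]) auto
    obtain I J where IJ: "\<And>X. ((\<lambda>x. of_real (1 / sqrt t) * (\<Sum>n\<in>X. q n x) * E k x) has_integral I X) {0..1}"
      "((\<lambda>x. Q x * E k x) has_integral J) {0..1}" "(I \<longlongrightarrow> J) (finite_subsets_at_top UNIV)"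
      using t by (rule_tac uniform_limit_integral[OF ul]) (auto intro!: continuous_intros E_cont simp: q_def)
    have qE: "of_real (1 / sqrt t) * q n x * E k x = c n * E (n + k) x" for n x
      by (simp add: q_def E_def c_def exp_add[symmetric] algebra_simps)
    have E_int: "((\<lambda>x. E m x) has_integral (if m = 0 then 1 else 0)) {0..1}" for m
    proof (cases "m = 0")
      case True
      thus ?thesis using has_integral_const_real[of "1::complex" 0 1] by (simp add: E_def)
    next
      case False
      have "((\<lambda>x. E m x) has_integral (E m 1 / (2*pi*\<i>* of_int m) - E m 0 / (2*pi*\<i>* of_int m))) {0..1}"
        by (rule fundamental_theorem_of_calculus)
           (use False in \<open>auto simp: E_def intro!: derivative_eq_intros has_vector_derivative_real_field\<close>)
      moreover have "E m 1 = E m 0" using E_shift[of m 1 0] by simp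
      ultimately show ?thesis using False by simp
    qed
    have I: "I X = c k" if "finite X" "-k \<in> X" for X
    proof -
      have "((\<lambda>x. \<Sum>n\<in>X. c n * E (n + k) x) has_integral (\<Sum>n\<in>X. c n * (if n + k = 0 then 1 else 0))) {0..1}"
        by (intro has_integral_sum has_integral_mult_right E_int that)
      moreover have "of_real (1 / sqrt t) * (\<Sum>n\<in>X. q n x) * E k x = (\<Sum>n\<in>X. c n * E (n + k) x)" for x
        by (simp only: sum_distrib_right sum_distrib_left qE)
      ultimately have "I X = (\<Sum>n\<in>X. c n * (if n + k = 0 then 1 else 0))"
        using IJ(1)[of X] by (simp only: has_integral_unique)
      also have "\<dots> = (\<Sum>n\<in>X. if n = -k then c (-k) else 0)" by (intro sum.cong) auto
      also have "\<dots> = c k" using that by (simp add: c_def)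
      finally show ?thesis .
    qed
    have "\<forall>\<^sub>F X in finite_subsets_at_top UNIV. I X = c k"
      unfolding eventually_finite_subsets_at_top using I by (intro exI[of _ "{-k}"]) auto
    hence "(I \<longlongrightarrow> c k) (finite_subsets_at_top UNIV)" by (rule tendsto_eventually)
    hence "J = c k" using IJ(3) tendsto_unique finite_subsets_at_top_neq_bot by blast
    thus ?thesis using IJ(2) by blast
  qed
  have "P x - Q x = 0"
  proof (rule fourier_complete[of "\<lambda>x. P x - Q x"])
    show "continuous_on UNIV (\<lambda>x. P x - Q x)" by (intro continuous_intros contP contQ)
    show "P (x+1) - Q (x+1) = P x - Q x" for x using perP perQ by simp
    show "integral {0..1} (\<lambda>x. (P x - Q x) * exp (2*pi*\<i>* of_int k* of_real x)) = 0" for k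
    proof -
      have "integral {0..1} (\<lambda>x. (P x - Q x) * E k x) = integral {0..1} (\<lambda>x. P x * E k x) - integral {0..1} (\<lambda>x. Q x * E k x)"
        by (subst integral_diff[symmetric])
           (auto intro!: integrable_continuous_interval continuous_intros contP E_cont continuous_on_subset[OF contQ] simp: algebra_simps)
      thus ?thesis using int_P int_Q by (simp add: E_def)
    qed
  qed
  thus ?thesis by (simp add: P_def Q_def)
qed

section \<open>Theta functions\<close>

abbreviation uhp :: "complex set" where "uhp \<equiv> {\<tau>. Im \<tau> > 0}"

lemma uhp_props: "open uhp" "convex uhp" "connected uhp"
  by (auto simp: open_halfspace_Im_gt convex_halfspace_Im_gt convex_connected)

lemma uhp_nonzero: "Im \<tau> > 0 \<Longrightarrow> \<tau> \<noteq> 0" by auto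

lemma Im_minus_inverse: "Im (-1/\<tau>) = Im \<tau> / (norm \<tau>)^2"
  by (cases "\<tau> = 0") (simp_all add: Im_divide cmod_power2 add_ac)

lemma Im_minus_inverse_pos: "Im \<tau> > 0 \<Longrightarrow> Im (-1/\<tau>) > 0"
  unfolding Im_minus_inverse by (auto intro!: divide_pos_pos)

text \<open>The weight 1/2 factor. On the upper half plane -i \<tau> has positive real part, so the
  principal root is holomorphic there and has positive real part itself.\<close>

definition jfac :: "complex \<Rightarrow> complex" where "jfac \<tau> = csqrt (-\<i> * \<tau>)"

lemma jfac_sq: "jfac \<tau> ^ 2 = -\<i> * \<tau>" by (simp add: jfac_def)

lemma jfac_nz: "Im \<tau> > 0 \<Longrightarrow> jfac \<tau> \<noteq> 0" by (auto simp: jfac_def)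

lemma norm_jfac: "norm (jfac \<tau>) = sqrt (norm \<tau>)" by (simp add: jfac_def norm_mult)

lemma jfac_holo [holomorphic_intros]: "A \<subseteq> uhp \<Longrightarrow> jfac holomorphic_on A"
  unfolding jfac_def
  by (intro holomorphic_intros) (auto simp: complex_nonpos_Reals_iff dest!: subsetD)

text \<open>The square of the product is 1, and positivity of both real parts rules out -1.\<close>

lemma jfac_inv:
  assumes "Im \<tau> > 0"
  shows "jfac (-1/\<tau>) * jfac \<tau> = 1"
proof -
  have r: "Re (csqrt z) > 0" if "Re z > 0" for z
  proof -
    have "Re z = Re ((csqrt z)^2)" by (simp only: power2_csqrt)
    hence "Re z = Re (csqrt z)^2 - Im (csqrt z)^2" by (simp only: Re_power2)
    hence "Re (csqrt z) \<noteq> 0" using that zero_le_power2[of "Im (csqrt z)"] by (metis diff_0 neg_le_0_iff_le not_less zero_power2)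
    thus ?thesis using csqrt_principal[of z] by linarith
  qed
  have "Re (jfac z) > 0" if "Im z > 0" for z
    unfolding jfac_def by (rule r) (use that in simp)
  hence 1: "Re (jfac (-1/\<tau>)) > 0" "Re (jfac \<tau>) > 0"
    using Im_minus_inverse_pos[OF assms] assms by blast+
  have "(jfac (-1/\<tau>) * jfac \<tau>)^2 = 1"
    using uhp_nonzero[OF assms] by (simp add: power_mult_distrib jfac_sq)
  hence "jfac (-1/\<tau>) * jfac \<tau> = 1 \<or> jfac (-1/\<tau>) * jfac \<tau> = -1" by (simp add: power2_eq_1_iff)
  moreover have "jfac (-1/\<tau>) * jfac \<tau> \<noteq> -1"
  proof
    assume "jfac (-1/\<tau>) * jfac \<tau> = -1"
    hence "jfac (-1/\<tau>) = -1/jfac \<tau>" using jfac_nz[OF assms] by (simp add: field_simps)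
    hence "Re (jfac (-1/\<tau>)) = - Re (jfac \<tau>) / (norm (jfac \<tau>))^2" by (simp add: Re_divide cmod_power2)
    hence "Re (jfac (-1/\<tau>)) \<le> 0" using 1 by (simp add: divide_le_0_iff)
    thus False using 1 by simp
  qed
  ultimately show ?thesis by blast
qed

text \<open>On the imaginary axis this is \<open>gauss_poisson\<close>; both sides are holomorphic,
  so the identity theorem extends it.\<close>

lemma thg_transform:
  assumes "Im \<tau> > 0"
  shows "thg a 0 \<tau> * jfac \<tau> = thg 0 a (-1/\<tau>)"
proof -
  define f where "f = (\<lambda>\<tau>. thg a 0 \<tau> * jfac \<tau> - thg 0 a (-1/\<tau>))"
  define U where "U = (\<lambda>t. \<i> * complex_of_real t) ` {0<..}"
  have "f \<tau> = 0"
  proof (rule analytic_continuation[of f uhp U \<i>])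
    have "(\<lambda>\<tau>. thg 0 a (-1/\<tau>)) holomorphic_on uhp"
      by (rule holomorphic_on_compose_gen[of "\<lambda>\<tau>. -1/\<tau>" _ "thg 0 a" uhp, unfolded o_def])
         (auto intro!: holomorphic_intros simp del: divide_minus_left simp: Im_minus_inverse_pos)
    thus "f holomorphic_on uhp" unfolding f_def by (intro holomorphic_intros) auto
    show "\<i> islimpt U"
      unfolding islimpt_approachable
    proof (intro allI impI)
      fix e :: real assume "e > 0"
      hence "\<i> * complex_of_real (1 + e/2) \<in> U" "\<i> * complex_of_real (1 + e/2) \<noteq> \<i>" "dist (\<i> * complex_of_real (1 + e/2)) \<i> < e"
        by (auto simp: U_def dist_norm algebra_simps norm_mult complex_eq_iff)
      thus "\<exists>x'\<in>U. x' \<noteq> \<i> \<and> dist x' \<i> < e" by blast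
    qed
    show "f z = 0" if "z \<in> U" for z
    proof -
      obtain t where t: "t > 0" "z = \<i> * of_real t" using \<open>z \<in> U\<close> by (auto simp: U_def)
      have "jfac z = of_real (sqrt t)" using t by (simp add: jfac_def csqrt_of_real_nonneg)
      moreover have "-1/z = \<i> / of_real t" using t by (simp add: field_simps)
      ultimately show ?thesis using gauss_poisson[OF t(1), of a] t by (simp add: f_def)
    qed
  qed (use assms uhp_props in \<open>auto simp: U_def\<close>)
  thus ?thesis by (simp add: f_def)
qed

definition th2 :: "complex \<Rightarrow> complex" where "th2 = thg (1/2) 0"
definition th3 :: "complex \<Rightarrow> complex" where "th3 = thg 0 0"
definition th4 :: "complex \<Rightarrow> complex" where "th4 = thg 0 (1/2)"

lemma th_holo [holomorphic_intros]:
  assumes "A \<subseteq> uhp" shows "th2 holomorphic_on A" "th3 holomorphic_on A" "th4 holomorphic_on A"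
  using assms by (auto simp: th2_def th3_def th4_def intro!: holomorphic_intros)

lemma th3_S: "Im \<tau> > 0 \<Longrightarrow> th3 (-1/\<tau>) = jfac \<tau> * th3 \<tau>"
  using thg_transform[of \<tau> 0] by (simp add: th3_def mult_ac)

lemma th4_S: "Im \<tau> > 0 \<Longrightarrow> th4 (-1/\<tau>) = jfac \<tau> * th2 \<tau>"
  using thg_transform[of \<tau> "1/2"] by (simp add: th2_def th4_def mult_ac)

lemma th2_S:
  assumes "Im \<tau> > 0" shows "th2 (-1/\<tau>) = jfac \<tau> * th4 \<tau>"
proof -
  have "th4 \<tau> = jfac (-1/\<tau>) * th2 (-1/\<tau>)"
    using th4_S[OF Im_minus_inverse_pos[OF assms]] uhp_nonzero[OF assms] by simp
  hence "jfac \<tau> * th4 \<tau> = (jfac (-1/\<tau>) * jfac \<tau>) * th2 (-1/\<tau>)" by (simp add: mult_ac)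
  thus ?thesis unfolding jfac_inv[OF assms] mult_1_left by (rule sym)
qed

section \<open>Translation and conjugation of the theta functions\<close>

lemma exp_pi_int_sq: "exp (\<i> * of_real pi * (of_int n)^2) = exp (\<i> * of_real pi * of_int n)"
proof -
  have "even (n^2 - n)" by auto
  then obtain k where "n^2 - n = 2*k" by blast
  hence k: "n^2 = n + 2*k" by simp
  have "exp (\<i> * of_real pi * (of_int n)^2) = exp (\<i> * of_real pi * of_int (n^2))" by simp
  also have "\<dots> = exp (\<i> * of_real pi * of_int n + 2 * of_int k * of_real pi * \<i>)"
    unfolding k by (rule arg_cong[where f=exp]) (simp add: algebra_simps)
  also have "\<dots> = exp (\<i> * of_real pi * of_int n)" by (simp only: exp_add exp_int_2pi mult_1_right)
  finally show ?thesis .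
qed

lemma th3_plus1: "th3 (\<tau> + 1) = th4 \<tau>"
  unfolding th3_def th4_def thg_def
proof (rule infsum_cong)
  fix n :: int
  have "exp (\<i>*pi*(of_int n + of_real 0)^2*(\<tau>+1)) = exp (\<i>*pi*(of_int n)^2*\<tau>) * exp (\<i> * of_real pi * (of_int n)^2)"
    by (simp add: exp_add[symmetric] algebra_simps)
  thus "exp (2*pi*\<i>* of_real 0 * of_int n) * exp (\<i>*pi*(of_int n + of_real 0)^2*(\<tau>+1)) =
    exp (2*pi*\<i>* of_real (1/2) * of_int n) * exp (\<i>*pi*(of_int n + of_real 0)^2*\<tau>)"
    unfolding exp_pi_int_sq by (simp add: mult_ac)
qed

lemma th4_plus1: "th4 (\<tau> + 1) = th3 \<tau>"
  unfolding th3_def th4_def thg_def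
proof (rule infsum_cong)
  fix n :: int
  have "exp (2*pi*\<i>* of_real (1/2) * of_int n) * exp (\<i>*pi*(of_int n + of_real 0)^2*(\<tau>+1)) = exp (\<i>*pi*(of_int n)^2*\<tau>) * (exp (\<i> * of_real pi * of_int n) * exp (\<i> * of_real pi * (of_int n)^2))"
    by (simp add: exp_add[symmetric] algebra_simps)
  also have "exp (\<i> * of_real pi * of_int n) * exp (\<i> * of_real pi * (of_int n)^2) = exp (2 * of_int n * of_real pi * \<i>)"
    unfolding exp_pi_int_sq exp_add[symmetric] by (rule arg_cong[where f=exp]) simp
  finally show "exp (2*pi*\<i>* of_real (1/2) * of_int n) * exp (\<i>*pi*(of_int n + of_real 0)^2*(\<tau>+1)) =
    exp (2*pi*\<i>* of_real 0 * of_int n) * exp (\<i>*pi*(of_int n + of_real 0)^2*\<tau>)"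
    by (simp only: exp_int_2pi) simp
qed

lemma th2_plus1: "th2 (\<tau> + 1) = exp (\<i> * pi / 4) * th2 \<tau>"
  unfolding th2_def thg_def infsum_cmult_right'[symmetric]
proof (rule infsum_cong)
  fix n :: int
  have "exp (\<i>*pi*(of_int n + of_real (1/2))^2*(\<tau>+1)) =
     exp (\<i> * pi / 4) * exp (\<i>*pi*(of_int n + of_real (1/2))^2*\<tau>) * (exp (\<i> * of_real pi * of_int n) * exp (\<i> * of_real pi * (of_int n)^2))"
    unfolding exp_add[symmetric] by (rule arg_cong[where f=exp]) (simp add: field_simps power2_eq_square)
  also have "exp (\<i> * of_real pi * of_int n) * exp (\<i> * of_real pi * (of_int n)^2) = exp (2 * of_int n * of_real pi * \<i>)"
    unfolding exp_pi_int_sq exp_add[symmetric] by (rule arg_cong[where f=exp]) simp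
  finally show "exp (2*pi*\<i>* of_real 0 * of_int n) * exp (\<i>*pi*(of_int n + of_real (1/2))^2*(\<tau>+1)) =
    exp (\<i> * pi / 4) * (exp (2*pi*\<i>* of_real 0 * of_int n) * exp (\<i>*pi*(of_int n + of_real (1/2))^2*\<tau>))"
    by (simp only: exp_int_2pi) simp
qed

lemma th3_plus2: "th3 (\<tau> + 2) = th3 \<tau>"
  using th3_plus1[of "\<tau>+1"] th4_plus1[of \<tau>] by (simp add: add_ac)

lemma cnj_thg: "cnj (thg a 0 \<tau>) = thg a 0 (- cnj \<tau>)"
  unfolding thg_def infsum_cnj[symmetric]
  by (rule infsum_cong) (simp add: exp_cnj)

lemma cnj_th2: "cnj (th2 \<tau>) = th2 (- cnj \<tau>)"
  and cnj_th3: "cnj (th3 \<tau>) = th3 (- cnj \<tau>)"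
  unfolding th2_def th3_def by (rule cnj_thg)+

lemma cnj_th4: "cnj (th4 \<tau>) = th4 (- cnj \<tau>)"
proof -
  have "cnj (th4 \<tau>) = cnj (th3 (\<tau> + 1))" by (simp add: th3_plus1)
  also have "\<dots> = th3 (- cnj \<tau> - 1)" by (simp add: cnj_th3)
  also have "\<dots> = th3 ((- cnj \<tau> - 1) + 2)" by (rule th3_plus2[symmetric])
  also have "\<dots> = th4 (- cnj \<tau>)" using th3_plus1[of "- cnj \<tau>"] by (simp add: add_ac)
  finally show ?thesis .
qed

section \<open>Duplication formulas and Jacobi's quartic identity\<close>

lemma infsum_times:
  fixes f :: "'a \<Rightarrow> complex" and g :: "'b \<Rightarrow> complex"
  assumes f: "(\<lambda>x. norm (f x)) summable_on A" and g: "(\<lambda>x. norm (g x)) summable_on B"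
  shows "(\<lambda>(x,y). f x * g y) summable_on (A \<times> B)"
    and "infsum f A * infsum g B = infsum (\<lambda>(x,y). f x * g y) (A \<times> B)"
proof -
  have "(\<lambda>p. norm (f (fst p)) * norm (g (snd p))) summable_on (A \<times> B)"
  proof (rule summable_on_SigmaI[where g="\<lambda>x. norm (f x) * infsum (\<lambda>y. norm (g y)) B"])
    show "((\<lambda>y. norm (f (fst (x, y))) * norm (g (snd (x, y)))) has_sum norm (f x) * infsum (\<lambda>y. norm (g y)) B) B" for x
      by (simp, intro has_sum_cmult_right has_sum_infsum g)
    show "(\<lambda>x. norm (f x) * infsum (\<lambda>y. norm (g y)) B) summable_on A"
      by (intro summable_on_cmult_left f)
  qed auto
  hence "(\<lambda>p. norm (f (fst p) * g (snd p))) summable_on (A \<times> B)" by (simp add: norm_mult)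
  hence "(\<lambda>p. f (fst p) * g (snd p)) summable_on (A \<times> B)" by (rule abs_summable_summable)
  thus s: "(\<lambda>(x,y). f x * g y) summable_on (A \<times> B)" by (simp add: case_prod_unfold)
  show "infsum f A * infsum g B = infsum (\<lambda>(x,y). f x * g y) (A \<times> B)"
    unfolding infsum_Sigma'_banach[OF s, symmetric]
    by (simp add: infsum_cmult_right' infsum_cmult_left')
qed

text \<open>The two pieces are the two cosets of the sublattice of pairs with even sum.\<close>

lemma infsum_parity_split:
  fixes F :: "int \<times> int \<Rightarrow> complex"
  assumes "F summable_on UNIV"
  shows "infsum F UNIV = infsum (\<lambda>(j,k). F (j+k, j-k)) UNIV + infsum (\<lambda>(j,k). F (j+k+1, j-k)) UNIV"
proof -
  define A where "A = {p::int\<times>int. even (fst p + snd p)}"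
  have "infsum F UNIV = infsum F (A \<union> -A)" by simp
  also have "\<dots> = infsum F A + infsum F (-A)"
    by (rule infsum_Un_disjoint) (use assms in \<open>auto intro: summable_on_subset_banach\<close>)
  also have "infsum F A = infsum (\<lambda>(j,k). F (j+k, j-k)) UNIV"
    by (rule infsum_reindex_bij_witness[where j="\<lambda>(m,n). ((m+n) div 2, (m-n) div 2)" and i="\<lambda>(j,k). (j+k, j-k)"])
       (auto simp: A_def intro!: arg_cong[of _ _ F], presburger+)
  also have "infsum F (-A) = infsum (\<lambda>(j,k). F (j+k+1, j-k)) UNIV"
    by (rule infsum_reindex_bij_witness[where j="\<lambda>(m,n). ((m+n) div 2, (m-n) div 2)" and i="\<lambda>(j,k). (j+k+1, j-k)"])
       (auto simp: A_def intro!: arg_cong[of _ _ F], presburger+)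
  finally show ?thesis .
qed

text \<open>In the coordinates of the parity split the quadratic form separates: (j+k+a)^2 +
  (j-k+a)^2 = 2(j+a)^2 + 2k^2, and on the odd coset both j and k are shifted by 1/2.\<close>

lemma thg_lattice:
  assumes "Im \<tau> > 0"
  shows "thg a 0 \<tau> * thg a 0 \<tau> = thg a 0 (2*\<tau>) * thg 0 0 (2*\<tau>) + thg (a+1/2) 0 (2*\<tau>) * thg (1/2) 0 (2*\<tau>)"
proof -
  define t where "t = (\<lambda>a \<tau> (n::int). exp (\<i>*pi*(of_int n + complex_of_real a)^2*\<tau>))"
  have thg_t: "thg a 0 \<tau> = infsum (t a \<tau>) UNIV" for a \<tau> by (simp add: thg_def t_def)
  have s: "(\<lambda>n. norm (t a \<tau> n)) summable_on UNIV" if "Im \<tau> > 0" for a \<tau>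
    using thg_abs_summable[OF that, of 0 a] by (simp add: t_def)
  have 2: "Im (2*\<tau>) > 0" using assms by simp
  note tm = infsum_times[OF s[OF assms] s[OF assms], of a a, unfolded UNIV_Times_UNIV]
  have "thg a 0 \<tau> * thg a 0 \<tau> = infsum (\<lambda>(x,y). t a \<tau> x * t a \<tau> y) UNIV"
    unfolding thg_t by (rule tm(2))
  also have "\<dots> = infsum (\<lambda>(j,k). t a \<tau> (j+k) * t a \<tau> (j-k)) UNIV + infsum (\<lambda>(j,k). t a \<tau> (j+k+1) * t a \<tau> (j-k)) UNIV"
    using infsum_parity_split[OF tm(1)] by simp
  also have "(\<lambda>(j,k). t a \<tau> (j+k) * t a \<tau> (j-k)) = (\<lambda>(j,k). t a (2*\<tau>) j * t 0 (2*\<tau>) k)"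
    unfolding t_def exp_add[symmetric] by (auto intro!: ext arg_cong[where f=exp] simp: algebra_simps power2_eq_square)
  also have "infsum \<dots> UNIV = thg a 0 (2*\<tau>) * thg 0 0 (2*\<tau>)"
    unfolding thg_t by (rule infsum_times(2)[OF s[OF 2] s[OF 2], unfolded UNIV_Times_UNIV, symmetric])
  also have "(\<lambda>(j,k). t a \<tau> (j+k+1) * t a \<tau> (j-k)) = (\<lambda>(j,k). t (a+1/2) (2*\<tau>) j * t (1/2) (2*\<tau>) k)"
    unfolding t_def exp_add[symmetric] by (auto intro!: ext arg_cong[where f=exp] simp: field_simps power2_eq_square)
  also have "infsum \<dots> UNIV = thg (a+1/2) 0 (2*\<tau>) * thg (1/2) 0 (2*\<tau>)"
    unfolding thg_t by (rule infsum_times(2)[OF s[OF 2] s[OF 2], unfolded UNIV_Times_UNIV, symmetric])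
  finally show ?thesis .
qed

lemma thg_shift: "thg (a+1) 0 \<tau> = thg a 0 \<tau>"
  unfolding thg_def
  by (rule infsum_reindex_bij_witness[where i="\<lambda>n. n-1" and j="\<lambda>n. n+1"]) (auto simp: algebra_simps)

lemma th3_dup: "Im \<tau> > 0 \<Longrightarrow> th3 \<tau>^2 = th3 (2*\<tau>)^2 + th2 (2*\<tau>)^2"
  using thg_lattice[of \<tau> 0] by (simp add: th3_def th2_def power2_eq_square)

lemma th2_dup: "Im \<tau> > 0 \<Longrightarrow> th2 \<tau>^2 = 2 * th3 (2*\<tau>) * th2 (2*\<tau>)"
  using thg_lattice[of \<tau> "1/2"] thg_shift[of 0] by (simp add: th3_def th2_def power2_eq_square)

lemma th4_dup: assumes "Im \<tau> > 0" shows "th4 \<tau>^2 = th3 (2*\<tau>)^2 - th2 (2*\<tau>)^2"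
proof -
  have "th4 \<tau>^2 = th3 (\<tau>+1)^2" by (simp add: th3_plus1)
  also have "\<dots> = th3 (2*\<tau>+2)^2 + th2 ((2*\<tau>+1)+1)^2" using th3_dup[of "\<tau>+1"] assms by (simp add: algebra_simps)
  also have "th2 ((2*\<tau>+1)+1)^2 = (exp (\<i> * pi / 4))^4 * th2 (2*\<tau>)^2"
    unfolding th2_plus1 by (simp add: power_mult_distrib flip: power_mult power_add)
  also have "(exp (\<i> * pi / 4))^4 = (-1::complex)"
    by (simp add: exp_of_nat_mult[symmetric])
  finally show ?thesis by (simp add: th3_plus2)
qed

text \<open>With A and B the squares of \<open>th3\<close> and \<open>th2\<close> at 2 \<tau>,
  duplication reduces the claim to (A+B)^2 = 4AB + (A-B)^2.\<close>

lemma jacobi_quartic: assumes "Im \<tau> > 0" shows "th3 \<tau>^4 = th2 \<tau>^4 + th4 \<tau>^4"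
proof -
  have *: "x^4 = (x^2)^2" for x :: complex by (simp flip: power_mult)
  show ?thesis unfolding * th3_dup[OF assms] th2_dup[OF assms] th4_dup[OF assms]
    by (simp add: algebra_simps power2_eq_square)
qed

lemma th4_double: assumes "Im \<tau> > 0" shows "th4 (2*\<tau>)^4 = (th3 \<tau> * th4 \<tau>)^2"
proof -
  have *: "x^4 = (x^2)^2" for x :: complex by (simp flip: power_mult)
  have "th4 (2*\<tau>)^4 = th3 (2*\<tau>)^4 - th2 (2*\<tau>)^4" using jacobi_quartic[of "2*\<tau>"] assms by simp
  also have "\<dots> = th3 \<tau>^2 * th4 \<tau>^2" unfolding th3_dup[OF assms] th4_dup[OF assms]
    by (simp add: algebra_simps power2_eq_square power4_eq_xxxx)
  finally show ?thesis by (simp add: power_mult_distrib)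
qed

section \<open>Asymptotics at infinity and absence of zeros\<close>

definition tht :: "real \<Rightarrow> real \<Rightarrow> complex \<Rightarrow> int \<Rightarrow> complex" where
  "tht a b \<tau> n = exp (2*pi*\<i>* of_real b * of_int n) * exp (\<i>*pi*(of_int n + of_real a)^2*\<tau>)"

lemma thg_tht: "thg a b \<tau> = infsum (tht a b \<tau>) UNIV"
  unfolding thg_def tht_def ..

lemma norm_tht: "norm (tht a b \<tau> n) = exp (-(pi * Im \<tau> * (of_int n + a)^2))"
  unfolding tht_def by (rule norm_thg_term)

lemma tht_abs_summable: "Im \<tau> > 0 \<Longrightarrow> (\<lambda>n. norm (tht a b \<tau> n)) summable_on A"
  unfolding norm_tht
  by (rule summable_on_subset_banach[OF summable_gauss_int]) auto

lemma thg_tail: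
  assumes "\<And>n. n \<in> A \<Longrightarrow> (of_int n + a)^2 \<ge> e" "\<delta> > 0"
  shows "\<exists>C>0. \<forall>\<tau>. Im \<tau> \<ge> \<delta> \<longrightarrow> norm (infsum (tht a b \<tau>) A) \<le> C * exp (- pi * e * Im \<tau>)"
proof -
  define S where "S = infsum (\<lambda>n. exp (-(pi*\<delta> * (of_int n + a)^2))) A"
  have sm: "(\<lambda>n::int. exp (-(pi*\<delta> * (of_int n + a)^2))) summable_on A"
    by (rule summable_on_subset_banach[OF summable_gauss_int]) (use assms in auto)
  have S0: "S \<ge> 0" unfolding S_def by (intro infsum_nonneg) auto
  have "norm (infsum (tht a b \<tau>) A) \<le> exp (pi*e*\<delta>) * (S+1) * exp (- pi * e * Im \<tau>)" if \<tau>: "Im \<tau> \<ge> \<delta>" for \<tau>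
  proof -
    have s: "(\<lambda>n. norm (tht a b \<tau> n)) summable_on A"
      by (rule tht_abs_summable) (use assms \<tau> in auto)
    have "norm (infsum (tht a b \<tau>) A) \<le> infsum (\<lambda>n. norm (tht a b \<tau> n)) A" by (rule norm_infsum_bound[OF s])
    also have "\<dots> \<le> infsum (\<lambda>n. exp (-(pi*e*(Im \<tau> - \<delta>))) * exp (-(pi*\<delta> * (of_int n + a)^2))) A"
    proof (rule infsum_mono[OF s])
      show "(\<lambda>n. exp (-(pi*e*(Im \<tau> - \<delta>))) * exp (-(pi*\<delta> * (of_int n + a)^2))) summable_on A"
        by (intro summable_on_cmult_right sm)
      fix n assume n: "n \<in> A"
      have "pi * (Im \<tau> - \<delta>) * e \<le> pi * (Im \<tau> - \<delta>) * (of_int n + a)^2"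
        by (rule mult_left_mono[OF assms(1)[OF n]]) (use \<tau> in auto)
      thus "norm (tht a b \<tau> n) \<le> exp (-(pi*e*(Im \<tau> - \<delta>))) * exp (-(pi*\<delta> * (of_int n + a)^2))"
        unfolding norm_tht exp_add[symmetric] by (simp add: algebra_simps)
    qed
    also have "\<dots> = exp (-(pi*e*(Im \<tau> - \<delta>))) * S" by (simp add: S_def infsum_cmult_right')
    also have "\<dots> \<le> exp (-(pi*e*(Im \<tau> - \<delta>))) * (S + 1)" by simp
    also have "exp (-(pi*e*(Im \<tau> - \<delta>))) = exp (pi*e*\<delta>) * exp (- pi * e * Im \<tau>)"
      unfolding exp_add[symmetric] by (rule arg_cong[where f=exp]) (simp add: algebra_simps)
    finally show ?thesis by (simp add: mult_ac)
  qed
  moreover have "exp (pi*e*\<delta>) * (S+1) > 0" using S0 by (intro mult_pos_pos) auto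
  ultimately show ?thesis by blast
qed

lemma thg_split:
  assumes "Im \<tau> > 0" "finite X"
  shows "thg a b \<tau> = (\<Sum>n\<in>X. tht a b \<tau> n) + infsum (tht a b \<tau>) (-X)"
proof -
  note s = abs_summable_summable[OF tht_abs_summable[OF assms(1), of a b]]
  have "thg a b \<tau> = infsum (tht a b \<tau>) (X \<union> -X)" by (simp add: thg_tht)
  also have "\<dots> = infsum (tht a b \<tau>) X + infsum (tht a b \<tau>) (-X)"
    by (rule infsum_Un_disjoint) (auto intro: s)
  finally show ?thesis using assms(2) by simp
qed

lemma int_sq_ge:
  fixes n :: int and m :: nat
  assumes "\<bar>n\<bar> \<ge> int m" shows "(real_of_int n)^2 \<ge> (real m)^2"
  using assms by (metis abs_le_square_iff abs_of_nat of_int_abs of_int_le_iff of_int_of_nat_eq)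

text \<open>Each exponent is the smallest square left in the tail: 1, 1, 4 and (3/2)^2. The linear
  term of \<open>th3\<close> is kept because the constant term of \<open>Wf\<close> at infinity will
  be needed.\<close>

lemma th_asymptotics:
  assumes "\<delta> > 0"
  obtains C where "C > 0"
    "\<And>\<tau>. Im \<tau> \<ge> \<delta> \<Longrightarrow> norm (th3 \<tau> - 1) \<le> C * exp (- pi * Im \<tau>)"
    "\<And>\<tau>. Im \<tau> \<ge> \<delta> \<Longrightarrow> norm (th4 \<tau> - 1) \<le> C * exp (- pi * Im \<tau>)"
    "\<And>\<tau>. Im \<tau> \<ge> \<delta> \<Longrightarrow> norm (th3 \<tau> - 1 - 2 * exp (\<i>*pi*\<tau>)) \<le> C * exp (- pi * 4 * Im \<tau>)"
    "\<And>\<tau>. Im \<tau> \<ge> \<delta> \<Longrightarrow> norm (th2 \<tau> - 2 * exp (\<i>*pi*\<tau>/4)) \<le> C * exp (- pi * (9/4) * Im \<tau>)"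
proof -
  have a1: "(of_int n + 0)^2 \<ge> (1::real)" if "n \<in> -{0}" for n :: int
    using int_sq_ge[of 1 n] that by auto
  have a2: "(of_int n + 0)^2 \<ge> (4::real)" if "n \<in> -{-1,0,1}" for n :: int
  proof -
    have "\<bar>n\<bar> \<ge> int 2" using that by auto
    thus ?thesis using int_sq_ge[of 2 n] by simp
  qed
  have a3: "(of_int n + 1/2)^2 \<ge> (9/4::real)" if "n \<in> -{-1,0}" for n :: int
  proof -
    have "\<bar>2*n+1\<bar> \<ge> int 3" using that by auto
    hence "(real_of_int (2*n+1))^2 \<ge> 9" using int_sq_ge[of 3 "2*n+1"] by simp
    moreover have "(of_int n + 1/2)^2 = (real_of_int (2*n+1))^2/4" by (simp add: power2_eq_square field_simps)
    ultimately show ?thesis by simp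
  qed
  obtain C1 where C1: "C1 > 0" "\<And>\<tau>. Im \<tau> \<ge> \<delta> \<Longrightarrow> norm (infsum (tht 0 0 \<tau>) (-{0})) \<le> C1 * exp (- pi * 1 * Im \<tau>)"
    using thg_tail[where A="-{0}" and a="0" and e="1" and b="0", OF a1 assms] by blast
  obtain C2 where C2: "C2 > 0" "\<And>\<tau>. Im \<tau> \<ge> \<delta> \<Longrightarrow> norm (infsum (tht 0 (1/2) \<tau>) (-{0})) \<le> C2 * exp (- pi * 1 * Im \<tau>)"
    using thg_tail[where A="-{0}" and a="0" and e="1" and b="1/2", OF a1 assms] by blast
  obtain C3 where C3: "C3 > 0" "\<And>\<tau>. Im \<tau> \<ge> \<delta> \<Longrightarrow> norm (infsum (tht 0 0 \<tau>) (-{-1,0,1})) \<le> C3 * exp (- pi * 4 * Im \<tau>)"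
    using thg_tail[where A="-{-1,0,1}" and a="0" and e="4" and b="0", OF a2 assms] by blast
  obtain C4 where C4: "C4 > 0" "\<And>\<tau>. Im \<tau> \<ge> \<delta> \<Longrightarrow> norm (infsum (tht (1/2) 0 \<tau>) (-{-1,0})) \<le> C4 * exp (- pi * (9/4) * Im \<tau>)"
    using thg_tail[where A="-{-1,0}" and a="1/2" and e="9/4" and b="0", OF a3 assms] by blast
  define C where "C = C1 + C2 + C3 + C4"
  have CC: "C > 0" "C1 \<le> C" "C2 \<le> C" "C3 \<le> C" "C4 \<le> C" using C1(1) C2(1) C3(1) C4(1) by (auto simp: C_def)
  show thesis
  proof (rule that[OF CC(1)])
    fix \<tau> assume \<tau>: "Im \<tau> \<ge> \<delta>"
    hence p: "Im \<tau> > 0" using assms by simp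
    have up: "norm z \<le> C * exp r" if "norm z \<le> c * exp r" "c \<le> C" for z :: complex and c r
      using that by (meson exp_ge_zero mult_right_mono order_trans)
    have e3: "(\<Sum>n\<in>{0}. tht 0 0 \<tau> n) = 1" "(\<Sum>n\<in>{0}. tht 0 (1/2) \<tau> n) = 1" by (simp_all add: tht_def)
    have e4: "(\<Sum>n\<in>{-1,0,1}. tht 0 0 \<tau> n) = 1 + 2 * exp (\<i>*pi*\<tau>)" by (simp add: tht_def)
    have e: "(\<Sum>n\<in>{-1,0}. tht (1/2) 0 \<tau> n) = 2 * exp (\<i>*pi*\<tau>/4)"
      by (simp add: tht_def power2_eq_square)
    show "norm (th3 \<tau> - 1) \<le> C * exp (- pi * Im \<tau>)"
      using up[OF C1(2)[OF \<tau>] CC(2)] unfolding th3_def thg_split[OF p finite.insertI[OF finite.emptyI], of _ _ 0] e3 by simp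
    show "norm (th4 \<tau> - 1) \<le> C * exp (- pi * Im \<tau>)"
      using up[OF C2(2)[OF \<tau>] CC(3)] unfolding th4_def thg_split[OF p finite.insertI[OF finite.emptyI], of _ _ 0] e3 by simp
    show "norm (th3 \<tau> - 1 - 2 * exp (\<i>*pi*\<tau>)) \<le> C * exp (- pi * 4 * Im \<tau>)"
      using up[OF C3(2)[OF \<tau>] CC(4)] unfolding th3_def thg_split[OF p finite.insertI[OF finite.insertI[OF finite.insertI[OF finite.emptyI]]], of 0 0 "-1" 0 1] e4 by simp
    show "norm (th2 \<tau> - 2 * exp (\<i>*pi*\<tau>/4)) \<le> C * exp (- pi * (9/4) * Im \<tau>)"
      using up[OF C4(2)[OF \<tau>] CC(5)] unfolding th2_def thg_split[OF p finite.insertI[OF finite.insertI[OF finite.emptyI]], of "1/2" 0 "-1" 0] e by simp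
  qed
qed

text \<open>By \<open>th4_double\<close> a zero at \<tau> would produce zeros at all 2^k \<tau>,
  contradicting the limit 1 at infinity. No product expansion is involved.\<close>

lemma th4_nz: assumes "Im \<tau> > 0" shows "th4 \<tau> \<noteq> 0"
proof
  assume z: "th4 \<tau> = 0"
  have z: "th4 (of_real (2^k) * \<tau>) = 0" for k
  proof (induction k)
    case (Suc k)
    have "Im (of_real (2^k) * \<tau>) > 0" using assms by simp
    from th4_double[OF this] Suc show ?case by (simp add: mult_ac)
  qed (use z in simp)
  obtain C where C: "C > 0" "\<And>\<tau>. Im \<tau> \<ge> 1 \<Longrightarrow> norm (th4 \<tau> - 1) \<le> C * exp (- pi * Im \<tau>)"
    by (rule th_asymptotics[OF zero_less_one]) blast
  have "((\<lambda>y::real. C * exp (-pi * y)) \<longlongrightarrow> 0) at_top" by real_asymp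
  hence "\<forall>\<^sub>F y in at_top. C * exp (-pi * y) < 1" by (rule order_tendstoD) simp
  then obtain Y where Y: "\<And>y. y \<ge> Y \<Longrightarrow> C * exp (-pi * y) < 1" unfolding eventually_at_top_linorder by blast
  obtain k :: nat where "max 1 Y / Im \<tau> < 2^k" using real_arch_pow[of 2] by auto
  hence k: "max 1 Y \<le> 2^k * Im \<tau>" using assms by (simp add: field_simps)
  have im: "Im (of_real (2^k) * \<tau>) = 2^k * Im \<tau>" by simp
  show False using C(2)[of "of_real (2^k) * \<tau>"] Y[of "2^k * Im \<tau>"] k z[of k] unfolding im by simp
qed

lemma th3_nz: assumes "Im \<tau> > 0" shows "th3 \<tau> \<noteq> 0"
  using th4_nz[of "\<tau>+1"] assms by (simp add: th4_plus1)

lemma th2_nz: assumes "Im \<tau> > 0" shows "th2 \<tau> \<noteq> 0"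
  using th4_S[OF assms] th4_nz[OF Im_minus_inverse_pos[OF assms]] by auto

section \<open>The Hauptmodul of the theta group\<close>

text \<open>With \<lambda> = th2^4/th3^4 this is 16 / (\<lambda> (1 - \<lambda>)). The factor 16
  makes the leading term at infinity exactly 1/\<open>qn\<close>. There are no zeros in the half
  plane; the value 0 is approached at the cusp 1.\<close>

definition Wf :: "complex \<Rightarrow> complex" where
  "Wf \<tau> = 16 * th3 \<tau>^8 / (th2 \<tau>^4 * th4 \<tau>^4)"

lemma Wf_holo [holomorphic_intros]: "A \<subseteq> uhp \<Longrightarrow> Wf holomorphic_on A"
  unfolding Wf_def by (intro holomorphic_intros) (auto simp: th2_nz th4_nz dest!: subsetD)

lemma Wf_cont: "A \<subseteq> uhp \<Longrightarrow> continuous_on A Wf"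
  by (intro holomorphic_on_imp_continuous_on Wf_holo)

lemma Wf_nz: "Im \<tau> > 0 \<Longrightarrow> Wf \<tau> \<noteq> 0"
  by (simp add: Wf_def th2_nz th3_nz th4_nz)

lemma jcancel:
  fixes J a b c :: complex
  assumes "J \<noteq> 0"
  shows "k * (J * a)^8 / ((J * b)^4 * (J * c)^4) = k * a^8 / (c^4 * b^4)"
proof -
  have "k * (J * a)^8 / ((J * b)^4 * (J * c)^4) = (J^8 * (k * a^8)) / (J^8 * (c^4 * b^4))"
    by (simp add: power_mult_distrib mult_ac flip: power_add)
  thus ?thesis using assms by simp
qed

lemma Wf_S: assumes "Im \<tau> > 0" shows "Wf (-1/\<tau>) = Wf \<tau>"
  unfolding Wf_def th2_S[OF assms] th3_S[OF assms] th4_S[OF assms] by (rule jcancel[OF jfac_nz[OF assms]])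

lemma th2_plus1_pow4: "th2 (\<tau>+1)^4 = - (th2 \<tau>^4)"
proof -
  have "(exp (\<i> * pi / 4))^4 = (-1::complex)" by (simp add: exp_of_nat_mult[symmetric])
  thus ?thesis by (simp add: th2_plus1 power_mult_distrib)
qed

lemma Wf_plus1: "Wf (\<tau>+1) = - 16 * th4 \<tau>^8 / (th2 \<tau>^4 * th3 \<tau>^4)"
  by (simp add: Wf_def th2_plus1_pow4 th3_plus1 th4_plus1)

lemma Wf_plus2: "Wf (\<tau>+2) = Wf \<tau>"
proof -
  have "Wf (\<tau>+2) = Wf ((\<tau>+1)+1)" by (simp add: add_ac)
  thus ?thesis unfolding Wf_plus1[of "\<tau>+1"] th2_plus1_pow4 th3_plus1 th4_plus1 by (simp add: Wf_def)
qed

lemma Wf_cnj: "cnj (Wf \<tau>) = Wf (- cnj \<tau>)"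
  by (simp add: Wf_def cnj_th2 cnj_th3 cnj_th4)

lemma th3_cusp: "Im \<zeta> > 0 \<Longrightarrow> th3 (1 - 1/\<zeta>) = jfac \<zeta> * th2 \<zeta>"
  using th3_plus1[of "-1/\<zeta>"] th4_S[of \<zeta>] by simp

text \<open>The substitution \<tau> = 1 - 1/\<zeta> carries the cusp 1 to infinity, where the theta
  expansions apply.\<close>

lemma Wf_cusp:
  assumes "Im \<zeta> > 0" shows "Wf (1 - 1/\<zeta>) = - 16 * th2 \<zeta>^8 / (th3 \<zeta>^4 * th4 \<zeta>^4)"
proof -
  have "Wf (1 - 1/\<zeta>) = Wf (-1/\<zeta> + 1)" by (simp add: add_ac)
  also have "\<dots> = - 16 * (jfac \<zeta> * th2 \<zeta>)^8 / ((jfac \<zeta> * th4 \<zeta>)^4 * (jfac \<zeta> * th3 \<zeta>)^4)"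
    unfolding Wf_plus1 th2_S[OF assms] th3_S[OF assms] th4_S[OF assms] ..
  finally show ?thesis unfolding jcancel[OF jfac_nz[OF assms]] .
qed

section \<open>Expansions at the two cusps\<close>

text \<open>Limits along this filter are uniform in the real part.\<close>

definition itop :: "complex filter" where "itop = filtercomap Im at_top"

lemma eventually_itop: "eventually P itop \<longleftrightarrow> (\<exists>Y. \<forall>\<tau>. Im \<tau> \<ge> Y \<longrightarrow> P \<tau>)"
proof -
  have "eventually P itop \<longleftrightarrow> (\<exists>Y. \<forall>\<tau>. Im \<tau> > Y \<longrightarrow> P \<tau>)"
    unfolding itop_def eventually_filtercomap_at_top_dense ..
  thus ?thesis by (meson gt_ex less_imp_le less_le_trans)
qed

lemma filterlim_Im_itop: "filterlim Im at_top itop"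
  unfolding itop_def by (rule filterlim_filtercomap)

lemma tendsto_itop_bound:
  fixes f :: "complex \<Rightarrow> complex"
  assumes "\<And>\<tau>. Im \<tau> \<ge> 1 \<Longrightarrow> norm (f \<tau> - l) \<le> g (Im \<tau>)" and "(g \<longlongrightarrow> 0) at_top"
  shows "(f \<longlongrightarrow> l) itop"
proof -
  have "((\<lambda>\<tau>. g (Im \<tau>)) \<longlongrightarrow> 0) itop" by (rule filterlim_compose[OF assms(2) filterlim_Im_itop])
  hence "((\<lambda>\<tau>. f \<tau> - l) \<longlongrightarrow> 0) itop"
    by (rule tendsto_0_le[where K=1]) (use assms(1) in \<open>auto simp: eventually_itop intro!: exI[of _ 1] order_trans[OF _ abs_ge_self]\<close>)
  thus ?thesis by (simp add: LIM_zero_iff)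
qed

definition qn :: "complex \<Rightarrow> complex" where "qn \<tau> = exp (\<i> * pi * \<tau>)"

lemma norm_qn: "norm (qn \<tau>) = exp (- pi * Im \<tau>)" by (simp add: qn_def)

lemma qn_nz [simp]: "qn \<tau> \<noteq> 0" by (simp add: qn_def)

text \<open>\<open>th2\<close> stripped of its fractional leading power, so that it has a nonzero
  limit at infinity.\<close>

definition e2 :: "complex \<Rightarrow> complex" where "e2 \<tau> = th2 \<tau> / exp (\<i> * pi * \<tau> / 4)"

lemma th2_e2: "th2 \<tau> = e2 \<tau> * exp (\<i> * pi * \<tau> / 4)" by (simp add: e2_def)

lemma th2_pow4: "th2 \<tau>^4 = e2 \<tau>^4 * qn \<tau>"
  by (simp add: th2_e2 power_mult_distrib qn_def exp_of_nat_mult[symmetric])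

lemma th_limits:
  shows "(th3 \<longlongrightarrow> 1) itop" "(th4 \<longlongrightarrow> 1) itop" "(e2 \<longlongrightarrow> 2) itop"
    "((\<lambda>\<tau>. (th3 \<tau> - 1) / qn \<tau>) \<longlongrightarrow> 2) itop" "((\<lambda>\<tau>. (th4 \<tau> - 1) / qn \<tau>) \<longlongrightarrow> -2) itop"
    "((\<lambda>\<tau>. (e2 \<tau> - 2) / qn \<tau>) \<longlongrightarrow> 0) itop"
proof -
  obtain C where C: "C > 0"
    "\<And>\<tau>. Im \<tau> \<ge> 1 \<Longrightarrow> norm (th3 \<tau> - 1) \<le> C * exp (- pi * Im \<tau>)"
    "\<And>\<tau>. Im \<tau> \<ge> 1 \<Longrightarrow> norm (th4 \<tau> - 1) \<le> C * exp (- pi * Im \<tau>)"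
    "\<And>\<tau>. Im \<tau> \<ge> 1 \<Longrightarrow> norm (th3 \<tau> - 1 - 2 * exp (\<i>*pi*\<tau>)) \<le> C * exp (- pi * 4 * Im \<tau>)"
    "\<And>\<tau>. Im \<tau> \<ge> 1 \<Longrightarrow> norm (th2 \<tau> - 2 * exp (\<i>*pi*\<tau>/4)) \<le> C * exp (- pi * (9/4) * Im \<tau>)"
    by (rule th_asymptotics[OF zero_less_one]) blast
  have lim: "((\<lambda>y. C * exp (-pi*a*y)) \<longlongrightarrow> 0) at_top" if "a > 0" for a
    using that C(1) by real_asymp
  show "(th3 \<longlongrightarrow> 1) itop" by (rule tendsto_itop_bound[where g="\<lambda>y. C * exp (-pi*y)", OF C(2)]) (use lim[of 1] in auto)
  show "(th4 \<longlongrightarrow> 1) itop" by (rule tendsto_itop_bound[where g="\<lambda>y. C * exp (-pi*y)", OF C(3)]) (use lim[of 1] in auto)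
  have e2b: "norm (e2 \<tau> - 2) \<le> C * exp (-pi*2*Im \<tau>)" if "Im \<tau> \<ge> 1" for \<tau>
  proof -
    have "e2 \<tau> - 2 = (th2 \<tau> - 2 * exp (\<i>*pi*\<tau>/4)) / exp (\<i>*pi*\<tau>/4)" by (simp add: e2_def field_simps)
    hence "norm (e2 \<tau> - 2) = norm (th2 \<tau> - 2 * exp (\<i>*pi*\<tau>/4)) / exp (-pi*Im \<tau>/4)" by (simp add: norm_divide)
    also have "\<dots> \<le> C * exp (- pi * (9/4) * Im \<tau>) / exp (-pi*Im \<tau>/4)"
      by (intro divide_right_mono C(5) that) auto
    also have "\<dots> = C * exp (- pi * (9/4) * Im \<tau> - (-pi*Im \<tau>/4))" by (simp only: exp_diff) simp
    finally show ?thesis by (simp add: field_simps)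
  qed
  show "(e2 \<longlongrightarrow> 2) itop" by (rule tendsto_itop_bound[where g="\<lambda>y. C * exp (-pi*2*y)", OF e2b]) (use lim[of 2] in auto)
  have div: "norm (z / qn \<tau>) \<le> C * exp (- pi * a * Im \<tau>)" if "norm z \<le> C * exp (- pi * (a+1) * Im \<tau>)" for z a \<tau>
  proof -
    have "norm (z / qn \<tau>) \<le> C * exp (- pi * (a+1) * Im \<tau>) / exp (- pi * Im \<tau>)"
      unfolding norm_divide norm_qn by (intro divide_right_mono that) auto
    also have "\<dots> = C * exp (- pi * (a+1) * Im \<tau> - (- pi * Im \<tau>))" by (simp only: exp_diff) simp
    finally show ?thesis by (simp add: algebra_simps)
  qed
  have t3: "norm ((th3 \<tau> - 1) / qn \<tau> - 2) \<le> C * exp (-pi*3*Im \<tau>)" if "Im \<tau> \<ge> 1" for \<tau>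
  proof -
    have "(th3 \<tau> - 1) / qn \<tau> - 2 = (th3 \<tau> - 1 - 2 * exp (\<i>*pi*\<tau>)) / qn \<tau>" by (simp add: field_simps qn_def)
    thus ?thesis using div[of "th3 \<tau> - 1 - 2 * exp (\<i>*pi*\<tau>)" 3 \<tau>] C(4)[OF that] by simp
  qed
  show "((\<lambda>\<tau>. (th3 \<tau> - 1) / qn \<tau>) \<longlongrightarrow> 2) itop"
    by (rule tendsto_itop_bound[where g="\<lambda>y. C * exp (-pi*3*y)", OF t3]) (use lim[of 3] in auto)
  have "norm ((th4 \<tau> - 1) / qn \<tau> - (-2)) \<le> C * exp (-pi*3*Im \<tau>)" if "Im \<tau> \<ge> 1" for \<tau>
  proof -
    have "qn (\<tau>+1) = - qn \<tau>" by (simp add: qn_def algebra_simps exp_add)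
    hence "(th3 (\<tau>+1) - 1) / qn (\<tau>+1) - 2 = - ((th4 \<tau> - 1) / qn \<tau> - (-2))" by (simp add: th3_plus1)
    thus ?thesis using t3[of "\<tau>+1"] that by (metis Im_complex_of_real norm_minus_cancel plus_complex.sel(2) one_complex.sel(2) add_0_right)
  qed
  thus "((\<lambda>\<tau>. (th4 \<tau> - 1) / qn \<tau>) \<longlongrightarrow> -2) itop"
    by (rule tendsto_itop_bound[where g="\<lambda>y. C * exp (-pi*3*y)"]) (use lim[of 3] in auto)
  have "norm ((e2 \<tau> - 2) / qn \<tau> - 0) \<le> C * exp (-pi*1*Im \<tau>)" if "Im \<tau> \<ge> 1" for \<tau>
    using div[of "e2 \<tau> - 2" 1 \<tau>] e2b[OF that] by simp
  thus "((\<lambda>\<tau>. (e2 \<tau> - 2) / qn \<tau>) \<longlongrightarrow> 0) itop"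
    by (rule tendsto_itop_bound[where g="\<lambda>y. C * exp (-pi*1*y)"]) (use lim[of 1] in auto)
qed

lemma Wf_qn: "Wf \<tau> * qn \<tau> = 16 * th3 \<tau>^8 / (e2 \<tau>^4 * th4 \<tau>^4)"
  by (simp add: Wf_def th2_pow4)

lemma Wf_qn_lim: "((\<lambda>\<tau>. Wf \<tau> * qn \<tau>) \<longlongrightarrow> 1) itop"
proof -
  have "((\<lambda>\<tau>. 16 * th3 \<tau>^8 / (e2 \<tau>^4 * th4 \<tau>^4)) \<longlongrightarrow> 16 * 1^8 / (2^4 * 1^4)) itop"
    by (intro tendsto_intros th_limits) auto
  thus ?thesis by (simp add: Wf_qn)
qed

text \<open>\<open>Wf_qn_lim\<close> is too weak to give the sign of Im \<open>Wf\<close> at large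
  height, because 1/\<open>qn\<close> is unbounded. What is needed is an additive comparison whose
  limit, 24, is real.\<close>

lemma Wf_top_lim: "((\<lambda>\<tau>. Wf \<tau> - 1 / qn \<tau>) \<longlongrightarrow> 24) itop"
proof -
  let ?a = "\<lambda>\<tau>. (th3 \<tau> - 1) / qn \<tau>" and ?b = "\<lambda>\<tau>. (th4 \<tau> - 1) / qn \<tau>" and ?c = "\<lambda>\<tau>. (e2 \<tau> - 2) / qn \<tau>"
  \<comment> \<open>Each power difference is factored through its first-order difference, so that
    only the known limits of the difference quotients by \<open>qn\<close> enter.\<close>
  let ?G = "\<lambda>\<tau>. (16 * (?a \<tau> * (\<Sum>i<8. th3 \<tau>^i)) - ?c \<tau> * (e2 \<tau>^3 + 2*e2 \<tau>^2 + 4*e2 \<tau> + 8) * th4 \<tau>^4 - 16 * (?b \<tau> * (\<Sum>i<4. th4 \<tau>^i))) / (e2 \<tau>^4 * th4 \<tau>^4)"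
  have "(?G \<longlongrightarrow> (16 * (2 * (\<Sum>i<8. 1^i)) - 0 * (2^3 + 2*2^2 + 4*2 + 8) * 1^4 - 16 * (-2 * (\<Sum>i<4. 1^i))) / (2^4 * 1^4)) itop"
    by (intro tendsto_intros th_limits) auto
  hence lim: "(?G \<longlongrightarrow> 24) itop" by simp
  moreover have "eventually (\<lambda>\<tau>. ?G \<tau> = Wf \<tau> - 1 / qn \<tau>) itop"
    unfolding eventually_itop
  proof (intro exI[of _ 1] allI impI)
    fix \<tau> :: complex assume "1 \<le> Im \<tau>"
    hence im: "Im \<tau> > 0" by simp
    have nz: "e2 \<tau> \<noteq> 0" "th4 \<tau> \<noteq> 0" using th2_nz[OF im] th4_nz[OF im] by (auto simp: e2_def)
    have p8: "(th3 \<tau> - 1) * (\<Sum>i<8. th3 \<tau>^i) = th3 \<tau>^8 - 1" by (rule power_diff_1_eq[symmetric])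
    have p4: "(th4 \<tau> - 1) * (\<Sum>i<4. th4 \<tau>^i) = th4 \<tau>^4 - 1" by (rule power_diff_1_eq[symmetric])
    have pe: "(e2 \<tau> - 2) * (e2 \<tau>^3 + 2*e2 \<tau>^2 + 4*e2 \<tau> + 8) = e2 \<tau>^4 - 16"
      by (simp add: algebra_simps power2_eq_square power3_eq_cube power4_eq_xxxx)
    have "16 * (?a \<tau> * (\<Sum>i<8. th3 \<tau>^i)) - ?c \<tau> * (e2 \<tau>^3 + 2*e2 \<tau>^2 + 4*e2 \<tau> + 8) * th4 \<tau>^4 - 16 * (?b \<tau> * (\<Sum>i<4. th4 \<tau>^i))
      = (16 * ((th3 \<tau> - 1) * (\<Sum>i<8. th3 \<tau>^i)) - ((e2 \<tau> - 2) * (e2 \<tau>^3 + 2*e2 \<tau>^2 + 4*e2 \<tau> + 8)) * th4 \<tau>^4 - 16 * ((th4 \<tau> - 1) * (\<Sum>i<4. th4 \<tau>^i))) / qn \<tau>"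
      by (simp add: diff_divide_distrib left_diff_distrib right_diff_distrib mult_ac)
    also have "\<dots> = (16 * th3 \<tau>^8 - e2 \<tau>^4 * th4 \<tau>^4) / qn \<tau>"
      unfolding p8 p4 pe by (simp add: algebra_simps)
    finally have "?G \<tau> = (16 * th3 \<tau>^8 - e2 \<tau>^4 * th4 \<tau>^4) / qn \<tau> / (e2 \<tau>^4 * th4 \<tau>^4)" by simp
    also have "\<dots> = Wf \<tau> - 1 / qn \<tau>"
      using nz by (simp add: Wf_def th2_pow4 field_simps)
    finally show "?G \<tau> = Wf \<tau> - 1 / qn \<tau>" .
  qed
  ultimately show ?thesis by (rule Lim_transform_eventually)
qed

text \<open>The leading factor at the cusp 1, where \<open>Wf\<close> has a double zero in
  \<open>qn\<close> of the cusp coordinate; the limit is -16 times 2^8, i.e. -4096.\<close>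

definition Rc :: "complex \<Rightarrow> complex" where "Rc \<zeta> = Wf (1 - 1/\<zeta>) / qn \<zeta>^2"

lemma Rc_eq: "Im \<zeta> > 0 \<Longrightarrow> Rc \<zeta> = - 16 * e2 \<zeta>^8 / (th3 \<zeta>^4 * th4 \<zeta>^4)"
proof -
  assume im: "Im \<zeta> > 0"
  have "th2 \<zeta>^8 = (th2 \<zeta>^4)^2" by (simp flip: power_mult)
  also have "\<dots> = e2 \<zeta>^8 * qn \<zeta>^2" by (simp add: th2_pow4 power_mult_distrib flip: power_mult)
  finally show ?thesis by (simp add: Rc_def Wf_cusp[OF im])
qed

lemma Rc_lim: "(Rc \<longlongrightarrow> -4096) itop"
proof -
  have "((\<lambda>\<zeta>. - 16 * e2 \<zeta>^8 / (th3 \<zeta>^4 * th4 \<zeta>^4)) \<longlongrightarrow> - 16 * 2^8 / (1^4*1^4)) itop"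
    by (intro tendsto_intros th_limits) auto
  moreover have "eventually (\<lambda>\<zeta>. - 16 * e2 \<zeta>^8 / (th3 \<zeta>^4 * th4 \<zeta>^4) = Rc \<zeta>) itop"
    unfolding eventually_itop by (intro exI[of _ 1]) (simp add: Rc_eq)
  ultimately have "(Rc \<longlongrightarrow> - 16 * 2^8 / (1^4*1^4)) itop" by (rule Lim_transform_eventually)
  thus ?thesis by simp
qed

lemma Wf_cusp_small:
  assumes "\<epsilon> > 0"
  obtains V where "V > 0" "\<And>\<zeta>. Im \<zeta> \<ge> V \<Longrightarrow> norm (Wf (1 - 1/\<zeta>)) \<le> \<epsilon>"
proof -
  have "(qn \<longlongrightarrow> 0) itop"
    by (rule tendsto_itop_bound[where g="\<lambda>y. exp (-pi*y)"]) (simp add: norm_qn, real_asymp)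
  hence "((\<lambda>\<zeta>. Rc \<zeta> * qn \<zeta>^2) \<longlongrightarrow> -4096 * 0^2) itop" by (intro tendsto_intros Rc_lim)
  hence "((\<lambda>\<zeta>. Wf (1 - 1/\<zeta>)) \<longlongrightarrow> 0) itop" by (simp add: Rc_def)
  hence "eventually (\<lambda>\<zeta>. norm (Wf (1 - 1/\<zeta>)) < \<epsilon>) itop" using assms by (auto simp: tendsto_iff)
  then obtain Y where Y: "\<And>\<zeta>. Im \<zeta> \<ge> Y \<Longrightarrow> norm (Wf (1 - 1/\<zeta>)) < \<epsilon>" unfolding eventually_itop by blast
  show thesis by (rule that[of "max 1 Y"]) (auto intro: less_imp_le[OF Y])
qed

section \<open>Real curves of the Hauptmodul and the sign of its imaginary part\<close>

text \<open>The reflection taking \<tau> to - \<open>cnj\<close> \<tau> conjugates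
  \<open>Wf\<close>; on each of these curves it coincides with the identity, a translation by 2 or
  the inversion, which leave \<open>Wf\<close> unchanged.\<close>

lemma Wf_real_on: 
  assumes "Im \<tau> > 0" "Re \<tau> = 0 \<or> Re \<tau> = 1 \<or> Re \<tau> = -1 \<or> norm \<tau> = 1"
  shows "Im (Wf \<tau>) = 0"
proof -
  have "Wf (- cnj \<tau>) = Wf \<tau>"
  proof -
    consider "Re \<tau> = 0" | "Re \<tau> = 1" | "Re \<tau> = -1" | "norm \<tau> = 1" using assms(2) by blast
    thus ?thesis
    proof cases
      case 1 hence "- cnj \<tau> = \<tau>" by (simp add: complex_eq_iff)
      thus ?thesis by simp
    next
      case 2 hence "\<tau> = - cnj \<tau> + 2" by (simp add: complex_eq_iff)
      thus ?thesis by (metis Wf_plus2)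
    next
      case 3 hence "- cnj \<tau> = \<tau> + 2" by (simp add: complex_eq_iff)
      thus ?thesis by (metis Wf_plus2)
    next
      case 4 hence "\<tau> * cnj \<tau> = 1" by (simp add: complex_norm_square[symmetric])
      hence "- cnj \<tau> = -1/\<tau>" using uhp_nonzero[OF assms(1)] by (simp add: field_simps)
      thus ?thesis using Wf_S[OF assms(1)] by metis
    qed
  qed
  hence "cnj (Wf \<tau>) = Wf \<tau>" by (simp add: Wf_cnj)
  hence "Im (cnj (Wf \<tau>)) = Im (Wf \<tau>)" by simp
  thus ?thesis by simp
qed

text \<open>With u = 1 - Re \<tau>, being outside both unit circles means 2|u| <= u^2 + y^2, and |u|
  <= 1 turns this into |u| <= y^2. The domain pinches quadratically at the cusp, so 1/(1-\<tau>) has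
  height comparable to 1/y.\<close>

lemma cusp_height:
  assumes "0 \<le> Re \<tau>" "Re \<tau> \<le> 2" "norm \<tau> \<ge> 1" "norm (\<tau> - 2) \<ge> 1" "Im \<tau> > 0" "Im \<tau> \<le> 1"
  shows "\<bar>1 - Re \<tau>\<bar> \<le> (Im \<tau>)^2" "Im (1/(1-\<tau>)) \<ge> 1/(2 * Im \<tau>)" "Im (1/(1-\<tau>)) \<le> 1/Im \<tau>" "norm (1/(1-\<tau>)) \<le> 1 / Im \<tau>"
proof -
  define u y where "u = 1 - Re \<tau>" and "y = Im \<tau>"
  have n1: "(1-u)^2 + y^2 \<ge> 1" using assms(3) using power_mono[OF assms(3), of 2] by (simp add: u_def y_def cmod_power2)
  have e2: "(norm (\<tau> - 2))^2 = (1+u)^2 + y^2" unfolding cmod_power2 u_def y_def by (simp add: power2_eq_square algebra_simps)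
  have "1 \<le> (norm (\<tau> - 2))^2" by (rule one_le_power[OF assms(4)])
  hence n2: "(1+u)^2 + y^2 \<ge> 1" unfolding e2 .
  have u1: "\<bar>u\<bar> \<le> 1" using assms by (auto simp: u_def)
  have "\<bar>u\<bar> * \<bar>u\<bar> \<le> 1 * \<bar>u\<bar>" using u1 by (intro mult_right_mono) auto
  hence "u^2 \<le> \<bar>u\<bar>" by (simp add: power2_eq_square)
  hence uy: "\<bar>u\<bar> \<le> y^2" using n1 n2 by (cases "u \<ge> 0") (auto simp: power2_eq_square algebra_simps)
  thus "\<bar>1 - Re \<tau>\<bar> \<le> (Im \<tau>)^2" by (simp add: u_def y_def)
  have y: "0 < y" "y \<le> 1" using assms by (auto simp: y_def)
  have "u^2 \<le> y^2" using \<open>u^2 \<le> \<bar>u\<bar>\<close> uy by linarith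
  have z: "Im (1/(1-\<tau>)) = y / (u^2 + y^2)" by (simp add: Im_divide u_def y_def power2_eq_square)
  have pos: "u^2 + y^2 > 0" using y by (simp add: add_nonneg_pos)
  have "1/(2*y) = y / (y^2 + y^2)" using y by (simp add: field_simps power2_eq_square)
  also have "\<dots> \<le> y / (u^2 + y^2)" using \<open>u^2 \<le> y^2\<close> pos y by (intro divide_left_mono) (auto intro!: mult_pos_pos add_pos_pos)
  finally show "Im (1/(1-\<tau>)) \<ge> 1/(2 * Im \<tau>)" using z by (simp add: y_def)
  have "y / (u^2 + y^2) \<le> y / y^2" using y pos by (intro divide_left_mono) (auto intro!: mult_pos_pos)
  also have "\<dots> = 1/y" using y by (simp add: power2_eq_square)
  finally show "Im (1/(1-\<tau>)) \<le> 1/Im \<tau>" using z by (simp add: y_def)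
  have "norm (1-\<tau>) \<ge> y" using abs_Im_le_cmod[of "1-\<tau>"] y by (simp add: y_def)
  thus "norm (1/(1-\<tau>)) \<le> 1 / Im \<tau>" using y unfolding norm_divide by (simp add: y_def frac_le)
qed

text \<open>Maximum principle for exp(-i \<open>Wf\<close>), whose modulus is exp(Im
  \<open>Wf\<close>), on the half domain cut off near the cusp and at a large height.
  \<open>Wf\<close> is real on the sides and the arc, small near the cusp, and close to
  1/\<open>qn\<close> + 24 at the top, where 1/\<open>qn\<close> has imaginary part at most
  0.\<close>

lemma Wf_Im_neg:
  assumes "0 < Re \<tau>" "Re \<tau> < 1" "norm \<tau> > 1" "Im \<tau> > 0"
  shows "Im (Wf \<tau>) < 0"
proof -
  define D where "D = {\<tau>. 0 < Re \<tau> \<and> Re \<tau> < 1 \<and> norm \<tau> > 1 \<and> Im \<tau> > 0}"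
  have oD: "open D" unfolding D_def by (intro open_Collect_conj open_Collect_less continuous_intros)
  have le: "Im (Wf \<tau>) \<le> 0" if "\<tau> \<in> D" for \<tau>
  proof (rule field_le_epsilon)
    fix \<epsilon> :: real assume \<epsilon>: "\<epsilon> > 0"
    obtain V where V: "V > 0" "\<And>\<zeta>. Im \<zeta> \<ge> V \<Longrightarrow> norm (Wf (1 - 1/\<zeta>)) \<le> \<epsilon>" using Wf_cusp_small[OF \<epsilon>] by blast
    have "eventually (\<lambda>\<tau>. dist (Wf \<tau> - 1 / qn \<tau>) 24 < \<epsilon>) itop" using Wf_top_lim \<epsilon> by (auto simp: tendsto_iff)
    then obtain Y0 where Y0: "\<And>\<tau>. Im \<tau> \<ge> Y0 \<Longrightarrow> dist (Wf \<tau> - 1 / qn \<tau>) 24 < \<epsilon>" unfolding eventually_itop by blast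
    define Y where "Y = max Y0 (Im \<tau> + 1)"
    \<comment> \<open>The lower cut is so low that the cusp coordinate has height at least V there,
      which makes |\<open>Wf\<close>| at most \<epsilon>.\<close>
    define \<eta> where "\<eta> = min (min (1/(2*V)) (Im \<tau>/2)) 1"
    have \<eta>: "\<eta> > 0" "\<eta> < Im \<tau>" "\<eta> \<le> 1" "\<eta> \<le> 1/(2*V)" using that V(1) by (auto simp: \<eta>_def D_def)
    have Vle: "1/(2*\<eta>) \<ge> V" using \<eta> V(1) by (simp add: field_simps)
    define S where "S = {\<tau>. 0 < Re \<tau> \<and> Re \<tau> < 1 \<and> norm \<tau> > 1 \<and> Im \<tau> > \<eta> \<and> Im \<tau> < Y}"
    define K where "K = {\<tau>. 0 \<le> Re \<tau> \<and> Re \<tau> \<le> 1 \<and> norm \<tau> \<ge> 1 \<and> Im \<tau> \<ge> \<eta> \<and> Im \<tau> \<le> Y}"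
    have oS: "open S" unfolding S_def by (intro open_Collect_conj open_Collect_less continuous_intros)
    have cK: "closed K" unfolding K_def by (intro closed_Collect_conj closed_Collect_le continuous_intros)
    have SK: "S \<subseteq> K" by (auto simp: S_def K_def)
    hence clS: "closure S \<subseteq> K" using cK by (simp add: closure_minimal)
    have K_uhp: "K \<subseteq> uhp" using \<eta> by (auto simp: K_def)
    have fr: "norm (exp (-\<i> * Wf z)) \<le> exp \<epsilon>" if "z \<in> frontier S" for z
    proof -
      have "z \<in> K" "z \<notin> S" using that clS oS by (auto simp: frontier_def interior_open)
      hence zK: "0 \<le> Re z" "Re z \<le> 1" "norm z \<ge> 1" "Im z \<ge> \<eta>" "Im z \<le> Y" "Im z > 0" using \<eta> by (auto simp: K_def)
      have "Im (Wf z) \<le> \<epsilon>"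
      proof -
        consider "Re z = 0 \<or> Re z = 1 \<or> norm z = 1" | "Im z = \<eta>" | "Im z = Y" using \<open>z \<in> K\<close> \<open>z \<notin> S\<close> by (force simp: K_def S_def)
        thus ?thesis
        proof cases
          case 1 thus ?thesis using Wf_real_on[of z] zK \<epsilon> by auto
        next
          case 2
          have "norm (z - 2) \<ge> 1" using zK abs_Re_le_cmod[of "z-2"] by auto
          hence "Im (1/(1-z)) \<ge> 1/(2 * Im z)" using zK 2 \<eta> by (intro cusp_height) auto
          hence "Im (1/(1-z)) \<ge> V" using 2 Vle by simp
          from V(2)[OF this] have "norm (Wf z) \<le> \<epsilon>" by simp
          thus ?thesis using abs_Im_le_cmod[of "Wf z"] by linarith
        next
          case 3
          have "norm (Wf z - 1 / qn z - 24) < \<epsilon>" using Y0[of z] 3 by (simp add: dist_norm Y_def)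
          hence "Im (Wf z - 1 / qn z - 24) \<le> \<epsilon>" using abs_Im_le_cmod[of "Wf z - 1 / qn z - 24"] by linarith
          hence "Im (Wf z) - Im (1 / qn z) \<le> \<epsilon>" by (simp only: minus_complex.sel) simp
          moreover have "1 / qn z = exp (- (\<i> * pi * z))" by (simp add: qn_def exp_minus field_simps)
          hence "Im (1 / qn z) = - (exp (pi * Im z) * sin (pi * Re z))" by (simp add: Im_exp)
          moreover have "sin (pi * Re z) \<ge> 0" using zK by (intro sin_ge_zero) auto
          hence "exp (pi * Im z) * sin (pi * Re z) \<ge> 0" by simp
          ultimately show ?thesis by linarith
        qed
      qed
      thus ?thesis by simp
    qed
    have bK: "bounded K"
    proof (rule boundedI)
      fix z assume "z \<in> K"
      thus "norm z \<le> 1 + Y" using cmod_le[of z] \<eta> by (auto simp: K_def)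
    qed
    have "norm (exp (-\<i> * Wf \<tau>)) \<le> exp \<epsilon>"
    proof (rule maximum_modulus_frontier[of "\<lambda>z. exp (-\<i> * Wf z)" S])
      show "(\<lambda>z. exp (-\<i> * Wf z)) holomorphic_on interior S"
        using SK K_uhp interior_subset[of S] by (intro holomorphic_intros) auto
      show "continuous_on (closure S) (\<lambda>z. exp (-\<i> * Wf z))"
        using clS K_uhp by (intro continuous_intros Wf_cont) auto
      show "bounded S" using bK SK bounded_subset by blast
      show "\<tau> \<in> S" using that \<eta> by (auto simp: S_def D_def Y_def)
    qed (rule fr)
    thus "Im (Wf \<tau>) \<le> 0 + \<epsilon>" by simp
  qed
  have "Im (Wf \<tau>) \<noteq> 0"
  proof
    assume z: "Im (Wf \<tau>) = 0"
    \<comment> \<open>Strictness: an interior maximum forces exp(-i \<open>Wf\<close>) to be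
      constant of modulus 1, whereas its modulus is below 1 high up on Re = 1/2.\<close>
    have "(\<lambda>z. exp (-\<i> * Wf z)) constant_on uhp"
    proof (rule maximum_modulus_principle[where U=D and \<xi>=\<tau>])
      show "norm (exp (-\<i> * Wf w)) \<le> norm (exp (-\<i> * Wf \<tau>))" if "w \<in> D" for w using le[OF that] z by simp
      show "\<tau> \<in> D" using assms by (simp add: D_def)
    qed (use oD uhp_props in \<open>auto intro!: holomorphic_intros simp: D_def\<close>)
    then obtain c where c: "\<And>z. Im z > 0 \<Longrightarrow> exp (-\<i> * Wf z) = c" by (auto simp: constant_on_def)
    have "eventually (\<lambda>\<tau>. dist (Wf \<tau> - 1 / qn \<tau>) 24 < 1) itop" using Wf_top_lim by (auto simp: tendsto_iff)
    then obtain Y0 where Y0: "\<And>\<tau>. Im \<tau> \<ge> Y0 \<Longrightarrow> dist (Wf \<tau> - 1 / qn \<tau>) 24 < 1" unfolding eventually_itop by blast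
    define w where "w = Complex (1/2) (max Y0 1)"
    have w: "Im w > 0" "Im w \<ge> Y0" "Im w \<ge> 1" "Re w = 1/2" by (auto simp: w_def)
    have "norm (Wf w - 1 / qn w - 24) < 1" using Y0[OF w(2)] by (simp add: dist_norm)
    hence "Im (Wf w - 1 / qn w - 24) < 1" using abs_Im_le_cmod[of "Wf w - 1 / qn w - 24"] by linarith
    hence "Im (Wf w) - Im (1 / qn w) < 1" by (simp only: minus_complex.sel) simp
    moreover have "1 / qn w = exp (- (\<i> * pi * w))" by (simp add: qn_def exp_minus field_simps)
    hence "Im (1 / qn w) = - (exp (pi * Im w) * sin (pi * (1/2)))" by (simp add: Im_exp w)
    hence "Im (1 / qn w) = - exp (pi * Im w)" by simp
    moreover have "exp (pi * Im w) \<ge> 1" using w by simp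
    ultimately have "Im (Wf w) < 0" by linarith
    hence "norm (exp (-\<i> * Wf w)) < 1" by simp
    hence "norm c < 1" unfolding c[OF w(1)] .
    moreover have "norm (exp (-\<i> * Wf \<tau>)) = 1" using z by simp
    hence "norm c = 1" unfolding c[OF assms(4)] .
    ultimately show False by simp
  qed
  with le[of \<tau>] assms show ?thesis by (simp add: D_def)
qed

lemma Wf_Im_pos:
  assumes "-1 < Re \<tau>" "Re \<tau> < 0" "norm \<tau> > 1" "Im \<tau> > 0"
  shows "Im (Wf \<tau>) > 0"
proof -
  have "Im (Wf (- cnj \<tau>)) < 0" by (rule Wf_Im_neg) (use assms in auto)
  thus ?thesis by (simp flip: Wf_cnj)
qed

lemma th_real_axis:
  assumes "Re \<tau> = 0" "Im \<tau> > 0"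
  obtains a b c :: real where "th2 \<tau> = of_real a" "th3 \<tau> = of_real b" "th4 \<tau> = of_real c" "a \<noteq> 0" "b \<noteq> 0" "c \<noteq> 0"
proof -
  have e: "- cnj \<tau> = \<tau>" using assms by (simp add: complex_eq_iff)
  have "th2 \<tau> \<in> \<real>" "th3 \<tau> \<in> \<real>" "th4 \<tau> \<in> \<real>"
    using cnj_th2[of \<tau>] cnj_th3[of \<tau>] cnj_th4[of \<tau>] unfolding e by (simp_all add: Reals_cnj_iff)
  then obtain a b c where "th2 \<tau> = of_real a" "th3 \<tau> = of_real b" "th4 \<tau> = of_real c" by (auto elim!: Reals_cases)
  thus thesis using that[of a b c] th2_nz[OF assms(2)] th3_nz[OF assms(2)] th4_nz[OF assms(2)] by auto
qed

lemma Wf_axis_pos: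
  assumes "Re \<tau> = 0" "Im \<tau> > 0" shows "Re (Wf \<tau>) > 0"
proof -
  obtain a b c where abc: "th2 \<tau> = of_real a" "th3 \<tau> = of_real b" "th4 \<tau> = of_real c" "a \<noteq> 0" "b \<noteq> 0" "c \<noteq> 0"
    using th_real_axis[OF assms] .
  have "Wf \<tau> = of_real (16 * b^8 / (a^4 * c^4))" unfolding Wf_def abc by simp
  hence "Re (Wf \<tau>) = 16 * b^8 / (a^4 * c^4)" by (simp only: Re_complex_of_real)
  thus ?thesis using abc by (simp add: zero_less_power_eq)
qed

lemma Wf_line_neg:
  assumes "Re \<tau> = 1 \<or> Re \<tau> = -1" "Im \<tau> > 0" shows "Re (Wf \<tau>) < 0"
proof -
  have *: "Re (Wf \<tau>) < 0" if r: "Re \<tau> = 1" and "Im \<tau> > 0" for \<tau>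
  proof -
    define t where "t = \<tau> - 1"
    have t: "Re t = 0" "Im t > 0" "\<tau> = t + 1" using that by (auto simp: t_def)
    obtain a b c where abc: "th2 t = of_real a" "th3 t = of_real b" "th4 t = of_real c" "a \<noteq> 0" "b \<noteq> 0" "c \<noteq> 0"
      using th_real_axis[OF t(1,2)] .
    have "Wf \<tau> = of_real (- (16 * c^8 / (a^4 * b^4)))" unfolding t(3) Wf_plus1 abc by simp
    hence "Re (Wf \<tau>) = - (16 * c^8 / (a^4 * b^4))" by (simp only: Re_complex_of_real)
    thus ?thesis using abc by (simp add: zero_less_power_eq)
  qed
  show ?thesis
  proof (cases "Re \<tau> = 1")
    case False
    have "Re (Wf (\<tau>+2)) < 0" by (rule *) (use assms False in auto)
    thus ?thesis by (simp add: Wf_plus2)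
  qed (use * assms in auto)
qed

text \<open>On the arc -1/\<tau> = - \<open>cnj\<close> \<tau>, so the inversion formulas express
  the conjugates of \<open>th2\<close> and \<open>th3\<close>, and \<open>Wf\<close> becomes 16
  |th3|^8 / |th2|^8.\<close>

lemma Wf_arc_pos:
  assumes "norm \<tau> = 1" "Im \<tau> > 0" shows "Re (Wf \<tau>) > 0"
proof -
  have "\<tau> * cnj \<tau> = 1" using assms by (simp add: complex_norm_square[symmetric])
  hence e: "- cnj \<tau> = -1/\<tau>" using uhp_nonzero[OF assms(2)] by (simp add: field_simps)
  have c2: "cnj (th2 \<tau>) = jfac \<tau> * th4 \<tau>" unfolding cnj_th2 e th2_S[OF assms(2)] ..
  have c3: "cnj (th3 \<tau>) = jfac \<tau> * th3 \<tau>" unfolding cnj_th3 e th3_S[OF assms(2)] ..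
  have J: "jfac \<tau> \<noteq> 0" using jfac_nz assms by blast
  have "16 * (th3 \<tau> * (jfac \<tau> * th3 \<tau>))^4 / (th2 \<tau> * (jfac \<tau> * th4 \<tau>))^4
     = (jfac \<tau>^4 * (16 * th3 \<tau>^8)) / (jfac \<tau>^4 * (th2 \<tau>^4 * th4 \<tau>^4))"
    by (simp add: power_mult_distrib mult_ac flip: power_add)
  hence "Wf \<tau> = 16 * (th3 \<tau> * cnj (th3 \<tau>))^4 / (th2 \<tau> * cnj (th2 \<tau>))^4"
    using J unfolding c2 c3 by (simp add: Wf_def)
  also have "\<dots> = of_real (16 * ((norm (th3 \<tau>))^2)^4 / ((norm (th2 \<tau>))^2)^4)"
    unfolding complex_norm_square[symmetric] by simp
  finally show ?thesis using th2_nz th3_nz assms(2) by simp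
qed

text \<open>\<open>Wf\<close> is real on the line and has negative imaginary part just left of it,
  so by the Cauchy-Riemann equations it is monotone in the height. If it were constant on an
  interval, the identity theorem would make it constant, although it takes both signs.\<close>

lemma Wf_line_inj:
  assumes "Re s = 1" "Re t = 1" "Im s > 0" "Im t > 0" "Wf s = Wf t"
  shows "s = t"
proof -
  define p where "p = (\<lambda>y. 1 + \<i> * complex_of_real y)"
  have Im_p: "Im (p y) = y" "Re (p y) = 1" for y by (auto simp: p_def)
  define g where "g = (\<lambda>y. Re (Wf (p y)))"
  have Wg: "Wf (p y) = of_real (g y)" if "y > 0" for y
    using Wf_real_on[of "p y"] that Im_p by (simp add: g_def complex_eq_iff)
  have der: "(Wf has_field_derivative deriv Wf (p y)) (at (p y))" if "y > 0" for y
    using that by (intro holomorphic_derivI[OF Wf_holo, of uhp]) (auto simp: Im_p uhp_props)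
  have gder: "(g has_real_derivative - Im (deriv Wf (p y))) (at y)" if "y > 0" for y
  proof -
    have "(p has_vector_derivative \<i>) (at y)" unfolding p_def by (auto intro!: derivative_eq_intros)
    from field_vector_diff_chain_at[OF this der[OF that]]
    have "((\<lambda>y. Wf (p y)) has_vector_derivative \<i> * deriv Wf (p y)) (at y)" by (simp add: o_def)
    from bounded_linear.has_vector_derivative[OF bounded_linear_Re this]
    show ?thesis by (simp add: g_def has_real_derivative_iff_has_vector_derivative)
  qed
  have Im_ge: "Im (deriv Wf (p y)) \<ge> 0" if y: "y > 0" for y
  proof -
    have "((\<lambda>h. (Wf (p y + h) - Wf (p y)) / h) \<longlongrightarrow> deriv Wf (p y)) (at 0)"
      using der[OF y] by (simp add: DERIV_def)
    moreover have "filterlim (\<lambda>e::real. complex_of_real (-e)) (at 0) (at_right 0)"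
      by (auto simp: filterlim_at eventually_at_filter intro!: tendsto_eq_intros)
    ultimately have "((\<lambda>e. (Wf (p y + of_real (-e)) - Wf (p y)) / of_real (-e)) \<longlongrightarrow> deriv Wf (p y)) (at_right 0)"
      by (rule filterlim_compose)
    hence lim: "((\<lambda>e. Im ((Wf (p y + of_real (-e)) - Wf (p y)) / of_real (-e))) \<longlongrightarrow> Im (deriv Wf (p y))) (at_right 0)"
      by (rule tendsto_Im)
    show ?thesis
    proof (rule tendsto_lowerbound[OF lim])
      \<comment> \<open>e < y^2/2 keeps the point 1 - e + i y outside the unit circle, so that
        \<open>Wf_Im_neg\<close> applies.\<close>
      have "min 1 (y^2/2) > 0" using y by simp
      thus "\<forall>\<^sub>F e in at_right 0. 0 \<le> Im ((Wf (p y + of_real (-e)) - Wf (p y)) / of_real (-e))"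
        unfolding eventually_at_right_field
      proof (intro exI conjI allI impI)
        fix e :: real assume e: "0 < e" "e < min 1 (y^2/2)"
        have "(norm (p y + of_real (-e)))^2 = (1-e)^2 + y^2" by (simp add: p_def cmod_power2)
        also have "(1-e)^2 + y^2 = 1 + (y^2 - 2*e) + e^2" by (simp add: power2_eq_square algebra_simps)
        also have "\<dots> > 1"
        proof -
          have "2*e < y^2" using e by simp
          thus ?thesis using zero_le_power2[of e] by linarith
        qed
        finally have "norm (p y + of_real (-e)) > 1" by (intro power2_less_imp_less[of 1]) auto
        hence "Im (Wf (p y + of_real (-e))) < 0" using e y by (intro Wf_Im_neg) (auto simp: p_def)
        thus "0 \<le> Im ((Wf (p y + of_real (-e)) - Wf (p y)) / of_real (-e))"
          using e Wg[OF y] by (simp add: divide_nonpos_pos flip: of_real_minus)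
      qed
    qed simp
  qed
  have mono: "g b \<le> g a" if "0 < a" "a \<le> b" for a b
    by (rule DERIV_nonpos_imp_nonincreasing[OF that(2)]) (use that gder Im_ge in \<open>meson less_le_trans neg_le_0_iff_le\<close>)
  have no: False if ab: "0 < a" "a < b" "g a = g b" for a b
  proof -
    have const: "Wf (p y) = Wf (p a)" if "y \<in> {a..b}" for y
    proof -
      have "g y \<le> g a" "g b \<le> g y" using that ab mono[of a y] mono[of y b] by auto
      hence "g y = g a" using ab by simp
      thus ?thesis using Wg[of y] Wg[of a] that ab by simp
    qed
    have "Wf \<i> - Wf (p a) = 0"
    proof (rule analytic_continuation[of "\<lambda>z. Wf z - Wf (p a)" uhp "p ` {a..b}" "p a"])
      show "p a islimpt p ` {a..b}" unfolding islimpt_approachable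
      proof (intro allI impI)
        fix e :: real assume "e > 0"
        define y where "y = a + min (e/2) (b-a)"
        have y: "a < y" "y \<le> b" "y - a < e" using \<open>e > 0\<close> ab by (auto simp: y_def)
        have "p y - p a = \<i> * of_real (y - a)" by (simp add: p_def algebra_simps)
        hence "norm (p y - p a) = y - a" using y by (simp only: norm_mult norm_of_real) simp
        hence "p y \<in> p ` {a..b}" "p y \<noteq> p a" "dist (p y) (p a) < e"
          using y by (auto simp: dist_norm)
        thus "\<exists>x'\<in>p ` {a..b}. x' \<noteq> p a \<and> dist x' (p a) < e" by blast
      qed
      show "Wf z - Wf (p a) = 0" if z: "z \<in> p ` {a..b}" for z
      proof -
        obtain y where "y \<in> {a..b}" "z = p y" using z by blast
        thus ?thesis using const[of y] by (simp only: right_minus_eq)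
      qed
    qed (use ab uhp_props in \<open>auto intro!: holomorphic_intros simp: Im_p\<close>)
    moreover have "Re (Wf \<i>) > 0" by (rule Wf_axis_pos) auto
    moreover have "Re (Wf (p a)) < 0" by (rule Wf_line_neg) (use ab Im_p in auto)
    ultimately show False by simp
  qed
  have st: "s = p (Im s)" "t = p (Im t)" using assms by (auto simp: p_def complex_eq_iff)
  have "g (Im s) = g (Im t)" using assms(5) st by (simp add: g_def)
  hence "Im s = Im t" using no[of "Im s" "Im t"] no[of "Im t" "Im s"] assms by (metis linorder_neqE_linordered_idom)
  thus ?thesis using st by simp
qed

section \<open>Size of the Hauptmodul, \<open>th3\<close> and \<open>psi\<close> on the fundamental
  domain\<close>

text \<open>Compactness below some height, the nonzero limit above it.\<close>

lemma band_bounds: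
  fixes G :: "complex \<Rightarrow> complex"
  assumes cont: "continuous_on uhp G" and nz: "\<And>z. Im z > 0 \<Longrightarrow> G z \<noteq> 0"
    and lim: "(G \<longlongrightarrow> L) itop" and L: "L \<noteq> 0" and d: "\<delta> > 0"
  obtains c C where "c > 0" "C > 0" "\<And>z. \<bar>Re z\<bar> \<le> M \<Longrightarrow> Im z \<ge> \<delta> \<Longrightarrow> c \<le> norm (G z) \<and> norm (G z) \<le> C"
proof -
  have "eventually (\<lambda>z. dist (G z) L < norm L / 2) itop" by (rule tendstoD[OF lim]) (use L in simp)
  then obtain Y where Y: "\<And>z. Im z \<ge> Y \<Longrightarrow> dist (G z) L < norm L / 2" unfolding eventually_itop by blast
  define K where "K = cbox (Complex (-M) \<delta>) (Complex M Y)"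
  have K: "K \<subseteq> uhp" "compact K" using d by (auto simp: K_def in_cbox_complex_iff)
  have cK: "continuous_on K G" using cont K(1) continuous_on_subset by blast
  have "\<exists>c>0. \<exists>C. \<forall>z\<in>K. c \<le> norm (G z) \<and> norm (G z) \<le> C"
  proof (cases "K = {}")
    case False
    have cn: "continuous_on K (\<lambda>z. norm (G z))" using cK by (intro continuous_intros)
    obtain a where a: "a \<in> K" "\<And>z. z \<in> K \<Longrightarrow> norm (G a) \<le> norm (G z)" using continuous_attains_inf[OF K(2) False cn] by blast
    obtain b where b: "b \<in> K" "\<And>z. z \<in> K \<Longrightarrow> norm (G z) \<le> norm (G b)" using continuous_attains_sup[OF K(2) False cn] by blast
    have "norm (G a) > 0" using nz[of a] a(1) K(1) by auto
    thus ?thesis using a b by blast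
  qed (auto intro: exI[of _ 1])
  then obtain c C where c: "c > 0" "\<And>z. z \<in> K \<Longrightarrow> c \<le> norm (G z) \<and> norm (G z) \<le> C" by blast
  show thesis
  proof (rule that[of "min c (norm L / 2)" "max C (2 * norm L)"])
    show "min c (norm L / 2) > 0" "max C (2 * norm L) > 0" using c(1) L by (auto simp: less_max_iff_disj)
    fix z assume z: "\<bar>Re z\<bar> \<le> M" "Im z \<ge> \<delta>"
    show "min c (norm L / 2) \<le> norm (G z) \<and> norm (G z) \<le> max C (2 * norm L)"
    proof (cases "Im z \<ge> Y")
      case True
      have 1: "dist (G z) L < norm L / 2" by (rule Y[OF True])
      have "norm L \<le> norm (G z) + dist (G z) L" "norm (G z) \<le> norm L + dist (G z) L"
        using norm_triangle_ineq4[of "G z" "G z - L"] norm_triangle_ineq[of "G z - L" L] by (auto simp: dist_norm)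
      thus ?thesis using 1 by auto
    next
      case False
      hence "z \<in> K" using z by (auto simp: K_def in_cbox_complex_iff)
      from c(2)[OF this] show ?thesis by auto
    qed
  qed
qed

lemma deriv_bound:
  assumes "G holomorphic_on uhp" "Im z \<ge> 2 * r" "r > 0" "r \<le> 1"
    and "\<And>w. \<bar>Re w\<bar> \<le> \<bar>Re z\<bar> + 1 \<Longrightarrow> Im w \<ge> r \<Longrightarrow> norm (G w) \<le> B"
  shows "norm (deriv G z) \<le> B / r"
proof -
  have in_cball: "\<bar>Re w\<bar> \<le> \<bar>Re z\<bar> + 1 \<and> Im w \<ge> r" if "w \<in> cball z r" for w
    using that abs_Re_le_cmod[of "z-w"] abs_Im_le_cmod[of "z-w"] assms(2,4) by (auto simp: dist_norm)
  have sub: "cball z r \<subseteq> uhp" using in_cball assms(3) by fastforce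
  have "norm ((deriv ^^ 1) G z) \<le> fact 1 * B / r ^ 1"
  proof (rule Cauchy_inequality)
    show "G holomorphic_on ball z r" using assms(1) sub by (meson ball_subset_cball holomorphic_on_subset order_trans)
    show "continuous_on (cball z r) G" using assms(1) sub holomorphic_on_imp_continuous_on holomorphic_on_subset by blast
    show "norm (G w) \<le> B" if "norm (z - w) = r" for w
      using assms(5) in_cball[of w] that by (auto simp: dist_norm)
  qed (use assms in auto)
  thus ?thesis by simp
qed

text \<open>Weight 2 - 3/2 = 1/2. Dividing by \<open>th3\<close>^3 normalises the Cauchy kernel with
  density \<open>th3\<close>^3 to residue 1. The minus sign in \<open>psi_S\<close> is what makes
  \<open>psi\<close> times a function of \<open>Wf\<close> a solution of the homogeneous functional
  equation.\<close>

definition psi :: "complex \<Rightarrow> complex" where "psi \<tau> = deriv Wf \<tau> / th3 \<tau>^3"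

lemma psi_holo [holomorphic_intros]: "A \<subseteq> uhp \<Longrightarrow> psi holomorphic_on A"
proof (rule holomorphic_on_subset)
  show "psi holomorphic_on uhp" unfolding psi_def
    by (intro holomorphic_intros holomorphic_deriv Wf_holo) (auto simp: th3_nz uhp_props)
qed

lemma Wf_has_deriv: "Im \<tau> > 0 \<Longrightarrow> (Wf has_field_derivative deriv Wf \<tau>) (at \<tau>)"
  by (intro holomorphic_derivI[OF Wf_holo, of uhp]) (auto simp: uhp_props)

lemma deriv_Wf_plus2: "Im \<tau> > 0 \<Longrightarrow> deriv Wf (\<tau>+2) = deriv Wf \<tau>"
proof -
  assume "Im \<tau> > 0"
  hence "((\<lambda>z. Wf (z + 2)) has_field_derivative deriv Wf (\<tau>+2)) (at \<tau>)"
    using Wf_has_deriv[of "\<tau>+2"] by (simp add: DERIV_shift)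
  hence "(Wf has_field_derivative deriv Wf (\<tau>+2)) (at \<tau>)" by (simp add: Wf_plus2)
  thus ?thesis by (simp add: DERIV_imp_deriv)
qed

lemma psi_plus2: "Im \<tau> > 0 \<Longrightarrow> psi (\<tau>+2) = psi \<tau>"
  by (simp add: psi_def deriv_Wf_plus2 th3_plus2)

lemma deriv_Wf_S: assumes "Im \<tau> > 0" shows "deriv Wf (-1/\<tau>) = \<tau>^2 * deriv Wf \<tau>"
proof -
  have nz: "\<tau> \<noteq> 0" using assms by auto
  have "((\<lambda>z. -1/z) has_field_derivative 1/\<tau>^2) (at \<tau>)"
    using nz by (auto intro!: derivative_eq_intros simp: power2_eq_square)
  from DERIV_chain2[OF Wf_has_deriv[OF Im_minus_inverse_pos[OF assms]] this]
  have "((\<lambda>z. Wf (-1/z)) has_field_derivative deriv Wf (-1/\<tau>) * (1/\<tau>^2)) (at \<tau>)" .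
  hence "(Wf has_field_derivative deriv Wf (-1/\<tau>) * (1/\<tau>^2)) (at \<tau>)"
    by (rule has_field_derivative_transform_within_open[where S=uhp])
       (use assms uhp_props Wf_S in auto)
  hence "deriv Wf \<tau> = deriv Wf (-1/\<tau>) * (1/\<tau>^2)" by (simp add: DERIV_imp_deriv)
  thus ?thesis using nz by (simp add: field_simps)
qed

lemma psi_S: assumes "Im \<tau> > 0" shows "psi (-1/\<tau>) = - jfac \<tau> * psi \<tau>"
proof -
  have "\<tau>^2 = - ((jfac \<tau>^2)^2)" unfolding jfac_sq by (simp add: power_mult_distrib)
  hence t: "\<tau>^2 = - jfac \<tau> * jfac \<tau>^3" by (simp add: power2_eq_square power3_eq_cube)
  show ?thesis unfolding psi_def deriv_Wf_S[OF assms] th3_S[OF assms] t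
    using jfac_nz[OF assms] by (simp add: power_mult_distrib)
qed

lemma th_band:
  assumes "\<delta> > 0"
  obtains c C where "c > 0" "C > 0"
    "\<And>z. \<bar>Re z\<bar> \<le> M \<Longrightarrow> Im z \<ge> \<delta> \<Longrightarrow> c \<le> norm (th3 z) \<and> norm (th3 z) \<le> C"
    "\<And>z. \<bar>Re z\<bar> \<le> M \<Longrightarrow> Im z \<ge> \<delta> \<Longrightarrow> c \<le> norm (e2 z) \<and> norm (e2 z) \<le> C"
    "\<And>z. \<bar>Re z\<bar> \<le> M \<Longrightarrow> Im z \<ge> \<delta> \<Longrightarrow> c \<le> norm (Wf z * qn z) \<and> norm (Wf z * qn z) \<le> C"
    "\<And>z. \<bar>Re z\<bar> \<le> M \<Longrightarrow> Im z \<ge> \<delta> \<Longrightarrow> c \<le> norm (Rc z) \<and> norm (Rc z) \<le> C"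
proof -
  have ch: "continuous_on uhp th3" "continuous_on uhp th2" "continuous_on uhp th4" "continuous_on uhp Wf"
    by (intro holomorphic_on_imp_continuous_on holomorphic_intros; simp)+
  have ce2: "continuous_on uhp e2" unfolding e2_def by (intro continuous_intros ch) auto
  have cW: "continuous_on uhp (\<lambda>z. Wf z * qn z)" unfolding qn_def by (intro continuous_intros ch)
  have "continuous_on uhp (\<lambda>\<zeta>. - 16 * e2 \<zeta>^8 / (th3 \<zeta>^4 * th4 \<zeta>^4))"
    by (intro continuous_intros ch ce2) (auto simp: th3_nz th4_nz)
  hence cR: "continuous_on uhp Rc" by (subst continuous_on_cong[OF refl Rc_eq]) auto
  have e2nz: "e2 z \<noteq> 0" if "Im z > 0" for z using th2_nz[OF that] by (simp add: e2_def)
  obtain c1 C1 where 1: "c1 > 0" "C1 > 0" "\<And>z. \<bar>Re z\<bar> \<le> M \<Longrightarrow> Im z \<ge> \<delta> \<Longrightarrow> c1 \<le> norm (th3 z) \<and> norm (th3 z) \<le> C1"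
    using band_bounds[OF ch(1) th3_nz th_limits(1) _ assms, of M] by (metis zero_neq_one)
  obtain c2 C2 where 2: "c2 > 0" "C2 > 0" "\<And>z. \<bar>Re z\<bar> \<le> M \<Longrightarrow> Im z \<ge> \<delta> \<Longrightarrow> c2 \<le> norm (e2 z) \<and> norm (e2 z) \<le> C2"
    using band_bounds[OF ce2 e2nz th_limits(3) _ assms, of M] by (metis zero_neq_numeral)
  obtain c3 C3 where 3: "c3 > 0" "C3 > 0" "\<And>z. \<bar>Re z\<bar> \<le> M \<Longrightarrow> Im z \<ge> \<delta> \<Longrightarrow> c3 \<le> norm (Wf z * qn z) \<and> norm (Wf z * qn z) \<le> C3"
    using band_bounds[OF cW _ Wf_qn_lim _ assms, of M] Wf_nz by (metis mult_eq_0_iff qn_nz zero_neq_one)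
  have Rnz: "Rc z \<noteq> 0" if "Im z > 0" for z using e2nz[OF that] th3_nz[OF that] th4_nz[OF that] by (simp add: Rc_eq[OF that])
  obtain c4 C4 where 4: "c4 > 0" "C4 > 0" "\<And>z. \<bar>Re z\<bar> \<le> M \<Longrightarrow> Im z \<ge> \<delta> \<Longrightarrow> c4 \<le> norm (Rc z) \<and> norm (Rc z) \<le> C4"
    using band_bounds[OF cR Rnz Rc_lim _ assms, of M] by auto
  define c C where "c = min (min c1 c2) (min c3 c4)" and "C = max (max C1 C2) (max C3 C4)"
  have cc: "c \<le> c1" "c \<le> c2" "c \<le> c3" "c \<le> c4" "C1 \<le> C" "C2 \<le> C" "C3 \<le> C" "C4 \<le> C" by (auto simp: c_def C_def)
  have pos: "c > 0" "C > 0" using 1 2 3 4 by (auto simp: c_def C_def less_max_iff_disj)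
  show thesis
  proof (rule that[OF pos])
    fix z assume z: "\<bar>Re z\<bar> \<le> M" "Im z \<ge> \<delta>"
    show "c \<le> norm (th3 z) \<and> norm (th3 z) \<le> C" using 1(3)[OF z] cc by linarith
    show "c \<le> norm (e2 z) \<and> norm (e2 z) \<le> C" using 2(3)[OF z] cc by linarith
    show "c \<le> norm (Wf z * qn z) \<and> norm (Wf z * qn z) \<le> C" using 3(3)[OF z] cc by linarith
    show "c \<le> norm (Rc z) \<and> norm (Rc z) \<le> C" using 4(3)[OF z] cc by linarith
  qed
qed

text \<open>The closed fundamental domain of the theta group with its left half moved by 2, so that
  the corners at -1 and 1 merge into a single cusp at 1.\<close>

definition OmC :: "complex set" where
  "OmC = {\<tau>. 0 \<le> Re \<tau> \<and> Re \<tau> \<le> 2 \<and> norm \<tau> \<ge> 1 \<and> norm (\<tau> - 2) \<ge> 1 \<and> Im \<tau> > 0}"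

lemma OmC_low:
  assumes "\<tau> \<in> OmC" "Im \<tau> \<le> 1"
  defines "\<zeta> \<equiv> 1/(1-\<tau>)"
  shows "\<tau> = 1 - 1/\<zeta>" "Im \<zeta> \<ge> 1/(2 * Im \<tau>)" "Im \<zeta> \<ge> 1/2" "Im \<zeta> \<le> 1/Im \<tau>" "\<bar>Re \<zeta>\<bar> \<le> 1" "norm \<zeta> \<le> 2 * Im \<zeta>"
proof -
  have im: "Im \<tau> > 0" using assms by (simp add: OmC_def)
  have nz: "1 - \<tau> \<noteq> 0" using im by (metis add.commute diff_add_cancel eq_iff_diff_eq_0 less_irrefl one_complex.sel(2))
  show "\<tau> = 1 - 1/\<zeta>" using nz by (simp add: \<zeta>_def)
  have h: "0 \<le> Re \<tau>" "Re \<tau> \<le> 2" "norm \<tau> \<ge> 1" "norm (\<tau> - 2) \<ge> 1" "Im \<tau> > 0" "Im \<tau> \<le> 1" using assms by (auto simp: OmC_def)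
  note ch = cusp_height[OF h]
  show 1: "Im \<zeta> \<ge> 1/(2 * Im \<tau>)" "Im \<zeta> \<le> 1/Im \<tau>" using ch unfolding \<zeta>_def by auto
  have "1/(2 * Im \<tau>) \<ge> 1/2" using im assms(2) by (simp add: field_simps)
  thus "Im \<zeta> \<ge> 1/2" using 1 by simp
  have "norm \<zeta> \<le> 1 / Im \<tau>" using ch unfolding \<zeta>_def by auto
  also have "\<dots> \<le> 2 * Im \<zeta>" using 1 by simp
  finally show "norm \<zeta> \<le> 2 * Im \<zeta>" .
  have "Re \<zeta> = (1 - Re \<tau>) / ((1 - Re \<tau>)^2 + (Im \<tau>)^2)" by (simp add: \<zeta>_def Re_divide power2_eq_square)
  hence "\<bar>Re \<zeta>\<bar> = \<bar>1 - Re \<tau>\<bar> / ((1 - Re \<tau>)^2 + (Im \<tau>)^2)" by (simp add: abs_divide)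
  also have "\<dots> \<le> (Im \<tau>)^2 / (Im \<tau>)^2" using im ch(1) by (intro frac_le) auto
  finally show "\<bar>Re \<zeta>\<bar> \<le> 1" using im by simp
qed

text \<open>High up these are the leading terms in \<open>qn\<close>. Near the cusp, with v = Im
  \<zeta>, \<open>Wf\<close> is of order exp(-2 pi v) and \<open>th3\<close> of order v^(1/2)
  exp(-pi v/4); the chain rule contributes \<zeta>^2 to the derivative of \<open>Wf\<close>, so
  \<open>psi\<close> has order v^(2 - 3/2) exp(-2 pi v + 3 pi v/4).\<close>

lemma OmC_bounds:
  obtains c C where "c > 0" "C > 0"
    "\<And>\<tau>. \<tau> \<in> OmC \<Longrightarrow> Im \<tau> \<ge> 1 \<Longrightarrow> c * exp (pi * Im \<tau>) \<le> norm (Wf \<tau>) \<and> norm (Wf \<tau>) \<le> C * exp (pi * Im \<tau>) \<and> norm (th3 \<tau>) \<le> C \<and> norm (psi \<tau>) \<le> C * exp (pi * Im \<tau>)"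
    "\<And>\<tau> \<zeta>. \<tau> \<in> OmC \<Longrightarrow> Im \<tau> \<le> 1 \<Longrightarrow> \<zeta> = 1/(1-\<tau>) \<Longrightarrow> c * exp (-2*pi * Im \<zeta>) \<le> norm (Wf \<tau>) \<and> norm (Wf \<tau>) \<le> C * exp (-2*pi * Im \<zeta>) \<and> norm (th3 \<tau>) \<le> C * sqrt (Im \<zeta>) * exp (-pi * Im \<zeta>/4)
       \<and> norm (psi \<tau>) \<le> C * sqrt (Im \<zeta>) * exp (-5*pi * Im \<zeta>/4)"
proof -
  \<comment> \<open>The band |Re| <= 3, Im >= 1/4 leaves room for Cauchy estimates on discs of
    radius 1/4 about points with |Re| <= 2 and Im >= 1/2.\<close>
  have q4: "(0::real) < 1/4" by simp
  obtain c C where cC: "c > 0" "C > 0"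
    and b3: "\<And>z. \<bar>Re z\<bar> \<le> 3 \<Longrightarrow> Im z \<ge> 1/4 \<Longrightarrow> c \<le> norm (th3 z) \<and> norm (th3 z) \<le> C"
    and b2: "\<And>z. \<bar>Re z\<bar> \<le> 3 \<Longrightarrow> Im z \<ge> 1/4 \<Longrightarrow> c \<le> norm (e2 z) \<and> norm (e2 z) \<le> C"
    and bW: "\<And>z. \<bar>Re z\<bar> \<le> 3 \<Longrightarrow> Im z \<ge> 1/4 \<Longrightarrow> c \<le> norm (Wf z * qn z) \<and> norm (Wf z * qn z) \<le> C"
    and bR: "\<And>z. \<bar>Re z\<bar> \<le> 3 \<Longrightarrow> Im z \<ge> 1/4 \<Longrightarrow> c \<le> norm (Rc z) \<and> norm (Rc z) \<le> C"
    by (rule th_band[OF q4, of 3]) blast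
  have dW: "norm (deriv Wf \<tau>) \<le> (4*C + pi*C) * exp (pi * Im \<tau>)" if t: "\<bar>Re \<tau>\<bar> \<le> 2" "Im \<tau> \<ge> 1/2" for \<tau>
  proof -
    let ?G = "\<lambda>z. Wf z * qn z"
    have hG: "?G holomorphic_on uhp" unfolding qn_def by (intro holomorphic_intros) auto
    have im: "Im \<tau> > 0" using t by simp
    have dG: "norm (deriv ?G \<tau>) \<le> C / (1/4)"
      by (rule deriv_bound[OF hG]) (use t bW in auto)
    have "(?G has_field_derivative deriv Wf \<tau> * qn \<tau> + Wf \<tau> * (qn \<tau> * (\<i> * pi))) (at \<tau>)"
      unfolding qn_def by (rule derivative_eq_intros Wf_has_deriv im refl | simp)+
    hence "deriv ?G \<tau> = deriv Wf \<tau> * qn \<tau> + Wf \<tau> * (qn \<tau> * (\<i> * pi))" by (rule DERIV_imp_deriv)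
    hence "deriv Wf \<tau> = (deriv ?G \<tau> - \<i> * pi * ?G \<tau>) / qn \<tau>" by (simp add: field_simps)
    hence "norm (deriv Wf \<tau>) = norm (deriv ?G \<tau> - \<i> * pi * ?G \<tau>) / exp (- pi * Im \<tau>)" by (simp add: norm_divide norm_qn)
    also have "\<dots> \<le> (4*C + pi*C) / exp (- pi * Im \<tau>)"
    proof (rule divide_right_mono)
      have "norm (deriv ?G \<tau> - \<i> * pi * ?G \<tau>) \<le> norm (deriv ?G \<tau>) + norm (\<i> * pi * ?G \<tau>)" by (rule norm_triangle_ineq4)
      also have "norm (\<i> * pi * ?G \<tau>) = pi * norm (?G \<tau>)" by (simp add: norm_mult)
      also have "norm (deriv ?G \<tau>) + pi * norm (?G \<tau>) \<le> 4*C + pi * C" using dG bW[of \<tau>] t by (intro add_mono mult_left_mono) auto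
      finally show "norm (deriv ?G \<tau> - \<i> * pi * ?G \<tau>) \<le> 4*C + pi*C" .
    qed simp
    also have "\<dots> = (4*C + pi*C) * exp (pi * Im \<tau>)" by (simp add: exp_minus field_simps)
    finally show ?thesis .
  qed
  have dR: "norm (deriv Wf (1-1/\<zeta>)) \<le> (4*C + 2*pi*C) * (norm \<zeta>)^2 * exp (-2*pi * Im \<zeta>)" if t: "\<bar>Re \<zeta>\<bar> \<le> 2" "Im \<zeta> \<ge> 1/2" for \<zeta>
  proof -
    have im: "Im \<zeta> > 0" using t by simp
    have nz: "\<zeta> \<noteq> 0" using im by auto
    have inu: "Im (1 - 1/z) > 0" if "Im z > 0" for z using Im_minus_inverse_pos[OF that] by simp
    have "(\<lambda>z. Wf (1-1/z)) holomorphic_on uhp"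
      by (rule holomorphic_on_compose_gen[of "\<lambda>z. 1-1/z" _ Wf uhp, unfolded o_def])
         (auto intro!: holomorphic_intros inu)
    hence hG: "Rc holomorphic_on uhp" unfolding Rc_def[abs_def] qn_def by (intro holomorphic_intros) auto
    have dG: "norm (deriv Rc \<zeta>) \<le> C / (1/4)"
      by (rule deriv_bound[OF hG]) (use t bR in auto)
    have d1: "((\<lambda>z. 1-1/z) has_field_derivative 1/\<zeta>^2) (at \<zeta>)"
      using nz by (auto intro!: derivative_eq_intros simp: power2_eq_square)
    from DERIV_chain2[OF Wf_has_deriv[OF inu[OF im]] d1]
    have A: "((\<lambda>z. Wf (1-1/z)) has_field_derivative deriv Wf (1-1/\<zeta>) * (1/\<zeta>^2)) (at \<zeta>)" .
    have q2: "qn z^2 = exp (2*\<i>*pi*z)" for z by (simp add: qn_def exp_double[symmetric] mult_ac)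
    have B: "((\<lambda>z. Rc z * qn z^2) has_field_derivative deriv Rc \<zeta> * qn \<zeta>^2 + Rc \<zeta> * (qn \<zeta>^2 * (2*\<i>*pi))) (at \<zeta>)"
      unfolding q2 by (rule derivative_eq_intros holomorphic_derivI[OF hG] refl | simp add: uhp_props im)+
    have fe: "(\<lambda>z. Rc z * qn z^2) = (\<lambda>z. Wf (1-1/z))" by (auto simp: Rc_def)
    have "deriv Wf (1-1/\<zeta>) * (1/\<zeta>^2) = deriv Rc \<zeta> * qn \<zeta>^2 + Rc \<zeta> * (qn \<zeta>^2 * (2*\<i>*pi))"
      by (rule DERIV_unique[OF A B[unfolded fe]])
    hence "deriv Wf (1-1/\<zeta>) = (deriv Rc \<zeta> + 2*\<i>*pi * Rc \<zeta>) * \<zeta>^2 * qn \<zeta>^2" using nz by (simp add: field_simps)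
    hence "norm (deriv Wf (1-1/\<zeta>)) = norm (deriv Rc \<zeta> + 2*\<i>*pi * Rc \<zeta>) * (norm \<zeta>)^2 * exp (-2*pi * Im \<zeta>)"
      by (simp add: norm_mult norm_power norm_qn exp_double[symmetric] mult_ac)
    also have "\<dots> \<le> (4*C + 2*pi*C) * (norm \<zeta>)^2 * exp (-2*pi * Im \<zeta>)"
    proof (intro mult_right_mono)
      have "norm (deriv Rc \<zeta> + 2*\<i>*pi * Rc \<zeta>) \<le> norm (deriv Rc \<zeta>) + norm (2*\<i>*pi * Rc \<zeta>)" by (rule norm_triangle_ineq)
      also have "norm (2*\<i>*pi * Rc \<zeta>) = 2*pi * norm (Rc \<zeta>)" by (simp add: norm_mult)
      also have "norm (deriv Rc \<zeta>) + 2*pi * norm (Rc \<zeta>) \<le> 4*C + 2*pi * C" using dG bR[of \<zeta>] t by (intro add_mono mult_left_mono) auto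
      finally show "norm (deriv Rc \<zeta> + 2*\<i>*pi * Rc \<zeta>) \<le> 4*C + 2*pi*C" .
    qed auto
    finally show ?thesis .
  qed
  define A where "A = 4*C + 2*pi*C"
  have A: "A > 0" "4*C + pi*C \<le> A" using cC by (auto simp: A_def intro!: add_pos_pos)
  define D where "D = max (max C (A / c^3)) (max (2*C) (4 * A / c^3))"
  have D: "C \<le> D" "A/c^3 \<le> D" "2*C \<le> D" "4*A/c^3 \<le> D" "D > 0" using cC by (auto simp: D_def less_max_iff_disj)
  show thesis
  proof (rule that[OF cC(1) D(5)])
    fix \<tau> assume t: "\<tau> \<in> OmC" "Im \<tau> \<ge> 1"
    have re: "\<bar>Re \<tau>\<bar> \<le> 2" using t by (auto simp: OmC_def)
    have W: "norm (Wf \<tau>) = norm (Wf \<tau> * qn \<tau>) * exp (pi * Im \<tau>)" by (simp add: norm_mult norm_qn exp_minus field_simps)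
    have "c * exp (pi * Im \<tau>) \<le> norm (Wf \<tau>)" "norm (Wf \<tau>) \<le> C * exp (pi * Im \<tau>)"
      unfolding W using bW[of \<tau>] re t by (auto intro!: mult_right_mono)
    moreover have "C * exp (pi * Im \<tau>) \<le> D * exp (pi * Im \<tau>)" using D by (intro mult_right_mono) auto
    moreover have "norm (th3 \<tau>) \<le> C" using b3[of \<tau>] re t by auto
    moreover have "norm (psi \<tau>) \<le> D * exp (pi * Im \<tau>)"
    proof -
      have "norm (psi \<tau>) = norm (deriv Wf \<tau>) / norm (th3 \<tau>)^3" by (simp add: psi_def norm_divide norm_power)
      also have "\<dots> \<le> (A * exp (pi * Im \<tau>)) / c^3"
      proof (rule frac_le)
        show "norm (deriv Wf \<tau>) \<le> A * exp (pi * Im \<tau>)"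
          using order_trans[OF dW[of \<tau>] mult_right_mono[OF A(2)]] re t by auto
        show "c^3 \<le> norm (th3 \<tau>)^3" using b3[of \<tau>] re t cC by (intro power_mono) auto
      qed (use A cC in auto)
      also have "\<dots> = (A/c^3) * exp (pi * Im \<tau>)" by simp
      also have "\<dots> \<le> D * exp (pi * Im \<tau>)" using D by (intro mult_right_mono) auto
      finally show ?thesis .
    qed
    ultimately show "c * exp (pi * Im \<tau>) \<le> norm (Wf \<tau>) \<and> norm (Wf \<tau>) \<le> D * exp (pi * Im \<tau>) \<and> norm (th3 \<tau>) \<le> D \<and> norm (psi \<tau>) \<le> D * exp (pi * Im \<tau>)"
      using D(1) by (intro conjI; linarith)
  next
    fix \<tau> \<zeta> assume t: "\<tau> \<in> OmC" "Im \<tau> \<le> 1" "\<zeta> = 1/(1-\<tau>)"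
    note z = OmC_low[OF t(1,2), folded t(3)]
    define v where "v = Im \<zeta>"
    have v: "v \<ge> 1/2" "norm \<zeta> \<le> 2* v" "v > 0" using z by (auto simp: v_def)
    have im: "Im \<zeta> > 0" using v by (simp add: v_def)
    have nz: "\<zeta> \<noteq> 0" using im by auto
    have "Wf \<tau> = Rc \<zeta> * qn \<zeta>^2" unfolding Rc_def by (subst z(1)) simp
    hence W: "norm (Wf \<tau>) = norm (Rc \<zeta>) * exp (-2*pi* v)" by (simp add: norm_mult norm_power norm_qn exp_double[symmetric] v_def mult_ac)
    have W1: "c * exp (-2*pi* v) \<le> norm (Wf \<tau>)" "norm (Wf \<tau>) \<le> C * exp (-2*pi* v)"
      unfolding W using bR[of \<zeta>] z by (auto intro!: mult_right_mono)
    have "C * exp (-2*pi* v) \<le> D * exp (-2*pi* v)" using D by (intro mult_right_mono) auto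
    hence W2: "norm (Wf \<tau>) \<le> D * exp (-2*pi* v)" using W1 by linarith
    have n3: "norm (th3 \<tau>) = sqrt (norm \<zeta>) * (norm (e2 \<zeta>) * exp (-pi* v/4))"
      by (subst z(1), subst th3_cusp[OF im]) (simp add: norm_mult norm_jfac th2_e2 v_def)
    have s2: "sqrt (norm \<zeta>) \<le> 2 * sqrt v"
    proof -
      have "sqrt (norm \<zeta>) \<le> sqrt (2* v)" using v by simp
      also have "\<dots> \<le> sqrt (4* v)" using v by simp
      also have "\<dots> = 2 * sqrt v" by (simp add: real_sqrt_mult)
      finally show ?thesis .
    qed
    have T: "norm (th3 \<tau>) \<le> D * sqrt v * exp (-pi* v/4)"
    proof -
      have "norm (th3 \<tau>) \<le> (2 * sqrt v) * (C * exp (-pi* v/4))" unfolding n3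
        using s2 bR b2[of \<zeta>] z v by (intro mult_mono mult_right_mono) (auto simp: v_def)
      also have "\<dots> = (2*C) * (sqrt v * exp (-pi* v/4))" by simp
      also have "\<dots> \<le> D * (sqrt v * exp (-pi* v/4))" using D v by (intro mult_right_mono) auto
      finally show ?thesis by (simp add: mult_ac)
    qed
    have P: "norm (psi \<tau>) \<le> D * sqrt v * exp (-5*pi* v/4)"
    proof -
      define r where "r = sqrt (norm \<zeta>)"
      have r: "r > 0" "r \<le> 2 * sqrt v" "(norm \<zeta>)^2 = r^4" using nz s2 by (auto simp: r_def real_sqrt_power[symmetric] power4_eq_xxxx power2_eq_square)
      have "norm (psi \<tau>) = norm (deriv Wf \<tau>) / norm (th3 \<tau>)^3" by (simp add: psi_def norm_divide norm_power)
      also have "\<dots> \<le> (A * (norm \<zeta>)^2 * exp (-2*pi* v)) / (r * (c * exp (-pi* v/4)))^3"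
      proof (rule frac_le)
        show "norm (deriv Wf \<tau>) \<le> A * (norm \<zeta>)^2 * exp (-2*pi* v)"
          using dR[of \<zeta>] z unfolding z(1)[symmetric] A_def v_def by auto
        show "(r * (c * exp (-pi* v/4)))^3 \<le> norm (th3 \<tau>)^3" unfolding n3 r_def
          using b2[of \<zeta>] z cC by (intro power_mono mult_mono) auto
      qed (use A cC r in auto)
      also have "\<dots> = (A/c^3) * r * (exp (-2*pi* v) / exp (-pi* v/4)^3)"
        unfolding r(3) using r(1) cC(1) by (simp add: field_simps power_mult_distrib eval_nat_numeral)
      also have "exp (-2*pi* v) / exp (-pi* v/4)^3 = exp (-5*pi* v/4)"
        by (simp add: exp_of_nat_mult[symmetric] exp_diff[symmetric])
      also have "(A/c^3) * r * exp (-5*pi* v/4) \<le> (A/c^3) * (2 * sqrt v) * exp (-5*pi* v/4)"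
        using r A cC by (intro mult_right_mono mult_left_mono) auto
      also have "\<dots> = (2*A/c^3) * (sqrt v * exp (-5*pi* v/4))" by simp
      also have "\<dots> \<le> D * (sqrt v * exp (-5*pi* v/4))"
      proof (rule mult_right_mono)
        have "2*A/c^3 \<le> 4*A/c^3" using A cC by (intro divide_right_mono) auto
        thus "2*A/c^3 \<le> D" using D by simp
      qed (use v in auto)
      finally show ?thesis by (simp add: mult_ac)
    qed
    show "c * exp (-2*pi * Im \<zeta>) \<le> norm (Wf \<tau>) \<and> norm (Wf \<tau>) \<le> D * exp (-2*pi * Im \<zeta>) \<and> norm (th3 \<tau>) \<le> D * sqrt (Im \<zeta>) * exp (-pi * Im \<zeta>/4)
       \<and> norm (psi \<tau>) \<le> D * sqrt (Im \<zeta>) * exp (-5*pi * Im \<zeta>/4)"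
      using W1 W2 T P by (simp add: v_def)
  qed
qed

section \<open>Cauchy transform along curves to the cusps\<close>

text \<open>The curves parametrised by zc run from the cusp 1 to infinity on either side of the line Re = 1; along them the Hauptmodul stays in a sector away from the real axis, uniformly up to both cusps.\<close>

definition kap :: "real \<Rightarrow> real" where "kap s = s^2 / (4 + 2 * s^2)"

definition kap' :: "real \<Rightarrow> real" where "kap' s = 8 * s / (4 + 2 * s^2)^2"

definition zc :: "real \<Rightarrow> real \<Rightarrow> complex" where "zc \<sigma> s = Complex (1 + \<sigma> * kap s) s"

definition zc' :: "real \<Rightarrow> real \<Rightarrow> complex" where "zc' \<sigma> s = Complex (\<sigma> * kap' s) 1"

lemma zc_sel [simp]: "Re (zc \<sigma> s) = 1 + \<sigma> * kap s" "Im (zc \<sigma> s) = s" by (simp_all add: zc_def)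

lemma pos42: "4 + 2 * s^2 > (0::real)" by (simp add: add_pos_nonneg)

lemma kap_bounds:
  assumes "s > 0" shows "0 < kap s" "kap s < 1/2" "kap s \<le> s^2/4" "2 * kap s < s^2" "kap s \<le> s/2"
proof -
  have s2: "s^2 > 0" using assms by simp
  show "0 < kap s" unfolding kap_def using s2 pos42 by (intro divide_pos_pos) auto
  show "kap s < 1/2" unfolding kap_def by (simp add: pos_divide_less_eq[OF pos42])
  show k: "kap s \<le> s^2/4" unfolding kap_def by (intro divide_left_mono mult_pos_pos pos42) auto
  show "2 * kap s < s^2" using k s2 by linarith
  show "kap s \<le> s/2"
  proof (cases "s \<le> 1")
    case True
    have "s^2 \<le> s" using True assms by (simp add: power2_eq_square mult_left_le)
    thus ?thesis using k assms by linarith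
  next
    case False
    have "kap s < 1/2" unfolding kap_def by (simp add: pos_divide_less_eq[OF pos42])
    thus ?thesis using False by simp
  qed
qed

lemma kap'_bounds: assumes "s > 0" shows "0 \<le> kap' s" "kap' s \<le> 1"
proof -
  show "0 \<le> kap' s" using assms by (simp add: kap'_def)
  have "0 \<le> (s-1)^2" by simp
  hence "2* s \<le> 1 + s^2" by (simp add: power2_diff)
  hence "8 * s \<le> 4 * (1 + s^2)" by simp
  also have "\<dots> \<le> 4 * (4 + 2 * s^2)" by simp
  also have "\<dots> \<le> (4 + 2 * s^2) * (4 + 2 * s^2)" using zero_le_power2[of s] by (intro mult_right_mono) auto
  finally show "kap' s \<le> 1" unfolding kap'_def using pos42[of s] by (simp add: divide_simps power2_eq_square)
qed

lemma zc_deriv: "(zc \<sigma> has_vector_derivative zc' \<sigma> s) (at s within A)"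
proof -
  have nz: "4 + 2 * s^2 \<noteq> 0" using pos42[of s] by linarith
  have "(kap has_real_derivative kap' s) (at s within A)"
    unfolding kap_def[abs_def] kap'_def using nz
    by (auto intro!: derivative_eq_intros simp: power2_eq_square) (simp add: field_simps)?
  hence "((\<lambda>s. 1 + \<sigma> * kap s) has_real_derivative \<sigma> * kap' s) (at s within A)"
    by (auto intro!: derivative_eq_intros)
  hence k: "((\<lambda>s. of_real (1 + \<sigma> * kap s)) has_vector_derivative complex_of_real (\<sigma> * kap' s)) (at s within A)"
    by (intro has_vector_derivative_of_real) (simp add: has_real_derivative_iff_has_vector_derivative)
  have "((\<lambda>s. \<i> * of_real s) has_vector_derivative \<i>) (at s within A)"
    by (auto intro!: derivative_eq_intros)
  from has_vector_derivative_add[OF k this]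
  have "((\<lambda>s. of_real (1 + \<sigma> * kap s) + \<i> * of_real s) has_vector_derivative (of_real (\<sigma> * kap' s) + \<i>)) (at s within A)" .
  moreover have "(\<lambda>s. of_real (1 + \<sigma> * kap s) + \<i> * of_real s) = zc \<sigma>" by (auto simp: zc_def complex_eq_iff)
  moreover have "of_real (\<sigma> * kap' s) + \<i> = zc' \<sigma> s" by (simp add: zc'_def complex_eq_iff)
  ultimately show ?thesis by simp
qed

lemma zc_cont: "continuous_on A (zc \<sigma>)"
  by (rule continuous_on_vector_derivative) (rule zc_deriv)

lemma zc'_cont: "continuous_on A (zc' \<sigma>)"
proof -
  have "zc' \<sigma> = (\<lambda>s. of_real (\<sigma> * kap' s) + \<i>)" by (auto simp: zc'_def complex_eq_iff)
  moreover have "4 + 2 * s^2 \<noteq> 0" for s :: real using pos42[of s] by linarith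
  hence "continuous_on A kap'" unfolding kap'_def[abs_def] by (intro continuous_intros) auto
  ultimately show ?thesis by (simp only:) (intro continuous_intros)
qed

lemma norm_zc': "s > 0 \<Longrightarrow> \<bar>\<sigma>\<bar> \<le> 1 \<Longrightarrow> norm (zc' \<sigma> s) \<le> 2"
proof -
  assume a: "s > 0" "\<bar>\<sigma>\<bar> \<le> 1"
  have "norm (zc' \<sigma> s) \<le> \<bar>\<sigma> * kap' s\<bar> + 1" using cmod_le[of "zc' \<sigma> s"] by (simp add: zc'_def)
  also have "\<bar>\<sigma> * kap' s\<bar> \<le> 1 * 1" unfolding abs_mult using a kap'_bounds[of s] by (intro mult_mono) auto
  finally show ?thesis by simp
qed

text \<open>The inequality 2 \<open>kap\<close> s < s^2 is what keeps both curves outside both unit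
  circles.\<close>

lemma zc_norms:
  assumes "s > 0"
  shows "norm (zc 1 s - 2) > 1" "norm (zc (-1) s) > 1" "norm (zc 1 s) > 1" "norm (zc (-1) s - 2) > 1"
proof -
  note k = kap_bounds[OF assms]
  have *: "1 < norm z" if "(Re z)^2 + (Im z)^2 > 1" for z
    by (rule power2_less_imp_less) (use that in \<open>simp_all add: cmod_power2\<close>)
  have "(1 - kap s)^2 + s^2 = 1 + (s^2 - 2 * kap s) + (kap s)^2" by (simp add: power2_diff)
  hence e: "(1 - kap s)^2 + s^2 > 1" using k(4) zero_le_power2[of "kap s"] by linarith
  have e': "(kap s - 1)^2 + s^2 > 1" using e by (simp add: power2_commute)
  have "(1 + kap s)^2 + s^2 = 1 + 2 * kap s + (kap s)^2 + s^2" by (simp add: power2_sum)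
  hence f: "(1 + kap s)^2 + s^2 > 1" using k(1) zero_le_power2[of "kap s"] zero_le_power2[of s] by linarith
  have f': "(- 1 - kap s)^2 + s^2 > 1" using f by (metis add.commute minus_add_distrib power2_minus uminus_add_conv_diff)
  show "norm (zc 1 s - 2) > 1" by (rule *) (use e' in simp)
  show "norm (zc (-1) s) > 1" by (rule *) (use e in simp)
  show "norm (zc 1 s) > 1" by (rule *) (use f in simp)
  show "norm (zc (-1) s - 2) > 1" by (rule *) (use f' in simp)
qed

lemma zc_OmC: assumes "s > 0" "\<sigma> = 1 \<or> \<sigma> = -1" shows "zc \<sigma> s \<in> OmC"
  using assms zc_norms[OF assms(1)] kap_bounds[OF assms(1)] by (auto simp: OmC_def)

lemma zc_cnj: "- cnj (zc 1 s) + 2 = zc (-1) s" by (simp add: complex_eq_iff)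

lemma Wf_zc_cnj: "Wf (zc (-1) s) = cnj (Wf (zc 1 s))"
  unfolding zc_cnj[symmetric] Wf_plus2 Wf_cnj ..

lemma Wf_zc_Im: assumes "s > 0" shows "Im (Wf (zc 1 s)) > 0"
proof -
  have "Im (Wf (zc (-1) s)) < 0"
    by (rule Wf_Im_neg) (use assms kap_bounds[OF assms] zc_norms[OF assms] in auto)
  thus ?thesis by (simp add: Wf_zc_cnj)
qed

lemma sgn_cis: "sgn (exp z) = cis (Im z)"
  by (simp add: sgn_eq exp_eq_polar norm_mult)

lemma sgn_qn2: "sgn (qn z^2) = cis (2 * pi * Re z)"
  unfolding qn_def exp_double[symmetric] sgn_cis by (simp add: mult.assoc)

text \<open>The ratio Im \<open>Wf\<close> / |\<open>Wf\<close>| is positive and continuous along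
  the curve and tends to 1 at both ends, so compactness gives a positive lower bound. The shape of
  \<open>kap\<close> is chosen for these two limits.\<close>

lemma Wf_zc_sector:
  obtains c where "0 < c" "c \<le> 1" "\<And>s. s > 0 \<Longrightarrow> Im (Wf (zc 1 s)) \<ge> c * norm (Wf (zc 1 s))"
proof -
  define r where "r = (\<lambda>s. Im (sgn (Wf (zc 1 s))))"
  have rpos: "r s > 0" if "s > 0" for s using Wf_zc_Im[OF that] Wf_nz[of "zc 1 s"] that by (simp add: r_def sgn_eq Im_divide_of_real)
  have zc_inf: "filterlim (zc 1) itop at_top" unfolding itop_def
    by (rule filterlim_filtercomap_iff[THEN iffD2]) (simp add: o_def filterlim_ident)
  have top: "(r \<longlongrightarrow> 1) at_top"
  proof -
    have "((\<lambda>s. Wf (zc 1 s) * qn (zc 1 s)) \<longlongrightarrow> 1) at_top" by (rule filterlim_compose[OF Wf_qn_lim zc_inf])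
    hence 1: "((\<lambda>s. sgn (Wf (zc 1 s) * qn (zc 1 s))) \<longlongrightarrow> sgn 1) at_top" by (rule tendsto_sgn) simp
    \<comment> \<open>At infinity Re z tends to 3/2, where 1/\<open>qn\<close> points along the
      positive imaginary axis.\<close>
    have "(kap \<longlongrightarrow> 1/2) at_top" unfolding kap_def[abs_def] by real_asymp
    hence 2: "((\<lambda>s. cis (- pi * (1 + kap s))) \<longlongrightarrow> cis (- pi * (1 + 1/2))) at_top"
      unfolding cis_conv_exp by (intro tendsto_intros)
    have 3: "r s = Im (sgn (Wf (zc 1 s) * qn (zc 1 s)) * cis (- pi * (1 + kap s)))" for s
    proof -
      have "sgn (qn (zc 1 s)) = cis (pi * (1 + kap s))" by (simp add: qn_def sgn_cis)
      hence "sgn (Wf (zc 1 s) * qn (zc 1 s)) * cis (- pi * (1 + kap s)) = sgn (Wf (zc 1 s)) * (cis (pi * (1 + kap s)) * cis (- pi * (1 + kap s)))"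
        by (simp add: sgn_mult)
      also have "cis (pi * (1 + kap s)) * cis (- pi * (1 + kap s)) = 1" by (simp add: cis_mult)
      finally show ?thesis by (simp add: r_def)
    qed
    have ci: "cis (- pi * (1 + 1/2)) = \<i>"
    proof -
      have e: "- pi * (1 + 1/2) = pi/2 - 2*pi" by (simp add: field_simps)
      have "cis (pi/2 - 2*pi) = cis (pi/2) / cis (2*pi)" by (rule cis_divide[symmetric])
      thus ?thesis unfolding e by simp
    qed
    show ?thesis using tendsto_Im[OF tendsto_mult[OF 1 2]] unfolding ci 3[symmetric] by simp
  qed
  have bot: "(r \<longlongrightarrow> 1) (at_right 0)"
  proof -
    let ?z = "\<lambda>s. 1/(1 - zc 1 s)"
    have reim: "Re (?z s) = - kap s / ((kap s)^2 + s^2)" "Im (?z s) = s / ((kap s)^2 + s^2)" for s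
      by (simp_all add: Re_divide Im_divide)
    have "filterlim (\<lambda>s. s / ((kap s)^2 + s^2)) at_top (at_right 0)" unfolding kap_def by real_asymp
    hence zi: "filterlim ?z itop (at_right 0)" unfolding itop_def
      by (intro filterlim_filtercomap_iff[THEN iffD2]) (simp add: o_def reim)
    have "((\<lambda>s. Rc (?z s)) \<longlongrightarrow> -4096) (at_right 0)" by (rule filterlim_compose[OF Rc_lim zi])
    hence 1: "((\<lambda>s. sgn (Rc (?z s))) \<longlongrightarrow> sgn (-4096)) (at_right 0)" by (rule tendsto_sgn) simp
    \<comment> \<open>Near the cusp \<open>kap\<close> s behaves like s^2/4, so the cusp coordinate
      has real part tending to -1/4 and \<open>qn\<close>^2 has phase tending to -pi/2. Times the
      negative constant -4096 this is again the positive imaginary direction.\<close>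
    have "((\<lambda>s. - kap s / ((kap s)^2 + s^2)) \<longlongrightarrow> - (1/4)) (at_right 0)" unfolding kap_def by real_asymp
    hence 2: "((\<lambda>s. cis (2 * pi * (- kap s / ((kap s)^2 + s^2)))) \<longlongrightarrow> cis (2 * pi * (-(1/4)))) (at_right 0)"
      unfolding cis_conv_exp by (intro tendsto_intros)
    have 3: "\<forall>\<^sub>F s in at_right 0. Im (sgn (Rc (?z s)) * cis (2 * pi * (- kap s / ((kap s)^2 + s^2)))) = r s"
      unfolding eventually_at_right_field
    proof (intro exI[of _ 1] conjI allI impI)
      fix s :: real assume s: "0 < s" "s < 1"
      have nz: "1 - zc 1 s \<noteq> 0" using s by (auto simp: complex_eq_iff)
      have "Wf (zc 1 s) = Rc (?z s) * qn (?z s)^2" unfolding Rc_def using nz by simp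
      moreover have "sgn (qn (?z s)^2) = cis (2 * pi * (- kap s / ((kap s)^2 + s^2)))"
        unfolding sgn_qn2 reim ..
      ultimately show "Im (sgn (Rc (?z s)) * cis (2 * pi * (- kap s / ((kap s)^2 + s^2)))) = r s" by (simp only: r_def sgn_mult)
    qed simp
    have "2 * pi * (-(1/4)) = - (pi/2)" by simp
    hence "Im (sgn (-4096) * cis (2 * pi * (-(1/4)))) = 1" by (simp only:) (simp add: sgn_eq)
    with Lim_transform_eventually[OF tendsto_Im[OF tendsto_mult[OF 1 2]] 3] show ?thesis by simp
  qed
  have "\<forall>\<^sub>F s in at_top. r s > 1/2" using top by (rule order_tendstoD) simp
  then obtain b where b: "\<And>s. s \<ge> b \<Longrightarrow> r s > 1/2" unfolding eventually_at_top_linorder by blast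
  have "\<forall>\<^sub>F s in at_right 0. r s > 1/2" using bot by (rule order_tendstoD) simp
  then obtain a where a: "a > 0" "\<And>s. 0 < s \<Longrightarrow> s < a \<Longrightarrow> r s > 1/2" unfolding eventually_at_right_field by blast
  have c: "continuous_on {a..max a b} (\<lambda>s. Wf (zc 1 s))"
    by (rule continuous_on_compose2[OF Wf_cont[of uhp] zc_cont]) (use a in auto)
  have rc: "continuous_on {a..max a b} r" unfolding r_def sgn_eq
    by (intro continuous_intros c) (use a Wf_nz in auto)
  obtain m where m: "m \<in> {a..max a b}" "\<And>s. s \<in> {a..max a b} \<Longrightarrow> r m \<le> r s"
    using continuous_attains_inf[OF _ _ rc] by auto
  define c where "c = min (1/2) (r m)"
  have c0: "c > 0" "c \<le> 1" using rpos[of m] m(1) a(1) by (auto simp: c_def)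
  show thesis
  proof (rule that[OF c0])
    fix s :: real assume s: "s > 0"
    have "c \<le> r s"
    proof (cases "s < a")
      case True thus ?thesis using a(2)[OF s] by (simp add: c_def)
    next
      case False
      show ?thesis
      proof (cases "s \<ge> b")
        case True thus ?thesis using b by (force simp: c_def)
      next
        case False
        hence "s \<in> {a..max a b}" using \<open>\<not> s < a\<close> by auto
        thus ?thesis using m(2) by (force simp: c_def)
      qed
    qed
    moreover have "r s * norm (Wf (zc 1 s)) = Im (Wf (zc 1 s))"
      using Wf_nz[of "zc 1 s"] s by (simp add: r_def sgn_eq Im_divide_of_real)
    ultimately show "Im (Wf (zc 1 s)) \<ge> c * norm (Wf (zc 1 s))"
      using mult_right_mono[of c "r s" "norm (Wf (zc 1 s))"] by simp
  qed
qed

text \<open>The imaginary part alone bounds |a - w| from below by c |a|; the triangle inequality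
  then transfers the bound to |w|.\<close>

lemma cone_dist:
  assumes "Im a \<ge> c * norm a" "0 < c" "c \<le> 1" "Im w \<le> 0"
  shows "norm (a - w) \<ge> c/2 * norm a" "norm (a - w) \<ge> c/2 * norm w"
proof -
  have "c * norm a \<le> Im (a - w)" using assms by simp
  also have "\<dots> \<le> norm (a - w)" using abs_Im_le_cmod[of "a-w"] by linarith
  finally have 1: "c * norm a \<le> norm (a - w)" .
  have "c/2 * norm a \<le> c * norm a" using assms by (intro mult_right_mono) auto
  with 1 show "norm (a - w) \<ge> c/2 * norm a" by linarith
  have "norm w \<le> norm a + norm (a - w)" using norm_triangle_ineq4[of a "a - w"] by simp
  hence "c * norm w \<le> c * norm a + c * norm (a - w)" using assms by (metis distrib_left mult_le_cancel_left_pos)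
  also have "c * norm (a - w) \<le> 1 * norm (a - w)" using assms by (intro mult_right_mono) auto
  finally have "c * norm w \<le> 2 * norm (a - w)" using 1 by linarith
  thus "norm (a - w) \<ge> c/2 * norm w" by simp
qed

text \<open>The transform along the right-hand curve is used for w in the closed lower half plane and the one along the left-hand curve for w in the closed upper half plane.\<close>

definition sgood :: "real \<Rightarrow> complex \<Rightarrow> bool" where
  "sgood \<sigma> w \<longleftrightarrow> (\<sigma> = 1 \<and> Im w \<le> 0) \<or> (\<sigma> = -1 \<and> Im w \<ge> 0)"

text \<open>The distance estimate behind all bounds for the transform. The left-hand curve is
  reduced to the right-hand one by conjugation.\<close>

lemma zc_dist:
  obtains c where "0 < c" "c \<le> 1"
    "\<And>\<sigma> w s. sgood \<sigma> w \<Longrightarrow> s > 0 \<Longrightarrow> norm (Wf (zc \<sigma> s) - w) \<ge> c * norm (Wf (zc \<sigma> s)) \<and> norm (Wf (zc \<sigma> s) - w) \<ge> c * norm w"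
proof -
  obtain c where c: "0 < c" "c \<le> 1" "\<And>s. s > 0 \<Longrightarrow> Im (Wf (zc 1 s)) \<ge> c * norm (Wf (zc 1 s))"
    by (rule Wf_zc_sector) blast
  show thesis
  proof (rule that[of "c/2"])
    fix \<sigma> w and s :: real assume g: "sgood \<sigma> w" and s: "s > 0"
    show "norm (Wf (zc \<sigma> s) - w) \<ge> c/2 * norm (Wf (zc \<sigma> s)) \<and> norm (Wf (zc \<sigma> s) - w) \<ge> c/2 * norm w"
    proof (cases "\<sigma> = 1")
      case True
      thus ?thesis using cone_dist[OF c(3)[OF s] c(1,2), of w] g by (auto simp: sgood_def)
    next
      case False
      hence sg: "\<sigma> = -1" "Im (cnj w) \<le> 0" using g by (auto simp: sgood_def)
      have "norm (Wf (zc \<sigma> s) - w) = norm (Wf (zc 1 s) - cnj w)"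
        unfolding sg Wf_zc_cnj by (metis complex_cnj_cnj complex_cnj_diff complex_mod_cnj)
      thus ?thesis using cone_dist[OF c(3)[OF s] c(1,2) sg(2)] unfolding sg Wf_zc_cnj by simp
    qed
  qed (use c in auto)
qed

text \<open>The defect of 2-periodicity of exp(pi i x t).\<close>

definition hx :: "real \<Rightarrow> complex \<Rightarrow> complex" where
  "hx x \<tau> = exp (\<i> * pi * of_real x * (\<tau> - 2)) - exp (\<i> * pi * of_real x * \<tau>)"

lemma hx_holo [holomorphic_intros]: "hx x holomorphic_on A"
  unfolding hx_def[abs_def] by (intro holomorphic_intros)

definition Nx :: "real \<Rightarrow> real" where "Nx x = (1 + x) powr (-1/4)"

lemma Nx_pos: "x \<ge> 0 \<Longrightarrow> Nx x > 0" by (simp add: Nx_def)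

lemma Nx_le1: "x \<ge> 0 \<Longrightarrow> Nx x \<le> 1"
  unfolding Nx_def by (rule order_trans[OF powr_mono2'[of "-1/4" 1]]) auto

lemma powr_quarter_le:
  assumes "a \<ge> 0" shows "(1 + a) powr (1/4) \<le> 1 + (a::real)"
  using powr_mono[of "1/4" 1 "1+a"] assms by simp

text \<open>The source of the decay in x: ((1+x)s)^(1/4) <= 1 + xs <= exp(pi x s) for s <= 1. The
  price s^(-1/4) is later absorbed by the weight Im^(1/4).\<close>

lemma exp_Nx:
  assumes "x \<ge> 0" "0 < s" "s \<le> 1"
  shows "exp (- (pi * x * s)) \<le> Nx x * s powr (-1/4)"
proof -
  have "((1+x) * s) powr (1/4) \<le> (1 + x * s) powr (1/4)"
    using assms by (intro powr_mono2) (auto simp: algebra_simps)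
  also have "\<dots> \<le> 1 + x * s" using assms by (intro powr_quarter_le) auto
  also have "\<dots> \<le> exp (x * s)" by (rule exp_ge_add_one_self)
  also have "\<dots> \<le> exp (pi * x * s)"
  proof -
    have "1 * (x * s) \<le> pi * (x * s)" using assms pi_gt3 by (intro mult_right_mono) auto
    thus ?thesis by (simp add: mult_ac)
  qed
  finally have 1: "((1+x) * s) powr (1/4) \<le> exp (pi * x * s)" .
  have pos: "((1+x) * s) powr (1/4) > 0" using assms by simp
  have "exp (- (pi * x * s)) = 1 / exp (pi * x * s)" by (simp add: exp_minus field_simps)
  also have "\<dots> \<le> 1 / ((1+x) * s) powr (1/4)" using 1 pos by (intro divide_left_mono) auto
  also have "\<dots> = ((1+x) * s) powr (-1/4)" using powr_minus_divide[of "(1+x) * s" "1/4"] by simp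
  also have "\<dots> = Nx x * s powr (-1/4)" using assms by (simp add: powr_mult Nx_def)
  finally show ?thesis .
qed

lemma exp_Nx1: assumes "x \<ge> 0" shows "exp (- (pi * x)) \<le> Nx x"
  using exp_Nx[of x 1] assms by simp

lemma norm_hx: "norm (hx x \<tau>) = norm (exp (-2*pi*\<i> * of_real x) - 1) * exp (- (pi * x * Im \<tau>))"
proof -
  have "hx x \<tau> = (exp (-2*pi*\<i> * of_real x) - 1) * exp (\<i> * pi * of_real x * \<tau>)"
    by (simp add: hx_def algebra_simps exp_diff exp_add[symmetric]) (simp add: exp_diff[symmetric] exp_add[symmetric] exp_minus field_simps)?
  thus ?thesis by (simp add: norm_mult mult_ac)
qed

text \<open>The second bound vanishes at x = 0; its integral over heights above 1 is a multiple of
  exp(-pi x) with no factor 1/x, so it stays uniform for small x.\<close>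

lemma norm_hx_le:
  assumes "x \<ge> 0"
  shows "norm (hx x \<tau>) \<le> 2 * exp (- (pi * x * Im \<tau>))" "norm (hx x \<tau>) \<le> 2 * pi * x * exp (- (pi * x * Im \<tau>))"
proof -
  have e: "exp (-2*pi*\<i> * of_real x) = exp (\<i> * of_real (-2*pi*x))" by (simp add: mult_ac)
  have n: "norm (exp (\<i> * of_real t) - 1) \<le> 2" "norm (exp (\<i> * of_real t) - 1) \<le> \<bar>t\<bar>" for t :: real
  proof -
    have d: "norm (exp (\<i> * of_real t) - 1) = 2 * \<bar>sin (t/2)\<bar>" by (rule dist_exp_i_1)
    show "norm (exp (\<i> * of_real t) - 1) \<le> 2" unfolding d using abs_sin_le_one[of "t/2"] by linarith
    show "norm (exp (\<i> * of_real t) - 1) \<le> \<bar>t\<bar>" unfolding d using abs_sin_x_le_abs_x[of "t/2"] by simp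
  qed
  show "norm (hx x \<tau>) \<le> 2 * exp (- (pi * x * Im \<tau>))"
    unfolding norm_hx e by (intro mult_right_mono n) auto
  have "norm (exp (\<i> * of_real (-2*pi*x)) - 1) \<le> 2*pi*x" using n(2)[of "-2*pi*x"] assms by (simp add: abs_mult)
  thus "norm (hx x \<tau>) \<le> 2 * pi * x * exp (- (pi * x * Im \<tau>))"
    unfolding norm_hx e by (intro mult_right_mono) auto
qed

section \<open>The Cauchy transform, its density and its majorants\<close>

definition Hc :: "real \<Rightarrow> real \<Rightarrow> real \<Rightarrow> complex" where
  "Hc x \<sigma> s = indicator {0<..} s *\<^sub>R (th3 (zc \<sigma> s)^3 * hx x (zc \<sigma> s) * zc' \<sigma> s / (2*pi*\<i>))"

definition Vc :: "real \<Rightarrow> real \<Rightarrow> complex" where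
  "Vc \<sigma> s = indicator {0<..} s *\<^sub>R Wf (zc \<sigma> s)"

text \<open>For w = \<open>Wf\<close> \<tau>, \<open>psi\<close> \<tau> times this is the contour
  integral of the kernel \<open>psi\<close> \<tau> \<open>th3\<close>(z)^3 / (\<open>Wf\<close> z -
  \<open>Wf\<close> \<tau>) against \<open>hx\<close> dz / (2 pi i). The kernel has residue 1 at z =
  \<tau> wherever the derivative of \<open>Wf\<close> is nonzero.\<close>

definition Phi :: "real \<Rightarrow> real \<Rightarrow> complex \<Rightarrow> complex" where
  "Phi x \<sigma> w = (LINT s|lborel. Hc x \<sigma> s / (Vc \<sigma> s - w))"

lemma uhp_zc_cont:
  assumes "continuous_on uhp f" shows "continuous_on {0<..} (\<lambda>s. f (zc \<sigma> s))"
  by (rule continuous_on_compose2[OF assms zc_cont]) auto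

lemma Hc_cont: "continuous_on {0<..} (\<lambda>s. th3 (zc \<sigma> s)^3 * hx x (zc \<sigma> s) * zc' \<sigma> s / (2*pi*\<i>))"
proof -
  have "continuous_on uhp th3" "continuous_on uhp (hx x)"
    by (intro holomorphic_on_imp_continuous_on holomorphic_intros; simp)+
  thus ?thesis by (intro continuous_intros uhp_zc_cont zc'_cont) auto
qed

lemma Hc_meas [measurable]: "Hc x \<sigma> \<in> borel_measurable borel"
  unfolding Hc_def[abs_def] by (rule borel_measurable_continuous_on_indicator[OF _ Hc_cont]) auto

lemma Vc_meas [measurable]: "Vc \<sigma> \<in> borel_measurable borel"
  unfolding Vc_def[abs_def] by (rule borel_measurable_continuous_on_indicator[OF _ uhp_zc_cont[OF Wf_cont]]) auto

definition B1 :: "real \<Rightarrow> real \<Rightarrow> real" where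
  "B1 x s = indicator {1<..} s *\<^sub>R (2 * pi * x * exp (- (pi * x * s)))"

text \<open>The derivative of -arctan(1/s - v): a bump where 1/s is near v, with integral at most pi
  whatever v is.\<close>

definition B2 :: "real \<Rightarrow> real \<Rightarrow> real" where
  "B2 v s = indicator {0<..<1} s *\<^sub>R ((1/s^2) / (1 + (1/s - v)^2))"

lemma B1_int: assumes "x \<ge> 0" shows "integrable lborel (B1 x)" "integral\<^sup>L lborel (B1 x) \<le> 2 * Nx x"
proof -
  have "integrable lborel (B1 x) \<and> integral\<^sup>L lborel (B1 x) \<le> 2 * exp (- (pi * x))"
  proof (cases "x = 0")
    case True
    hence "B1 x = (\<lambda>_. 0)" by (auto simp: B1_def)
    thus ?thesis by simp
  next
    case False
    hence x: "x > 0" using assms by simp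
    have lim: "((\<lambda>s. - 2 * exp (- (pi * x * s))) \<longlongrightarrow> 0) at_top" using x by real_asymp
    have lim1: "((\<lambda>s. - 2 * exp (- (pi * x * s))) \<longlongrightarrow> - 2 * exp (- (pi * x * 1))) (at_right 1)"
      by (intro tendsto_intros)
    have FTC: "set_integrable lborel (einterval (ereal 1) \<infinity>) (\<lambda>s. 2 * pi * x * exp (- (pi * x * s)))"
      "(LBINT s=ereal 1..\<infinity>. 2 * pi * x * exp (- (pi * x * s))) = 0 - (- 2 * exp (- (pi * x * 1)))"
      by (rule interval_integral_FTC_nonneg[where F="\<lambda>s. - 2 * exp (- (pi * x * s))"];
          use x lim lim1 in \<open>auto intro!: derivative_eq_intros simp: ereal_tendsto_simps\<close>)+
    have e: "einterval (ereal 1) \<infinity> = {1<..}" by (auto simp: einterval_def)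
    have "integrable lborel (B1 x)" using FTC(1) unfolding e set_integrable_def B1_def .
    moreover have "integral\<^sup>L lborel (B1 x) = 2 * exp (- (pi * x))"
      using FTC(2) unfolding interval_lebesgue_integral_def e set_lebesgue_integral_def B1_def by simp
    ultimately show ?thesis by simp
  qed
  thus "integrable lborel (B1 x)" "integral\<^sup>L lborel (B1 x) \<le> 2 * Nx x" using exp_Nx1[OF assms] by auto
qed

lemma B2_int: shows "integrable lborel (B2 v)" "integral\<^sup>L lborel (B2 v) \<le> pi"
proof -
  have lim0: "((\<lambda>s. - arctan (1/s - v)) \<longlongrightarrow> - (pi/2)) (at_right 0)"
  proof -
    have "filterlim (\<lambda>s. 1/s - v) at_top (at_right (0::real))" by real_asymp
    from filterlim_compose[OF tendsto_arctan_at_top this] show ?thesis by (intro tendsto_intros)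
  qed
  have lim1: "((\<lambda>s. - arctan (1/s - v)) \<longlongrightarrow> - arctan (1/1 - v)) (at_left 1)"
    by (intro tendsto_intros) auto
  have der: "((\<lambda>s. - arctan (1/s - v)) has_real_derivative (1/s^2) / (1 + (1/s - v)^2)) (at s)" if "0 < s" for s
  proof -
    have d: "((\<lambda>s. 1/s - v) has_real_derivative - (1/s^2)) (at s)"
      using that by (auto intro!: derivative_eq_intros simp: power2_eq_square)
    show ?thesis using DERIV_minus[OF DERIV_chain2[OF DERIV_arctan d]] by (simp add: inverse_eq_divide mult.commute)
  qed
  have cont: "isCont (\<lambda>s. (1/s^2) / (1 + (1/s - v)^2)) s" if "0 < s" for s
  proof -
    have "1 + (1/s - v)^2 > 0" by (simp add: add_pos_nonneg)
    hence "1 + (1/s - v)^2 \<noteq> 0" by linarith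
    thus ?thesis using that by (intro continuous_intros) auto
  qed
  have FTC: "set_integrable lborel (einterval (ereal 0) (ereal 1)) (\<lambda>s. (1/s^2) / (1 + (1/s - v)^2))"
    "(LBINT s=ereal 0..ereal 1. (1/s^2) / (1 + (1/s - v)^2)) = - arctan (1/1 - v) - (- (pi/2))"
    by (rule interval_integral_FTC_nonneg[where F="\<lambda>s. - arctan (1/s - v)"];
        use lim0 lim1 der cont in \<open>auto simp: ereal_tendsto_simps\<close>)+
  have e: "einterval (ereal 0) (ereal 1) = {0<..<1}" by (auto simp: einterval_def)
  show "integrable lborel (B2 v)" using FTC(1) unfolding e set_integrable_def B2_def .
  have "integral\<^sup>L lborel (B2 v) = - arctan (1/1 - v) + pi/2"
    using FTC(2) unfolding interval_lebesgue_integral_def e set_lebesgue_integral_def B2_def by simp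
  thus "integral\<^sup>L lborel (B2 v) \<le> pi" using arctan_lbound[of "1/1 - v"] by linarith
qed

lemma B_nonneg: "x \<ge> 0 \<Longrightarrow> 0 \<le> B1 x s" "0 \<le> B2 v s"
  by (auto simp: B1_def B2_def indicator_def)

text \<open>Put r = |p - v|. Since 5v/4 + 3p/4 - 2 min(p, v) equals 5r/4 or 3r/4, the exponentials
  combine to at most exp(-r); the powers satisfy sqrt v p^(7/4) <= v^(1/4) p^2 (1+r). The remaining
  quotient is \<open>B2\<close> v at s = 1/p.\<close>

lemma kernel_real_bound:
  fixes p v :: real
  assumes p: "p \<ge> 1" and v: "v \<ge> 1/2"
  defines "M \<equiv> max (exp (-2*pi*p)) (exp (-2*pi* v))"
  shows "(sqrt v * exp (-5*pi* v/4)) * (p powr (7/4) * exp (-3*pi*p/4)) / M \<le> 27 * v powr (1/4) * (p^2 / (1 + (p - v)^2))"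
proof -
  define r where "r = \<bar>p - v\<bar>"
  have r0: "r \<ge> 0" by (simp add: r_def)
  have e: "exp (-5*pi* v/4) * exp (-3*pi*p/4) / M \<le> exp (- r)"
  proof (cases "p \<le> v")
    case True
    hence "M = exp (-2*pi*p)" by (simp add: M_def max_def)
    hence "exp (-5*pi* v/4) * exp (-3*pi*p/4) / M = exp (-5*pi* v/4 + -3*pi*p/4 - (-2*pi*p))"
      by (simp only: exp_add exp_diff)
    also have "-5*pi* v/4 + -3*pi*p/4 - (-2*pi*p) = - (5*pi/4 * r)" using True by (simp add: r_def field_simps)
    also have "exp (- (5*pi/4 * r)) \<le> exp (- (1 * r))" using r0 pi_gt3 by (subst exp_le_cancel_iff, simp only: neg_le_iff_le, intro mult_right_mono) auto
    finally show ?thesis by simp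
  next
    case False
    hence "M = exp (-2*pi* v)" by (simp add: M_def max_def)
    hence "exp (-5*pi* v/4) * exp (-3*pi*p/4) / M = exp (-5*pi* v/4 + -3*pi*p/4 - (-2*pi* v))"
      by (simp only: exp_add exp_diff)
    also have "-5*pi* v/4 + -3*pi*p/4 - (-2*pi* v) = - (3*pi/4 * r)" using False by (simp add: r_def field_simps)
    also have "exp (- (3*pi/4 * r)) \<le> exp (- (1 * r))" using r0 pi_gt3 by (subst exp_le_cancel_iff, simp only: neg_le_iff_le, intro mult_right_mono) auto
    finally show ?thesis by simp
  qed
  have vp: "v \<le> p * (1 + r)"
  proof -
    have "v \<le> p + r" by (simp add: r_def)
    also have "\<dots> \<le> p + p * r" using mult_right_mono[of 1 p r] p r0 by simp
    finally show ?thesis by (simp add: algebra_simps)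
  qed
  have q: "sqrt v * p powr (7/4) \<le> v powr (1/4) * p^2 * (1 + r)"
  proof -
    have "v powr (1/4) \<le> (p * (1+r)) powr (1/4)" using vp v by (intro powr_mono2) auto
    also have "\<dots> = p powr (1/4) * (1+r) powr (1/4)" using p r0 by (simp add: powr_mult)
    also have "\<dots> \<le> p powr (1/4) * (1+r)" using powr_quarter_le[OF r0] by (intro mult_left_mono) auto
    finally have 1: "v powr (1/4) \<le> p powr (1/4) * (1+r)" .
    have "sqrt v * p powr (7/4) = v powr (1/4) * (v powr (1/4) * p powr (7/4))"
      using v by (simp add: powr_half_sqrt[symmetric] powr_add[symmetric])
    also have "\<dots> \<le> v powr (1/4) * ((p powr (1/4) * (1+r)) * p powr (7/4))"
      using 1 by (intro mult_left_mono mult_right_mono) auto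
    also have "\<dots> = v powr (1/4) * (p powr (1/4) * p powr (7/4)) * (1+r)" by simp
    also have "p powr (1/4) * p powr (7/4) = p^2" using p by (simp add: powr_add[symmetric])
    finally show ?thesis .
  qed
  \<comment> \<open>The constant 27 comes from exp r >= (1 + r/3)^3, compared coefficientwise with
    (1+r)(1+r^2).\<close>
  have rr: "(1 + r) * exp (- r) \<le> 27 / (1 + r^2)"
  proof -
    have c1: "27 * (1 + r/3)^3 = 27 + 27 * r + 9 * r^2 + r^3" by (simp add: power2_eq_square power3_eq_cube field_simps)
    have c2: "(1 + r) * (1 + r^2) = 1 + r + r^2 + r^3" by (simp add: power2_eq_square power3_eq_cube algebra_simps)
    have "(1 + r) * (1 + r^2) \<le> 27 * (1 + r/3)^3" unfolding c1 c2 using r0 zero_le_power2[of r] by linarith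
    also have "(1 + r/3)^3 \<le> exp (r/3)^3" using r0 by (intro power_mono exp_ge_add_one_self) auto
    also have "exp (r/3)^3 = exp r" by (simp add: exp_of_nat_mult[symmetric])
    finally have "(1 + r) * (1 + r^2) \<le> 27 * exp r" by simp
    moreover have "1 + r^2 > 0" by (simp add: add_pos_nonneg)
    ultimately show ?thesis by (simp add: exp_minus field_simps)
  qed
  have "(sqrt v * exp (-5*pi* v/4)) * (p powr (7/4) * exp (-3*pi*p/4)) / M = (sqrt v * p powr (7/4)) * (exp (-5*pi* v/4) * exp (-3*pi*p/4) / M)"
    by (simp add: mult_ac)
  also have "\<dots> \<le> (v powr (1/4) * p^2 * (1 + r)) * exp (- r)"
    by (rule mult_mono[OF q e]) (use r0 in \<open>auto simp: M_def le_max_iff_disj intro!: divide_nonneg_nonneg\<close>)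
  also have "\<dots> = v powr (1/4) * p^2 * ((1 + r) * exp (- r))" by simp
  also have "\<dots> \<le> v powr (1/4) * p^2 * (27 / (1 + r^2))" using rr by (intro mult_left_mono) auto
  also have "r^2 = (p - v)^2" by (simp add: r_def)
  finally show ?thesis by (simp add: mult_ac)
qed

lemma zc_height:
  assumes "0 < s" "s < 1" "\<sigma> = 1 \<or> \<sigma> = -1"
  shows "Im (1/(1 - zc \<sigma> s)) \<le> 1/s" "Im (1/(1 - zc \<sigma> s)) \<ge> 1/s - 1/16"
proof -
  define k where "k = kap s"
  have k: "0 < k" "k \<le> s^2/4" using kap_bounds[OF assms(1)] by (auto simp: k_def)
  have I: "Im (1/(1 - zc \<sigma> s)) = s / (k^2 + s^2)" using assms(3) by (auto simp: Im_divide k_def)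
  have pos: "k^2 + s^2 > 0" using assms by (simp add: add_nonneg_pos)
  have "s / (k^2 + s^2) \<le> s / s^2" using assms pos by (intro divide_left_mono) auto
  thus "Im (1/(1 - zc \<sigma> s)) \<le> 1/s" unfolding I using assms by (simp add: power2_eq_square)
  have "1/s - s / (k^2 + s^2) = k^2 / (s * (k^2 + s^2))" using assms pos by (simp add: field_simps power2_eq_square)
  also have "\<dots> \<le> (s^2/4)^2 / (s * (0 + s^2))" using assms pos k
    by (intro frac_le power_mono mult_left_mono add_right_mono) auto
  also have "\<dots> = s/16" using assms by (simp add: power2_eq_square)
  also have "\<dots> \<le> 1/16" using assms by simp
  finally show "Im (1/(1 - zc \<sigma> s)) \<ge> 1/s - 1/16" unfolding I by simp
qed

text \<open>Near the cusp \<open>th3\<close>^3 supplies (1/s)^(3/2) exp(-3 pi/(4s)) and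
  \<open>exp_Nx\<close> another (1/s)^(1/4). The factor exp(3 pi/64) pays for the cusp height being
  only at least 1/s - 1/16.\<close>

lemma Hc_bound:
  obtains K where "K > 0"
    "\<And>x \<sigma> s. x \<ge> 0 \<Longrightarrow> \<sigma> = 1 \<or> \<sigma> = -1 \<Longrightarrow> s > 1 \<Longrightarrow> norm (Hc x \<sigma> s) \<le> K * B1 x s"
    "\<And>x \<sigma> s. x \<ge> 0 \<Longrightarrow> \<sigma> = 1 \<or> \<sigma> = -1 \<Longrightarrow> 0 < s \<Longrightarrow> s < 1 \<Longrightarrow> norm (Hc x \<sigma> s) \<le> K * Nx x * ((1/s) powr (7/4) * exp (-3*pi*(1/s)/4))"
proof -
  obtain c C where cC: "c > 0" "C > 0"
    and top: "\<And>\<tau>. \<tau> \<in> OmC \<Longrightarrow> Im \<tau> \<ge> 1 \<Longrightarrow> c * exp (pi * Im \<tau>) \<le> norm (Wf \<tau>) \<and> norm (Wf \<tau>) \<le> C * exp (pi * Im \<tau>) \<and> norm (th3 \<tau>) \<le> C \<and> norm (psi \<tau>) \<le> C * exp (pi * Im \<tau>)"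
    and low: "\<And>\<tau> \<zeta>. \<tau> \<in> OmC \<Longrightarrow> Im \<tau> \<le> 1 \<Longrightarrow> \<zeta> = 1/(1-\<tau>) \<Longrightarrow> c * exp (-2*pi * Im \<zeta>) \<le> norm (Wf \<tau>) \<and> norm (Wf \<tau>) \<le> C * exp (-2*pi * Im \<zeta>) \<and> norm (th3 \<tau>) \<le> C * sqrt (Im \<zeta>) * exp (-pi * Im \<zeta>/4)
       \<and> norm (psi \<tau>) \<le> C * sqrt (Im \<zeta>) * exp (-5*pi * Im \<zeta>/4)"
    by (rule OmC_bounds) blast
  define K where "K = C^3 * exp (3*pi/64) * 2"
  have K: "K > 0" "C^3 \<le> K"
  proof -
    show "K > 0" using cC by (simp add: K_def)
    have "1 \<le> exp (3*pi/64)" by simp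
    hence "1 \<le> exp (3*pi/64) * 2" by linarith
    hence "C^3 * 1 \<le> C^3 * (exp (3*pi/64) * 2)" using cC by (intro mult_left_mono) auto
    thus "C^3 \<le> K" by (simp add: K_def)
  qed
  have nH: "norm (Hc x \<sigma> s) \<le> norm (th3 (zc \<sigma> s))^3 * norm (hx x (zc \<sigma> s)) / 3" if "s > 0" "\<sigma> = 1 \<or> \<sigma> = -1" for x \<sigma> s
  proof -
    have "norm (Hc x \<sigma> s) = norm (th3 (zc \<sigma> s))^3 * norm (hx x (zc \<sigma> s)) * (norm (zc' \<sigma> s) / (2*pi))"
      using that by (simp add: Hc_def norm_mult norm_divide norm_power)
    also have "\<dots> \<le> norm (th3 (zc \<sigma> s))^3 * norm (hx x (zc \<sigma> s)) * (2 / (2*3))"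
      using norm_zc'[OF that(1), of \<sigma>] that(2) pi_gt3 by (intro mult_left_mono frac_le) auto
    finally show ?thesis by simp
  qed
  show thesis
  proof (rule that[OF K(1)])
    fix x \<sigma> s :: real assume a: "x \<ge> 0" "\<sigma> = 1 \<or> \<sigma> = -1" "s > 1"
    have s0: "s > 0" using a by simp
    have t: "norm (th3 (zc \<sigma> s)) \<le> C" using top[OF zc_OmC[OF s0 a(2)]] a by simp
    have "norm (Hc x \<sigma> s) \<le> norm (th3 (zc \<sigma> s))^3 * norm (hx x (zc \<sigma> s)) / 3" by (rule nH[OF s0 a(2)])
    also have "\<dots> \<le> norm (th3 (zc \<sigma> s))^3 * norm (hx x (zc \<sigma> s))" by simp
    also have "\<dots> \<le> K * (2 * pi * x * exp (- (pi * x * s)))"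
    proof (rule mult_mono)
      show "norm (th3 (zc \<sigma> s))^3 \<le> K" using power_mono[OF t, of 3] K(2) by simp
      show "norm (hx x (zc \<sigma> s)) \<le> 2 * pi * x * exp (- (pi * x * s))" using norm_hx_le(2)[OF a(1), of "zc \<sigma> s"] by simp
    qed (use K in auto)
    also have "\<dots> = K * B1 x s" using a by (simp add: B1_def)
    finally show "norm (Hc x \<sigma> s) \<le> K * B1 x s" .
  next
    fix x \<sigma> s :: real assume a: "x \<ge> 0" "\<sigma> = 1 \<or> \<sigma> = -1" "0 < s" "s < 1"
    define v where "v = Im (1/(1 - zc \<sigma> s))"
    have v: "v \<le> 1/s" "v \<ge> 1/s - 1/16" using zc_height[OF a(3,4,2)] by (auto simp: v_def)
    have "1/s > 1" using a by simp
    hence v0: "v \<ge> 0" using v by linarith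
    have t: "norm (th3 (zc \<sigma> s)) \<le> C * sqrt v * exp (-pi* v/4)"
      using low[OF zc_OmC[OF a(3,2)], of "1/(1 - zc \<sigma> s)"] a by (simp add: v_def)
    also have "\<dots> \<le> C * sqrt (1/s) * (exp (pi/64) * exp (-pi*(1/s)/4))"
    proof (intro mult_mono)
      have "pi * (1/s - 1/16) \<le> pi * v" using v by (intro mult_left_mono) auto
      hence "pi * (1/s) - pi/16 \<le> pi * v" by (simp add: right_diff_distrib)
      moreover have lin: "- C/4 \<le> B/64 + - A/4" if "A - B/16 \<le> C" for A B C :: real using that by simp
      ultimately have "-(pi * v)/4 \<le> pi/64 + -(pi * (1/s))/4" by blast
      hence "-pi * v/4 \<le> pi/64 + -pi * (1/s)/4" by (simp only: minus_mult_left)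
      thus "exp (-pi* v/4) \<le> exp (pi/64) * exp (-pi*(1/s)/4)" unfolding exp_add[symmetric] by (simp only: exp_le_cancel_iff)
    qed (use cC v v0 a in auto)
    finally have t: "norm (th3 (zc \<sigma> s)) \<le> C * sqrt (1/s) * (exp (pi/64) * exp (-pi*(1/s)/4))" .
    have p3: "(C * sqrt (1/s) * (exp (pi/64) * exp (-pi*(1/s)/4)))^3 = C^3 * exp (3*pi/64) * ((1/s) powr (3/2) * exp (-3*pi*(1/s)/4))"
    proof -
      have "sqrt (1/s)^3 = (1/s) powr (3/2)" using a by (simp add: powr_half_sqrt[symmetric] powr_power)
      moreover have "exp (pi/64)^3 = exp (3*pi/64)" "exp (-pi*(1/s)/4)^3 = exp (-3*pi*(1/s)/4)"
        by (simp_all add: exp_of_nat_mult[symmetric])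
      ultimately show ?thesis by (simp only: power_mult_distrib) (simp add: mult_ac)
    qed
    have h: "norm (hx x (zc \<sigma> s)) \<le> 2 * (Nx x * (1/s) powr (1/4))"
    proof -
      have "norm (hx x (zc \<sigma> s)) \<le> 2 * exp (- (pi * x * s))" using norm_hx_le(1)[OF a(1), of "zc \<sigma> s"] by simp
      also have "\<dots> \<le> 2 * (Nx x * s powr (-1/4))" using exp_Nx[OF a(1,3)] a by simp
      also have "s powr (-1/4) = (1/s) powr (1/4)" using a by (simp add: powr_divide powr_minus_divide)
      finally show ?thesis .
    qed
    have "norm (Hc x \<sigma> s) \<le> norm (th3 (zc \<sigma> s))^3 * norm (hx x (zc \<sigma> s)) / 3" by (rule nH[OF a(3,2)])
    also have "\<dots> \<le> norm (th3 (zc \<sigma> s))^3 * norm (hx x (zc \<sigma> s))" by simp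
    also have "\<dots> \<le> (C^3 * exp (3*pi/64) * ((1/s) powr (3/2) * exp (-3*pi*(1/s)/4))) * (2 * (Nx x * (1/s) powr (1/4)))"
      using power_mono[OF t, of 3] h cC unfolding p3 by (intro mult_mono) auto
    also have "\<dots> = K * Nx x * (((1/s) powr (3/2) * (1/s) powr (1/4)) * exp (-3*pi*(1/s)/4))" by (simp add: K_def mult_ac)
    also have "(1/s) powr (3/2) * (1/s) powr (1/4) = (1/s) powr (7/4)" using a by (simp add: powr_add[symmetric])
    finally show "norm (Hc x \<sigma> s) \<le> K * Nx x * ((1/s) powr (7/4) * exp (-3*pi*(1/s)/4))" .
  qed
qed

lemma low_term_bound:
  fixes s :: real assumes "0 < s" "s < 1"
  shows "(1/s) powr (7/4) * exp (-3*pi*(1/s)/4) \<le> 2 * B2 1 s"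
proof -
  define p where "p = 1/s"
  have p: "p \<ge> 1" using assms by (simp add: p_def)
  have "p powr (7/4) \<le> p powr 2" using p by (intro powr_mono) auto
  hence 1: "p powr (7/4) \<le> p^2" using p by simp
  have "p^2 \<le> 2 * exp p" using exp_lower_Taylor_quadratic[of p] p by simp
  also have "exp p \<le> exp (3*pi*p/4)" using p pi_gt3 by (simp add: field_simps)
  finally have "p powr (7/4) \<le> 2 * exp (3*pi*p/4)" using 1 by simp
  hence 2: "p powr (7/4) * exp (-3*pi*p/4) \<le> 2" by (simp add: exp_minus field_simps)
  have "1 + (p-1)^2 \<le> p^2" using p by (simp add: power2_diff)
  moreover have "1 + (p-1)^2 > 0" by (simp add: add_pos_nonneg)
  ultimately have "1 \<le> p^2 / (1 + (p-1)^2)" by simp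
  also have "\<dots> = B2 1 s" using assms by (simp add: B2_def p_def power_divide)
  finally show ?thesis using 2 by (simp add: p_def)
qed

lemma AE_ne1: "AE s in lborel. s \<noteq> (1::real) \<and> s \<noteq> 0"
  using AE_lborel_singleton[of 1] AE_lborel_singleton[of "0::real"] by eventually_elim auto

lemma Hc_integrable:
  assumes "x \<ge> 0" "\<sigma> = 1 \<or> \<sigma> = -1"
  shows "integrable lborel (Hc x \<sigma>)"
proof -
  obtain K where K: "K > 0"
    "\<And>x \<sigma> s. x \<ge> 0 \<Longrightarrow> \<sigma> = 1 \<or> \<sigma> = -1 \<Longrightarrow> s > 1 \<Longrightarrow> norm (Hc x \<sigma> s) \<le> K * B1 x s"
    "\<And>x \<sigma> s. x \<ge> 0 \<Longrightarrow> \<sigma> = 1 \<or> \<sigma> = -1 \<Longrightarrow> 0 < s \<Longrightarrow> s < 1 \<Longrightarrow> norm (Hc x \<sigma> s) \<le> K * Nx x * ((1/s) powr (7/4) * exp (-3*pi*(1/s)/4))"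
    by (rule Hc_bound) blast
  show ?thesis
  proof (rule Bochner_Integration.integrable_bound)
    show "integrable lborel (\<lambda>s. K * B1 x s + K * Nx x * (2 * B2 1 s))"
      by (intro Bochner_Integration.integrable_add Bochner_Integration.integrable_mult_right B1_int(1) B2_int(1) assms(1))
    show "AE s in lborel. norm (Hc x \<sigma> s) \<le> norm (K * B1 x s + K * Nx x * (2 * B2 1 s))"
      using AE_ne1
    proof eventually_elim
      case (elim s)
      have nn: "K * B1 x s \<ge> 0" "K * Nx x * (2 * B2 1 s) \<ge> 0" using K(1) assms B_nonneg Nx_pos[of x] by (auto intro!: mult_nonneg_nonneg)
      consider "s > 1" | "0 < s" "s < 1" | "s \<le> 0" using elim by linarith
      hence "norm (Hc x \<sigma> s) \<le> K * B1 x s + K * Nx x * (2 * B2 1 s)"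
      proof cases
        case 1 thus ?thesis using K(2)[OF assms 1] nn by linarith
      next
        case 2
        have "norm (Hc x \<sigma> s) \<le> K * Nx x * ((1/s) powr (7/4) * exp (-3*pi*(1/s)/4))" by (rule K(3)[OF assms 2])
        also have "\<dots> \<le> K * Nx x * (2 * B2 1 s)" using low_term_bound[OF 2] K(1) Nx_pos[of x] assms by (intro mult_left_mono) auto
        finally show ?thesis using nn by linarith
      next
        case 3 thus ?thesis using nn by (simp add: Hc_def)
      qed
      thus ?case using nn by simp
    qed
  qed simp
qed

text \<open>The size of \<open>psi\<close> is balanced by |\<open>Wf\<close> z - w| >= d
  max(|\<open>Wf\<close> z|, |w|): for large Im \<tau> by |w|, for low \<tau> and s > 1 by
  |\<open>Wf\<close> z|, and when both are near the cusp by the larger of the two. Only the last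
  case leaves a factor v^(1/4), where the cusp height v is at most 1/Im \<tau>.\<close>

lemma G_bound:
  obtains K where "K > 0"
    "\<And>x \<sigma> \<tau>. x \<ge> 0 \<Longrightarrow> \<tau> \<in> OmC \<Longrightarrow> sgood \<sigma> (Wf \<tau>) \<Longrightarrow> norm (psi \<tau> * Phi x \<sigma> (Wf \<tau>)) \<le> K * Nx x * max 1 (Im \<tau> powr (-1/4))"
proof -
  obtain c C where cC: "c > 0" "C > 0"
    and top: "\<And>\<tau>. \<tau> \<in> OmC \<Longrightarrow> Im \<tau> \<ge> 1 \<Longrightarrow> c * exp (pi * Im \<tau>) \<le> norm (Wf \<tau>) \<and> norm (Wf \<tau>) \<le> C * exp (pi * Im \<tau>) \<and> norm (th3 \<tau>) \<le> C \<and> norm (psi \<tau>) \<le> C * exp (pi * Im \<tau>)"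
    and low: "\<And>\<tau> \<zeta>. \<tau> \<in> OmC \<Longrightarrow> Im \<tau> \<le> 1 \<Longrightarrow> \<zeta> = 1/(1-\<tau>) \<Longrightarrow> c * exp (-2*pi * Im \<zeta>) \<le> norm (Wf \<tau>) \<and> norm (Wf \<tau>) \<le> C * exp (-2*pi * Im \<zeta>) \<and> norm (th3 \<tau>) \<le> C * sqrt (Im \<zeta>) * exp (-pi * Im \<zeta>/4)
       \<and> norm (psi \<tau>) \<le> C * sqrt (Im \<zeta>) * exp (-5*pi * Im \<zeta>/4)"
    by (rule OmC_bounds) blast
  obtain d where d: "0 < d" "d \<le> 1"
    "\<And>\<sigma> w s. sgood \<sigma> w \<Longrightarrow> s > 0 \<Longrightarrow> norm (Wf (zc \<sigma> s) - w) \<ge> d * norm (Wf (zc \<sigma> s)) \<and> norm (Wf (zc \<sigma> s) - w) \<ge> d * norm w"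
    by (rule zc_dist) blast
  obtain K where K: "K > 0"
    "\<And>x \<sigma> s. x \<ge> 0 \<Longrightarrow> \<sigma> = 1 \<or> \<sigma> = -1 \<Longrightarrow> s > 1 \<Longrightarrow> norm (Hc x \<sigma> s) \<le> K * B1 x s"
    "\<And>x \<sigma> s. x \<ge> 0 \<Longrightarrow> \<sigma> = 1 \<or> \<sigma> = -1 \<Longrightarrow> 0 < s \<Longrightarrow> s < 1 \<Longrightarrow> norm (Hc x \<sigma> s) \<le> K * Nx x * ((1/s) powr (7/4) * exp (-3*pi*(1/s)/4))"
    by (rule Hc_bound) blast
  define L where "L = C/(c*d)"
  have L: "L > 0" using cC d by (simp add: L_def)
  define Q where "Q = 27 * L * K"
  have Q: "Q > 0" "L * K \<le> Q" "2 * (L * K) \<le> Q" using L K(1) by (auto simp: Q_def)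
  show thesis
  proof (rule that[of "Q * (2 + pi)"])
    show "Q * (2 + pi) > 0" using Q(1) by (intro mult_pos_pos add_pos_pos) auto
    fix x \<sigma> :: real and \<tau> assume a: "x \<ge> 0" "\<tau> \<in> OmC" "sgood \<sigma> (Wf \<tau>)"
    have sg: "\<sigma> = 1 \<or> \<sigma> = -1" using a(3) by (auto simp: sgood_def)
    have im: "Im \<tau> > 0" using a(2) by (simp add: OmC_def)
    define w where "w = Wf \<tau>"
    have w0: "norm w > 0" using Wf_nz[OF im] by (simp add: w_def)
    define m where "m = max 1 (Im \<tau> powr (-1/4))"
    have m1: "m \<ge> 1" by (simp add: m_def)
    have N: "Nx x > 0" using Nx_pos a by simp
    \<comment> \<open>v is the cusp height of \<tau> if Im \<tau> < 1 and simply 1 otherwise; in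
      either case \<open>B2\<close> v integrates to at most pi.\<close>
    obtain v where pw: "\<And>s. s > 1 \<Longrightarrow> norm (psi \<tau> * (Hc x \<sigma> s / (Vc \<sigma> s - w))) \<le> Q * B1 x s"
      "\<And>s. 0 < s \<Longrightarrow> s < 1 \<Longrightarrow> norm (psi \<tau> * (Hc x \<sigma> s / (Vc \<sigma> s - w))) \<le> Q * Nx x * m * B2 v s"
    proof -
      have nrm: "norm (psi \<tau> * (Hc x \<sigma> s / (Vc \<sigma> s - w))) = (norm (psi \<tau>) / norm (Wf (zc \<sigma> s) - w)) * norm (Hc x \<sigma> s)" if "s > 0" for s
        using that by (simp add: Vc_def norm_mult norm_divide)
      show thesis
      proof (cases "Im \<tau> \<ge> 1")
        case True
        have k: "norm (psi \<tau>) / norm (Wf (zc \<sigma> s) - w) \<le> L" if "s > 0" for s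
        proof -
          have "norm (psi \<tau>) / norm (Wf (zc \<sigma> s) - w) \<le> (C * exp (pi * Im \<tau>)) / (d * (c * exp (pi * Im \<tau>)))"
          proof (rule frac_le)
            have "d * (c * exp (pi * Im \<tau>)) \<le> d * norm w" using top[OF a(2) True] d by (intro mult_left_mono) (auto simp: w_def)
            also have "\<dots> \<le> norm (Wf (zc \<sigma> s) - w)" using d(3)[OF a(3) that] by (simp add: w_def)
            finally show "d * (c * exp (pi * Im \<tau>)) \<le> norm (Wf (zc \<sigma> s) - w)" .
          qed (use top[OF a(2) True] d cC in auto)
          also have "\<dots> = L" by (simp add: L_def)
          finally show ?thesis .
        qed
        show thesis
        proof (rule that[of 1])
          fix s :: real assume s: "s > 1"
          have "norm (psi \<tau> * (Hc x \<sigma> s / (Vc \<sigma> s - w))) \<le> L * (K * B1 x s)"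
            unfolding nrm[OF less_trans[OF zero_less_one s]] using k[of s] K(2)[OF a(1) sg s] s L by (intro mult_mono) auto
          also have "\<dots> = (L * K) * B1 x s" by simp
          also have "\<dots> \<le> Q * B1 x s" using Q B_nonneg a by (intro mult_right_mono) auto
          finally show "norm (psi \<tau> * (Hc x \<sigma> s / (Vc \<sigma> s - w))) \<le> Q * B1 x s" .
        next
          fix s :: real assume s: "0 < s" "s < 1"
          have "norm (psi \<tau> * (Hc x \<sigma> s / (Vc \<sigma> s - w))) \<le> L * (K * Nx x * ((1/s) powr (7/4) * exp (-3*pi*(1/s)/4)))"
            unfolding nrm[OF s(1)] using k[of s] K(3)[OF a(1) sg s] s L by (intro mult_mono) auto
          also have "\<dots> \<le> L * (K * Nx x * (2 * B2 1 s))"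
            using low_term_bound[OF s] L K(1) N by (intro mult_left_mono) auto
          also have "\<dots> = (2 * (L * K)) * (Nx x * 1 * B2 1 s)" by simp
          also have "\<dots> \<le> Q * (Nx x * m * B2 1 s)"
            using Q N m1 B_nonneg(2)[of 1 s] by (intro mult_mono mult_right_mono mult_left_mono) auto
          finally show "norm (psi \<tau> * (Hc x \<sigma> s / (Vc \<sigma> s - w))) \<le> Q * Nx x * m * B2 1 s" by (simp add: mult_ac)
        qed
      next
        case False
        hence im1: "Im \<tau> \<le> 1" by simp
        define v where "v = Im (1/(1-\<tau>))"
        have v: "v \<ge> 1/2" "v \<le> 1/Im \<tau>" using OmC_low[OF a(2) im1] by (auto simp: v_def)
        have l: "c * exp (-2*pi* v) \<le> norm w" "norm (psi \<tau>) \<le> C * (sqrt v * exp (-5*pi* v/4))"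
          using low[OF a(2) im1 refl] by (auto simp: w_def v_def mult_ac)
        have vm: "v powr (1/4) \<le> m"
        proof -
          have "v powr (1/4) \<le> (1/Im \<tau>) powr (1/4)" using v by (intro powr_mono2) auto
          also have "\<dots> = Im \<tau> powr (-1/4)" using im by (simp add: powr_divide powr_minus_divide)
          finally show ?thesis by (simp add: m_def)
        qed
        have psi1: "norm (psi \<tau>) \<le> C"
        proof -
          have "sqrt v \<le> v + 1" using v by (intro real_le_lsqrt) (auto simp: power2_eq_square algebra_simps)
          also have "\<dots> \<le> exp v" using exp_ge_add_one_self[of v] by (simp add: add.commute)
          also have "\<dots> \<le> exp (5*pi* v/4)" using v pi_gt3 by (simp add: field_simps)
          finally have "sqrt v * exp (-5*pi* v/4) \<le> 1" by (simp add: exp_minus field_simps)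
          hence "C * (sqrt v * exp (-5*pi* v/4)) \<le> C * 1" using cC by (intro mult_left_mono) auto
          thus ?thesis using l(2) by simp
        qed
        show thesis
        proof (rule that[of v])
          fix s :: real assume s: "s > 1"
          hence s0: "s > 0" by simp
          have "norm (psi \<tau>) / norm (Wf (zc \<sigma> s) - w) \<le> C / (d * c)"
          proof (rule frac_le[OF _ psi1])
            have "c * exp (pi * s) \<le> norm (Wf (zc \<sigma> s))" using top[OF zc_OmC[OF s0 sg]] s by auto
            moreover have "c * 1 \<le> c * exp (pi * s)" using cC s0 by (intro mult_left_mono) auto
            ultimately have "d * c \<le> d * norm (Wf (zc \<sigma> s))" using d by (intro mult_left_mono) auto
            also have "\<dots> \<le> norm (Wf (zc \<sigma> s) - w)" using d(3)[OF a(3) s0] by (simp add: w_def)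
            finally show "d * c \<le> norm (Wf (zc \<sigma> s) - w)" .
          qed (use d cC in auto)
          hence "norm (psi \<tau>) / norm (Wf (zc \<sigma> s) - w) \<le> L" by (simp add: L_def mult_ac)
          hence "norm (psi \<tau> * (Hc x \<sigma> s / (Vc \<sigma> s - w))) \<le> L * (K * B1 x s)"
            unfolding nrm[OF s0] using K(2)[OF a(1) sg s] s L by (intro mult_mono) auto
          also have "\<dots> = (L * K) * B1 x s" by simp
          also have "\<dots> \<le> Q * B1 x s" using Q B_nonneg a by (intro mult_right_mono) auto
          finally show "norm (psi \<tau> * (Hc x \<sigma> s / (Vc \<sigma> s - w))) \<le> Q * B1 x s" .
        next
          fix s :: real assume s: "0 < s" "s < 1"
          define p where "p = 1/s"
          have p: "p \<ge> 1" using s by (simp add: p_def)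
          define M where "M = max (exp (-2*pi*p)) (exp (-2*pi* v))"
          have M0: "M > 0" by (simp add: M_def less_max_iff_disj)
          have den: "d * c * M \<le> norm (Wf (zc \<sigma> s) - w)"
          proof -
            have vz: "Im (1/(1 - zc \<sigma> s)) \<le> p" using zc_height[OF s sg] by (simp add: p_def)
            have "c * exp (-2*pi*p) \<le> c * exp (-2*pi*Im (1/(1 - zc \<sigma> s)))" using vz cC by (intro mult_left_mono) auto
            also have "\<dots> \<le> norm (Wf (zc \<sigma> s))" using low[OF zc_OmC[OF s(1) sg] _ refl] s by auto
            finally have "d * (c * exp (-2*pi*p)) \<le> d * norm (Wf (zc \<sigma> s))" using d by (intro mult_left_mono) auto
            also have "\<dots> \<le> norm (Wf (zc \<sigma> s) - w)" using d(3)[OF a(3) s(1)] by (simp add: w_def)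
            finally have A: "d * c * exp (-2*pi*p) \<le> norm (Wf (zc \<sigma> s) - w)" by (simp add: mult_ac)
            have "d * (c * exp (-2*pi* v)) \<le> d * norm w" using d l by (intro mult_left_mono) auto
            also have "\<dots> \<le> norm (Wf (zc \<sigma> s) - w)" using d(3)[OF a(3) s(1)] by (simp add: w_def)
            finally have B: "d * c * exp (-2*pi* v) \<le> norm (Wf (zc \<sigma> s) - w)" by (simp add: mult_ac)
            show ?thesis using A B by (simp add: M_def max_def)
          qed
          have "norm (psi \<tau>) / norm (Wf (zc \<sigma> s) - w) \<le> (C * (sqrt v * exp (-5*pi* v/4))) / (d * c * M)"
            by (rule frac_le) (use l den d cC M0 v in auto)
          also have "\<dots> = L * ((sqrt v * exp (-5*pi* v/4)) / M)" by (simp add: L_def mult_ac)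
          finally have "norm (psi \<tau> * (Hc x \<sigma> s / (Vc \<sigma> s - w))) \<le> (L * ((sqrt v * exp (-5*pi* v/4)) / M)) * (K * Nx x * (p powr (7/4) * exp (-3*pi*p/4)))"
            unfolding nrm[OF s(1)] using K(3)[OF a(1) sg s] L M0 v by (intro mult_mono) (auto simp: p_def)
          also have "\<dots> = (L * K * Nx x) * ((sqrt v * exp (-5*pi* v/4)) * (p powr (7/4) * exp (-3*pi*p/4)) / M)"
            by (simp add: mult_ac)
          also have "\<dots> \<le> (L * K * Nx x) * (27 * v powr (1/4) * (p^2 / (1 + (p - v)^2)))"
            unfolding M_def using kernel_real_bound[OF p v(1)] L K(1) N by (intro mult_left_mono) auto
          also have "p^2 / (1 + (p - v)^2) = B2 v s" using s by (simp add: B2_def p_def power_divide)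
          also have "(L * K * Nx x) * (27 * v powr (1/4) * B2 v s) = Q * Nx x * (v powr (1/4) * B2 v s)" by (simp add: Q_def)
          also have "\<dots> \<le> Q * Nx x * (m * B2 v s)"
            using vm Q(1) N B_nonneg(2)[of v s] by (intro mult_left_mono mult_right_mono) auto
          finally show "norm (psi \<tau> * (Hc x \<sigma> s / (Vc \<sigma> s - w))) \<le> Q * Nx x * m * B2 v s" by (simp add: mult_ac)
        qed
      qed
    qed
    let ?b = "\<lambda>s. Q * B1 x s + Q * Nx x * m * B2 v s"
    have bi: "integrable lborel ?b" by (intro Bochner_Integration.integrable_add Bochner_Integration.integrable_mult_right B1_int(1) B2_int(1) a(1))
    have ae: "AE s in lborel. norm (psi \<tau> * (Hc x \<sigma> s / (Vc \<sigma> s - w))) \<le> ?b s"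
      using AE_ne1
    proof eventually_elim
      case (elim s)
      have nn: "Q * B1 x s \<ge> 0" "Q * Nx x * m * B2 v s \<ge> 0" using Q(1) a B_nonneg N m1 by (auto intro!: mult_nonneg_nonneg)
      consider "s > 1" | "0 < s" "s < 1" | "s \<le> 0" using elim by linarith
      thus ?case
      proof cases
        case 1 thus ?thesis using pw(1)[OF 1] nn by linarith
      next
        case 2 thus ?thesis using pw(2)[OF 2] nn by linarith
      next
        case 3 thus ?thesis using nn by (simp add: Hc_def)
      qed
    qed
    have "norm (psi \<tau> * Phi x \<sigma> w) = norm (LINT s|lborel. psi \<tau> * (Hc x \<sigma> s / (Vc \<sigma> s - w)))"
      by (simp only: Phi_def Bochner_Integration.integral_mult_right_zero)
    also have "\<dots> \<le> (LINT s|lborel. ?b s)"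
      by (rule order_trans[OF integral_norm_bound integral_mono_AE'[OF bi ae]])
         (use Q(1) a B_nonneg N m1 in \<open>auto intro!: AE_I2 add_nonneg_nonneg mult_nonneg_nonneg\<close>)
    also have "\<dots> = Q * integral\<^sup>L lborel (B1 x) + Q * Nx x * m * integral\<^sup>L lborel (B2 v)"
      using B1_int[OF a(1)] B2_int by simp
    also have "\<dots> \<le> Q * (2 * Nx x) + Q * Nx x * m * pi"
      using B1_int(2)[OF a(1)] B2_int(2)[of v] Q(1) N m1 by (intro add_mono mult_left_mono) auto
    also have "\<dots> \<le> Q * (2 * Nx x) * m + Q * Nx x * m * pi" using Q(1) N m1 by simp
    also have "\<dots> = Q * (2 + pi) * Nx x * m" by (simp add: algebra_simps)
    finally show "norm (psi \<tau> * Phi x \<sigma> (Wf \<tau>)) \<le> Q * (2 + pi) * Nx x * max 1 (Im \<tau> powr (-1/4))"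
      by (simp add: w_def m_def)
  qed
qed

section \<open>Holomorphy of the transform\<close>

lemma second_difference_quotient:
  fixes a b h :: complex
  assumes "a \<noteq> 0" "b \<noteq> 0" "b - a \<noteq> 0"
  shows "(h/a - h/b) / (b - a) - h / b^2 = (b - a) * (h / (a * b^2))"
proof -
  have 1: "h/a - h/b = h * (b - a) / (a * b)" using assms by (simp add: field_simps)
  have 2: "h * (b - a) / (a * b) / (b - a) = h / (a * b)" using assms by simp
  have 3: "h / (a * b) - h / b^2 = (h * b - h * a) / (a * b^2)"
    using assms(1,2) by (simp add: power2_eq_square diff_divide_distrib)
  show ?thesis unfolding 1 2 3 by (simp add: right_diff_distrib mult.commute)
qed

text \<open>Differentiation under the integral: the difference quotient minus the expected
  derivative is dominated by |w - w0| |H| / r^3.\<close>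

lemma cauchy_transform_differentiable:
  fixes H V :: "real \<Rightarrow> complex"
  assumes H: "integrable lborel H" and V[measurable]: "V \<in> borel_measurable borel" and r: "r > 0"
    and far: "\<And>s w. H s \<noteq> 0 \<Longrightarrow> norm (w - w0) < r \<Longrightarrow> norm (V s - w) \<ge> r"
  shows "(\<lambda>w. LINT s|lborel. H s / (V s - w)) field_differentiable at w0"
proof -
  have [measurable]: "H \<in> borel_measurable borel" using H by (simp add: borel_measurable_integrable)
  define F where "F = (\<lambda>w. LINT s|lborel. H s / (V s - w))"
  define D where "D = (LINT s|lborel. H s / (V s - w0)^2)"
  define M where "M = (LINT s|lborel. norm (H s) / r^3)"
  have w0: "norm (w0 - w0) < r" using r by simp
  have i1: "integrable lborel (\<lambda>s. H s / (V s - w))" if "norm (w - w0) < r" for w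
  proof (rule Bochner_Integration.integrable_bound[of _ "\<lambda>s. norm (H s) / r"])
    have "norm (H s / (V s - w)) \<le> norm (H s) / r" for s
      using far[OF _ that, of s] r by (cases "H s = 0") (auto simp: norm_divide intro!: divide_left_mono mult_pos_pos)
    thus "AE s in lborel. norm (H s / (V s - w)) \<le> norm (norm (H s) / r)" using r by simp
  qed (use H in auto)
  have i2: "integrable lborel (\<lambda>s. H s / (V s - w0)^2)"
  proof (rule Bochner_Integration.integrable_bound[of _ "\<lambda>s. norm (H s) / r^2"])
    have "norm (H s / (V s - w0)^2) \<le> norm (H s) / r^2" for s
    proof (cases "H s = 0")
      case False
      have "r^2 \<le> norm (V s - w0)^2" using far[OF False w0] r by (intro power_mono) auto
      thus ?thesis unfolding norm_divide norm_power by (intro frac_le) (use r in auto)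
    qed simp
    thus "AE s in lborel. norm (H s / (V s - w0)^2) \<le> norm (norm (H s) / r^2)" using r by simp
  qed (use H in auto)
  have key: "norm ((F w - F w0) / (w - w0) - D) \<le> norm (w - w0) * M" if w: "norm (w - w0) < r" "w \<noteq> w0" for w
  proof -
    have eq: "(H s / (V s - w) - H s / (V s - w0)) / (w - w0) - H s / (V s - w0)^2 = (w - w0) * (H s / ((V s - w) * (V s - w0)^2))" for s
    proof (cases "H s = 0")
      case False
      have nz: "V s - w \<noteq> 0" "V s - w0 \<noteq> 0" using far[OF False w(1)] far[OF False w0] r by auto
      have e: "(V s - w0) - (V s - w) = w - w0" by simp
      hence "(V s - w0) - (V s - w) \<noteq> 0" using w(2) by simp
      from second_difference_quotient[OF nz this, of "H s"] show ?thesis unfolding e .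
    qed simp
    have "F w - F w0 = (LINT s|lborel. H s / (V s - w) - H s / (V s - w0))"
      unfolding F_def by (rule Bochner_Integration.integral_diff[symmetric]) (use i1 w w0 in auto)
    hence "(F w - F w0) / (w - w0) - D = (LINT s|lborel. (H s / (V s - w) - H s / (V s - w0)) / (w - w0)) - D" by simp
    also have "\<dots> = (LINT s|lborel. (H s / (V s - w) - H s / (V s - w0)) / (w - w0) - H s / (V s - w0)^2)"
      unfolding D_def by (rule Bochner_Integration.integral_diff[symmetric])
         (intro integrable_divide Bochner_Integration.integrable_diff i1 w w0 i2)+
    also have "\<dots> = (LINT s|lborel. (w - w0) * (H s / ((V s - w) * (V s - w0)^2)))" by (simp only: eq)
    also have "norm \<dots> \<le> (LINT s|lborel. norm (w - w0) * (norm (H s) / r^3))"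
    proof (rule order_trans[OF integral_norm_bound integral_mono_AE'])
      show "integrable lborel (\<lambda>s. norm (w - w0) * (norm (H s) / r^3))" using H by auto
      have "norm (H s / ((V s - w) * (V s - w0)^2)) \<le> norm (H s) / r^3" for s
      proof (cases "H s = 0")
        case False
        have "r * r^2 \<le> norm (V s - w) * norm (V s - w0)^2" using far[OF False w(1)] far[OF False w0] r by (intro mult_mono power_mono) auto
        hence "r^3 \<le> norm ((V s - w) * (V s - w0)^2)" by (simp add: norm_mult norm_power power3_eq_cube power2_eq_square)
        thus ?thesis unfolding norm_divide by (intro frac_le) (use r in auto)
      qed simp
      thus "AE s in lborel. norm ((w - w0) * (H s / ((V s - w) * (V s - w0)^2))) \<le> norm (w - w0) * (norm (H s) / r^3)"
        unfolding norm_mult by (intro AE_I2 mult_left_mono) (simp_all add: norm_mult)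
    qed (use r in auto)
    also have "\<dots> = norm (w - w0) * M" by (simp add: M_def)
    finally show ?thesis .
  qed
  have "((\<lambda>w. (F w - F w0) / (w - w0) - D) \<longlongrightarrow> 0) (at w0)"
  proof (rule Lim_null_comparison)
    show "\<forall>\<^sub>F w in at w0. norm ((F w - F w0) / (w - w0) - D) \<le> norm (w - w0) * M"
      unfolding eventually_at using key r by (intro exI[of _ r]) (auto simp: dist_norm)
    have "((\<lambda>w. norm (w - w0) * M) \<longlongrightarrow> norm (w0 - w0) * M) (at w0)" by (intro tendsto_intros)
    thus "((\<lambda>w. norm (w - w0) * M) \<longlongrightarrow> 0) (at w0)" by simp
  qed
  hence "((\<lambda>w. (F w - F w0) / (w - w0)) \<longlongrightarrow> D) (at w0)" by (simp add: LIM_zero_iff)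
  hence "(F has_field_derivative D) (at w0)" by (simp add: has_field_derivative_iff)
  thus ?thesis unfolding F_def field_differentiable_def by blast
qed

text \<open>Differentiability holds on a full disc, hence also on the side of the real axis for
  which the curve was not chosen. This lets both transforms be compared in a neighbourhood of a
  point of the line Re = 1.\<close>

lemma Phi_differentiable_near:
  assumes "x \<ge> 0" "sgood \<sigma> w0" "w0 \<noteq> 0"
  obtains r where "r > 0" "\<And>w. norm (w - w0) < r \<Longrightarrow> Phi x \<sigma> field_differentiable at w"
proof -
  obtain d where d: "0 < d" "d \<le> 1"
    "\<And>\<sigma> w s. sgood \<sigma> w \<Longrightarrow> s > 0 \<Longrightarrow> norm (Wf (zc \<sigma> s) - w) \<ge> d * norm (Wf (zc \<sigma> s)) \<and> norm (Wf (zc \<sigma> s) - w) \<ge> d * norm w"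
    by (rule zc_dist) blast
  have sg: "\<sigma> = 1 \<or> \<sigma> = -1" using assms by (auto simp: sgood_def)
  define r where "r = d * norm w0 / 4"
  have r: "r > 0" "d * norm w0 = 4 * r" using d assms by (auto simp: r_def)
  show thesis
  proof (rule that[OF r(1)])
    fix w1 assume w1: "norm (w1 - w0) < r"
    show "Phi x \<sigma> field_differentiable at w1" unfolding Phi_def[abs_def]
    proof (rule cauchy_transform_differentiable[OF Hc_integrable[OF assms(1) sg] Vc_meas r(1)])
      fix s w assume s: "Hc x \<sigma> s \<noteq> 0" and w: "norm (w - w1) < r"
      have s0: "s > 0" using s by (auto simp: Hc_def indicator_def split: if_splits)
      have "4 * r \<le> norm (Vc \<sigma> s - w0)" using d(3)[OF assms(2) s0] s0 r by (simp add: Vc_def)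
      also have "\<dots> \<le> norm (Vc \<sigma> s - w) + norm (w - w0)" using norm_triangle_ineq[of "Vc \<sigma> s - w" "w - w0"] by simp
      also have "norm (w - w0) \<le> norm (w - w1) + norm (w1 - w0)" using norm_triangle_ineq[of "w - w1" "w1 - w0"] by simp
      finally show "r \<le> norm (Vc \<sigma> s - w)" using w w1 r by linarith
    qed
  qed
qed

lemma Phi_differentiable:
  assumes "x \<ge> 0" "sgood \<sigma> w0" "w0 \<noteq> 0"
  shows "Phi x \<sigma> field_differentiable at w0"
  by (rule Phi_differentiable_near[OF assms]) (metis cancel_comm_monoid_add_class.diff_cancel norm_zero)

section \<open>The jump between the two transforms\<close>

definition Om :: "complex set" where
  "Om = {\<tau>. 0 < Re \<tau> \<and> Re \<tau> < 2 \<and> norm \<tau> > 1 \<and> norm (\<tau> - 2) > 1 \<and> Im \<tau> > 0}"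

lemma Om_open: "open Om"
  unfolding Om_def by (intro open_Collect_conj open_Collect_less continuous_intros)

lemma Om_uhp: "Om \<subseteq> uhp" by (auto simp: Om_def)

lemma Om_OmC: "Om \<subseteq> OmC" by (auto simp: Om_def OmC_def)

lemma Om_iff:
  "\<tau> \<in> Om \<longleftrightarrow> \<bar>Re \<tau> - 1\<bar> < 1 \<and> (Im \<tau>)^2 > 2 * \<bar>Re \<tau> - 1\<bar> - \<bar>Re \<tau> - 1\<bar>^2 \<and> Im \<tau> > 0"
proof -
  have n: "1 < norm z \<longleftrightarrow> 1 < (Re z)^2 + (Im z)^2" for z
    using abs_square_less_1[of "norm z"] power_strict_mono[of 1 "norm z" 2] power2_less_imp_less[of 1 "norm z"]
    by (auto simp: cmod_power2[symmetric])
  have a: "1 < norm \<tau> \<longleftrightarrow> (Im \<tau>)^2 > 2 * (1 - Re \<tau>) - (1 - Re \<tau>)^2" unfolding n by (simp add: power2_eq_square algebra_simps)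
  have b: "1 < norm (\<tau> - 2) \<longleftrightarrow> (Im \<tau>)^2 > 2 * (Re \<tau> - 1) - (1 - Re \<tau>)^2" unfolding n by (simp add: power2_eq_square algebra_simps)
  have c: "\<bar>Re \<tau> - 1\<bar>^2 = (1 - Re \<tau>)^2" by (simp add: power2_commute)
  show ?thesis unfolding Om_def mem_Collect_eq a b c by (auto simp: abs_if)
qed

text \<open>Moving towards 1 + i shrinks a = |Re - 1|, and the bound 2a - a^2 < 1 on the squared
  height increases with a, while the height stays above min(y, 1). Starlikeness provides primitives
  on \<open>Om\<close>.\<close>

lemma Om_starlike: "starlike Om"
  unfolding starlike_def
proof (intro bexI[of _ "1 + \<i>"] ballI subsetI)
  show "1 + \<i> \<in> Om" by (simp add: Om_iff)
  fix t z assume t: "t \<in> Om" and z: "z \<in> closed_segment (1+\<i>) t"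
  then obtain u where u: "0 \<le> u" "u \<le> 1" "z = (1-u) *\<^sub>R (1+\<i>) + u *\<^sub>R t" by (auto simp: closed_segment_def)
  define a y where "a = \<bar>Re t - 1\<bar>" and "y = Im t"
  have T: "a < 1" "y^2 > 2*a - a^2" "y > 0" "a \<ge> 0" using t by (auto simp: Om_iff a_def y_def)
  have re: "Re z - 1 = u * (Re t - 1)" unfolding u(3) by (simp add: algebra_simps)
  hence a': "\<bar>Re z - 1\<bar> = u * a" using u by (simp add: a_def abs_mult)
  have im: "Im z = (1-u) + u * y" unfolding u(3) by (simp add: y_def)
  have ua: "u * a \<le> a" "u * a \<ge> 0" using u T by (auto simp: mult_left_le_one_le)
  have g: "2*(u*a) - (u*a)^2 \<le> 2*a - a^2"
  proof -
    have "0 \<le> (a - u*a) * (2 - a - u*a)" using ua T by (intro mult_nonneg_nonneg) auto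
    thus ?thesis by (simp add: power2_eq_square algebra_simps)
  qed
  have lt1: "2*a - a^2 < 1" using T(1) zero_less_power2[of "1-a"] by (simp add: power2_diff)
  have impos: "Im z > 0" unfolding im using u T by (cases "u = 1") (auto intro!: add_pos_nonneg)
  have "(Im z)^2 > 2*a - a^2"
  proof (cases "y \<le> 1")
    case True
    have "u * y + (1-u) * y \<le> u * y + (1-u) * 1" using u True by (intro add_left_mono mult_left_mono) auto
    hence "y \<le> Im z" unfolding im by (simp add: algebra_simps)
    hence "y^2 \<le> (Im z)^2" using T by (intro power_mono) auto
    thus ?thesis using T by linarith
  next
    case False
    have "u * 1 \<le> u * y" using u False by (intro mult_left_mono) auto
    hence "1 \<le> Im z" unfolding im by simp
    hence "1 \<le> (Im z)^2" by (rule one_le_power)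
    thus ?thesis using lt1 by linarith
  qed
  thus "z \<in> Om" unfolding Om_iff a' using g ua T impos by auto
qed

lemma Wf_Om:
  assumes "\<tau> \<in> Om" shows "(Re \<tau> < 1 \<longrightarrow> Im (Wf \<tau>) < 0) \<and> (Re \<tau> > 1 \<longrightarrow> Im (Wf \<tau>) > 0) \<and> (Re \<tau> = 1 \<longrightarrow> Im (Wf \<tau>) = 0 \<and> Re (Wf \<tau>) < 0)"
proof (intro conjI impI)
  assume "Re \<tau> < 1" thus "Im (Wf \<tau>) < 0" using assms by (intro Wf_Im_neg) (auto simp: Om_def)
next
  assume "Re \<tau> > 1"
  hence "Im (Wf (\<tau> - 2)) > 0" using assms by (intro Wf_Im_pos) (auto simp: Om_def)
  thus "Im (Wf \<tau>) > 0" using Wf_plus2[of "\<tau> - 2"] by simp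
next
  assume "Re \<tau> = 1" thus "Im (Wf \<tau>) = 0" "Re (Wf \<tau>) < 0" using Wf_real_on[of \<tau>] Wf_line_neg[of \<tau>] assms by (auto simp: Om_def)
qed

lemma zc_seg:
  assumes "s > 0" "z \<in> closed_segment (zc (-1) s) (zc 1 s)"
  shows "z \<in> Om" "Im z = s"
proof -
  obtain u where u: "0 \<le> u" "u \<le> 1" "z = (1-u) *\<^sub>R zc (-1) s + u *\<^sub>R zc 1 s" using assms(2) by (auto simp: closed_segment_def)
  show im: "Im z = s" unfolding u(3) by (simp add: algebra_simps)
  note k = kap_bounds[OF assms(1)]
  have re: "Re z - 1 = (2*u - 1) * kap s" unfolding u(3) by (simp add: algebra_simps)
  hence "\<bar>Re z - 1\<bar> = \<bar>2*u-1\<bar> * kap s" using k by (simp add: abs_mult)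
  also have "\<dots> \<le> 1 * kap s" using u k by (intro mult_right_mono) auto
  finally have a: "\<bar>Re z - 1\<bar> \<le> kap s" by simp
  moreover have "2 * \<bar>Re z - 1\<bar> - \<bar>Re z - 1\<bar>^2 \<le> 2 * kap s" using a by (smt (verit) zero_le_power2)
  ultimately show "z \<in> Om" unfolding Om_iff im using k assms by linarith
qed

lemma OmC_th3_bounded:
  obtains C where "C > 0" "\<And>\<tau>. \<tau> \<in> OmC \<Longrightarrow> norm (th3 \<tau>) \<le> C"
proof -
  obtain c C where cC: "c > 0" "C > 0"
    and top: "\<And>\<tau>. \<tau> \<in> OmC \<Longrightarrow> Im \<tau> \<ge> 1 \<Longrightarrow> c * exp (pi * Im \<tau>) \<le> norm (Wf \<tau>) \<and> norm (Wf \<tau>) \<le> C * exp (pi * Im \<tau>) \<and> norm (th3 \<tau>) \<le> C \<and> norm (psi \<tau>) \<le> C * exp (pi * Im \<tau>)"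
    and low: "\<And>\<tau> \<zeta>. \<tau> \<in> OmC \<Longrightarrow> Im \<tau> \<le> 1 \<Longrightarrow> \<zeta> = 1/(1-\<tau>) \<Longrightarrow> c * exp (-2*pi * Im \<zeta>) \<le> norm (Wf \<tau>) \<and> norm (Wf \<tau>) \<le> C * exp (-2*pi * Im \<zeta>) \<and> norm (th3 \<tau>) \<le> C * sqrt (Im \<zeta>) * exp (-pi * Im \<zeta>/4)
       \<and> norm (psi \<tau>) \<le> C * sqrt (Im \<zeta>) * exp (-5*pi * Im \<zeta>/4)"
    by (rule OmC_bounds) blast
  show thesis
  proof (rule that[of "2*C"])
    show "2*C > 0" using cC by simp
    fix \<tau> assume t: "\<tau> \<in> OmC"
    show "norm (th3 \<tau>) \<le> 2*C"
    proof (cases "Im \<tau> \<ge> 1")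
      case True thus ?thesis using top[OF t] cC by auto
    next
      case False
      define v where "v = Im (1/(1-\<tau>))"
      have v: "v \<ge> 1/2" using OmC_low[OF t] False by (auto simp: v_def)
      have "sqrt v \<le> 2 * (1 + pi* v/4)"
      proof -
        have "sqrt v \<le> 1 + v" using v by (intro real_le_lsqrt) (auto simp: power2_eq_square algebra_simps)
        also have "\<dots> \<le> 2 * (1 + 3* v/4)" using v by simp
        also have "\<dots> \<le> 2 * (1 + pi* v/4)" using v pi_gt3 by simp
        finally show ?thesis .
      qed
      also have "\<dots> \<le> 2 * exp (pi* v/4)" by (intro mult_left_mono exp_ge_add_one_self) auto
      finally have "sqrt v * exp (-pi* v/4) \<le> 2" by (simp add: exp_minus field_simps)
      hence "C * (sqrt v * exp (-pi* v/4)) \<le> C * 2" using cC by (intro mult_left_mono) auto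
      moreover have "norm (th3 \<tau>) \<le> C * sqrt v * exp (-pi* v/4)" using low[OF t _ refl] False by (simp add: v_def)
      ultimately show ?thesis by (simp add: mult_ac)
    qed
  qed
qed

lemma Wf_bottom:
  assumes "\<epsilon> > 0"
  obtains s0 where "s0 > 0" "\<And>\<tau>. \<tau> \<in> OmC \<Longrightarrow> Im \<tau> < s0 \<Longrightarrow> norm (Wf \<tau>) \<le> \<epsilon>"
proof -
  obtain V where V: "V > 0" "\<And>\<zeta>. Im \<zeta> \<ge> V \<Longrightarrow> norm (Wf (1 - 1/\<zeta>)) \<le> \<epsilon>" by (rule Wf_cusp_small[OF assms]) blast
  show thesis
  proof (rule that[of "min 1 (1/(2*V))"])
    show "min 1 (1/(2*V)) > 0" using V by simp
    fix \<tau> assume t: "\<tau> \<in> OmC" "Im \<tau> < min 1 (1/(2*V))"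
    have im: "Im \<tau> > 0" using t by (simp add: OmC_def)
    have "V \<le> 1/(2 * Im \<tau>)" using t im V(1) by (simp add: field_simps)
    moreover note OmC_low[OF t(1)]
    ultimately have "V \<le> Im (1/(1-\<tau>))" "\<tau> = 1 - 1/(1/(1-\<tau>))" using t(2) by force+
    thus "norm (Wf \<tau>) \<le> \<epsilon>" using V(2) by metis
  qed
qed

text \<open>The residue theorem by explicit primitives. The integrand is E + c/(z - \<tau>0) on
  \<open>Om\<close>; a primitive P of E serves both curves, while the logarithms differ. The
  difference of the two primitives at equal height is followed from the cusp to infinity and
  increases by 2 pi i c.\<close>

lemma Phi_jump_general:
  assumes x: "x \<ge> 0" and w0: "Im w0 = 0" "w0 \<noteq> 0" and t0: "Re \<tau>0 = 1" "Im \<tau>0 > 0"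
    and E: "E holomorphic_on Om"
    and f: "\<And>z. z \<in> Om \<Longrightarrow> z \<noteq> \<tau>0 \<Longrightarrow> th3 z^3 * hx x z / (Wf z - w0) / (2*pi*\<i>) = E z + c / (z - \<tau>0)"
  shows "Phi x 1 w0 - Phi x (-1) w0 = 2*pi*\<i>*c"
proof -
  define y0 where "y0 = Im \<tau>0"
  have y0: "y0 > 0" using t0 by (simp add: y0_def)
  have sgood: "sgood 1 w0" "sgood (-1) w0" using w0 by (auto simp: sgood_def)
  obtain P where P: "\<And>z. z \<in> Om \<Longrightarrow> (P has_field_derivative E z) (at z)"
    using holomorphic_starlike_primitive[OF holomorphic_on_imp_continuous_on[OF E] Om_starlike Om_open finite.emptyI] E Om_open
    by (auto simp: holomorphic_on_imp_differentiable_at)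
  have zOm: "zc \<sigma> s \<in> Om" if "s > 0" "\<sigma> = 1 \<or> \<sigma> = -1" for \<sigma> s
    using zc_seg(1)[OF that(1), of "zc \<sigma> s"] that(2) by auto
  have zne: "zc \<sigma> s \<noteq> \<tau>0" if "s > 0" "\<sigma> = 1 \<or> \<sigma> = -1" for \<sigma> s
    using that kap_bounds[of s] t0 by (auto simp: complex_eq_iff)
  define g where "g = (\<lambda>\<sigma> s. th3 (zc \<sigma> s)^3 * hx x (zc \<sigma> s) * zc' \<sigma> s / (2*pi*\<i>) / (Wf (zc \<sigma> s) - w0))"
  \<comment> \<open>The factor \<sigma> puts the argument of the logarithm in the right half plane
    on either curve, so the principal branch serves both.\<close>
  define Q where "Q = (\<lambda>\<sigma> s. P (zc \<sigma> s) + c * Ln (of_real \<sigma> * (zc \<sigma> s - \<tau>0)))"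
  have Qd: "(Q \<sigma> has_vector_derivative g \<sigma> s) (at s)" if s: "s > 0" and sg: "\<sigma> = 1 \<or> \<sigma> = -1" for \<sigma> s
  proof -
    note k = kap_bounds[OF s]
    have "Re (of_real \<sigma> * (zc \<sigma> s - \<tau>0)) = kap s" using sg t0 by (elim disjE) simp_all
    hence "Re (of_real \<sigma> * (zc \<sigma> s - \<tau>0)) > 0" using k by simp
    hence np: "of_real \<sigma> * (zc \<sigma> s - \<tau>0) \<notin> \<real>\<^sub>\<le>\<^sub>0" by (metis complex_nonpos_Reals_iff not_le)
    have ne: "zc \<sigma> s - \<tau>0 \<noteq> 0" "\<sigma> \<noteq> 0" using zne[OF s sg] sg by auto
    have "((\<lambda>z. of_real \<sigma> * (z - \<tau>0)) has_field_derivative of_real \<sigma>) (at (zc \<sigma> s))"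
      by (auto intro!: derivative_eq_intros)
    from DERIV_add[OF P[OF zOm[OF s sg]] DERIV_cmult[OF DERIV_chain2[OF has_field_derivative_Ln[OF np] this], of c]]
    have "((\<lambda>z. P z + c * Ln (of_real \<sigma> * (z - \<tau>0))) has_field_derivative E (zc \<sigma> s) + c * (inverse (of_real \<sigma> * (zc \<sigma> s - \<tau>0)) * of_real \<sigma>)) (at (zc \<sigma> s))" .
    moreover have "c * (inverse (of_real \<sigma> * (zc \<sigma> s - \<tau>0)) * of_real \<sigma>) = c / (zc \<sigma> s - \<tau>0)" using ne by (simp add: field_simps)
    ultimately have "((\<lambda>z. P z + c * Ln (of_real \<sigma> * (z - \<tau>0))) has_field_derivative E (zc \<sigma> s) + c / (zc \<sigma> s - \<tau>0)) (at (zc \<sigma> s))"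
      by (simp only:)
    from field_vector_diff_chain_at[OF zc_deriv this]
    have "(Q \<sigma> has_vector_derivative zc' \<sigma> s * (E (zc \<sigma> s) + c / (zc \<sigma> s - \<tau>0))) (at s)"
      by (simp add: Q_def o_def)
    also have "zc' \<sigma> s * (E (zc \<sigma> s) + c / (zc \<sigma> s - \<tau>0)) = g \<sigma> s"
      using f[OF zOm[OF s sg] zne[OF s sg]] by (simp add: g_def mult_ac flip: f[OF zOm[OF s sg] zne[OF s sg]])
    finally show ?thesis .
  qed
  have Wne: "Wf (zc \<sigma> s) - w0 \<noteq> 0" if "s > 0" "\<sigma> = 1 \<or> \<sigma> = -1" for \<sigma> s
  proof
    assume "Wf (zc \<sigma> s) - w0 = 0"
    hence "Im (Wf (zc \<sigma> s)) = 0" using w0 by (metis eq_iff_diff_eq_0)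
    thus False using Wf_Om[OF zOm[OF that]] that(2) kap_bounds[OF that(1)] by auto
  qed
  have gc: "continuous_on {0<..} (g \<sigma>)" if "\<sigma> = 1 \<or> \<sigma> = -1" for \<sigma>
    unfolding g_def by (intro continuous_on_divide Hc_cont continuous_on_diff uhp_zc_cont Wf_cont continuous_on_const) (use Wne that in auto)
  have gH: "indicator {0<..} s *\<^sub>R g \<sigma> s = Hc x \<sigma> s / (Vc \<sigma> s - w0)" for \<sigma> s
    by (auto simp: g_def Hc_def Vc_def indicator_def)
  obtain d where d: "0 < d" "d \<le> 1"
    "\<And>\<sigma> w s. sgood \<sigma> w \<Longrightarrow> s > 0 \<Longrightarrow> norm (Wf (zc \<sigma> s) - w) \<ge> d * norm (Wf (zc \<sigma> s)) \<and> norm (Wf (zc \<sigma> s) - w) \<ge> d * norm w"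
    by (rule zc_dist) blast
  have gi: "integrable lborel (\<lambda>s. Hc x \<sigma> s / (Vc \<sigma> s - w0))" if sg: "\<sigma> = 1 \<or> \<sigma> = -1" for \<sigma>
  proof (rule Bochner_Integration.integrable_bound[of _ "\<lambda>s. norm (Hc x \<sigma> s) / (d * norm w0)"])
    show "integrable lborel (\<lambda>s. norm (Hc x \<sigma> s) / (d * norm w0))"
      by (intro integrable_divide integrable_norm Hc_integrable x sg)
    have "norm (Hc x \<sigma> s / (Vc \<sigma> s - w0)) \<le> norm (Hc x \<sigma> s) / (d * norm w0)" for s
    proof (cases "s > 0")
      case True
      have "sgood \<sigma> w0" using sg sgood by auto
      from d(3)[OF this True] have "d * norm w0 \<le> norm (Vc \<sigma> s - w0)" using True by (simp add: Vc_def)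
      thus ?thesis using d(1) w0 unfolding norm_divide by (intro frac_le) auto
    qed (simp add: Hc_def)
    thus "AE s in lborel. norm (Hc x \<sigma> s / (Vc \<sigma> s - w0)) \<le> norm (norm (Hc x \<sigma> s) / (d * norm w0))" using d(1) by simp
  qed simp
  define DQ where "DQ = (\<lambda>s. Q 1 s - Q (-1) s)"
  obtain C where C: "C > 0" "\<And>\<tau>. \<tau> \<in> OmC \<Longrightarrow> norm (th3 \<tau>) \<le> C" by (rule OmC_th3_bounded) blast
  have hx2: "norm (hx x z) \<le> 2" if "Im z > 0" for z
  proof -
    have "norm (hx x z) \<le> 2 * exp (- (pi * x * Im z))" by (rule norm_hx_le(1)[OF x])
    also have "\<dots> \<le> 2" using x that by simp
    finally show ?thesis .
  qed
  have num: "norm (th3 z^3 * hx x z) \<le> C^3 * 2" if "z \<in> Om" for z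
  proof -
    have "norm (th3 z)^3 \<le> C^3" using C(2)[of z] that Om_OmC by (intro power_mono) auto
    thus ?thesis unfolding norm_mult norm_power using hx2[of z] that C(1) by (intro mult_mono) (auto simp: Om_def)
  qed
  have PL: "norm (P (zc 1 s) - P (zc (-1) s)) \<le> M * (2 * kap s)"
    if s: "s > 0" and M: "\<And>z. z \<in> closed_segment (zc (-1) s) (zc 1 s) \<Longrightarrow> norm (E z) \<le> M" for s M
  proof -
    have "norm (P (zc 1 s) - P (zc (-1) s)) \<le> M * norm (zc 1 s - zc (-1) s)"
    proof (rule field_differentiable_bound)
      show "convex (closed_segment (zc (-1) s) (zc 1 s))" by simp
      show "(P has_field_derivative E z) (at z within closed_segment (zc (-1) s) (zc 1 s))" if "z \<in> closed_segment (zc (-1) s) (zc 1 s)" for z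
        using P[OF zc_seg(1)[OF s that]] by (rule has_field_derivative_at_within)
    qed (use M in auto)
    also have "zc 1 s - zc (-1) s = of_real (2 * kap s)" by (simp add: complex_eq_iff)
    finally show ?thesis using kap_bounds[OF s] by (simp add: norm_of_real del: of_real_mult)
  qed
  have Eb: "norm (E z) \<le> C^3 * 2 / norm (Wf z - w0) + norm c / \<bar>Im z - y0\<bar>" if z: "z \<in> Om" "Im z \<noteq> y0" for z
  proof -
    have zne: "z \<noteq> \<tau>0" using z by (auto simp: y0_def)
    have "E z = th3 z^3 * hx x z / (Wf z - w0) / (2*pi*\<i>) - c / (z - \<tau>0)" using f[OF z(1) zne] by simp
    hence "norm (E z) \<le> norm (th3 z^3 * hx x z / (Wf z - w0) / (2*pi*\<i>)) + norm (c / (z - \<tau>0))"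
      by (simp only: norm_triangle_ineq4)
    also have "norm (th3 z^3 * hx x z / (Wf z - w0) / (2*pi*\<i>)) = norm (th3 z^3 * hx x z) / norm (Wf z - w0) / (2*pi)"
      by (simp add: norm_divide norm_mult)
    also have "\<dots> \<le> norm (th3 z^3 * hx x z) / norm (Wf z - w0) / 1"
      using pi_gt3 by (intro divide_left_mono) auto
    also have "\<dots> \<le> C^3 * 2 / norm (Wf z - w0)" using num[OF z(1)] by (simp add: divide_right_mono)
    also have "norm (c / (z - \<tau>0)) \<le> norm c / \<bar>Im z - y0\<bar>"
      using abs_Im_le_cmod[of "z - \<tau>0"] z(2) unfolding norm_divide by (intro frac_le) (auto simp: y0_def)
    finally show ?thesis by simp
  qed
  \<comment> \<open>The two arguments are conjugate, so the logarithms differ by 2i times an angle,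
    which runs from -pi/2 at the cusp to pi/2 at infinity.\<close>
  have LnD: "c * Ln (of_real 1 * (zc 1 s - \<tau>0)) - c * Ln (of_real (-1) * (zc (-1) s - \<tau>0)) = 2 * \<i> * c * of_real (arctan ((s - y0) / kap s))"
    if s: "s > 0" for s
  proof -
    define u where "u = zc 1 s - \<tau>0"
    have ru: "Re u > 0" "Re u = kap s" "Im u = s - y0" using kap_bounds[OF s] t0 by (auto simp: u_def y0_def)
    have u2: "of_real (-1) * (zc (-1) s - \<tau>0) = cnj u" using t0 by (simp add: u_def complex_eq_iff)
    have "u \<notin> \<real>\<^sub>\<le>\<^sub>0" using ru by (auto simp: complex_nonpos_Reals_iff)
    hence "Ln (cnj u) = cnj (Ln u)" by (rule cnj_Ln[symmetric])
    hence "Ln u - Ln (cnj u) = 2 * \<i> * of_real (Im (Ln u))" by (simp add: complex_eq_iff)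
    also have "Im (Ln u) = arctan (Im u / Re u)" using ru(1) by (metis Arg_eq_Im_Ln arg_conv_arctan order_less_irrefl zero_complex.simps(1))
    finally have "Ln u - Ln (cnj u) = 2 * \<i> * of_real (arctan ((s - y0) / kap s))" by (simp add: ru)
    hence "c * Ln u - c * Ln (cnj u) = c * (2 * \<i> * of_real (arctan ((s - y0) / kap s)))" by (simp only: right_diff_distrib[symmetric])
    thus ?thesis unfolding u2 by (simp add: u_def mult_ac)
  qed
  have DQ_eq: "DQ s = (P (zc 1 s) - P (zc (-1) s)) + 2 * \<i> * c * of_real (arctan ((s - y0) / kap s))" if "s > 0" for s
    using LnD[OF that] by (simp add: DQ_def Q_def algebra_simps)
  \<comment> \<open>Near the cusp E stays bounded while the horizontal chord between the curves, of
    length 2 \<open>kap\<close> s, shrinks to 0.\<close>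
  have lim_bot: "(DQ \<longlongrightarrow> 0 + 2 * \<i> * c * of_real (- (pi/2))) (at_right 0)"
  proof -
    have w2: "norm w0 / 2 > 0" using w0 by simp
    obtain s0 where s0: "s0 > 0" "\<And>\<tau>. \<tau> \<in> OmC \<Longrightarrow> Im \<tau> < s0 \<Longrightarrow> norm (Wf \<tau>) \<le> norm w0 / 2" by (rule Wf_bottom[OF w2]) blast
    define M where "M = C^3 * 2 / (norm w0 / 2) + norm c / (y0/2)"
    have Pb: "norm (P (zc 1 s) - P (zc (-1) s)) \<le> M * (2 * kap s)" if s: "0 < s" "s < min s0 (y0/2)" for s
    proof (rule PL[OF s(1)])
      fix z assume "z \<in> closed_segment (zc (-1) s) (zc 1 s)"
      note z = zc_seg[OF s(1) this]
      have "norm (Wf z) \<le> norm w0 / 2" using s0(2)[of z] z s Om_OmC by auto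
      hence 1: "norm (Wf z - w0) \<ge> norm w0 / 2" using norm_triangle_ineq2[of w0 "Wf z"] by (simp add: norm_minus_commute)
      have 2: "\<bar>Im z - y0\<bar> \<ge> y0/2" using z s by auto
      have "norm (E z) \<le> C^3 * 2 / norm (Wf z - w0) + norm c / \<bar>Im z - y0\<bar>" by (rule Eb) (use z s y0 in auto)
      also have "\<dots> \<le> M" unfolding M_def using 1 2 w2 y0 C(1) by (intro add_mono frac_le) auto
      finally show "norm (E z) \<le> M" .
    qed
    have "((\<lambda>s. P (zc 1 s) - P (zc (-1) s)) \<longlongrightarrow> 0) (at_right 0)"
    proof (rule Lim_null_comparison)
      show "\<forall>\<^sub>F s in at_right 0. norm (P (zc 1 s) - P (zc (-1) s)) \<le> M * (2 * kap s)"
        unfolding eventually_at_right_field using Pb s0(1) y0 by (intro exI[of _ "min s0 (y0/2)"]) auto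
      show "((\<lambda>s. M * (2 * kap s)) \<longlongrightarrow> 0) (at_right 0)" unfolding kap_def by real_asymp
    qed
    moreover have "((\<lambda>s. arctan ((s - y0) / kap s)) \<longlongrightarrow> - (pi/2)) (at_right 0)"
    proof -
      have "filterlim (\<lambda>s. (s - y0) / kap s) at_bot (at_right 0)" unfolding kap_def using y0 by real_asymp
      thus ?thesis by (rule filterlim_compose[OF tendsto_arctan_at_bot])
    qed
    ultimately have L: "((\<lambda>s. (P (zc 1 s) - P (zc (-1) s)) + 2 * \<i> * c * of_real (arctan ((s - y0) / kap s))) \<longlongrightarrow> 0 + 2 * \<i> * c * of_real (- (pi/2))) (at_right 0)"
      by (intro tendsto_intros)
    show ?thesis
      by (rule Lim_transform_eventually[OF L]) (use DQ_eq in \<open>auto simp: eventually_at_right_field intro!: exI[of _ 1]\<close>)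
  qed
  \<comment> \<open>Towards infinity the chord length stays below 1, but E tends to 0 because
    |\<open>Wf\<close>| grows exponentially.\<close>
  have lim_top: "(DQ \<longlongrightarrow> 0 + 2 * \<i> * c * of_real (pi/2)) at_top"
  proof -
    obtain c' C' where cC: "c' > 0" "C' > 0"
      and top: "\<And>\<tau>. \<tau> \<in> OmC \<Longrightarrow> Im \<tau> \<ge> 1 \<Longrightarrow> c' * exp (pi * Im \<tau>) \<le> norm (Wf \<tau>) \<and> norm (Wf \<tau>) \<le> C' * exp (pi * Im \<tau>) \<and> norm (th3 \<tau>) \<le> C' \<and> norm (psi \<tau>) \<le> C' * exp (pi * Im \<tau>)"
      by (rule OmC_bounds) blast
    have "filterlim (\<lambda>s. c' * exp (pi * s) - norm w0) at_top at_top" using cC by real_asymp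
    hence ev: "\<forall>\<^sub>F s in at_top. c' * exp (pi * s) - norm w0 > 0" unfolding filterlim_at_top_dense by (rule spec)
    have "((\<lambda>s. P (zc 1 s) - P (zc (-1) s)) \<longlongrightarrow> 0) at_top"
    proof (rule Lim_null_comparison)
      show "\<forall>\<^sub>F s in at_top. norm (P (zc 1 s) - P (zc (-1) s)) \<le> (C^3 * 2 / (c' * exp (pi * s) - norm w0) + norm c / (s - y0)) * (2 * kap s)"
        using ev eventually_gt_at_top[of "y0 + 1"]
      proof eventually_elim
        case (elim s)
        have s: "s > 0" "s > 1" "s > y0" using elim y0 by auto
        show ?case
        proof (rule PL[OF s(1)])
          fix z assume "z \<in> closed_segment (zc (-1) s) (zc 1 s)"
          note z = zc_seg[OF s(1) this]
          have "c' * exp (pi * s) \<le> norm (Wf z)" using top[of z] z s Om_OmC by auto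
          hence 1: "norm (Wf z - w0) \<ge> c' * exp (pi * s) - norm w0" using norm_triangle_ineq2[of "Wf z" w0] by linarith
          have "norm (E z) \<le> C^3 * 2 / norm (Wf z - w0) + norm c / \<bar>Im z - y0\<bar>" by (rule Eb) (use z s in auto)
          also have "\<dots> \<le> C^3 * 2 / (c' * exp (pi * s) - norm w0) + norm c / (s - y0)"
            using 1 elim C(1) z s by (intro add_mono frac_le) auto
          finally show "norm (E z) \<le> C^3 * 2 / (c' * exp (pi * s) - norm w0) + norm c / (s - y0)" .
        qed
      qed
      show "((\<lambda>s. (C^3 * 2 / (c' * exp (pi * s) - norm w0) + norm c / (s - y0)) * (2 * kap s)) \<longlongrightarrow> 0) at_top"
        unfolding kap_def using cC by real_asymp
    qed
    moreover have "((\<lambda>s. arctan ((s - y0) / kap s)) \<longlongrightarrow> pi/2) at_top"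
    proof -
      have "filterlim (\<lambda>s. (s - y0) / kap s) at_top at_top" unfolding kap_def by real_asymp
      thus ?thesis by (rule filterlim_compose[OF tendsto_arctan_at_top])
    qed
    ultimately have L: "((\<lambda>s. (P (zc 1 s) - P (zc (-1) s)) + 2 * \<i> * c * of_real (arctan ((s - y0) / kap s))) \<longlongrightarrow> 0 + 2 * \<i> * c * of_real (pi/2)) at_top"
      by (intro tendsto_intros)
    show ?thesis
    proof (rule Lim_transform_eventually[OF L])
      show "\<forall>\<^sub>F s in at_top. (P (zc 1 s) - P (zc (-1) s)) + 2 * \<i> * c * of_real (arctan ((s - y0) / kap s)) = DQ s"
        using eventually_gt_at_top[of 0] by eventually_elim (rule DQ_eq[symmetric])
    qed
  qed
  have e: "einterval (ereal 0) \<infinity> = {0<..}" by (auto simp: einterval_def)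
  have int: "set_integrable lborel {0<..} (\<lambda>s. g 1 s - g (-1) s)"
    unfolding set_integrable_def scaleR_diff_right gH by (intro Bochner_Integration.integrable_diff gi) auto
  have FTC: "(LBINT s=ereal 0..\<infinity>. g 1 s - g (-1) s) = (0 + 2 * \<i> * c * of_real (pi/2)) - (0 + 2 * \<i> * c * of_real (- (pi/2)))"
  proof (rule interval_integral_FTC_integrable)
    show "(DQ has_vector_derivative g 1 s - g (-1) s) (at s)" if "ereal 0 < ereal s" "ereal s < \<infinity>" for s
      unfolding DQ_def by (intro has_vector_derivative_diff Qd) (use that in auto)
    show "isCont (\<lambda>s. g 1 s - g (-1) s) s" if "ereal 0 < ereal s" "ereal s < \<infinity>" for s
    proof -
      have "continuous_on {0<..} (\<lambda>s. g 1 s - g (-1) s)" by (intro continuous_intros gc) auto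
      thus ?thesis using that by (auto simp: continuous_on_eq_continuous_at)
    qed
  qed (use int e lim_bot lim_top in \<open>auto simp: ereal_tendsto_simps\<close>)
  have "Phi x 1 w0 - Phi x (-1) w0 = (LINT s|lborel. Hc x 1 s / (Vc 1 s - w0) - Hc x (-1) s / (Vc (-1) s - w0))"
    unfolding Phi_def by (rule Bochner_Integration.integral_diff[symmetric]) (rule gi; simp)+
  also have "\<dots> = (LBINT s=ereal 0..\<infinity>. g 1 s - g (-1) s)"
    unfolding interval_lebesgue_integral_def e set_lebesgue_integral_def by (simp add: gH[symmetric] scaleR_diff_right)
  finally show ?thesis unfolding FTC by (simp add: algebra_simps)
qed

section \<open>The modular solution of the functional equation\<close>

text \<open>On \<open>Om\<close> the function \<open>Wf\<close> is real only on Re = 1, where it is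
  negative. For positive w the integrand has no pole, so c = 0.\<close>

lemma Phi_agree_pos:
  assumes x: "x \<ge> 0" and w: "Im w = 0" "Re w > 0"
  shows "Phi x 1 w = Phi x (-1) w"
proof -
  have ne: "Wf z - w \<noteq> 0" if "z \<in> Om" for z
  proof
    assume "Wf z - w = 0"
    hence "Wf z = w" by simp
    thus False using Wf_Om[OF that] w by (cases "Re z" "1::real" rule: linorder_cases) auto
  qed
  have "Phi x 1 w - Phi x (-1) w = 2*pi*\<i>*0"
  proof (rule Phi_jump_general[OF x w(1), of "1+\<i>" "\<lambda>z. th3 z^3 * hx x z / (Wf z - w) / (2*pi*\<i>)"])
    show "(\<lambda>z. th3 z^3 * hx x z / (Wf z - w) / (2*pi*\<i>)) holomorphic_on Om"
      by (intro holomorphic_intros Om_uhp) (use ne in auto)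
  qed (use w in auto)
  thus ?thesis by simp
qed

text \<open>By injectivity on the line \<tau> is the only pole in \<open>Om\<close>, and it is
  simple because the derivative is nonzero. The factor \<open>psi\<close> cancels everything in the
  residue except \<open>hx\<close>.\<close>

lemma Phi_jump_line:
  assumes x: "x \<ge> 0" and t: "Re \<tau> = 1" "Im \<tau> > 0" and d: "deriv Wf \<tau> \<noteq> 0"
  shows "psi \<tau> * (Phi x 1 (Wf \<tau>) - Phi x (-1) (Wf \<tau>)) = hx x \<tau>"
proof -
  have tO: "\<tau> \<in> Om" using t by (simp add: Om_iff)
  have w: "Im (Wf \<tau>) = 0" "Re (Wf \<tau>) < 0" using Wf_Om[OF tO] t by auto
  have ne: "Wf z - Wf \<tau> \<noteq> 0" if "z \<in> Om" "z \<noteq> \<tau>" for z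
  proof
    assume "Wf z - Wf \<tau> = 0"
    hence e: "Wf z = Wf \<tau>" by simp
    show False
    proof (cases "Re z" "1::real" rule: linorder_cases)
      case equal
      hence "z = \<tau>" using Wf_line_inj[of z \<tau>] t that e by (auto simp: Om_def)
      thus False using that by simp
    qed (use Wf_Om[OF that(1)] e w in auto)
  qed
  define k where "k = (\<lambda>z. if z = \<tau> then deriv Wf \<tau> else (Wf z - Wf \<tau>) / (z - \<tau>))"
  have kh: "k holomorphic_on Om" unfolding k_def by (intro pole_lemma_open Wf_holo Om_uhp Om_open)
  have kn: "k z \<noteq> 0" if "z \<in> Om" for z using ne[OF that] d by (auto simp: k_def)
  define g where "g = (\<lambda>z. th3 z^3 * hx x z / k z / (2*pi*\<i>))"
  have gh: "g holomorphic_on Om" unfolding g_def by (intro holomorphic_intros Om_uhp kh) (use kn in auto)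
  have "Phi x 1 (Wf \<tau>) - Phi x (-1) (Wf \<tau>) = 2*pi*\<i>*g \<tau>"
  proof (rule Phi_jump_general[OF x w(1) _ t, where E="\<lambda>z. if z = \<tau> then deriv g \<tau> else (g z - g \<tau>) / (z - \<tau>)"])
    show "(\<lambda>z. if z = \<tau> then deriv g \<tau> else (g z - g \<tau>) / (z - \<tau>)) holomorphic_on Om"
      by (intro pole_lemma_open gh Om_open)
    fix z assume z: "z \<in> Om" "z \<noteq> \<tau>"
    have "th3 z^3 * hx x z / (Wf z - Wf \<tau>) / (2*pi*\<i>) = g z / (z - \<tau>)" using z by (simp add: g_def k_def)
    also have "\<dots> = (g z - g \<tau>) / (z - \<tau>) + g \<tau> / (z - \<tau>)" by (simp add: diff_divide_distrib)
    finally show "th3 z^3 * hx x z / (Wf z - Wf \<tau>) / (2*pi*\<i>) = (if z = \<tau> then deriv g \<tau> else (g z - g \<tau>) / (z - \<tau>)) + g \<tau> / (z - \<tau>)" using z by simp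
  qed (use w in auto)
  thus ?thesis using d th3_nz[OF t(2)] by (simp add: g_def k_def psi_def)
qed

text \<open>The two transforms agree on the positive axis; on the negative axis, the image of the line Re = 1, their jump is the residue that restores 2-periodicity.\<close>

definition Phi0 :: "real \<Rightarrow> complex \<Rightarrow> complex" where
  "Phi0 x w = (if Im w \<ge> 0 then Phi x (-1) w else Phi x 1 w)"

text \<open>The two halves are pasted across the positive axis, where \<open>Phi_agree_pos\<close>
  makes them agree; only the cut along the nonpositive axis remains.\<close>

lemma Phi0_differentiable:
  assumes x: "x \<ge> 0" and w: "w \<notin> \<real>\<^sub>\<le>\<^sub>0"
  shows "Phi0 x field_differentiable at w"
proof -
  have oS: "open (-\<real>\<^sub>\<le>\<^sub>0 :: complex set)" by (simp add: open_Compl)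
  have "Phi0 x holomorphic_on - \<real>\<^sub>\<le>\<^sub>0"
  proof (rule holomorphic_on_paste_across_line[OF oS, of "\<i>" _ 0])
    have up: "Phi x (-1) field_differentiable at w" if "Im w \<ge> 0" "w \<noteq> 0" for w
      using that by (intro Phi_differentiable x) (auto simp: sgood_def)
    have dn: "Phi x 1 field_differentiable at w" if "Im w \<le> 0" "w \<noteq> 0" for w
      using that by (intro Phi_differentiable x) (auto simp: sgood_def)
    have "Phi x 1 holomorphic_on (- \<real>\<^sub>\<le>\<^sub>0 \<inter> {z. \<i> \<bullet> z < 0})"
      unfolding holomorphic_on_def by (rule ballI, rule field_differentiable_at_within, rule dn) (auto simp: inner_complex_def)
    thus "Phi0 x holomorphic_on (- \<real>\<^sub>\<le>\<^sub>0 \<inter> {z. \<i> \<bullet> z < 0})"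
      by (rule holomorphic_transform) (auto simp: Phi0_def inner_complex_def)
    have "Phi x (-1) holomorphic_on (- \<real>\<^sub>\<le>\<^sub>0 \<inter> {z. 0 < \<i> \<bullet> z})"
      unfolding holomorphic_on_def by (rule ballI, rule field_differentiable_at_within, rule up) (auto simp: inner_complex_def)
    thus "Phi0 x holomorphic_on (- \<real>\<^sub>\<le>\<^sub>0 \<inter> {z. 0 < \<i> \<bullet> z})"
      by (rule holomorphic_transform) (auto simp: Phi0_def inner_complex_def)
    have c1: "continuous_on (- \<real>\<^sub>\<le>\<^sub>0 \<inter> {z. Im z \<ge> 0}) (Phi x (-1))"
      by (intro continuous_at_imp_continuous_on ballI field_differentiable_imp_continuous_at up) auto
    have c2: "continuous_on (- \<real>\<^sub>\<le>\<^sub>0 \<inter> {z. Im z \<le> 0}) (Phi x 1)"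
      by (intro continuous_at_imp_continuous_on ballI field_differentiable_imp_continuous_at dn) auto
    have cov: "- \<real>\<^sub>\<le>\<^sub>0 = (- \<real>\<^sub>\<le>\<^sub>0 \<inter> {z. Im z \<ge> 0}) \<union> (- \<real>\<^sub>\<le>\<^sub>0 \<inter> {z::complex. Im z \<le> 0})" by auto
    have "continuous_on ((- \<real>\<^sub>\<le>\<^sub>0 \<inter> {z. Im z \<ge> 0}) \<union> (- \<real>\<^sub>\<le>\<^sub>0 \<inter> {z. Im z \<le> 0})) (\<lambda>w. if Im w \<ge> 0 then Phi x (-1) w else Phi x 1 w)"
    proof (rule continuous_on_cases_local)
      show "closedin (top_of_set (- \<real>\<^sub>\<le>\<^sub>0 \<inter> {z. 0 \<le> Im z} \<union> - \<real>\<^sub>\<le>\<^sub>0 \<inter> {z. Im z \<le> 0})) (- \<real>\<^sub>\<le>\<^sub>0 \<inter> {z. 0 \<le> Im z})"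
        unfolding cov[symmetric] by (intro closedin_closed_Int closed_halfspace_Im_ge)
      show "closedin (top_of_set (- \<real>\<^sub>\<le>\<^sub>0 \<inter> {z. 0 \<le> Im z} \<union> - \<real>\<^sub>\<le>\<^sub>0 \<inter> {z. Im z \<le> 0})) (- \<real>\<^sub>\<le>\<^sub>0 \<inter> {z. Im z \<le> 0})"
        unfolding cov[symmetric] by (intro closedin_closed_Int closed_halfspace_Im_le)
      fix w assume "w \<in> - \<real>\<^sub>\<le>\<^sub>0 \<inter> {z. 0 \<le> Im z} \<and> \<not> 0 \<le> Im w \<or> w \<in> - \<real>\<^sub>\<le>\<^sub>0 \<inter> {z. Im z \<le> 0} \<and> 0 \<le> Im w"
      hence "Im w = 0" "Re w > 0" by (auto simp: complex_nonpos_Reals_iff)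
      thus "Phi x (-1) w = Phi x 1 w" using Phi_agree_pos[OF x] by simp
    qed (fact c1 c2)+
    thus "continuous_on (- \<real>\<^sub>\<le>\<^sub>0) (Phi0 x)" unfolding cov[symmetric] Phi0_def[abs_def] .
  qed simp
  thus ?thesis using w oS holomorphic_on_imp_differentiable_at by blast
qed

lemma deriv_Wf_nontrivial: "\<exists>\<beta>\<in>uhp. deriv Wf \<beta> \<noteq> 0"
proof (rule ccontr)
  assume no: "\<not> ?thesis"
  have "(Wf has_field_derivative 0) (at z within uhp)" if "z \<in> uhp" for z
  proof (rule has_field_derivative_at_within)
    have "deriv Wf z = 0" using that no by blast
    thus "(Wf has_field_derivative 0) (at z)" using Wf_has_deriv[of z] that by simp
  qed
  hence "\<exists>c. \<forall>z\<in>uhp. Wf z = c" by (rule has_field_derivative_zero_constant[OF uhp_props(2)])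
  then obtain c where c: "\<And>z. z \<in> uhp \<Longrightarrow> Wf z = c" by (elim exE bexE) (rule that, simp)
  have "Wf \<i> = Wf (1 + \<i>)" using c[of \<i>] c[of "1 + \<i>"] by simp
  moreover have "Re (Wf \<i>) > 0" "Re (Wf (1 + \<i>)) < 0" by (intro Wf_axis_pos Wf_line_neg; simp)+
  ultimately show False by simp
qed

lemma deriv_Wf_nonzero_near:
  assumes "Im \<tau> > 0"
  obtains r where "r > 0" "\<And>z. z \<in> ball \<tau> r - {\<tau>} \<Longrightarrow> deriv Wf z \<noteq> 0"
proof -
  have hol: "deriv Wf holomorphic_on uhp" by (intro holomorphic_deriv Wf_holo uhp_props order_refl)
  show thesis
  proof (cases "deriv Wf \<tau> = 0")
    case True
    obtain \<beta> where \<beta>: "\<beta> \<in> uhp" "deriv Wf \<beta> \<noteq> 0" using deriv_Wf_nontrivial by blast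
    show thesis
      by (rule isolated_zeros[OF hol uhp_props(1,3) _ True \<beta>]) (use assms that in auto)
  next
    case False
    have "continuous_on uhp (deriv Wf)" by (rule holomorphic_on_imp_continuous_on[OF hol])
    hence "continuous (at \<tau>) (deriv Wf)" by (rule continuous_on_interior) (use assms uhp_props in \<open>simp add: interior_open\<close>)
    from continuous_at_avoid[OF this False] that show thesis by (auto simp: dist_commute)
  qed
qed

text \<open>\<open>Phi_jump_line\<close> excludes zeros of the derivative of \<open>Wf\<close>.
  These are isolated and both transforms are holomorphic near \<open>Wf\<close> \<tau>, so the
  identity theorem spreads the jump relation from nearby points of the line to a disc around any
  \<tau> on it.\<close>

lemma jump_ball:
  assumes x: "x \<ge> 0" and t: "Re \<tau> = 1" "Im \<tau> > 0"
  obtains r where "r > 0" "\<And>z. z \<in> ball \<tau> r \<Longrightarrow> Im z > 0"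
    "\<And>z. z \<in> ball \<tau> r \<Longrightarrow> (\<lambda>z. psi z * Phi x (-1) (Wf z)) field_differentiable at z"
    "\<And>z. z \<in> ball \<tau> r \<Longrightarrow> psi z * Phi x 1 (Wf z) = psi z * Phi x (-1) (Wf z) + hx x z"
proof -
  have tO: "\<tau> \<in> Om" using t by (simp add: Om_iff)
  have w: "Im (Wf \<tau>) = 0" "Wf \<tau> \<noteq> 0" using Wf_Om[OF tO] t Wf_nz by auto
  obtain r1 where r1: "r1 > 0" "\<And>w. norm (w - Wf \<tau>) < r1 \<Longrightarrow> Phi x 1 field_differentiable at w"
    by (rule Phi_differentiable_near[OF x _ w(2), of 1]) (use w in \<open>auto simp: sgood_def\<close>)
  obtain r2 where r2: "r2 > 0" "\<And>w. norm (w - Wf \<tau>) < r2 \<Longrightarrow> Phi x (-1) field_differentiable at w"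
    by (rule Phi_differentiable_near[OF x _ w(2), of "-1"]) (use w in \<open>auto simp: sgood_def\<close>)
  have iC: "isCont Wf \<tau>" using Wf_has_deriv[OF t(2)] DERIV_isCont by blast
  obtain r3 where r3: "r3 > 0" "\<And>z. dist z \<tau> < r3 \<Longrightarrow> dist (Wf z) (Wf \<tau>) < min r1 r2"
  proof -
    define e where "e = min r1 r2"
    have e: "e > 0" using r1(1) r2(1) by (simp add: e_def)
    have "\<forall>e>0. \<exists>d>0. \<forall>z. dist z \<tau> < d \<longrightarrow> dist (Wf z) (Wf \<tau>) < e" using iC by (simp only: continuous_at_eps_delta)
    with e have "\<exists>d>0. \<forall>z. dist z \<tau> < d \<longrightarrow> dist (Wf z) (Wf \<tau>) < e" by simp
    then obtain d where "d > 0" "\<forall>z. dist z \<tau> < d \<longrightarrow> dist (Wf z) (Wf \<tau>) < e" by (elim exE conjE)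
    thus thesis using that[of d] unfolding e_def by simp
  qed
  obtain r4 where r4: "r4 > 0" "ball \<tau> r4 \<subseteq> uhp" 
  proof (rule openE[OF uhp_props(1), of \<tau>])
    show "\<tau> \<in> uhp" using t(2) by simp
  qed blast
  obtain r5 where r5: "r5 > 0" "\<And>z. z \<in> ball \<tau> r5 - {\<tau>} \<Longrightarrow> deriv Wf z \<noteq> 0" by (rule deriv_Wf_nonzero_near[OF t(2)]) blast
  define r where "r = min r3 (min r4 r5)"
  have r: "r > 0" "r \<le> r3" "r \<le> r4" "r \<le> r5" using r3 r4 r5 by (auto simp: r_def)
  have im: "Im z > 0" if "z \<in> ball \<tau> r" for z using that r r4(2) by (auto simp: subset_iff)
  have near: "norm (Wf z - Wf \<tau>) < r1" "norm (Wf z - Wf \<tau>) < r2" if "z \<in> ball \<tau> r" for z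
    using r3(2)[of z] that r by (auto simp: dist_norm norm_minus_commute)
  have psid: "psi field_differentiable at z" if "z \<in> ball \<tau> r" for z
    using psi_holo[OF order_refl] im[OF that] uhp_props(1) holomorphic_on_imp_differentiable_at by blast
  have Wd: "Wf field_differentiable at z" if "z \<in> ball \<tau> r" for z
    using Wf_has_deriv[OF im[OF that]] field_differentiable_def by blast
  have d1: "(\<lambda>z. psi z * Phi x 1 (Wf z)) field_differentiable at z" if "z \<in> ball \<tau> r" for z
    by (intro field_differentiable_mult psid that field_differentiable_compose[OF Wd[OF that] r1(2)[OF near(1)[OF that]], unfolded o_def])
  have d2: "(\<lambda>z. psi z * Phi x (-1) (Wf z)) field_differentiable at z" if "z \<in> ball \<tau> r" for z
    by (intro field_differentiable_mult psid that field_differentiable_compose[OF Wd[OF that] r2(2)[OF near(2)[OF that]], unfolded o_def])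
  define f where "f = (\<lambda>z. psi z * Phi x 1 (Wf z) - psi z * Phi x (-1) (Wf z) - hx x z)"
  define U where "U = {z \<in> ball \<tau> r. Re z = 1 \<and> z \<noteq> \<tau>}"
  have f0: "f z = 0" if z: "z \<in> ball \<tau> r" for z
  proof (rule analytic_continuation[of f "ball \<tau> r" U \<tau>])
    have "(\<lambda>z. psi z * Phi x 1 (Wf z)) holomorphic_on ball \<tau> r" "(\<lambda>z. psi z * Phi x (-1) (Wf z)) holomorphic_on ball \<tau> r"
      using d1 d2 by (auto simp: holomorphic_on_def field_differentiable_at_within)
    thus "f holomorphic_on ball \<tau> r" unfolding f_def by (intro holomorphic_on_diff) (assumption | intro holomorphic_intros)+
    show "\<tau> islimpt U" unfolding islimpt_approachable
    proof (intro allI impI)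
      fix e :: real assume e: "e > 0"
      define q where "q = min e r / 2"
      have q: "q > 0" "q < e" "q < r" using e r by (auto simp: q_def)
      have "norm (\<i> * complex_of_real q) = q" using q by (simp add: norm_mult)
      hence "\<tau> + \<i> * of_real q \<in> U" "\<tau> + \<i> * of_real q \<noteq> \<tau>" "dist (\<tau> + \<i> * of_real q) \<tau> < e"
        using q t by (auto simp: U_def dist_norm)
      thus "\<exists>x'\<in>U. x' \<noteq> \<tau> \<and> dist x' \<tau> < e" by blast
    qed
    fix u assume u: "u \<in> U"
    have "psi u * (Phi x 1 (Wf u) - Phi x (-1) (Wf u)) = hx x u"
      by (rule Phi_jump_line[OF x _ im r5(2)]) (use u r in \<open>auto simp: U_def\<close>)
    thus "f u = 0" by (simp add: f_def algebra_simps)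
  qed (use r z in \<open>auto simp: U_def\<close>)
  show thesis
    by (rule that[OF r(1) im d2]) (use f0 in \<open>auto simp: f_def algebra_simps\<close>)
qed

section \<open>Reduction modulo 2 and the glued function\<close>

definition fr :: "complex \<Rightarrow> complex" where "fr \<tau> = \<tau> - of_int (2 * \<lfloor>(Re \<tau> + 1)/2\<rfloor>)"

lemma fr_bounds: "-1 \<le> Re (fr \<tau>)" "Re (fr \<tau>) < 1" "Im (fr \<tau>) = Im \<tau>"
proof -
  have "2 * of_int \<lfloor>(Re \<tau> + 1)/2\<rfloor> \<le> Re \<tau> + 1" "Re \<tau> + 1 < 2 * of_int \<lfloor>(Re \<tau> + 1)/2\<rfloor> + 2"
    using floor_correct[of "(Re \<tau> + 1)/2"] by (simp_all add: field_simps)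
  thus "-1 \<le> Re (fr \<tau>)" "Re (fr \<tau>) < 1" "Im (fr \<tau>) = Im \<tau>" by (auto simp: fr_def)
qed

lemma fr_unique:
  assumes "z = \<tau> - of_int (2 * m)" "-1 \<le> Re z" "Re z < 1"
  shows "fr \<tau> = z"
proof -
  have "\<lfloor>(Re \<tau> + 1)/2\<rfloor> = m" using assms by (intro floor_unique) auto
  thus ?thesis using assms by (simp add: fr_def)
qed

lemma fr_id: "-1 \<le> Re z \<Longrightarrow> Re z < 1 \<Longrightarrow> fr z = z"
  by (rule fr_unique[of _ _ 0]) auto

lemma fr_shift: "fr (\<tau> + 2) = fr \<tau>"
  by (rule fr_unique[of _ _ "\<lfloor>(Re \<tau> + 1)/2\<rfloor> + 1"]) (use fr_bounds in \<open>auto simp: fr_def\<close>)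

definition ph :: "real \<Rightarrow> complex \<Rightarrow> complex" where "ph x \<tau> = exp (\<i> * pi * of_real x * \<tau>)"

definition base :: "real \<Rightarrow> complex \<Rightarrow> complex" where
  "base x \<tau> = ph x \<tau> + psi \<tau> * Phi0 x (Wf \<tau>)"

definition Psi :: "real \<Rightarrow> complex \<Rightarrow> complex" where
  "Psi x \<tau> = ph x \<tau> + ph x (-1/\<tau>) / jfac \<tau>"

definition lat :: "complex \<Rightarrow> (int \<times> int) set" where
  "lat \<tau> = {(c,d). norm (of_int c * \<tau> + of_int d) < 1}"

lemma lat_finite: assumes "Im \<tau> > 0" shows "finite (lat \<tau>)"
proof -
  define M where "M = \<lceil>1 / Im \<tau>\<rceil>"
  define L where "L = \<lceil>1 + of_int M * norm \<tau>\<rceil>"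
  have "lat \<tau> \<subseteq> {-M..M} \<times> {-L..L}"
  proof
    fix p assume "p \<in> lat \<tau>"
    then obtain c d where p: "p = (c,d)" and n: "norm (of_int c * \<tau> + of_int d) < 1" by (auto simp: lat_def)
    have "\<bar>of_int c\<bar> * Im \<tau> < 1" using abs_Im_le_cmod[of "of_int c * \<tau> + of_int d"] n assms by (simp add: abs_mult)
    hence "\<bar>of_int c\<bar> < 1 / Im \<tau>" using assms by (simp add: field_simps)
    hence "\<bar>of_int c\<bar> \<le> real_of_int M" unfolding M_def by linarith
    hence c: "\<bar>c\<bar> \<le> M" by linarith
    have "norm (of_int d :: complex) \<le> norm (of_int c * \<tau> + of_int d) + norm (of_int c * \<tau>)"
      using norm_triangle_ineq4[of "of_int c * \<tau> + of_int d" "of_int c * \<tau>"] by simp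
    also have "norm (of_int c * \<tau>) \<le> of_int M * norm \<tau>" unfolding norm_mult using c by (intro mult_right_mono) auto
    finally have "\<bar>of_int d\<bar> \<le> 1 + of_int M * norm \<tau>" using n by simp
    hence "\<bar>of_int d\<bar> \<le> real_of_int L" unfolding L_def by linarith
    hence "\<bar>d\<bar> \<le> L" by linarith
    thus "p \<in> {-M..M} \<times> {-L..L}" using c p by auto
  qed
  thus ?thesis by (rule finite_subset) auto
qed

text \<open>The pairs for -1 / \<open>fr\<close> \<tau> map injectively to pairs for \<tau> with
  modulus below |\<open>fr\<close> \<tau>|. The pair (1, -2m), whose modulus is |\<open>fr\<close>
  \<tau>| itself, is missed.\<close>

lemma lat_decrease:
  assumes "Im \<tau> > 0" "norm (fr \<tau>) < 1"
  shows "card (lat (-1 / fr \<tau>)) < card (lat \<tau>)"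
proof -
  define m where "m = \<lfloor>(Re \<tau> + 1)/2\<rfloor>"
  define \<sigma> where "\<sigma> = fr \<tau>"
  have s: "\<sigma> = \<tau> - of_int (2*m)" by (simp add: \<sigma>_def fr_def m_def)
  have nz: "\<sigma> \<noteq> 0" using assms fr_bounds(3)[of \<tau>] by (auto simp: \<sigma>_def)
  define h where "h = (\<lambda>(c::int,d::int). (d, - (2*m*d + c)))"
  have key: "norm (of_int (fst (h p)) * \<tau> + of_int (snd (h p))) < norm \<sigma>" if "p \<in> lat (-1/\<sigma>)" for p
  proof -
    obtain c d where p: "p = (c,d)" by fastforce
    have n: "norm (of_int c * (-1/\<sigma>) + of_int d) < 1" using that unfolding lat_def p by blast
    have "of_int (fst (h p)) * \<tau> + of_int (snd (h p)) = (of_int c * (-1/\<sigma>) + of_int d) * \<sigma>"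
    proof -
      have "(of_int c * (-1/\<sigma>) + of_int d) * \<sigma> = - of_int c + of_int d * \<sigma>" using nz by (simp add: left_diff_distrib)
      thus ?thesis by (simp add: p h_def s algebra_simps)
    qed
    hence "norm (of_int (fst (h p)) * \<tau> + of_int (snd (h p))) = norm (of_int c * (-1/\<sigma>) + of_int d) * norm \<sigma>"
      by (simp only: norm_mult)
    also have "\<dots> < 1 * norm \<sigma>" using n nz by (intro mult_strict_right_mono) auto
    finally show ?thesis by simp
  qed
  have inj: "inj_on h (lat (-1/\<sigma>))" by (auto simp: inj_on_def h_def)
  have "h ` lat (-1/\<sigma>) \<subset> lat \<tau>"
  proof
    show "h ` lat (-1/\<sigma>) \<subseteq> lat \<tau>" using key assms(2) by (force simp: lat_def \<sigma>_def[symmetric])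
    have "(1, -(2*m)) \<in> lat \<tau>" using assms(2) unfolding \<sigma>_def[symmetric] s by (simp add: lat_def)
    moreover have "(1, -(2*m)) \<notin> h ` lat (-1/\<sigma>)"
    proof
      assume "(1, -(2*m)) \<in> h ` lat (-1/\<sigma>)"
      then obtain p where "p \<in> lat (-1/\<sigma>)" "h p = (1, -(2*m))" by auto
      from key[OF this(1)] this(2) show False by (simp add: s)
    qed
    ultimately show "h ` lat (-1/\<sigma>) \<noteq> lat \<tau>" by blast
  qed
  hence "card (h ` lat (-1/\<sigma>)) < card (lat \<tau>)" by (intro psubset_card_mono lat_finite assms)
  thus ?thesis using card_image[OF inj] by (simp add: \<sigma>_def)
qed

text \<open>The number of pairs (c,d) with |c t + d| < 1 drops at every inversion, which gives termination.\<close>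

function FF :: "real \<Rightarrow> complex \<Rightarrow> complex" where
  "FF x \<tau> = (if Im \<tau> \<le> 0 \<or> norm (fr \<tau>) \<ge> 1 then base x (fr \<tau>)
     else Psi x (fr \<tau>) - FF x (-1 / fr \<tau>) / jfac (fr \<tau>))"
  by auto
termination
  by (relation "Wellfounded.measure (\<lambda>(x,\<tau>). card (lat \<tau>))") (use lat_decrease in \<open>auto simp: not_le\<close>)

declare FF.simps [simp del]

lemma Wf_dom:
  assumes "\<bar>Re \<sigma>\<bar> < 1" "norm \<sigma> \<ge> 1" "Im \<sigma> > 0"
  shows "Wf \<sigma> \<notin> \<real>\<^sub>\<le>\<^sub>0"
proof (cases "norm \<sigma> = 1")
  case True thus ?thesis using Wf_arc_pos[OF True assms(3)] by (auto simp: complex_nonpos_Reals_iff)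
next
  case False
  hence n: "norm \<sigma> > 1" using assms by simp
  show ?thesis
  proof (cases "Re \<sigma>" "0::real" rule: linorder_cases)
    case less thus ?thesis using Wf_Im_pos[of \<sigma>] assms n by (auto simp: complex_nonpos_Reals_iff)
  next
    case equal thus ?thesis using Wf_axis_pos[OF equal assms(3)] by (auto simp: complex_nonpos_Reals_iff)
  next
    case greater thus ?thesis using Wf_Im_neg[of \<sigma>] assms n by (auto simp: complex_nonpos_Reals_iff)
  qed
qed

lemma ph_differentiable: "ph x field_differentiable at z"
  unfolding ph_def by (intro holomorphic_on_imp_differentiable_at[of _ UNIV] holomorphic_intros) auto

lemma fd_simps:
  assumes "Im z > 0"
  shows "psi field_differentiable at z" "Wf field_differentiable at z" "jfac field_differentiable at z"
    "(\<lambda>z. -1/z) field_differentiable at z"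
proof -
  have z: "z \<in> uhp" using assms by simp
  show "psi field_differentiable at z" "Wf field_differentiable at z" "jfac field_differentiable at z"
    by (rule holomorphic_on_imp_differentiable_at[OF _ uhp_props(1) z], intro holomorphic_intros order_refl)+
  show "(\<lambda>z. -1/z) field_differentiable at z"
    using assms by (intro field_differentiable_divide field_differentiable_const field_differentiable_ident) auto
qed

lemma base_differentiable:
  assumes "x \<ge> 0" "\<bar>Re \<sigma>\<bar> < 1" "norm \<sigma> \<ge> 1" "Im \<sigma> > 0"
  shows "base x field_differentiable at \<sigma>"
  unfolding base_def[abs_def]
  by (intro field_differentiable_add field_differentiable_mult ph_differentiable fd_simps assms(4)
      field_differentiable_compose[OF fd_simps(2)[OF assms(4)] Phi0_differentiable[OF assms(1) Wf_dom[OF assms(2-4)]], unfolded o_def])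

text \<open>Under inversion the Cauchy part changes sign through \<open>psi_S\<close> while its
  argument \<open>Wf\<close> z is unchanged; adding \<open>base\<close> itself therefore leaves only
  exponentials.\<close>

lemma base_S:
  assumes "Im z > 0"
  shows "base x (-1/z) / jfac z = ph x (-1/z) / jfac z - psi z * Phi0 x (Wf z)"
  using jfac_nz[OF assms] by (simp add: base_def psi_S[OF assms] Wf_S[OF assms] diff_divide_distrib del: divide_minus_left)

lemma FF_base: "norm (fr \<tau>) \<ge> 1 \<Longrightarrow> FF x \<tau> = base x (fr \<tau>)"
  by (subst FF.simps) simp

lemma FF_rec: "Im \<tau> > 0 \<Longrightarrow> norm (fr \<tau>) < 1 \<Longrightarrow> FF x \<tau> = Psi x (fr \<tau>) - FF x (-1 / fr \<tau>) / jfac (fr \<tau>)"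
  by (subst FF.simps) simp

text \<open>On one side of the unit arc an inversion is used, on the other none;
  \<open>base_S\<close> makes both formulas agree, so nothing happens across the arc. The condition
  on -1/z ensures that it is already reduced modulo 2.\<close>

lemma FF_near_base:
  assumes "Im z > 0" "\<bar>Re z\<bar> < 1" "\<bar>Re (-1/z)\<bar> < 1"
  shows "FF x z = base x z"
proof (cases "norm z \<ge> 1")
  case True thus ?thesis using FF_base[of z x] fr_id[of z] assms by simp
next
  case False
  have fz: "fr z = z" using fr_id[of z] assms by simp
  have fz': "fr (-1/z) = -1/z" using fr_id[of "-1/z"] assms by simp
  have "z \<noteq> 0" using assms(1) by auto
  hence "norm (-1/z) \<ge> 1" using False by (simp add: norm_divide)
  hence "FF x (-1/z) = base x (-1/z)" using FF_base[of "-1/z" x] fz' by simp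
  hence "FF x z = Psi x z - base x (-1/z) / jfac z" using FF_rec[of z x] assms False fz by simp
  also have "\<dots> = base x z" unfolding base_S[OF assms(1)] by (simp add: Psi_def base_def)
  finally show ?thesis .
qed

lemma FF_shift: "FF x (\<tau> + 2) = FF x \<tau>"
  by (subst (1 2) FF.simps) (simp add: fr_shift)

lemma FF_shift_int: "FF x (\<tau> + of_int (2*m)) = FF x \<tau>"
proof (induction m rule: int_induct[where k=0])
  case (step1 i) thus ?case using FF_shift[of x "\<tau> + of_int (2*i)"] by (simp add: algebra_simps)
next
  case (step2 i) thus ?case using FF_shift[of x "\<tau> + of_int (2*(i-1))"] by (simp add: algebra_simps)
qed simp

lemma FF_differentiable_fr:
  assumes "FF x field_differentiable at (fr \<tau>)"
  shows "FF x field_differentiable at \<tau>"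
proof -
  define m where "m = \<lfloor>(Re \<tau> + 1)/2\<rfloor>"
  have "(\<lambda>z. z - of_int (2*m)) field_differentiable at \<tau>"
    by (intro field_differentiable_diff field_differentiable_ident field_differentiable_const)
  hence "(FF x \<circ> (\<lambda>z. z - of_int (2*m))) field_differentiable at \<tau>"
    by (rule field_differentiable_compose) (use assms in \<open>simp add: fr_def m_def\<close>)
  moreover have "FF x \<circ> (\<lambda>z. z - of_int (2*m)) = FF x"
    using FF_shift_int[of x _ "-m"] by (auto simp: fun_eq_iff)
  ultimately show ?thesis by simp
qed

text \<open>Induction along the recursion, at the reduced point. The cases are the base domain with
  its arc, the edge Re = -1, where the branch of \<open>Phi0\<close> switches, and the inside of the
  unit disc.\<close>

lemma FF_differentiable: "x \<ge> 0 \<Longrightarrow> Im \<tau> > 0 \<Longrightarrow> FF x field_differentiable at \<tau>"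
proof (induction x \<tau> rule: FF.induct)
  case (1 x \<tau>)
  note x = 1(2)
  define \<sigma> where "\<sigma> = fr \<tau>"
  have im: "Im \<sigma> > 0" using 1(3) fr_bounds by (simp add: \<sigma>_def)
  have re: "-1 \<le> Re \<sigma>" "Re \<sigma> < 1" using fr_bounds by (auto simp: \<sigma>_def)
  consider (a) "norm \<sigma> \<ge> 1" "Re \<sigma> > -1" | (b) "norm \<sigma> \<ge> 1" "Re \<sigma> = -1" | (c) "norm \<sigma> < 1"
    using re by linarith
  hence "FF x field_differentiable at \<sigma>"
  proof cases
    case a
    \<comment> \<open>The last condition says |Re (-1/z)| < 1, as required by
      \<open>FF_near_base\<close>.\<close>
    define S where "S = {z. Im z > 0 \<and> \<bar>Re z\<bar> < 1 \<and> \<bar>Re z\<bar> < (norm z)^2}"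
    have oS: "open S" unfolding S_def by (intro open_Collect_conj open_Collect_less continuous_intros)
    have "1 \<le> (norm \<sigma>)^2" using a(1) by (rule one_le_power)
    moreover have "\<bar>Re \<sigma>\<bar> < 1" using a re by simp
    ultimately have sS: "\<sigma> \<in> S" using im by (auto simp: S_def)
    have eq: "base x z = FF x z" if "z \<in> S" for z
    proof -
      have z: "Im z > 0" "\<bar>Re z\<bar> < 1" "\<bar>Re z\<bar> < (norm z)^2" using that by (auto simp: S_def)
      have nz: "(norm z)^2 > 0" using z(1) by auto
      have "Re (-1/z) = - Re z / (norm z)^2" by (simp add: Re_divide cmod_power2)
      hence "\<bar>Re (-1/z)\<bar> = \<bar>Re z\<bar> / (norm z)^2" by (simp only: abs_divide abs_minus_cancel) simp
      also have "\<dots> < 1" using z(3) nz by (simp only: pos_divide_less_eq mult_1_left)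
      finally show ?thesis using FF_near_base[OF z(1,2), of x] by simp
    qed
    have "base x field_differentiable at \<sigma>" by (rule base_differentiable[OF x]) (use a re im in auto)
    then obtain D where "(base x has_field_derivative D) (at \<sigma>)" by (auto simp: field_differentiable_def)
    hence "(FF x has_field_derivative D) (at \<sigma>)"
      by (rule has_field_derivative_transform_within_open[OF _ oS sS]) (rule eq)
    thus ?thesis by (auto simp: field_differentiable_def)
  next
    case b
    have n1: "norm \<sigma> > 1"
    proof (rule power2_less_imp_less)
      show "1^2 < (norm \<sigma>)^2" unfolding cmod_power2 b(2) using im by simp
    qed simp
    have "\<sigma> + 2 = - cnj \<sigma>" using b(2) by (simp add: complex_eq_iff)
    hence n2: "norm (\<sigma> + 2) > 1" using n1 by simp
    obtain r where r: "r > 0" "\<And>z. z \<in> ball (\<sigma> + 2) r \<Longrightarrow> Im z > 0"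
      "\<And>z. z \<in> ball (\<sigma> + 2) r \<Longrightarrow> (\<lambda>z. psi z * Phi x (-1) (Wf z)) field_differentiable at z"
      "\<And>z. z \<in> ball (\<sigma> + 2) r \<Longrightarrow> psi z * Phi x 1 (Wf z) = psi z * Phi x (-1) (Wf z) + hx x z"
      by (rule jump_ball[OF x, of "\<sigma> + 2"]) (use b im in auto)
    define q where "q = (\<lambda>z. psi z * Phi x (-1) (Wf z))"
    define S where "S = {z. z \<in> ball \<sigma> r \<and> norm z > 1 \<and> norm (z + 2) > 1 \<and> Re z < 0 \<and> Re z > -2}"
    have oS: "open S"
    proof -
      have "S = ball \<sigma> r \<inter> {z. norm z > 1 \<and> norm (z + 2) > 1 \<and> Re z < 0 \<and> Re z > -2}" by (auto simp: S_def)
      thus ?thesis by (auto intro!: open_Int open_Collect_conj open_Collect_less continuous_intros)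
    qed
    have sS: "\<sigma> \<in> S" using b r(1) n1 n2 by (simp add: S_def)
    \<comment> \<open>One holomorphic expression in the left-hand transform serves both sides of the
      edge: right of it by definition of \<open>Phi0\<close>, left of it because the jump
      \<open>hx\<close> turns the exponential at z + 2 into the one at z.\<close>
    have eq: "ph x z + q (z + 2) = FF x z" if z: "z \<in> S" for z
    proof -
      have zb: "z + 2 \<in> ball (\<sigma> + 2) r" using z by (simp add: S_def dist_norm)
      have imz: "Im z > 0" using r(2)[OF zb] by simp
      have per: "psi (z + 2) = psi z" "Wf (z + 2) = Wf z" using psi_plus2[OF imz] Wf_plus2 by auto
      show ?thesis
      proof (cases "Re z \<ge> -1")
        case True
        have f: "fr z = z" using True z by (intro fr_id) (auto simp: S_def)
        have "Im (Wf z) \<ge> 0"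
        proof (cases "Re z = -1")
          case True thus ?thesis using Wf_real_on[OF imz] by simp
        next
          case False
          have "Im (Wf z) > 0" by (rule Wf_Im_pos) (use False True z imz in \<open>auto simp: S_def\<close>)
          thus ?thesis by simp
        qed
        hence "base x z = ph x z + q (z + 2)" by (simp add: base_def Phi0_def q_def per)
        moreover have "FF x z = base x z" using FF_base[of z x] f z by (simp add: S_def)
        ultimately show ?thesis by simp
      next
        case False
        have f: "fr z = z + 2" by (rule fr_unique[of _ _ "-1"]) (use False z in \<open>auto simp: S_def\<close>)
        have "Im (Wf (z + 2)) < 0" by (rule Wf_Im_neg) (use False z imz in \<open>auto simp: S_def\<close>)
        hence "base x (z + 2) = ph x (z + 2) + psi (z + 2) * Phi x 1 (Wf (z + 2))" by (simp add: base_def Phi0_def)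
        also have "\<dots> = ph x (z + 2) + (q (z + 2) + hx x (z + 2))" unfolding r(4)[OF zb] q_def ..
        also have "hx x (z + 2) = ph x z - ph x (z + 2)" by (simp add: hx_def ph_def)
        finally have "base x (z + 2) = ph x z + q (z + 2)" by simp
        moreover have "FF x z = base x (z + 2)" using FF_base[of z x] f z by (simp add: S_def)
        ultimately show ?thesis by simp
      qed
    qed
    have "(\<lambda>z. z + 2) field_differentiable at \<sigma>"
      by (intro field_differentiable_add field_differentiable_ident field_differentiable_const)
    moreover have "q field_differentiable at (\<sigma> + 2)" unfolding q_def using r(1,3) by simp
    ultimately have "(q \<circ> (\<lambda>z. z + 2)) field_differentiable at \<sigma>" by (rule field_differentiable_compose)
    hence "(\<lambda>z. ph x z + q (z + 2)) field_differentiable at \<sigma>"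
      by (intro field_differentiable_add ph_differentiable) (simp add: o_def)
    then obtain D where "((\<lambda>z. ph x z + q (z + 2)) has_field_derivative D) (at \<sigma>)" by (auto simp: field_differentiable_def)
    hence "(FF x has_field_derivative D) (at \<sigma>)"
      by (rule has_field_derivative_transform_within_open[OF _ oS sS]) (rule eq)
    thus ?thesis by (auto simp: field_differentiable_def)
  next
    case c
    have im': "Im (-1/\<sigma>) > 0" by (rule Im_minus_inverse_pos[OF im])
    have IH: "FF x field_differentiable at (-1/\<sigma>)"
      unfolding \<sigma>_def by (rule 1(1)) (use c x im' 1(3) in \<open>simp_all add: \<sigma>_def\<close>)
    define S where "S = {z. Im z > 0 \<and> norm z < 1}"
    have oS: "open S" unfolding S_def by (intro open_Collect_conj open_Collect_less continuous_intros)
    have sS: "\<sigma> \<in> S" using c im by (simp add: S_def)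
    have eq: "(ph x z + ph x (-1/z) / jfac z) - FF x (-1/z) / jfac z = FF x z" if z: "z \<in> S" for z
    proof -
      have "\<bar>Re z\<bar> < 1" using z abs_Re_le_cmod[of z] by (simp add: S_def)
      hence "fr z = z" by (intro fr_id) auto
      thus ?thesis using FF_rec[of z x] z by (simp add: S_def Psi_def)
    qed
    note inv = fd_simps(4)[OF im]
    have "(\<lambda>z. (ph x z + ph x (-1/z) / jfac z) - FF x (-1/z) / jfac z) field_differentiable at \<sigma>"
      by (intro field_differentiable_diff field_differentiable_add field_differentiable_divide ph_differentiable fd_simps(3)[OF im] jfac_nz[OF im]
          field_differentiable_compose[OF inv ph_differentiable, unfolded o_def] field_differentiable_compose[OF inv IH, unfolded o_def])
    then obtain D where "((\<lambda>z. (ph x z + ph x (-1/z) / jfac z) - FF x (-1/z) / jfac z) has_field_derivative D) (at \<sigma>)"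
      by (auto simp: field_differentiable_def)
    hence "(FF x has_field_derivative D) (at \<sigma>)"
      by (rule has_field_derivative_transform_within_open[OF _ oS sS]) (rule eq)
    thus ?thesis by (auto simp: field_differentiable_def)
  qed
  thus ?case unfolding \<sigma>_def by (rule FF_differentiable_fr)
qed

lemma FF_functional:
  assumes "a > 0"
  shows "FF x (\<i> * of_real a) + FF x (\<i> * of_real (1/a)) / of_real (sqrt a) =
         of_real (exp (- (pi * x * a))) + of_real (exp (- (pi * x * (1/a)))) / of_real (sqrt a)"
proof -
  have fr_ia: "fr (\<i> * of_real a) = \<i> * of_real a" for a by (rule fr_id) auto
  have inv: "-1 / (\<i> * of_real a) = \<i> * of_real (1/a)" for a :: real by (cases "a = 0") (auto simp: field_simps)
  have jf: "jfac (\<i> * of_real a) = of_real (sqrt a)" if "a > 0" for a using that by (simp add: jfac_def csqrt_of_real_nonneg)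
  have ph: "ph x (\<i> * of_real a) = of_real (exp (- (pi * x * a)))" for a
  proof -
    have "\<i> * pi * of_real x * (\<i> * of_real a) = complex_of_real (- (pi * x * a))" by (simp add: algebra_simps)
    thus ?thesis unfolding ph_def by (simp only: exp_of_real)
  qed
  have main: "FF x (\<i> * of_real a) + FF x (\<i> * of_real (1/a)) / of_real (sqrt a) =
         of_real (exp (- (pi * x * a))) + of_real (exp (- (pi * x * (1/a)))) / of_real (sqrt a)" if a: "0 < a" "a < 1" for a
  proof -
    have "FF x (\<i> * of_real a) = Psi x (\<i> * of_real a) - FF x (-1 / (\<i> * of_real a)) / jfac (\<i> * of_real a)"
      using FF_rec[of "\<i> * of_real a" x] fr_ia[of a] a by (simp add: norm_mult)
    thus ?thesis unfolding Psi_def inv jf[OF a(1)] ph by simp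
  qed
  show ?thesis
  proof (cases a "1::real" rule: linorder_cases)
    case less thus ?thesis using main assms by simp
  next
    case equal
    \<comment> \<open>At the fixed point of the inversion the minus sign forces \<open>psi\<close>
      to vanish, so only the exponential survives.\<close>
    have "psi (-1/\<i>) = - jfac \<i> * psi \<i>" by (rule psi_S) simp
    moreover have "jfac \<i> = 1" "-1/\<i> = \<i>" by (simp_all add: jfac_def)
    ultimately have "psi \<i> = 0" by simp
    moreover have "FF x \<i> = base x \<i>" using FF_base[of \<i> x] fr_id[of \<i>] by simp
    ultimately have "FF x \<i> = ph x \<i>" by (simp add: base_def)
    also have "ph x \<i> = of_real (exp (- (pi * x)))" using ph[of 1] by simp
    finally show ?thesis using equal by simp
  next
    case greater
    define b where "b = 1/a"
    have b: "0 < b" "b < 1" "1/b = a" using greater by (auto simp: b_def)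
    have sq: "sqrt a = 1 / sqrt b" using b by (simp add: b_def real_sqrt_divide)
    have sb: "complex_of_real (sqrt b) \<noteq> 0" using b by simp
    have "FF x (\<i> * of_real a) + FF x (\<i> * of_real b) * of_real (sqrt b) = (FF x (\<i> * of_real b) + FF x (\<i> * of_real (1/b)) / of_real (sqrt b)) * of_real (sqrt b)"
      using sb b(3) by (simp add: distrib_right)
    also have "\<dots> = (of_real (exp (- (pi * x * b))) + of_real (exp (- (pi * x * (1/b)))) / of_real (sqrt b)) * of_real (sqrt b)"
      unfolding main[OF b(1,2)] ..
    also have "\<dots> = of_real (exp (- (pi * x * a))) + of_real (exp (- (pi * x * b))) * of_real (sqrt b)"
      using sb b(3) by (simp add: distrib_right)
    finally show ?thesis unfolding sq b_def[symmetric] by simp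
  qed
qed

text \<open>Points of the left half are moved by 2 into \<open>OmC\<close>, where
  \<open>G_bound\<close> applies; the exponential is covered by \<open>exp_Nx\<close>.\<close>

lemma base_bound:
  obtains K where "K \<ge> 1"
    "\<And>x \<sigma>. x \<ge> 0 \<Longrightarrow> -1 \<le> Re \<sigma> \<Longrightarrow> Re \<sigma> < 1 \<Longrightarrow> norm \<sigma> \<ge> 1 \<Longrightarrow> Im \<sigma> > 0 \<Longrightarrow> norm (base x \<sigma>) \<le> K * Nx x * max 1 (Im \<sigma> powr (-1/4))"
proof -
  obtain K where K: "K > 0"
    "\<And>x \<sigma> \<tau>. x \<ge> 0 \<Longrightarrow> \<tau> \<in> OmC \<Longrightarrow> sgood \<sigma> (Wf \<tau>) \<Longrightarrow> norm (psi \<tau> * Phi x \<sigma> (Wf \<tau>)) \<le> K * Nx x * max 1 (Im \<tau> powr (-1/4))"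
    by (rule G_bound) blast
  show thesis
  proof (rule that[of "K+1"])
    fix x :: real and \<sigma> assume a: "x \<ge> 0" "-1 \<le> Re \<sigma>" "Re \<sigma> < 1" "norm \<sigma> \<ge> 1" "Im \<sigma> > 0"
    define s :: real where "s = (if Im (Wf \<sigma>) \<ge> 0 then -1 else 1)"
    have P0: "Phi0 x (Wf \<sigma>) = Phi x s (Wf \<sigma>)" by (simp add: Phi0_def s_def)
    have sg: "sgood s (Wf \<sigma>)" by (simp add: sgood_def s_def)
    define m where "m = max 1 (Im \<sigma> powr (-1/4))"
    have N: "Nx x > 0" using Nx_pos a by simp
    have G: "norm (psi \<sigma> * Phi x s (Wf \<sigma>)) \<le> K * Nx x * m"
    proof (cases "Re \<sigma> \<ge> 0")
      case True
      have "norm (\<sigma> - 2) \<ge> 1" using abs_Re_le_cmod[of "\<sigma> - 2"] a by simp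
      hence "\<sigma> \<in> OmC" using True a by (auto simp: OmC_def)
      thus ?thesis using K(2)[OF a(1) _ sg] by (simp add: m_def)
    next
      case False
      have "norm (\<sigma> + 2) \<ge> 1" using abs_Re_le_cmod[of "\<sigma> + 2"] a by simp
      hence O: "\<sigma> + 2 \<in> OmC" using False a by (auto simp: OmC_def)
      have "sgood s (Wf (\<sigma> + 2))" using sg by (simp add: Wf_plus2)
      from K(2)[OF a(1) O this] show ?thesis using psi_plus2[OF a(5)] by (simp add: Wf_plus2 m_def)
    qed
    have phn: "norm (ph x \<sigma>) = exp (- (pi * x * Im \<sigma>))" by (simp add: ph_def)
    have "norm (ph x \<sigma>) \<le> Nx x * m"
    proof (cases "Im \<sigma> \<le> 1")
      case True
      have "norm (ph x \<sigma>) \<le> Nx x * Im \<sigma> powr (-1/4)" unfolding phn by (rule exp_Nx) (use a True in auto)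
      also have "\<dots> \<le> Nx x * m" using N by (intro mult_left_mono) (auto simp: m_def)
      finally show ?thesis .
    next
      case False
      have "pi * x * 1 \<le> pi * x * Im \<sigma>" using False a by (intro mult_left_mono) auto
      hence "norm (ph x \<sigma>) \<le> exp (- (pi * x))" unfolding phn by simp
      also have "\<dots> \<le> Nx x * 1" using exp_Nx1[OF a(1)] by simp
      also have "\<dots> \<le> Nx x * m" using N by (intro mult_left_mono) (auto simp: m_def)
      finally show ?thesis .
    qed
    hence "norm (base x \<sigma>) \<le> Nx x * m + K * Nx x * m"
      unfolding base_def P0 using G norm_triangle_ineq[of "ph x \<sigma>" "psi \<sigma> * Phi x s (Wf \<sigma>)"] by linarith
    thus "norm (base x \<sigma>) \<le> (K+1) * Nx x * max 1 (Im \<sigma> powr (-1/4))" by (simp add: m_def algebra_simps)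
  qed (use K in simp)
qed

section \<open>Counting inversions\<close>

text \<open>Multiplying by Im^(1/4) makes the weight 1/2 inversion isometric, so in the weighted
  recursion the inverted term enters with coefficient 1.\<close>

lemma Im_powr_jfac:
  assumes "Im z > 0"
  shows "Im z powr (1/4) / norm (jfac z) = Im (-1/z) powr (1/4)"
proof -
  have n: "norm z > 0" using assms by auto
  have "((norm z)^2) powr (1/4) = (norm z powr 2) powr (1/4)" using n by simp
  also have "\<dots> = norm z powr (1/2)" by (simp only: powr_powr) simp
  also have "\<dots> = norm (jfac z)" using n by (simp add: norm_jfac powr_half_sqrt)
  finally show ?thesis unfolding Im_minus_inverse using assms by (subst powr_divide) auto
qed

lemma Psi_bound:
  assumes x: "x \<ge> 0" and z: "Im z > 0" "norm z < 1"
  shows "Im z powr (1/4) * norm (Psi x z) \<le> Nx x * (1 + max 1 (Im (-1/z) powr (1/4)))"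
proof -
  define v v1 where "v = Im z" and "v1 = Im (-1/z)"
  have v: "0 < v" "v \<le> 1" using z abs_Im_le_cmod[of z] by (auto simp: v_def)
  have v1: "v1 > 0" unfolding v1_def by (rule Im_minus_inverse_pos[OF z(1)])
  have N: "Nx x > 0" by (rule Nx_pos[OF x])
  have A: "s powr (1/4) * exp (- (pi * x * s)) \<le> Nx x" if "0 < s" "s \<le> 1" for s
  proof -
    have "s powr (1/4) * exp (- (pi * x * s)) \<le> s powr (1/4) * (Nx x * s powr (-1/4))"
      by (intro mult_left_mono exp_Nx x that) simp
    also have "\<dots> = Nx x * (s powr (1/4) * s powr (-1/4))" by (simp only: mult_ac)
    also have "s powr (1/4) * s powr (-1/4) = 1" using that(1) by (simp flip: powr_add)
    finally show ?thesis by simp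
  qed
  have B: "v1 powr (1/4) * exp (- (pi * x * v1)) \<le> Nx x * max 1 (v1 powr (1/4))"
  proof (cases "v1 \<le> 1")
    case True
    have "Nx x * 1 \<le> Nx x * max 1 (v1 powr (1/4))" using N by (intro mult_left_mono) auto
    thus ?thesis using A[OF v1 True] by simp
  next
    case False
    have "pi * x * 1 \<le> pi * x * v1" using False x by (intro mult_left_mono) auto
    hence "exp (- (pi * x * v1)) \<le> exp (- (pi * x))" by simp
    also have "\<dots> \<le> Nx x" by (rule exp_Nx1[OF x])
    finally have "v1 powr (1/4) * exp (- (pi * x * v1)) \<le> v1 powr (1/4) * Nx x" by (rule mult_left_mono) simp
    also have "\<dots> \<le> max 1 (v1 powr (1/4)) * Nx x" using N by (intro mult_right_mono) auto
    finally show ?thesis by (simp only: mult.commute)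
  qed
  have ph: "norm (ph x w) = exp (- (pi * x * Im w))" for w by (simp add: ph_def)
  have "norm (Psi x z) \<le> exp (- (pi * x * v)) + exp (- (pi * x * v1)) / norm (jfac z)"
    unfolding Psi_def v_def v1_def ph[symmetric] by (rule order_trans[OF norm_triangle_ineq]) (simp add: norm_divide)
  hence "v powr (1/4) * norm (Psi x z) \<le> v powr (1/4) * (exp (- (pi * x * v)) + exp (- (pi * x * v1)) / norm (jfac z))"
    by (rule mult_left_mono) simp
  also have "\<dots> = v powr (1/4) * exp (- (pi * x * v)) + v powr (1/4) / norm (jfac z) * exp (- (pi * x * v1))"
    by (simp add: distrib_left)
  also have "v powr (1/4) / norm (jfac z) = v1 powr (1/4)" unfolding v_def v1_def by (rule Im_powr_jfac[OF z(1)])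
  finally show ?thesis using A[OF v] B by (simp add: v_def v1_def distrib_left)
qed

text \<open>The matrices that can occur at an inversion step in the reduction of a point: consecutive steps have lower rows (c,d) and (a,b), and |c| < |a| makes the steps distinct.\<close>

definition DD :: "complex \<Rightarrow> (int \<times> int \<times> int \<times> int) set" where
  "DD \<tau> = {(a,b,c,d). a*d - b*c = 1 \<and> \<bar>c\<bar> < \<bar>a\<bar> \<and>
     norm (of_int a * \<tau> + of_int b) < norm (of_int c * \<tau> + of_int d)}"

lemma mobius_Im:
  assumes "z = (of_int a * \<tau> + of_int b) / (of_int c * \<tau> + of_int d)" "a*d - b*c = 1"
  shows "Im z = Im \<tau> / (norm (of_int c * \<tau> + of_int d))^2"
proof -
  have "real_of_int a * real_of_int d - real_of_int b * real_of_int c = 1"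
    using assms(2) by (metis of_int_1 of_int_diff of_int_mult)
  hence "Im \<tau> = (real_of_int a * real_of_int d - real_of_int b * real_of_int c) * Im \<tau>" by simp
  also have "\<dots> = (real_of_int a * Im \<tau>) * (real_of_int c * Re \<tau> + real_of_int d) - (real_of_int a * Re \<tau> + real_of_int b) * (real_of_int c * Im \<tau>)"
    by (simp add: algebra_simps)
  finally have "Im \<tau> = (real_of_int a * Im \<tau>) * (real_of_int c * Re \<tau> + real_of_int d) - (real_of_int a * Re \<tau> + real_of_int b) * (real_of_int c * Im \<tau>)" .
  thus ?thesis unfolding assms(1) by (simp add: Im_divide cmod_power2)
qed

lemma mobius_denom_nz:
  assumes "Im \<tau> > 0" "a*d - b*c = (1::int)"
  shows "of_int c * \<tau> + of_int d \<noteq> 0"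
proof
  assume h: "of_int c * \<tau> + of_int d = 0"
  hence "real_of_int c * Im \<tau> = 0" by (auto simp: complex_eq_iff)
  hence "c = 0" using assms by auto
  hence "d = 0" using h by simp
  thus False using \<open>c = 0\<close> assms by simp
qed

text \<open>The recursion is unrolled for images z of \<tau> under integral matrices. An inversion
  landing at height at most 1 costs 2 \<open>Nx\<close> x by \<open>Psi_bound\<close>; landing above
  height 1 ends the recursion, at a cost bounded through \<open>W\<close>. Every inversion uses an
  element of \<open>DD\<close> with lower left entry c, and later ones have strictly larger |c|, so
  none is counted twice.\<close>

lemma FF_count:
  assumes K: "K \<ge> 1"
    "\<And>\<sigma>. -1 \<le> Re \<sigma> \<Longrightarrow> Re \<sigma> < 1 \<Longrightarrow> norm \<sigma> \<ge> 1 \<Longrightarrow> Im \<sigma> > 0 \<Longrightarrow> norm (base x \<sigma>) \<le> K * Nx x * max 1 (Im \<sigma> powr (-1/4))"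
    and W: "W \<ge> 0" "\<And>c d. c \<noteq> 0 \<Longrightarrow> 1 < Im \<tau> / (norm (of_int c * \<tau> + of_int d))^2 \<Longrightarrow> Im \<tau> / (norm (of_int c * \<tau> + of_int d))^2 \<le> W"
    and t: "0 < Im \<tau>" "Im \<tau> \<le> 1" and fin: "finite (DD \<tau>)"
    and x: "x \<ge> 0"
  shows "z = (of_int a * \<tau> + of_int b) / (of_int c * \<tau> + of_int d) \<Longrightarrow> a*d - b*c = 1 \<Longrightarrow>
    (a = 1 \<and> c = 0) \<or> (norm z \<ge> 1 \<and> \<bar>a\<bar> < \<bar>c\<bar>) \<Longrightarrow>
    Im z powr (1/4) * norm (FF x z) \<le> Nx x * (2 * real (card {(a',b',c',d')\<in>DD \<tau>. \<bar>c\<bar> \<le> \<bar>c'\<bar>}) + (K+1) * (1+W))"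
  using K(2) x
proof (induction x z arbitrary: a b c d rule: FF.induct)
  case (1 x z)
  note K2 = 1(5) and x = 1(6)
  define S where "S = (\<lambda>k::int. {(a',b',c',d')\<in>DD \<tau>. k \<le> \<bar>c'\<bar>})"
  have N: "Nx x > 0" by (rule Nx_pos[OF x])
  define q where "q = of_int c * \<tau> + of_int d"
  have q: "q \<noteq> 0" unfolding q_def by (rule mobius_denom_nz[OF t(1) 1(3)])
  have Imz: "Im z = Im \<tau> / (norm q)^2" unfolding q_def by (rule mobius_Im[OF 1(2,3)])
  have im: "Im z > 0" unfolding Imz using t q by simp
  have quarter: "s powr (1/4) \<le> max 1 s" if "s > 0" for s :: real
  proof (cases "s \<le> 1")
    case True
    have "s powr (1/4) \<le> 1 powr (1/4)" by (rule powr_mono2) (use that True in auto)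
    thus ?thesis by simp
  next
    case False thus ?thesis using powr_mono[of "1/4" 1 s] by simp
  qed
  have baseb: "Im w powr (1/4) * norm (base x (fr w)) \<le> K * Nx x * max 1 (Im w)" if w: "Im w > 0" "norm (fr w) \<ge> 1" for w
  proof -
    have "norm (base x (fr w)) \<le> K * Nx x * max 1 (Im w powr (-1/4))"
      using K2[of "fr w"] fr_bounds[of w] w by simp
    hence "Im w powr (1/4) * norm (base x (fr w)) \<le> Im w powr (1/4) * (K * Nx x * max 1 (Im w powr (-1/4)))"
      by (rule mult_left_mono) simp
    also have "\<dots> = K * Nx x * (Im w powr (1/4) * max 1 (Im w powr (-1/4)))" by (simp only: mult_ac)
    also have "Im w powr (1/4) * max 1 (Im w powr (-1/4)) = max (Im w powr (1/4)) (Im w powr (1/4) * Im w powr (-1/4))"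
      by (subst max_mult_distrib_left) simp
    also have "Im w powr (1/4) * Im w powr (-1/4) = 1" using w(1) by (simp flip: powr_add)
    also have "K * Nx x * max (Im w powr (1/4)) 1 \<le> K * Nx x * max 1 (Im w)"
      using quarter[OF w(1)] K(1) N by (intro mult_left_mono) auto
    finally show ?thesis .
  qed
  have nn: "0 \<le> real (card (S k))" for k by simp
  have "Im z powr (1/4) * norm (FF x z) \<le> Nx x * (2 * real (card (S \<bar>c\<bar>)) + (K+1) * (1+W))"
  proof (cases "norm (fr z) \<ge> 1")
    case True
    have "max 1 (Im z) \<le> 1 + W"
    proof (cases "Im z \<le> 1")
      case True thus ?thesis using W(1) by simp
    next
      case False
      have "c \<noteq> 0"
      proof
        assume c0: "c = 0"
        hence "a = 1" "d = 1" using 1(3,4) by auto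
        hence "Im z = Im \<tau>" using c0 Imz by (simp add: q_def)
        thus False using False t by simp
      qed
      hence "Im z \<le> W" using W(2)[of c d] False unfolding Imz q_def by simp
      thus ?thesis using W(1) by simp
    qed
    hence "K * Nx x * max 1 (Im z) \<le> K * Nx x * (1 + W)" using K(1) N by (intro mult_left_mono) auto
    also have "\<dots> \<le> Nx x * (2 * real (card (S \<bar>c\<bar>)) + (K+1) * (1+W))"
    proof -
      have "K * (1+W) \<le> 2 * real (card (S \<bar>c\<bar>)) + (K+1) * (1+W)" using nn[of "\<bar>c\<bar>"] W(1) by (simp add: distrib_right)
      hence "Nx x * (K * (1+W)) \<le> Nx x * (2 * real (card (S \<bar>c\<bar>)) + (K+1) * (1+W))" using N by (intro mult_left_mono) auto
      thus ?thesis by (simp only: mult_ac)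
    qed
    finally show "Im z powr (1/4) * norm (FF x z) \<le> Nx x * (2 * real (card (S \<bar>c\<bar>)) + (K+1) * (1+W))"
      using baseb[OF im True] FF_base[OF True, of x] by simp
  next
    case False
    hence lt: "norm (fr z) < 1" by simp
    define m where "m = \<lfloor>(Re z + 1)/2\<rfloor>"
    define z' where "z' = fr z"
    define a' b' where "a' = a - 2*m*c" and "b' = b - 2*m*d"
    define p where "p = of_int a' * \<tau> + of_int b'"
    have z': "z' = z - of_int (2*m)" by (simp add: z'_def fr_def m_def)
    have im': "Im z' = Im z" by (simp add: z'_def fr_bounds)
    have zp: "z' = p / q"
    proof -
      have "z = (of_int a * \<tau> + of_int b) / q" using 1(2) by (simp add: q_def)
      hence "z' = (of_int a * \<tau> + of_int b - of_int (2*m) * q) / q" using q z' by (simp add: diff_divide_distrib)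
      also have "of_int a * \<tau> + of_int b - of_int (2*m) * q = p" by (simp add: p_def q_def a'_def b'_def algebra_simps)
      finally show ?thesis .
    qed
    have det: "a'*d - b'*c = 1" using 1(3) by (simp add: a'_def b'_def algebra_simps)
    have det2: "(-c)*b' - (-d)*a' = 1" using det by (simp add: algebra_simps)
    have p: "p \<noteq> 0" unfolding p_def by (rule mobius_denom_nz[OF t(1) det2])
    have pq: "norm p < norm q"
    proof -
      have "norm p / norm q < 1" using lt unfolding z'_def[symmetric] zp by (simp add: norm_divide)
      thus ?thesis using q by simp
    qed
    \<comment> \<open>If |z| >= 1 but the reduced point is inside the unit disc, then m is nonzero
      and |a - 2mc| >= 2|c| - |a| > |c|.\<close>
    have ac: "\<bar>c\<bar> < \<bar>a'\<bar>" using 1(4)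
    proof
      assume "a = 1 \<and> c = 0" thus ?thesis by (simp add: a'_def)
    next
      assume h: "1 \<le> norm z \<and> \<bar>a\<bar> < \<bar>c\<bar>"
      have "m \<noteq> 0" using h lt z' by (auto simp: z'_def)
      hence "1 \<le> \<bar>m\<bar>" by simp
      hence "1 * \<bar>c\<bar> \<le> \<bar>m\<bar> * \<bar>c\<bar>" by (rule mult_right_mono) simp
      hence "2 * \<bar>c\<bar> \<le> \<bar>2*m*c\<bar>" by (simp add: abs_mult)
      moreover have "\<bar>2*m*c\<bar> \<le> \<bar>a'\<bar> + \<bar>a\<bar>" unfolding a'_def by linarith
      ultimately show ?thesis using h by linarith
    qed
    have inD: "(a',b',c,d) \<in> DD \<tau>" using det ac pq by (simp add: DD_def p_def q_def)
    have finS: "finite (S k)" for k by (rule finite_subset[OF _ fin]) (auto simp: S_def)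
    have "insert (a',b',c,d) (S \<bar>a'\<bar>) \<subseteq> S \<bar>c\<bar>" using inD ac by (auto simp: S_def)
    hence "card (insert (a',b',c,d) (S \<bar>a'\<bar>)) \<le> card (S \<bar>c\<bar>)" by (rule card_mono[OF finS])
    moreover have "(a',b',c,d) \<notin> S \<bar>a'\<bar>" using ac by (auto simp: S_def)
    ultimately have cardS: "card (S \<bar>a'\<bar>) + 1 \<le> card (S \<bar>c\<bar>)" using finS by simp
    define u where "u = -1/z'"
    have u: "u = (of_int (-c) * \<tau> + of_int (-d)) / (of_int a' * \<tau> + of_int b')"
    proof -
      have "u = (-q)/p" unfolding u_def zp using p q by simp
      thus ?thesis by (simp add: p_def q_def)
    qed
    have imz': "Im z' > 0" using im im' by simp
    have imu: "Im u > 0" unfolding u_def by (rule Im_minus_inverse_pos[OF imz'])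
    have Imu: "Im u = Im \<tau> / (norm (of_int a' * \<tau> + of_int b'))^2" by (rule mobius_Im[OF u det2])
    have rec: "FF x z = Psi x z' - FF x u / jfac z'" using FF_rec[OF im lt, of x] by (simp add: z'_def u_def)
    have "Im z powr (1/4) * norm (FF x z) \<le> Im z' powr (1/4) * (norm (Psi x z') + norm (FF x u / jfac z'))"
      unfolding im' rec by (intro mult_left_mono norm_triangle_ineq4) simp
    also have "\<dots> = Im z' powr (1/4) * norm (Psi x z') + Im z' powr (1/4) / norm (jfac z') * norm (FF x u)"
      by (simp add: norm_divide distrib_left)
    also have "Im z' powr (1/4) / norm (jfac z') = Im u powr (1/4)" unfolding u_def by (rule Im_powr_jfac[OF imz'])
    also have "Im z' powr (1/4) * norm (Psi x z') \<le> Nx x * (1 + max 1 (Im u powr (1/4)))"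
      unfolding u_def by (rule Psi_bound[OF x imz']) (use lt in \<open>simp add: z'_def\<close>)
    finally have main: "Im z powr (1/4) * norm (FF x z) \<le> Nx x * (1 + max 1 (Im u powr (1/4))) + Im u powr (1/4) * norm (FF x u)" by simp
    have quu: "Im u powr (1/4) \<le> max 1 (Im u)" by (rule quarter[OF imu])
    show "Im z powr (1/4) * norm (FF x z) \<le> Nx x * (2 * real (card (S \<bar>c\<bar>)) + (K+1) * (1+W))"
    proof (cases "Im u \<le> 1")
      case True
      have "Im u powr (1/4) * norm (FF x u) \<le> Nx x * (2 * real (card (S \<bar>a'\<bar>)) + (K+1) * (1+W))"
        unfolding S_def
      proof (rule 1(1)[of "-c" "-d" a' b', folded z'_def, folded u_def])
        have "norm z' < 1" "z' \<noteq> 0" using lt zp p q by (auto simp: z'_def)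
        hence "norm u \<ge> 1" by (simp add: u_def norm_divide)
        thus "(- c = 1 \<and> a' = 0) \<or> (1 \<le> norm u \<and> \<bar>- c\<bar> < \<bar>a'\<bar>)" using ac by simp
      qed (use im lt u det2 K2 x in \<open>simp_all add: z'_def\<close>)
      moreover have "Nx x * (1 + max 1 (Im u powr (1/4))) \<le> Nx x * 2" using quu True N by (intro mult_left_mono) auto
      ultimately have "Im z powr (1/4) * norm (FF x z) \<le> Nx x * 2 + Nx x * (2 * real (card (S \<bar>a'\<bar>)) + (K+1) * (1+W))"
        using main by linarith
      also have "\<dots> = Nx x * (2 * real (card (S \<bar>a'\<bar>) + 1) + (K+1) * (1+W))" by (simp add: algebra_simps)
      also have "\<dots> \<le> Nx x * (2 * real (card (S \<bar>c\<bar>)) + (K+1) * (1+W))"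
        using cardS N by (intro mult_left_mono add_right_mono) (auto simp: of_nat_mono)
      finally show ?thesis .
    next
      case False
      have a0: "a' \<noteq> 0" using ac by auto
      have uW: "Im u \<le> W" using W(2)[OF a0, of b'] False unfolding Imu by simp
      \<comment> \<open>A height above 1 survives reduction modulo 2, so u falls into the base case
        at once.\<close>
      have "norm (fr u) \<ge> 1" using abs_Im_le_cmod[of "fr u"] fr_bounds(3)[of u] False by simp
      hence "Im u powr (1/4) * norm (FF x u) \<le> K * Nx x * max 1 (Im u)" using baseb[OF imu] FF_base[of u x] by simp
      also have "\<dots> \<le> K * Nx x * W" using False uW K(1) N by (intro mult_left_mono) auto
      finally have f: "Im u powr (1/4) * norm (FF x u) \<le> K * Nx x * W" .
      have "Nx x * (1 + max 1 (Im u powr (1/4))) \<le> Nx x * (1 + W)" using quu uW False N by (intro mult_left_mono add_left_mono) auto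
      with f main have "Im z powr (1/4) * norm (FF x z) \<le> Nx x * (1 + W) + K * Nx x * W" by linarith
      also have "\<dots> \<le> Nx x * ((K+1) * (1+W))"
      proof -
        have "0 \<le> Nx x * K" using N K(1) by simp
        thus ?thesis by (simp add: algebra_simps)
      qed
      also have "\<dots> \<le> Nx x * (2 * real (card (S \<bar>c\<bar>)) + (K+1) * (1+W))" using N by (intro mult_left_mono) auto
      finally show ?thesis .
    qed
  qed
  thus ?case by (simp only: S_def)
qed

text \<open>Inversion by (a,b;c,d) happens exactly on the half disc with centre ctr a b c d and radius 1/(a^2-c^2).\<close>

definition ctr :: "int \<Rightarrow> int \<Rightarrow> int \<Rightarrow> int \<Rightarrow> real" where
  "ctr a b c d = of_int (c*d - a*b) / of_int (a*a - c*c)"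

text \<open>The half discs that can matter at height y above the period {0..2}: their radius exceeds
  y, and since it is at most 1 the centre lies in {-1..3}.\<close>

definition QQ :: "real \<Rightarrow> (int \<times> int \<times> int \<times> int) set" where
  "QQ y = {(a,b,c,d). a*d - b*c = 1 \<and> \<bar>c\<bar> < \<bar>a\<bar> \<and> of_int (a*a - c*c) * y < 1 \<and> -1 \<le> ctr a b c d \<and> ctr a b c d \<le> 3}"

section \<open>Half discs above a period\<close>

lemma abs_less_sq: "\<bar>c\<bar> < \<bar>a\<bar> \<Longrightarrow> 0 < a*a - c*c" for a c :: int
  using abs_square_less_1 mult_strict_mono[of "\<bar>c\<bar>" "\<bar>a\<bar>" "\<bar>c\<bar>" "\<bar>a\<bar>"] by (simp flip: abs_mult)

text \<open>Multiply |a \<tau> + b|^2 < |c \<tau> + d|^2 by a^2 - c^2 and complete the square; the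
  constant left over is (ad - bc)^2 = 1.\<close>

lemma DD_disc:
  assumes q: "(a,b,c,d) \<in> DD \<tau>" and y: "Im \<tau> > 0"
  shows "(Re \<tau> - ctr a b c d)^2 + (Im \<tau>)^2 < (1 / of_int (a*a - c*c))^2"
proof -
  define A B C D where "A = real_of_int a" "B = real_of_int b" "C = real_of_int c" "D = real_of_int d"
  define t y where "t = Re \<tau>" "y = Im \<tau>"
  have h: "a*d - b*c = 1" "\<bar>c\<bar> < \<bar>a\<bar>" "norm (of_int a * \<tau> + of_int b) < norm (of_int c * \<tau> + of_int d)"
    using q by (auto simp: DD_def)
  have det: "A*D - B*C = 1" using h(1) unfolding A_B_C_D_def by (metis of_int_1 of_int_diff of_int_mult)
  have D0: "0 < a*a - c*c" by (rule abs_less_sq[OF h(2)])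
  have "0 < real_of_int (a*a - c*c)" using D0 by (simp only: of_int_0_less_iff)
  hence De: "0 < A*A - C*C" by (simp add: A_B_C_D_def)
  have "(norm (of_int a * \<tau> + of_int b))^2 < (norm (of_int c * \<tau> + of_int d))^2"
    by (rule power_strict_mono[OF h(3)]) auto
  hence "(A*t+B)^2 + (A*y)^2 < (C*t+D)^2 + (C*y)^2"
    by (simp add: cmod_power2 A_B_C_D_def t_y_def)
  hence lt: "((A*t+B)^2 + (A*y)^2 - (C*t+D)^2 - (C*y)^2) * (A*A - C*C) < 0" using De by (intro mult_neg_pos) auto
  have "((t * (A*A - C*C) - (C*D - A*B))^2 + (y * (A*A - C*C))^2) - (A*D-B*C)^2 = ((A*t+B)^2 + (A*y)^2 - (C*t+D)^2 - (C*y)^2) * (A*A - C*C)"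
    by algebra
  hence k: "(t * (A*A - C*C) - (C*D - A*B))^2 + (y * (A*A - C*C))^2 < 1" using lt det by simp
  define E where "E = A*A - C*C"
  have E: "E > 0" using De by (simp add: E_def)
  have k2: "(t * E - (C*D - A*B))^2 + (y * E)^2 < 1" using k by (simp add: E_def)
  have "(t - (C*D - A*B)/E)^2 + y^2 = ((t * E - (C*D - A*B))^2 + (y * E)^2) / E^2"
    using E by (simp add: power2_eq_square field_simps)
  also have "\<dots> < 1 / E^2" using E by (intro divide_strict_right_mono k2) simp
  finally have "(t - (C*D - A*B)/E)^2 + y^2 < (1/E)^2" by (simp add: power_divide)
  thus ?thesis by (simp add: ctr_def A_B_C_D_def E_def t_y_def)
qed

lemma DD_QQ:
  assumes t: "0 \<le> Re \<tau>" "Re \<tau> \<le> 2" and y: "Im \<tau> > 0" and q: "(a,b,c,d) \<in> DD \<tau>"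
  shows "(a,b,c,d) \<in> QQ (Im \<tau>)" "\<bar>Re \<tau> - ctr a b c d\<bar> \<le> 1 / of_int (a*a - c*c)"
proof -
  have h: "a*d - b*c = 1" "\<bar>c\<bar> < \<bar>a\<bar>" using q by (auto simp: DD_def)
  define E where "E = real_of_int (a*a - c*c)"
  have E: "E \<ge> 1" using abs_less_sq[OF h(2)] unfolding E_def by linarith
  have k: "(Re \<tau> - ctr a b c d)^2 + (Im \<tau>)^2 < (1 / E)^2" unfolding E_def by (rule DD_disc[OF q y])
  have "(Im \<tau>)^2 < (1/E)^2" using k zero_le_power2[of "Re \<tau> - ctr a b c d"] by linarith
  hence y1: "Im \<tau> < 1/E" by (rule power2_less_imp_less) (use E in simp)
  have "\<bar>Re \<tau> - ctr a b c d\<bar>^2 < (1/E)^2" using k zero_le_power2[of "Im \<tau>"] unfolding power2_abs by linarith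
  hence t1: "\<bar>Re \<tau> - ctr a b c d\<bar> < 1/E" by (rule power2_less_imp_less) (use E in simp)
  show "\<bar>Re \<tau> - ctr a b c d\<bar> \<le> 1 / of_int (a*a - c*c)" using t1 unfolding E_def by simp
  have "1/E \<le> 1" using E by simp
  hence "-1 \<le> ctr a b c d" "ctr a b c d \<le> 3" using t t1 by linarith+
  moreover have "E * Im \<tau> < 1" using y1 E by (simp add: field_simps)
  ultimately show "(a,b,c,d) \<in> QQ (Im \<tau>)" using h by (simp add: QQ_def E_def)
qed

text \<open>For fixed a and c the solutions of ad - bc = 1 differ by an integer k times (a, c) in
  (b, d). This moves the centre by -k, which its floor detects.\<close>

lemma QQ_inj: "inj_on (\<lambda>(a,b,c,d). (a-c, a+c, \<lfloor>ctr a b c d\<rfloor>)) (QQ y)"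
proof (rule inj_onI)
  fix s s' assume s: "s \<in> QQ y" "s' \<in> QQ y"
    and hs: "(\<lambda>(a,b,c,d). (a-c, a+c, \<lfloor>ctr a b c d\<rfloor>)) s = (\<lambda>(a,b,c,d). (a-c, a+c, \<lfloor>ctr a b c d\<rfloor>)) s'"
  obtain a b c d a' b' c' d' where ss: "s = (a,b,c,d)" "s' = (a',b',c',d')" by (cases s, cases s') auto
  have q: "(a,b,c,d) \<in> QQ y" "(a',b',c',d') \<in> QQ y" and e: "a - c = a' - c'" "a + c = a' + c'"
    and f: "\<lfloor>ctr a b c d\<rfloor> = \<lfloor>ctr a' b' c' d'\<rfloor>" using s hs unfolding ss prod.case prod.inject by blast+
  have ac: "a' = a" "c' = c" using e by linarith+
  have h: "a*d - b*c = 1" "a*d' - b'*c = 1" "\<bar>c\<bar> < \<bar>a\<bar>" using q by (auto simp: QQ_def ac)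
  have E: "a*a - c*c > 0" by (rule abs_less_sq[OF h(3)])
  define k where "k = (b' - b)*d - (d' - d)*b"
  have k1: "b' - b = k * a" 
  proof -
    have "b' - b = (b'-b)*(a*d - b*c)" using h by simp
    also have "\<dots> = k * a + b * (a*d' - b'*c - (a*d - b*c))" unfolding k_def by algebra
    finally show ?thesis using h by simp
  qed
  have k2: "d' - d = k * c"
  proof -
    have "d' - d = (d'-d)*(a*d - b*c)" using h by simp
    also have "\<dots> = k * c + d * (a*d' - b'*c - (a*d - b*c))" unfolding k_def by algebra
    finally show ?thesis using h by simp
  qed
  have "c*d' - a*b' = (c*d - a*b) + (c*(d'-d) - a*(b'-b))" by (simp add: algebra_simps)
  also have "\<dots> = (c*d - a*b) - k * (a*a - c*c)" unfolding k1 k2 by (simp add: algebra_simps)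
  finally have "real_of_int (c*d' - a*b') = real_of_int (c*d - a*b) - of_int k * real_of_int (a*a - c*c)" by (metis of_int_diff of_int_mult)
  moreover have "real_of_int (a*a - c*c) \<noteq> 0" using E unfolding of_int_eq_0_iff by linarith
  moreover have "U = V - w * E \<Longrightarrow> E \<noteq> 0 \<Longrightarrow> U / E = V / E - w" for U V w E :: real
    by (simp add: diff_divide_distrib)
  ultimately have "ctr a b' c d' = ctr a b c d - of_int k" unfolding ctr_def by blast
  hence "\<lfloor>ctr a b' c d'\<rfloor> = \<lfloor>ctr a b c d\<rfloor> - k" by simp
  hence "k = 0" using f unfolding ac by linarith
  thus "s = s'" using k1 k2 ac by (simp add: ss)
qed

definition rad :: "int \<times> int \<times> int \<times> int \<Rightarrow> real" where
  "rad = (\<lambda>(a,b,c,d). 1 / of_int (a*a - c*c))"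

lemma harm_le_ln: "(\<Sum>k=1..n. 1 / real k) \<le> 1 + ln (real n)" if "n \<ge> 1"
  using that
proof (induction n rule: nat_induct_at_least)
  case (Suc n)
  have "1 / real (Suc n) \<le> ln (real (Suc n)) - ln (real n)"
  proof -
    have "ln (real n / real (Suc n)) \<le> real n / real (Suc n) - 1" using Suc by (intro ln_le_minus_one) simp
    also have "\<dots> = - (1 / real (Suc n))" by (simp add: field_simps)
    finally show ?thesis using Suc by (simp add: ln_div)
  qed
  thus ?case using Suc by simp
qed simp

lemma sum_int_inverse:
  assumes "M \<ge> 1"
  shows "(\<Sum>p\<in>{-int M..int M}-{0}. 1 / \<bar>real_of_int p\<bar>) \<le> 2 * (1 + ln (real M))"
proof -
  have 1: "{-int M..int M}-{0} = (\<lambda>k. int k) ` {1..M} \<union> (\<lambda>k. - int k) ` {1..M}"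
  proof (intro equalityI subsetI)
    fix p assume p: "p \<in> {-int M..int M}-{0}"
    show "p \<in> (\<lambda>k. int k) ` {1..M} \<union> (\<lambda>k. - int k) ` {1..M}"
    proof (cases "p > 0")
      case True thus ?thesis using p by (intro UnI1 image_eqI[of _ _ "nat p"]) auto
    next
      case False thus ?thesis using p by (intro UnI2 image_eqI[of _ _ "nat (-p)"]) auto
    qed
  qed auto
  have "(\<Sum>p\<in>{-int M..int M}-{0}. 1 / \<bar>real_of_int p\<bar>) = (\<Sum>p\<in>(\<lambda>k. int k) ` {1..M}. 1 / \<bar>real_of_int p\<bar>) + (\<Sum>p\<in>(\<lambda>k. - int k) ` {1..M}. 1 / \<bar>real_of_int p\<bar>)"
    unfolding 1 by (rule sum.union_disjoint) auto
  also have "\<dots> = (\<Sum>k=1..M. 1 / real k) + (\<Sum>k=1..M. 1 / real k)"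
    by (simp add: sum.reindex inj_on_def)
  finally show ?thesis using harm_le_ln[OF assms] by simp
qed

text \<open>With p = a - c and q = a + c the radius is 1/(|p| |q|), and p, q are nonzero integers of
  modulus at most 1/y. A diameter contributes a factor 2, the five possible floors a factor 5, and
  the two harmonic sums a factor 2 each, which gives 40.\<close>

lemma QQ_sum:
  assumes y: "0 < y" "y \<le> 1"
  shows "finite (QQ y)" "(\<Sum>q\<in>QQ y. 2 * rad q) \<le> 40 * (1 + ln (1/y))^2"
proof -
  define M where "M = nat \<lfloor>1/y\<rfloor>"
  have y1: "1 \<le> 1/y" using y by simp
  have M: "M \<ge> 1" unfolding M_def using y1 by (simp add: le_nat_floor le_floor_iff nat_le_iff)
  have M2: "real M \<le> 1/y" unfolding M_def using y1 by linarith
  have intM: "int M = \<lfloor>1/y\<rfloor>" unfolding M_def using y1 by linarith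
  define Z where "Z = {-int M..int M} - {0}"
  define T where "T = Z \<times> Z \<times> {-1..3::int}"
  define h where "h = (\<lambda>(a::int,b,c::int,d). (a-c, a+c, \<lfloor>ctr a b c d\<rfloor>))"
  have sub: "h ` QQ y \<subseteq> T"
  proof (rule image_subsetI)
    fix s assume s: "s \<in> QQ y"
    obtain a b c d where ss: "s = (a,b,c,d)" by (cases s) auto
    have q: "(a,b,c,d) \<in> QQ y" using s unfolding ss .
    have H: "\<bar>c\<bar> < \<bar>a\<bar>" "of_int (a*a - c*c) * y < 1" "-1 \<le> ctr a b c d" "ctr a b c d \<le> 3" using q by (auto simp: QQ_def)
    have nz: "a - c \<noteq> 0" "a + c \<noteq> 0" using H(1) by auto
    have E: "a*a - c*c = \<bar>a-c\<bar> * \<bar>a+c\<bar>" using abs_less_sq[OF H(1)] by (simp add: abs_mult[symmetric] algebra_simps)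
    have ge1: "1 \<le> \<bar>a-c\<bar>" "1 \<le> \<bar>a+c\<bar>" using nz by auto
    have "\<bar>a-c\<bar> * 1 \<le> \<bar>a-c\<bar> * \<bar>a+c\<bar>" "1 * \<bar>a+c\<bar> \<le> \<bar>a-c\<bar> * \<bar>a+c\<bar>" using ge1 by (intro mult_left_mono mult_right_mono; simp)+
    hence le: "\<bar>a-c\<bar> \<le> a*a - c*c" "\<bar>a+c\<bar> \<le> a*a - c*c" using E by auto
    have "real_of_int (a*a-c*c) < 1/y" using H(2) y(1) by (simp add: field_simps)
    hence "a*a-c*c \<le> \<lfloor>1/y\<rfloor>" by linarith
    hence "\<bar>a-c\<bar> \<le> int M" "\<bar>a+c\<bar> \<le> int M" using le unfolding intM by linarith+
    moreover have "-1 \<le> \<lfloor>ctr a b c d\<rfloor>" "\<lfloor>ctr a b c d\<rfloor> \<le> 3" using H(3,4) by linarith+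
    ultimately show "h s \<in> T" using nz unfolding h_def T_def Z_def ss by (simp add: abs_le_iff)
  qed
  have finT: "finite T" by (simp add: T_def Z_def)
  have inj: "inj_on h (QQ y)" unfolding h_def by (rule QQ_inj)
  show "finite (QQ y)" by (rule finite_imageD[OF finite_subset[OF sub finT] inj])
  define g where "g = (\<lambda>(p::int,r::int,k::int). 2 * (1 / \<bar>real_of_int p\<bar> * (1 / \<bar>real_of_int r\<bar>)))"
  have rg: "2 * rad q = g (h q)" if "q \<in> QQ y" for q
  proof -
    obtain a b c d where q: "q = (a,b,c,d)" by (cases q) auto
    have H: "\<bar>c\<bar> < \<bar>a\<bar>" using that by (auto simp: QQ_def q)
    have "a*a - c*c = \<bar>a-c\<bar> * \<bar>a+c\<bar>" using abs_less_sq[OF H] by (simp add: abs_mult[symmetric] algebra_simps)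
    hence "real_of_int (a*a - c*c) = \<bar>real_of_int (a-c)\<bar> * \<bar>real_of_int (a+c)\<bar>" by (metis of_int_abs of_int_mult)
    thus ?thesis by (simp only: rad_def g_def h_def q case_prod_conv) simp
  qed
  have "(\<Sum>q\<in>QQ y. 2 * rad q) = (\<Sum>q\<in>QQ y. g (h q))" by (rule sum.cong[OF refl rg])
  also have "\<dots> = (\<Sum>t\<in>h ` QQ y. g t)" by (simp add: sum.reindex[OF inj] o_def)
  also have "\<dots> \<le> (\<Sum>t\<in>T. g t)" by (rule sum_mono2[OF finT sub]) (auto simp: g_def)
  also have "\<dots> = (\<Sum>p\<in>Z. \<Sum>r\<in>Z. \<Sum>k\<in>{-1..3::int}. 2 * (1 / \<bar>real_of_int p\<bar> * (1 / \<bar>real_of_int r\<bar>)))"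
    unfolding T_def g_def by (simp only: sum.cartesian_product)
  also have "\<dots> = 10 * ((\<Sum>p\<in>Z. 1 / \<bar>real_of_int p\<bar>) * (\<Sum>r\<in>Z. 1 / \<bar>real_of_int r\<bar>))"
  proof -
    have "(\<Sum>p\<in>Z. \<Sum>r\<in>Z. \<Sum>k\<in>{-1..3::int}. 2 * (1 / \<bar>real_of_int p\<bar> * (1 / \<bar>real_of_int r\<bar>))) = (\<Sum>p\<in>Z. \<Sum>r\<in>Z. 10 * (1 / \<bar>real_of_int p\<bar> * (1 / \<bar>real_of_int r\<bar>)))"
      by (intro sum.cong refl) simp
    also have "(\<Sum>p\<in>Z. \<Sum>r\<in>Z. 10 * (1 / \<bar>real_of_int p\<bar> * (1 / \<bar>real_of_int r\<bar>))) = 10 * (\<Sum>p\<in>Z. \<Sum>r\<in>Z. 1 / \<bar>real_of_int p\<bar> * (1 / \<bar>real_of_int r\<bar>))"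
      by (simp only: sum_distrib_left)
    finally show ?thesis by (simp only: sum_product)
  qed
  also have "(\<Sum>p\<in>Z. 1 / \<bar>real_of_int p\<bar>) * (\<Sum>r\<in>Z. 1 / \<bar>real_of_int r\<bar>) \<le> (2 * (1 + ln (1/y))) * (2 * (1 + ln (1/y)))"
  proof -
    have "ln (real M) \<le> ln (1/y)" using M M2 by (subst ln_le_cancel_iff) (use y in auto)
    hence "(\<Sum>p\<in>Z. 1 / \<bar>real_of_int p\<bar>) \<le> 2 * (1 + ln (1/y))" using order_trans[OF sum_int_inverse[OF M], of "2 * (1 + ln (1/y))"] unfolding Z_def by simp
    moreover have "0 \<le> (\<Sum>p\<in>Z. 1 / \<bar>real_of_int p\<bar>)" by (intro sum_nonneg) auto
    ultimately show ?thesis by (intro mult_mono) auto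
  qed
  finally show "(\<Sum>q\<in>QQ y. 2 * rad q) \<le> 40 * (1 + ln (1/y))^2" by (simp add: power2_eq_square algebra_simps)
qed

section \<open>Integration over a period\<close>

lemma indicator_interval_integral:
  assumes "u \<le> v"
  shows "indicat_real {u..v} integrable_on {0..2::real}" "integral {0..2} (indicat_real {u..v}) \<le> v - u"
proof -
  have 1: "{u..v} \<inter> {0..2} \<in> lmeasurable" by (simp only: Int_atLeastAtMost cbox_interval[symmetric]) simp
  show "indicat_real {u..v} integrable_on {0..2::real}" using 1 by (simp only: integrable_on_indicator)
  have "integral {0..2} (indicat_real {u..v}) = measure lebesgue ({u..v} \<inter> {0..2})"
    by (rule Equivalence_Lebesgue_Henstock_Integration.integral_indicator[OF 1])
  also have "\<dots> \<le> measure lebesgue {u..v}"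
    by (rule measure_mono_fmeasurable[OF _ fmeasurableD[OF 1]]) (simp_all only: Int_lower1 cbox_interval[symmetric] lmeasurable_cbox)
  also have "\<dots> = v - u" using assms by (simp add: measure_completion)
  finally show "integral {0..2} (indicat_real {u..v}) \<le> v - u" .
qed

text \<open>A rescaled Poisson kernel: its primitive is an arctangent divided by c^2, so the
  integral is at most pi / c^2 whatever e is.\<close>

lemma cauchy_kernel_integral:
  fixes y e :: real
  assumes "c \<ge> (1::real)" "y > 0"
  shows "(\<lambda>t. y / ((c*t+e)^2 + (c*y)^2)) integrable_on {0..2}" "integral {0..2} (\<lambda>t. y / ((c*t+e)^2 + (c*y)^2)) \<le> pi / c^2"
proof -
  define F where "F = (\<lambda>t. arctan ((c*t+e)/(c*y)) / c^2)"
  have "(F has_vector_derivative y / ((c*t+e)^2 + (c*y)^2)) (at t within {0..2})" for t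
  proof -
    have nz: "c \<noteq> 0" "y \<noteq> 0" using assms by auto
    have pos: "(c*t+e)^2 + (c*y)^2 > 0" using nz by (intro add_nonneg_pos) auto
    have "(F has_real_derivative (c / (c*y)) / (1 + ((c*t+e)/(c*y))^2) / c^2) (at t within {0..2})"
    proof -
      have d1: "((\<lambda>t. (c*t+e)/(c*y)) has_real_derivative c/(c*y)) (at t within {0..2})"
        by (rule DERIV_cdivide) (auto intro!: derivative_eq_intros)
      have "(F has_real_derivative inverse (1 + ((c*t+e)/(c*y))^2) * (c / (c*y)) / c^2) (at t within {0..2})"
        unfolding F_def by (rule DERIV_cdivide[OF DERIV_chain'[OF d1 DERIV_arctan]])
      thus ?thesis by (simp only: divide_inverse mult_ac)
    qed
    also have "(c / (c*y)) / (1 + ((c*t+e)/(c*y))^2) / c^2 = y / ((c*t+e)^2 + (c*y)^2)"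
    proof -
      have g: "1 + A / B = (A + B) / B" if "B \<noteq> 0" for A B :: real using that by (simp add: add_divide_distrib)
      have "1 + ((c*t+e)/(c*y))^2 = ((c*t+e)^2 + (c*y)^2) / (c*y)^2" unfolding power_divide by (rule g) (use nz in simp)
      thus ?thesis using nz pos by (simp add: power2_eq_square)
    qed
    finally show ?thesis by (simp add: has_real_derivative_iff_has_vector_derivative)
  qed
  hence I: "((\<lambda>t. y / ((c*t+e)^2 + (c*y)^2)) has_integral F 2 - F 0) {0..2}"
    by (intro fundamental_theorem_of_calculus) auto
  show "(\<lambda>t. y / ((c*t+e)^2 + (c*y)^2)) integrable_on {0..2}" using I by (rule has_integral_integrable)
  have "F 2 - F 0 = (arctan ((c*2+e)/(c*y)) - arctan ((c*0+e)/(c*y))) / c^2" by (simp add: F_def diff_divide_distrib)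
  also have "\<dots> \<le> pi / c^2"
    using arctan_ubound[of "(c*2+e)/(c*y)"] arctan_lbound[of "(c*0+e)/(c*y)"] by (intro divide_right_mono) auto
  finally show "integral {0..2} (\<lambda>t. y / ((c*t+e)^2 + (c*y)^2)) \<le> pi / c^2" using I by (simp add: integral_unique)
qed

text \<open>Dominates the height of any image of t + iy that lies above 1.\<close>

definition WW :: "real \<Rightarrow> real \<Rightarrow> real" where
  "WW y t = (\<Sum>c\<in>{1..nat \<lfloor>1/y\<rfloor>}. \<Sum>d\<in>{-3*int c..3*int c}. y / ((real c * t + of_int d)^2 + (real c * y)^2))"

text \<open>A height above 1 means (ct+d)^2 + (cy)^2 < y, hence c^2 y < 1 and |ct + d| < 1. For
  positive c this gives c < 1/y and |d| <= 3c, the ranges summed in \<open>WW\<close>; negative c is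
  covered by changing both signs.\<close>

lemma WW_ge:
  assumes y: "0 < y" "y \<le> 1" and t: "0 \<le> t" "t \<le> 2" and \<tau>: "\<tau> = of_real t + \<i> * of_real y"
    and c: "c \<noteq> (0::int)" and big: "1 < y / (norm (of_int c * \<tau> + of_int d))^2"
  shows "y / (norm (of_int c * \<tau> + of_int d))^2 \<le> WW y t"
proof -
  have pos: "y / (norm (of_int c * \<tau> + of_int d))^2 \<le> WW y t"
    if c: "c > 0" and big: "1 < y / (norm (of_int c * \<tau> + of_int d))^2" for c d :: int
  proof -
    define n where "n = nat c"
    have n: "c = int n" "n \<ge> 1" using c by (auto simp: n_def)
    have nrm: "(norm (of_int c * \<tau> + of_int d))^2 = (real n * t + of_int d)^2 + (real n * y)^2"
      unfolding cmod_power2 \<tau> n by simp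
    define Q where "Q = (real n * t + of_int d)^2 + (real n * y)^2"
    have Qp: "Q > 0" unfolding Q_def using n y by (intro add_nonneg_pos) auto
    have Qy: "Q < y" using big Qp unfolding nrm Q_def[symmetric] by (simp add: field_simps)
    have "(real n * y)^2 < y" using Qy zero_le_power2[of "real n * t + of_int d"] unfolding Q_def by linarith
    hence "y * ((real n)^2 * y) < y * 1" by (simp add: power2_eq_square mult_ac)
    hence ny: "(real n)^2 * y < 1" using y(1) by (simp only: mult_less_cancel_left_pos)
    have "real n * y \<le> (real n)^2 * y" using n y by (intro mult_right_mono) (auto simp: power2_eq_square)
    hence "real n * y < 1" using ny by linarith
    hence "real n < 1/y" using y(1) by (simp add: field_simps)
    hence nM: "n \<le> nat \<lfloor>1/y\<rfloor>" by (simp add: le_nat_floor)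
    have "(real n * t + of_int d)^2 < 1^2" using Qy y zero_le_power2[of "real n * y"] unfolding Q_def power_one by linarith
    hence "\<bar>real n * t + of_int d\<bar> < 1" by (simp only: abs_square_less_1[symmetric] power_one)
    moreover have "real n * t \<le> real n * 2" "0 \<le> real n * t" using t n by (auto intro: mult_left_mono)
    moreover have "real n \<ge> 1" using n by simp
    ultimately have "\<bar>real_of_int d\<bar> \<le> 3 * real n" by linarith
    hence d: "d \<in> {-3*int n..3*int n}" by auto
    have "y / ((real n * t + of_int d)^2 + (real n * y)^2) \<le> (\<Sum>d\<in>{-3*int n..3*int n}. y / ((real n * t + of_int d)^2 + (real n * y)^2))"
      by (rule member_le_sum[OF d]) (use y in auto)
    also have "\<dots> \<le> WW y t" unfolding WW_def
      by (rule member_le_sum[of n _ "\<lambda>n. (\<Sum>d\<in>{-3*int n..3*int n}. y / ((real n * t + of_int d)^2 + (real n * y)^2))"])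
        (use n nM y in \<open>auto intro!: sum_nonneg\<close>)
    finally show ?thesis unfolding nrm .
  qed
  show ?thesis
  proof (cases "c > 0")
    case True thus ?thesis using pos big by blast
  next
    case False
    have "norm (of_int (-c) * \<tau> + of_int (-d)) = norm (of_int c * \<tau> + of_int d)"
      using norm_minus_cancel[of "of_int c * \<tau> + of_int d"] by simp
    thus ?thesis using pos[of "-c" "-d"] False c big by simp
  qed
qed

text \<open>For each c there are 6c + 1 <= 7c values of d, each contributing at most pi / c^2; what
  remains is a harmonic sum.\<close>

lemma WW_integral:
  assumes y: "0 < y" "y \<le> 1"
  shows "WW y integrable_on {0..2}" "integral {0..2} (WW y) \<le> 7 * pi * (1 + ln (1/y))"
proof -
  define M where "M = nat \<lfloor>1/y\<rfloor>"
  have y1: "1 \<le> 1/y" using y by simp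
  have M: "M \<ge> 1" unfolding M_def using y1 by (simp add: le_nat_floor le_floor_iff nat_le_iff)
  have M2: "real M \<le> 1/y" unfolding M_def using y1 by linarith
  define f where "f = (\<lambda>(c::nat) (d::int) t. y / ((real c * t + of_int d)^2 + (real c * y)^2))"
  have fi: "f c d integrable_on {0..2}" "integral {0..2} (f c d) \<le> pi / (real c)^2" if "c \<in> {1..M}" for c d
    unfolding f_def using cauchy_kernel_integral[of "real c" y "of_int d"] that y by auto
  have We: "WW y = (\<lambda>t. \<Sum>c\<in>{1..M}. \<Sum>d\<in>{-3*int c..3*int c}. f c d t)" by (simp add: fun_eq_iff WW_def f_def M_def)
  have i1: "(\<lambda>t. \<Sum>d\<in>{-3*int c..3*int c}. f c d t) integrable_on {0..2}" if "c \<in> {1..M}" for c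
    by (intro Henstock_Kurzweil_Integration.integrable_sum fi that) auto
  show "WW y integrable_on {0..2}" unfolding We by (intro Henstock_Kurzweil_Integration.integrable_sum i1) auto
  have "integral {0..2} (WW y) = (\<Sum>c\<in>{1..M}. integral {0..2} (\<lambda>t. \<Sum>d\<in>{-3*int c..3*int c}. f c d t))"
    unfolding We by (intro Henstock_Kurzweil_Integration.integral_sum i1) auto
  also have "\<dots> \<le> (\<Sum>c\<in>{1..M}. 7 * pi * (1 / real c))"
  proof (rule sum_mono)
    fix c assume c: "c \<in> {1..M}"
    have "integral {0..2} (\<lambda>t. \<Sum>d\<in>{-3*int c..3*int c}. f c d t) = (\<Sum>d\<in>{-3*int c..3*int c}. integral {0..2} (f c d))"
      by (intro Henstock_Kurzweil_Integration.integral_sum fi c) auto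
    also have "\<dots> \<le> (\<Sum>d\<in>{-3*int c..3*int c}. pi / (real c)^2)" by (intro sum_mono fi c)
    also have "\<dots> = real (6*c+1) * (pi / (real c)^2)" by (simp add: nat_add_distrib)
    also have "\<dots> \<le> real (7*c) * (pi / (real c)^2)" using c by (intro mult_right_mono) auto
    also have "\<dots> = 7 * pi * (1 / real c)" using c by (simp add: power2_eq_square)
    finally show "integral {0..2} (\<lambda>t. \<Sum>d\<in>{-3*int c..3*int c}. f c d t) \<le> 7 * pi * (1 / real c)" .
  qed
  also have "\<dots> = 7 * pi * (\<Sum>c\<in>{1..M}. 1 / real c)" by (simp only: sum_distrib_left)
  also have "\<dots> \<le> 7 * pi * (1 + ln (1/y))"
  proof -
    have "ln (real M) \<le> ln (1/y)" using M M2 by (subst ln_le_cancel_iff) (use y in auto)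
    thus ?thesis using harm_le_ln[OF M] by (intro mult_left_mono) auto
  qed
  finally show "integral {0..2} (WW y) \<le> 7 * pi * (1 + ln (1/y))" .
qed

text \<open>\<open>FF_count\<close> is started from the identity matrix, and the number of
  inversions is replaced by the number of intervals around centres that contain t. On integration
  the intervals contribute the square of 1 + ln(1/y), the heights only its first power.\<close>

lemma FF_integral_bound:
  obtains K where "K > 0"
    "\<And>x y. x \<ge> 0 \<Longrightarrow> 0 < y \<Longrightarrow> y \<le> 1 \<Longrightarrow>
       integral {0..2} (\<lambda>t. norm (FF x (of_real t + \<i> * of_real y))) \<le> K * Nx x * y powr (-1/4) * (1 + ln (1/y))^2"
proof -
  obtain K where K: "K \<ge> 1"
    "\<And>x \<sigma>. x \<ge> 0 \<Longrightarrow> -1 \<le> Re \<sigma> \<Longrightarrow> Re \<sigma> < 1 \<Longrightarrow> norm \<sigma> \<ge> 1 \<Longrightarrow> Im \<sigma> > 0 \<Longrightarrow> norm (base x \<sigma>) \<le> K * Nx x * max 1 (Im \<sigma> powr (-1/4))"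
    by (rule base_bound) blast
  define C where "C = 80 + (K+1) * (2 + 7 * pi)"
  show thesis
  proof (rule that[of C])
    show "C > 0" using K(1) by (simp add: C_def add_pos_nonneg)
    fix x y :: real assume x: "x \<ge> 0" and y: "0 < y" "y \<le> 1"
    define L where "L = 1 + ln (1/y)"
    have L: "L \<ge> 1" using y by (simp add: L_def ln_div)
    have N: "Nx x > 0" by (rule Nx_pos[OF x])
    define \<tau> where "\<tau> = (\<lambda>t. of_real t + \<i> * complex_of_real y)"
    have ri: "Re (\<tau> t) = t" "Im (\<tau> t) = y" for t by (simp_all add: \<tau>_def)
    define I where "I = (\<lambda>(a,b,c,d). {ctr a b c d - rad (a,b,c,d)..ctr a b c d + rad (a,b,c,d)})"
    have radp: "rad q \<ge> 0" if "q \<in> QQ y" for q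
    proof -
      obtain a b c d where e: "q = (a,b,c,d)" by (cases q) auto
      have "0 < a*a - c*c" by (rule abs_less_sq) (use that in \<open>simp add: QQ_def e\<close>)
      hence "0 < real_of_int (a*a - c*c)" by (simp only: of_int_0_less_iff)
      thus ?thesis by (simp add: rad_def e del: of_int_diff of_int_mult)
    qed
    define S where "S = (\<lambda>t. \<Sum>q\<in>QQ y. indicat_real (I q) t)"
    have fQ: "finite (QQ y)" by (rule QQ_sum[OF y])
    have point: "norm (FF x (\<tau> t)) \<le> y powr (-1/4) * Nx x * (2 * S t + (K+1) * (1 + WW y t))" if t: "t \<in> {0..2}" for t
    proof -
      have sub: "DD (\<tau> t) \<subseteq> {q\<in>QQ y. t \<in> I q}"
      proof (rule subsetI)
        fix q assume q: "q \<in> DD (\<tau> t)"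
        obtain a b c d where e: "q = (a,b,c,d)" by (cases q) auto
        have "(a,b,c,d) \<in> QQ y" "\<bar>t - ctr a b c d\<bar> \<le> 1 / of_int (a*a - c*c)"
          using DD_QQ[of "\<tau> t" a b c d] q t y by (simp_all add: ri e)
        thus "q \<in> {q\<in>QQ y. t \<in> I q}" by (simp add: e I_def rad_def abs_le_iff)
      qed
      have fD: "finite (DD (\<tau> t))" by (rule finite_subset[OF sub]) (use fQ in auto)
      have "card (DD (\<tau> t)) \<le> card {q\<in>QQ y. t \<in> I q}" by (rule card_mono[OF _ sub]) (use fQ in auto)
      also have "real (card {q\<in>QQ y. t \<in> I q}) = S t"
      proof -
        have "S t = (\<Sum>q\<in>{q\<in>QQ y. t \<in> I q}. 1)" unfolding S_def
          by (rule sum.mono_neutral_cong_right) (use fQ in \<open>auto simp: indicator_def\<close>)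
        thus ?thesis by simp
      qed
      finally have cS: "real (card (DD (\<tau> t))) \<le> S t" by simp
      have W0: "WW y t \<ge> 0" unfolding WW_def using y by (intro sum_nonneg) auto
      have WWb: "y / (norm (of_int c * \<tau> t + of_int d))^2 \<le> WW y t" if "c \<noteq> 0" "1 < y / (norm (of_int c * \<tau> t + of_int d))^2" for c d
        by (rule WW_ge[OF y _ _ _ that]) (use t in \<open>auto simp: \<tau>_def\<close>)
      have "Im (\<tau> t) powr (1/4) * norm (FF x (\<tau> t)) \<le> Nx x * (2 * real (card {(a',b',c',d')\<in>DD (\<tau> t). \<bar>0\<bar> \<le> \<bar>c'\<bar>}) + (K+1) * (1 + WW y t))"
        by (rule FF_count[OF K(1) K(2)[OF x] W0 _ _ _ fD x, where z="\<tau> t" and a=1 and b=0 and c=0 and d=1]) (use y WWb in \<open>simp_all add: ri\<close>)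
      also have "{(a',b',c',d')\<in>DD (\<tau> t). \<bar>0\<bar> \<le> \<bar>c'\<bar>} = DD (\<tau> t)" by auto
      also have "Nx x * (2 * real (card (DD (\<tau> t))) + (K+1) * (1 + WW y t)) \<le> Nx x * (2 * S t + (K+1) * (1 + WW y t))"
        using cS N by (intro mult_left_mono) auto
      finally have "y powr (-1/4) * (y powr (1/4) * norm (FF x (\<tau> t))) \<le> y powr (-1/4) * (Nx x * (2 * S t + (K+1) * (1 + WW y t)))"
        unfolding ri by (rule mult_left_mono) simp
      moreover have "y powr (-1/4) * (y powr (1/4) * norm (FF x (\<tau> t))) = norm (FF x (\<tau> t))"
        using y by (simp add: mult.assoc[symmetric] flip: powr_add)
      ultimately show ?thesis by (simp only: mult.assoc)
    qed
    have Si: "S integrable_on {0..2}" "integral {0..2} S \<le> 40 * L^2"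
    proof -
      have i: "indicat_real (I q) integrable_on {0..2}" "integral {0..2} (indicat_real (I q)) \<le> 2 * rad q" if "q \<in> QQ y" for q
      proof -
        obtain a b c d where e: "q = (a,b,c,d)" by (cases q) auto
        show "indicat_real (I q) integrable_on {0..2}" "integral {0..2} (indicat_real (I q)) \<le> 2 * rad q"
          using indicator_interval_integral[of "ctr a b c d - rad q" "ctr a b c d + rad q"] radp[OF that] by (simp_all add: I_def e)
      qed
      show "S integrable_on {0..2}" unfolding S_def by (intro Henstock_Kurzweil_Integration.integrable_sum i fQ)
      have "integral {0..2} S = (\<Sum>q\<in>QQ y. integral {0..2} (indicat_real (I q)))"
        unfolding S_def by (intro Henstock_Kurzweil_Integration.integral_sum i fQ)
      also have "\<dots> \<le> (\<Sum>q\<in>QQ y. 2 * rad q)" by (intro sum_mono i)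
      also have "\<dots> \<le> 40 * L^2" unfolding L_def by (rule QQ_sum(2)[OF y])
      finally show "integral {0..2} S \<le> 40 * L^2" .
    qed
    have Wi: "WW y integrable_on {0..2}" "integral {0..2} (WW y) \<le> 7 * pi * L" unfolding L_def by (rule WW_integral[OF y])+
    have cF: "continuous_on {0..2} (\<lambda>t. norm (FF x (\<tau> t)))"
    proof -
      have c1: "continuous_on uhp (FF x)"
        by (intro continuous_at_imp_continuous_on ballI field_differentiable_imp_continuous_at FF_differentiable x) auto
      have c2: "continuous_on {0..2} \<tau>" unfolding \<tau>_def by (intro continuous_intros)
      have "\<tau> ` {0..2} \<subseteq> uhp" by (auto simp: ri y)
      thus ?thesis by (rule continuous_on_norm[OF continuous_on_compose2[OF c1 c2]])
    qed
    define D where "D = y powr (-1/4) * Nx x"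
    have D: "D \<ge> 0" using N by (simp add: D_def)
    have "((\<lambda>t. D * (2 * S t + (K+1) * (1 + WW y t))) has_integral D * (2 * integral {0..2} S + (K+1) * (2 + integral {0..2} (WW y)))) {0..2}"
    proof -
      have "((\<lambda>t::real. 1::real) has_integral 2) {0..2}" using has_integral_const_real[of "1::real" 0 2] by simp
      thus ?thesis using Si(1) Wi(1) by (intro has_integral_mult_right has_integral_add integrable_integral)
    qed
    hence gi: "(\<lambda>t. D * (2 * S t + (K+1) * (1 + WW y t))) integrable_on {0..2}"
      and ge: "integral {0..2} (\<lambda>t. D * (2 * S t + (K+1) * (1 + WW y t))) = D * (2 * integral {0..2} S + (K+1) * (2 + integral {0..2} (WW y)))"
      by (auto simp: has_integral_iff)
    have "integral {0..2} (\<lambda>t. norm (FF x (\<tau> t))) \<le> integral {0..2} (\<lambda>t. D * (2 * S t + (K+1) * (1 + WW y t)))"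
      by (rule integral_le[OF integrable_continuous_real[OF cF] gi]) (use point in \<open>simp add: D_def\<close>)
    also have "\<dots> \<le> D * (2 * (40 * L^2) + (K+1) * (2 + 7 * pi * L))"
      unfolding ge using D Si(2) Wi(2) K(1) by (intro mult_left_mono add_mono) auto
    also have "\<dots> \<le> D * (C * L^2)"
    proof (rule mult_left_mono[OF _ D])
      have "1 * 1 \<le> L * L" "1 * L \<le> L * L" using L by (intro mult_mono; simp)+
      hence L2: "1 \<le> L^2" "L \<le> L^2" by (simp_all add: power2_eq_square)
      have "7 * pi * L \<le> 7 * pi * L^2" using L2 by (intro mult_left_mono) auto
      moreover have "2 \<le> 2 * L^2" using L2 by simp
      ultimately have "2 + 7 * pi * L \<le> (2 + 7 * pi) * L^2" unfolding distrib_right by (intro add_mono)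
      hence "(K+1) * (2 + 7 * pi * L) \<le> (K+1) * ((2 + 7 * pi) * L^2)" using K(1) by (intro mult_left_mono) auto
      thus "2 * (40 * L^2) + (K+1) * (2 + 7 * pi * L) \<le> C * L^2" by (simp add: C_def algebra_simps)
    qed
    finally show "integral {0..2} (\<lambda>t. norm (FF x (of_real t + \<i> * of_real y))) \<le> C * Nx x * y powr (-1/4) * (1 + ln (1/y))^2"
      by (simp add: \<tau>_def D_def L_def mult_ac)
  qed
qed

section \<open>Fourier coefficients\<close>

lemma FF_continuous:
  assumes "x \<ge> 0" "y > 0"
  shows "continuous_on S (\<lambda>t::real. norm (FF x (of_real t + \<i> * of_real y)))"
proof -
  have c1: "continuous_on uhp (FF x)"
    by (intro continuous_at_imp_continuous_on ballI field_differentiable_imp_continuous_at FF_differentiable assms(1)) auto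
  have c2: "continuous_on S (\<lambda>t::real. complex_of_real t + \<i> * of_real y)" by (intro continuous_intros)
  have "(\<lambda>t::real. complex_of_real t + \<i> * of_real y) ` S \<subseteq> uhp" using assms by auto
  thus ?thesis by (rule continuous_on_norm[OF continuous_on_compose2[OF c1 c2]])
qed

text \<open>By 2-periodicity \<open>FF\<close> is a function of q = exp(pi i \<tau>) on the
  punctured disc. It is bounded near q = 0, so the singularity is removable and the c n are Taylor
  coefficients; the bound is Cauchy's formula on the circle of radius exp(-pi y).\<close>

lemma FF_coeffs:
  assumes x: "x \<ge> 0"
  obtains c :: "nat \<Rightarrow> complex" where
    "\<And>a. a > 0 \<Longrightarrow> (\<lambda>n. c n * of_real (exp (-(pi * real n * a)))) sums FF x (\<i> * of_real a)"
    "\<And>n y. y > 0 \<Longrightarrow> norm (c n) \<le> exp (pi * real n * y) * (integral {0..2} (\<lambda>t. norm (FF x (of_real t + \<i> * of_real y))) / 2)"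
proof -
  define A where "A = (\<lambda>q. FF x (Ln q / (\<i> * of_real pi)))"
  have A_exp: "A (exp (\<i> * of_real pi * \<tau>)) = FF x \<tau>" for \<tau>
  proof -
    define w where "w = exp (\<i> * of_real pi * \<tau>)"
    have "exp (Ln w) = exp (\<i> * of_real pi * \<tau>)" by (simp add: w_def)
    then obtain k :: int where k: "Ln w = \<i> * of_real pi * \<tau> + of_real (of_int (2 * k) * pi) * \<i>"
      unfolding exp_eq by blast
    have "Ln w / (\<i> * of_real pi) = \<tau> + of_int (2 * k)" unfolding k by (simp add: field_simps)
    thus ?thesis using FF_shift_int[of x \<tau> k] by (simp add: A_def w_def)
  qed
  have Imq: "Im (Ln q / (\<i> * of_real pi)) = - ln (norm q) / pi" if "q \<noteq> 0" for q
    using that by (simp add: Im_divide power2_eq_square)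
  \<comment> \<open>On the cut of \<open>Ln\<close> the same function is rewritten with Ln(-q) and a
    shift by 1, which is regular there.\<close>
  have Aeq: "A q = FF x (Ln (- q) / (\<i> * of_real pi) + 1)" if "q \<noteq> 0" for q
  proof -
    have "\<i> * of_real pi * (Ln (- q) / (\<i> * of_real pi) + 1) = Ln (-q) + \<i> * of_real pi" by (simp add: field_simps)
    hence "exp (\<i> * of_real pi * (Ln (- q) / (\<i> * of_real pi) + 1)) = q" using that by (simp add: exp_add)
    thus ?thesis using A_exp[of "Ln (- q) / (\<i> * of_real pi) + 1"] by simp
  qed
  have Adiff: "A field_differentiable at q" if q: "q \<noteq> 0" "norm q < 1" for q
  proof -
    have lnq: "ln (norm q) < 0" using q by simp
    show ?thesis
    proof (cases "q \<in> \<real>\<^sub>\<le>\<^sub>0")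
      case False
      have "(\<lambda>q. Ln q / (\<i> * of_real pi)) field_differentiable at q"
        by (intro field_differentiable_divide field_differentiable_const field_differentiable_at_Ln) (use False in auto)
      moreover have "FF x field_differentiable at (Ln q / (\<i> * of_real pi))"
        by (rule FF_differentiable[OF x]) (unfold Imq[OF q(1)], use lnq in \<open>simp add: field_simps\<close>)
      ultimately have "FF x \<circ> (\<lambda>q. Ln q / (\<i> * of_real pi)) field_differentiable at q" by (rule field_differentiable_compose)
      thus ?thesis by (simp add: A_def o_def)
    next
      case True
      hence nq: "- q \<notin> \<real>\<^sub>\<le>\<^sub>0" using q(1) by (auto simp: complex_nonpos_Reals_iff complex_eq_iff)
      have uq: "(\<lambda>q. - q) field_differentiable at q" by (intro field_differentiable_minus field_differentiable_ident)
      have "(Ln \<circ> (\<lambda>q. - q)) field_differentiable at q"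
        by (rule field_differentiable_compose[OF uq]) (rule field_differentiable_at_Ln[OF nq])
      hence "(\<lambda>q. Ln (- q) / (\<i> * of_real pi) + 1) field_differentiable at q"
        by (intro field_differentiable_add field_differentiable_divide field_differentiable_const) (auto simp: o_def)
      moreover have "FF x field_differentiable at (Ln (- q) / (\<i> * of_real pi) + 1)"
      proof (rule FF_differentiable[OF x])
        have "Im (Ln (- q) / (\<i> * of_real pi) + 1) = - ln (norm q) / pi" using Imq[of "-q"] q(1) by simp
        moreover have "- ln (norm q) / pi > 0" using lnq by (intro divide_pos_pos) auto
        ultimately show "Im (Ln (- q) / (\<i> * of_real pi) + 1) > 0" by (simp only:)
      qed
      ultimately have "FF x \<circ> (\<lambda>q. Ln (- q) / (\<i> * of_real pi) + 1) field_differentiable at q" by (rule field_differentiable_compose)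
      then obtain d where d: "((\<lambda>q. FF x (Ln (- q) / (\<i> * of_real pi) + 1)) has_field_derivative d) (at q)"
        by (auto simp: field_differentiable_def o_def)
      have "(A has_field_derivative d) (at q)"
        by (rule has_field_derivative_transform_within_open[OF d, of "- {0}"]) (use q Aeq in auto)
      thus ?thesis by (auto simp: field_differentiable_def)
    qed
  qed
  have Ahol: "A holomorphic_on (ball 0 1 - {0})"
    unfolding holomorphic_on_def by (rule ballI, rule field_differentiable_at_within, rule Adiff) auto
  obtain K where K: "K \<ge> 1"
    "\<And>x \<sigma>. x \<ge> 0 \<Longrightarrow> -1 \<le> Re \<sigma> \<Longrightarrow> Re \<sigma> < 1 \<Longrightarrow> norm \<sigma> \<ge> 1 \<Longrightarrow> Im \<sigma> > 0 \<Longrightarrow> norm (base x \<sigma>) \<le> K * Nx x * max 1 (Im \<sigma> powr (-1/4))"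
    by (rule base_bound) blast
  \<comment> \<open>|q| < exp(-pi) means height above 1, so the reduced point lies in the base
    domain and \<open>base_bound\<close> applies.\<close>
  have Abd: "norm (A q) \<le> K * Nx x" if q: "q \<noteq> 0" "norm q < exp (-pi)" for q
  proof -
    define \<tau> where "\<tau> = Ln q / (\<i> * of_real pi)"
    have "ln (norm q) < ln (exp (-pi))" using q by (subst ln_less_cancel_iff) auto
    hence im: "Im \<tau> > 1" unfolding \<tau>_def Imq[OF q(1)] by (simp add: field_simps)
    have im2: "Im (fr \<tau>) > 1" using im by (simp add: fr_bounds)
    have n1: "norm (fr \<tau>) \<ge> 1" using abs_Im_le_cmod[of "fr \<tau>"] im2 by simp
    have "norm (base x (fr \<tau>)) \<le> K * Nx x * max 1 (Im (fr \<tau>) powr (-1/4))"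
      by (rule K(2)[OF x]) (use fr_bounds[of \<tau>] n1 im2 in auto)
    also have "max 1 (Im (fr \<tau>) powr (-1/4)) = 1"
    proof -
      have "Im (fr \<tau>) powr (-1/4) \<le> 1 powr (-1/4)" by (rule powr_mono2') (use im2 in auto)
      thus ?thesis by simp
    qed
    finally show ?thesis using FF_base[OF n1, of x] by (simp add: A_def \<tau>_def)
  qed
  have "\<exists>g. g holomorphic_on ball 0 1 \<and> (\<forall>z\<in>ball 0 1 - {0}. g z = A z)"
  proof (subst holomorphic_on_extend_bounded[OF Ahol])
    show "0 \<in> interior (ball 0 (1::real) :: complex set)" by simp
    have "\<forall>\<^sub>F z in at 0. norm (A z) \<le> K * Nx x"
      unfolding eventually_at using Abd by (intro exI[of _ "exp (-pi)"]) auto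
    thus "\<exists>B. \<forall>\<^sub>F z in at 0. norm (A z) \<le> B" by blast
  qed
  then obtain g where g: "g holomorphic_on ball 0 1" "\<And>z. z \<in> ball 0 1 - {0} \<Longrightarrow> g z = A z" by blast
  define c where "c = (\<lambda>n. (deriv ^^ n) g 0 / fact n)"
  have gexp: "g (exp (\<i> * of_real pi * \<tau>)) = FF x \<tau>" if "Im \<tau> > 0" for \<tau>
    using g(2)[of "exp (\<i> * of_real pi * \<tau>)"] A_exp[of \<tau>] that by simp
  show thesis
  proof (rule that[of c])
    fix a :: real assume a: "a > 0"
    define w where "w = complex_of_real (exp (-(pi * a)))"
    have we: "exp (\<i> * of_real pi * (\<i> * of_real a)) = w"
    proof -
      have "\<i> * of_real pi * (\<i> * of_real a) = complex_of_real (- (pi * a))" by (simp add: algebra_simps)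
      thus ?thesis unfolding w_def by (simp only: exp_of_real)
    qed
    have wb: "w \<in> ball 0 1" using a by (simp add: w_def)
    have "(\<lambda>n. c n * (w - 0)^n) sums g w" unfolding c_def by (rule holomorphic_power_series[OF g(1) wb])
    moreover have "g w = FF x (\<i> * of_real a)" using gexp[of "\<i> * of_real a"] a we by simp
    moreover have "(w - 0)^n = of_real (exp (-(pi * real n * a)))" for n
    proof -
      have "w^n = of_real (exp (-(pi * a)) ^ n)" by (simp add: w_def)
      also have "exp (-(pi * a)) ^ n = exp (-(pi * real n * a))" by (simp add: exp_of_nat_mult[symmetric] mult_ac)
      finally show ?thesis by simp
    qed
    ultimately show "(\<lambda>n. c n * of_real (exp (-(pi * real n * a)))) sums FF x (\<i> * of_real a)" by simp
  next
    fix n and y :: real assume y: "y > 0"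
    define r where "r = exp (-(pi * y))"
    have r: "0 < r" "r < 1" using y by (auto simp: r_def)
    define h where "h = (\<lambda>t::real. norm (FF x (of_real t + \<i> * of_real y)))"
    define I where "I = integral {0..2} h"
    have hI: "(h has_integral I) {0..2}"
      unfolding I_def h_def by (intro integrable_integral integrable_continuous_real FF_continuous x y)
    have h1: "((\<lambda>t. h (2 * t)) has_integral I / 2) {0..1}"
    proof -
      have "((\<lambda>t. h (2 * t)) has_integral (1 / \<bar>2\<bar>) *\<^sub>R I) ((\<lambda>x. x / 2) ` {0..2})" by (rule has_integral_stretch_real[OF hI]) simp
      moreover have "(\<lambda>x. x / 2) ` {0..2} = {0..1::real}" by (simp add: image_divide_atLeastAtMost)
      ultimately show ?thesis by simp
    qed
    define w where "w = (\<lambda>t::real. of_real r * exp (2 * of_real pi * \<i> * of_real t))"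
    have we: "w t = exp (\<i> * of_real pi * (of_real (2 * t) + \<i> * of_real y))" for t
    proof -
      have "\<i> * of_real pi * (of_real (2 * t) + \<i> * of_real y) = of_real (-(pi * y)) + 2 * of_real pi * \<i> * complex_of_real t"
        by (simp add: algebra_simps)
      thus ?thesis by (simp only: w_def r_def exp_add exp_of_real)
    qed
    have gw: "norm (g (w t)) = h (2 * t)" for t
      unfolding we using gexp[of "of_real (2 * t) + \<i> * of_real y"] y by (simp add: h_def)
    have nw: "norm (w t) = r" for t using r by (simp add: w_def norm_mult)
    have CI: "((\<lambda>u. g u / (u - 0) ^ Suc n) has_contour_integral (2 * pi * \<i>) / (fact n) * (deriv ^^ n) g 0) (circlepath 0 r)"
    proof (rule Cauchy_has_contour_integral_higher_derivative_circlepath)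
      show "continuous_on (cball 0 r) g" by (rule holomorphic_on_imp_continuous_on[OF holomorphic_on_subset[OF g(1)]]) (use r in auto)
      show "g holomorphic_on ball 0 r" by (rule holomorphic_on_subset[OF g(1)]) (use r in auto)
    qed (use r in auto)
    define G where "G = (\<lambda>t. g (w t) / (w t) ^ Suc n * (2 * of_real pi * \<i> * w t))"
    have GI: "(G has_integral (2 * pi * \<i>) * c n) {0..1}"
    proof -
      have "((\<lambda>t. g (circlepath 0 r t) / (circlepath 0 r t - 0) ^ Suc n * vector_derivative (circlepath 0 r) (at t)) has_integral (2 * pi * \<i>) / (fact n) * (deriv ^^ n) g 0) {0..1}"
        using CI unfolding has_contour_integral .
      moreover have "g (circlepath 0 r t) / (circlepath 0 r t - 0) ^ Suc n * vector_derivative (circlepath 0 r) (at t) = G t" for t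
      proof -
        have "circlepath 0 r t = w t" by (simp add: circlepath w_def)
        moreover have "vector_derivative (circlepath 0 r) (at t) = 2 * of_real pi * \<i> * w t"
          unfolding vector_derivative_circlepath by (simp add: w_def)
        ultimately show ?thesis by (simp only: G_def diff_zero)
      qed
      ultimately show ?thesis by (simp add: c_def)
    qed
    have Gn: "norm (G t) = 2 * pi / r^n * h (2 * t)" for t
    proof -
      have "w t \<noteq> 0" using nw[of t] r by auto
      hence "G t = 2 * of_real pi * \<i> * (g (w t) / (w t) ^ n)" by (simp add: G_def)
      thus ?thesis by (simp add: norm_mult norm_divide norm_power nw gw)
    qed
    have "norm ((2 * pi * \<i>) * c n) = norm (integral {0..1} G)" using GI by (simp add: integral_unique)
    also have "\<dots> \<le> integral {0..1} (\<lambda>t. 2 * pi / r^n * h (2 * t))"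
    proof (rule Henstock_Kurzweil_Integration.integral_norm_bound_integral)
      show "G integrable_on {0..1}" using GI by blast
      show "(\<lambda>t. 2 * pi / r^n * h (2 * t)) integrable_on {0..1}" using has_integral_mult_right[OF h1] by blast
    qed (simp add: Gn)
    also have "\<dots> = 2 * pi / r^n * (I / 2)" by (rule integral_unique[OF has_integral_mult_right[OF h1]])
    finally have "2 * pi * norm (c n) \<le> 2 * pi * (1 / r^n * (I / 2))" by (simp add: norm_mult)
    hence "norm (c n) \<le> 1 / r^n * (I / 2)" by (rule mult_left_le_imp_le) simp
    also have "1 / r^n = exp (pi * real n * y)"
    proof -
      have "r^n = exp (-(pi * real n * y))" unfolding r_def by (simp add: exp_of_nat_mult[symmetric] mult_ac)
      thus ?thesis by (simp add: exp_minus inverse_eq_divide)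
    qed
    finally show "norm (c n) \<le> exp (pi * real n * y) * (integral {0..2} (\<lambda>t. norm (FF x (of_real t + \<i> * of_real y))) / 2)"
      by (simp add: I_def h_def)
  qed
qed

lemma coeffs_bound:
  obtains C where "C > 0"
    "\<And>x. x \<ge> 0 \<Longrightarrow> \<exists>c::nat \<Rightarrow> real.
       (\<forall>n\<ge>1. \<bar>c n\<bar> \<le> C * Nx x * real n powr (1/4) * (1 + ln (real n))^2) \<and>
       (\<forall>a>0. (\<lambda>n. c n * (exp (-(pi * real n * a)) + exp (-(pi * real n * (1/a))) / sqrt a)) sums
                (exp (-(pi * x * a)) + exp (-(pi * x * (1/a))) / sqrt a))"
proof -
  obtain K where K: "K > 0"
    "\<And>x y. x \<ge> 0 \<Longrightarrow> 0 < y \<Longrightarrow> y \<le> 1 \<Longrightarrow>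
       integral {0..2} (\<lambda>t. norm (FF x (of_real t + \<i> * of_real y))) \<le> K * Nx x * y powr (-1/4) * (1 + ln (1/y))^2"
    by (rule FF_integral_bound) blast
  show thesis
  proof (rule that[of "exp pi * K"])
    show "exp pi * K > 0" using K(1) by simp
    fix x :: real assume x: "x \<ge> 0"
    obtain c where c: "\<And>a. a > 0 \<Longrightarrow> (\<lambda>n. c n * of_real (exp (-(pi * real n * a)))) sums FF x (\<i> * of_real a)"
      "\<And>n y. y > 0 \<Longrightarrow> norm (c n) \<le> exp (pi * real n * y) * (integral {0..2} (\<lambda>t. norm (FF x (of_real t + \<i> * of_real y))) / 2)"
      by (rule FF_coeffs[OF x]) blast
    have b: "\<bar>Re (c n)\<bar> \<le> exp pi * K * Nx x * real n powr (1/4) * (1 + ln (real n))^2" if n: "n \<ge> 1" for n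
    proof -
      \<comment> \<open>At this height the Cauchy factor exp(pi n y) is the constant exp pi, and
        y^(-1/4) becomes n^(1/4).\<close>
      define y where "y = 1 / real n"
      have y: "0 < y" "y \<le> 1" "1/y = real n" "pi * real n * y = pi" using n by (auto simp: y_def)
      have yp: "y powr (-1/4) = real n powr (1/4)" using n by (simp add: y_def powr_divide powr_minus)
      define B where "B = K * Nx x * real n powr (1/4) * (1 + ln (real n))^2"
      have B0: "B \<ge> 0" using K(1) Nx_pos[OF x] by (simp add: B_def)
      define I where "I = integral {0..2} (\<lambda>t. norm (FF x (of_real t + \<i> * of_real y)))"
      have "I \<le> B" using K(2)[OF x y(1,2)] unfolding I_def B_def y(3) yp .
      hence "I / 2 \<le> B" using B0 by simp
      have "\<bar>Re (c n)\<bar> \<le> norm (c n)" by (rule abs_Re_le_cmod)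
      also have "\<dots> \<le> exp pi * (I / 2)" using c(2)[OF y(1), of n] unfolding y(4) I_def .
      also have "\<dots> \<le> exp pi * B" using \<open>I / 2 \<le> B\<close> by simp
      finally show ?thesis by (simp add: B_def mult_ac)
    qed
    \<comment> \<open>The right side of the functional equation on the imaginary axis is real, so
      the real parts of the coefficients satisfy it too.\<close>
    have s: "(\<lambda>n. Re (c n) * (exp (-(pi * real n * a)) + exp (-(pi * real n * (1/a))) / sqrt a)) sums
                (exp (-(pi * x * a)) + exp (-(pi * x * (1/a))) / sqrt a)" if a: "a > 0" for a
    proof -
      have a': "1/a > 0" using a by simp
      have "(\<lambda>n. c n * of_real (exp (-(pi * real n * a))) + c n * of_real (exp (-(pi * real n * (1/a)))) / of_real (sqrt a)) sums
          (FF x (\<i> * of_real a) + FF x (\<i> * of_real (1/a)) / of_real (sqrt a))"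
        by (intro sums_add sums_divide c(1) a a')
      hence "(\<lambda>n. Re (c n * of_real (exp (-(pi * real n * a))) + c n * of_real (exp (-(pi * real n * (1/a)))) / of_real (sqrt a))) sums
          Re (of_real (exp (- (pi * x * a))) + of_real (exp (- (pi * x * (1/a)))) / of_real (sqrt a))"
        unfolding FF_functional[OF a] by (rule sums_Re)
      moreover have "Re (c n * of_real (exp (-(pi * real n * a))) + c n * of_real (exp (-(pi * real n * (1/a)))) / of_real (sqrt a)) =
          Re (c n) * (exp (-(pi * real n * a)) + exp (-(pi * real n * (1/a))) / sqrt a)" for n
        by (simp only: plus_complex.sel Re_complex_of_real Im_complex_of_real Re_divide_of_real times_complex.sel mult_zero_right diff_zero distrib_left times_divide_eq_right)
      moreover have "Re (of_real (exp (- (pi * x * a))) + of_real (exp (- (pi * x * (1/a)))) / of_real (sqrt a)) = exp (-(pi * x * a)) + exp (-(pi * x * (1/a))) / sqrt a"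
        by (simp only: plus_complex.sel Re_complex_of_real Re_divide_of_real)
      ultimately show ?thesis by simp
    qed
    show "\<exists>c::nat \<Rightarrow> real.
       (\<forall>n\<ge>1. \<bar>c n\<bar> \<le> exp pi * K * Nx x * real n powr (1/4) * (1 + ln (real n))^2) \<and>
       (\<forall>a>0. (\<lambda>n. c n * (exp (-(pi * real n * a)) + exp (-(pi * real n * (1/a))) / sqrt a)) sums
                (exp (-(pi * x * a)) + exp (-(pi * x * (1/a))) / sqrt a))"
      using b s by (intro exI[of _ "\<lambda>n. Re (c n)"]) blast
  qed
qed

section \<open>Duality with self-dual functions\<close>

text \<open>Integrating an even u against this kernel yields v plus the Fourier transform of v, where v is the mollification of u at scale 1/sqrt D; a Gaussian u gives a multiple of a Gaussian v.\<close>

definition Ek :: "real \<Rightarrow> real \<Rightarrow> real \<Rightarrow> real" where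
  "Ek D r s = sqrt D * exp (-(pi * D * (r - s)^2)) + exp (-(pi * r^2 / D)) * cos (2 * pi * r * s)"

definition EE :: "real \<Rightarrow> (real \<Rightarrow> real) \<Rightarrow> real \<Rightarrow> real" where
  "EE D u r = (LINT s|lborel. u s * Ek D r s)"

lemma Ek_bound:
  assumes "D > 0"
  shows "\<bar>Ek D r s\<bar> \<le> sqrt D * exp (-(pi * D * (r - s)^2)) + exp (-(pi * r^2 / D))"
proof -
  have "\<bar>exp (-(pi * r^2 / D)) * cos (2 * pi * r * s)\<bar> \<le> exp (-(pi * r^2 / D)) * 1"
    unfolding abs_mult by (intro mult_mono) auto
  moreover have "\<bar>sqrt D * exp (-(pi * D * (r - s)^2))\<bar> = sqrt D * exp (-(pi * D * (r - s)^2))" using assms by simp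
  ultimately show ?thesis unfolding Ek_def by linarith
qed

lemma Ek_bound':
  assumes "D > 0"
  shows "\<bar>Ek D r s\<bar> \<le> sqrt D + 1"
proof -
  have "sqrt D * exp (-(pi * D * (r - s)^2)) \<le> sqrt D * 1" using assms by (intro mult_left_mono) auto
  moreover have "exp (-(pi * r^2 / D)) \<le> 1" using assms by simp
  ultimately show ?thesis using Ek_bound[OF assms, of r s] by linarith
qed

lemma Ek_measurable [measurable]: "Ek D r \<in> borel_measurable borel"
  unfolding Ek_def[abs_def] by measurable

lemma EE_integrable:
  assumes "D > 0" "integrable lborel w"
  shows "integrable lborel (\<lambda>s. w s * Ek D r s)"
proof (rule Bochner_Integration.integrable_bound)
  show "integrable lborel (\<lambda>s. (sqrt D + 1) * w s)" using assms(2) by simp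
  have [measurable]: "w \<in> borel_measurable borel" using assms(2) by auto
  show "(\<lambda>s. w s * Ek D r s) \<in> borel_measurable lborel" by measurable
  show "AE s in lborel. norm (w s * Ek D r s) \<le> norm ((sqrt D + 1) * w s)"
  proof (rule AE_I2)
    fix s
    have "\<bar>w s\<bar> * \<bar>Ek D r s\<bar> \<le> \<bar>w s\<bar> * (sqrt D + 1)" by (intro mult_left_mono Ek_bound' assms(1)) simp
    thus "norm (w s * Ek D r s) \<le> norm ((sqrt D + 1) * w s)" using assms(1) by (simp add: abs_mult mult.commute)
  qed
qed

lemma gauss_shift:
  fixes a D r :: real
  assumes a: "a > 0" and D: "D > 0"
  defines "\<beta> \<equiv> a * D / (a + D)"
  shows "integrable lborel (\<lambda>s. exp (-(pi*a * s^2)) * exp (-(pi * D * (r - s)^2)))"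
    "(LINT s|lborel. exp (-(pi*a * s^2)) * exp (-(pi * D * (r - s)^2))) = exp (-(pi * r^2 * \<beta>)) / sqrt (a + D)"
proof -
  define t where "t = D * r / (a + D)"
  have S: "a + D > 0" using a D by simp
  have nzS: "a + D \<noteq> 0" using S by simp
  define g where "g = (\<lambda>s. exp (-(pi * (a + D) * s^2)))"
  have e: "exp (-(pi*a * s^2)) * exp (-(pi * D * (r - s)^2)) = exp (-(pi * r^2 * \<beta>)) * g (-t + 1 * s)" for s
  proof -
    have "(a + D) * (a * s^2 + D * (r - s)^2) = (a + D) * (r^2 * \<beta> + (a + D) * (-t + 1 * s)^2)"
    proof -
      have 1: "(a + D) * \<beta> = a * D" "(a + D) * t = D * r" using S by (simp_all add: \<beta>_def t_def)
      have "(a + D) * (r^2 * \<beta> + (a + D) * (-t + 1 * s)^2) = r^2 * ((a + D) * \<beta>) + ((a + D) * s - (a + D) * t)^2"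
        by algebra
      also have "\<dots> = (a + D) * (a * s^2 + D * (r - s)^2)" unfolding 1 by algebra
      finally show ?thesis by (rule sym)
    qed
    hence "a * s^2 + D * (r - s)^2 = r^2 * \<beta> + (a + D) * (-t + 1 * s)^2" by (rule mult_left_cancel[OF nzS, THEN iffD1])
    hence "- (pi * (a * s^2 + D * (r - s)^2)) = - (pi * (r^2 * \<beta> + (a + D) * (-t + 1 * s)^2))" by (simp only:)
    hence "-(pi*a * s^2) + -(pi * D * (r - s)^2) = -(pi * r^2 * \<beta>) + -(pi * (a + D) * (-t + 1 * s)^2)"
      by (simp only: distrib_left[of pi "a * s^2"] distrib_left[of pi "r^2 * \<beta>"] minus_add_distrib mult.assoc)
    thus ?thesis unfolding g_def by (simp only: exp_add[symmetric])
  qed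
  have gi: "integrable lborel g" unfolding g_def by (rule gauss_integrable[OF S])
  have gi': "integrable lborel (\<lambda>s. g (-t + 1 * s))" by (rule lborel_integrable_real_affine[OF gi]) simp
  show "integrable lborel (\<lambda>s. exp (-(pi*a * s^2)) * exp (-(pi * D * (r - s)^2)))" unfolding e using gi' by simp
  have "(LINT s|lborel. g (-t + 1 * s)) = (LINT s|lborel. g s)"
    using lborel_integral_real_affine[of 1 g "-t"] by simp
  also have "\<dots> = 1 / sqrt (a + D)" unfolding g_def by (rule gauss_integral[OF S])
  finally show "(LINT s|lborel. exp (-(pi*a * s^2)) * exp (-(pi * D * (r - s)^2))) = exp (-(pi * r^2 * \<beta>)) / sqrt (a + D)"
    unfolding e by simp
qed

lemma gauss_cos:
  fixes a r :: real
  assumes a: "a > 0"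
  shows "integrable lborel (\<lambda>s. exp (-(pi*a * s^2)) * cos (2 * pi * r * s))"
    "(LINT s|lborel. exp (-(pi*a * s^2)) * cos (2 * pi * r * s)) = exp (-(pi * r^2 / a)) / sqrt a"
proof -
  define f where "f = (\<lambda>s::real. complex_of_real (exp (-(pi*a * s^2))) * exp (2*pi*\<i>*r * s))"
  have ef: "exp (2*pi*\<i>*r * complex_of_real s) = cis (2 * pi * r * s)" for s by (simp add: cis_conv_exp mult_ac)
  have fi: "integrable lborel f"
  proof (rule Bochner_Integration.integrable_bound[OF gauss_integrable[OF a]])
    show "f \<in> borel_measurable lborel" unfolding f_def by measurable
    show "AE s in lborel. norm (f s) \<le> norm (exp (-(pi*a * s^2)))" unfolding f_def ef by (simp add: norm_mult)
  qed
  have Re: "Re (f s) = exp (-(pi*a * s^2)) * cos (2 * pi * r * s)" for s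
    unfolding f_def ef by (simp del: of_real_exp)
  show "integrable lborel (\<lambda>s. exp (-(pi*a * s^2)) * cos (2 * pi * r * s))"
    unfolding Re[symmetric] by (rule integrable_Re[OF fi])
  have "(LINT s|lborel. exp (-(pi*a * s^2)) * cos (2 * pi * r * s)) = Re (LINT s|lborel. f s)"
    unfolding Re[symmetric] by (rule integral_Re[OF fi])
  also have "(LINT s|lborel. f s) = complex_of_real (exp (-(pi * r^2 / a)) / sqrt a)"
    unfolding f_def by (rule gauss_fourier[OF a])
  finally show "(LINT s|lborel. exp (-(pi*a * s^2)) * cos (2 * pi * r * s)) = exp (-(pi * r^2 / a)) / sqrt a"
    by (simp only: Re_complex_of_real)
qed

text \<open>Mollification adds reciprocals: 1/\<beta> = 1/a + 1/D. The cut-off Fourier part turns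
  out to be exactly the transform of the mollified Gaussian, with the same prefactor.\<close>

lemma EE_gauss:
  fixes a D r :: real
  assumes a: "a > 0" and D: "D > 0"
  defines "\<beta> \<equiv> a * D / (a + D)"
  shows "EE D (\<lambda>s. exp (-(pi*a * s^2))) r =
    sqrt (D / (a + D)) * (exp (-(pi * r^2 * \<beta>)) + exp (-(pi * r^2 * (1/\<beta>))) / sqrt \<beta>)"
proof -
  have S: "a + D > 0" using a D by simp
  note sh = gauss_shift[OF a D, of r, folded \<beta>_def] and co = gauss_cos[OF a, of r]
  have "EE D (\<lambda>s. exp (-(pi*a * s^2))) r = (LINT s|lborel. sqrt D * (exp (-(pi*a * s^2)) * exp (-(pi * D * (r - s)^2))) +
      exp (-(pi * r^2 / D)) * (exp (-(pi*a * s^2)) * cos (2 * pi * r * s)))"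
    unfolding EE_def Ek_def by (simp only: distrib_left mult_ac)
  also have "\<dots> = sqrt D * (exp (-(pi * r^2 * \<beta>)) / sqrt (a + D)) + exp (-(pi * r^2 / D)) * (exp (-(pi * r^2 / a)) / sqrt a)"
    unfolding sh(2)[symmetric] co(2)[symmetric] by (subst Bochner_Integration.integral_add) (use sh(1) co(1) in auto)
  also have "exp (-(pi * r^2 / D)) * (exp (-(pi * r^2 / a)) / sqrt a) = exp (-(pi * r^2 * (1/\<beta>))) / sqrt a"
  proof -
    have "1/\<beta> = 1/a + 1/D" using a D by (simp add: \<beta>_def field_simps)
    hence "-(pi * r^2 / D) + -(pi * r^2 / a) = -(pi * r^2 * (1/\<beta>))" by (simp add: distrib_left)
    hence "exp (-(pi * r^2 / D)) * exp (-(pi * r^2 / a)) = exp (-(pi * r^2 * (1/\<beta>)))" by (simp only: exp_add[symmetric])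
    thus ?thesis by simp
  qed
  also have "1 / sqrt a = sqrt (D / (a + D)) / sqrt \<beta>"
  proof -
    have "sqrt (D / (a + D)) / sqrt \<beta> = sqrt ((D / (a + D)) / \<beta>)" by (rule real_sqrt_divide[symmetric])
    also have "(D / (a + D)) / \<beta> = 1 / a"
    proof -
      have "\<beta> = a * (D / (a + D))" by (simp add: \<beta>_def)
      moreover have "D / (a + D) \<noteq> 0" using D S by simp
      ultimately show ?thesis by simp
    qed
    finally show ?thesis by (simp add: real_sqrt_divide)
  qed
  hence "exp (-(pi * r^2 * (1/\<beta>))) / sqrt a = exp (-(pi * r^2 * (1/\<beta>))) * (sqrt (D / (a + D)) / sqrt \<beta>)"
    by (simp only: divide_inverse mult_1_left)
  finally show ?thesis by (simp add: real_sqrt_divide distrib_left mult_ac)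
qed

section \<open>The pairing extended from Gaussians to regularised functions\<close>

text \<open>The interpolation identity on each Gaussian plus its transform, evaluated at square
  roots. Cubic growth of the coefficients is a convenient allowance: against decay (1+m)^(-5) it
  leaves the summable (1+m)^(-2).\<close>

definition gpairing :: "(nat \<Rightarrow> real) \<Rightarrow> real \<Rightarrow> real \<Rightarrow> bool" where
  "gpairing c x M \<longleftrightarrow> x \<ge> 0 \<and> (\<forall>m. \<bar>c m\<bar> \<le> M * (1 + real m)^3) \<and>
     (\<forall>a>0. (\<lambda>n. c n * (exp (-(pi * real n * a)) + exp (-(pi * real n * (1/a))) / sqrt a)) sums
                (exp (-(pi * x * a)) + exp (-(pi * x * (1/a))) / sqrt a))"

lemma gpairing_EE_gauss:
  assumes g: "gpairing c x M" and a: "a > 0" and D: "D > 0"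
  shows "(\<lambda>m. c m * EE D (\<lambda>s. exp (-(pi*a * s^2))) (sqrt (real m))) sums EE D (\<lambda>s. exp (-(pi*a * s^2))) (sqrt x)"
proof -
  define \<beta> where "\<beta> = a * D / (a + D)"
  have b: "\<beta> > 0" using a D by (simp add: \<beta>_def)
  have x: "x \<ge> 0" using g by (simp add: gpairing_def)
  have "(\<lambda>n. sqrt (D / (a + D)) * (c n * (exp (-(pi * real n * \<beta>)) + exp (-(pi * real n * (1/\<beta>))) / sqrt \<beta>))) sums
      (sqrt (D / (a + D)) * (exp (-(pi * x * \<beta>)) + exp (-(pi * x * (1/\<beta>))) / sqrt \<beta>))"
    using g b unfolding gpairing_def by (intro sums_mult) blast
  thus ?thesis unfolding EE_gauss[OF a D, folded \<beta>_def] using x by (simp add: mult.left_commute)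
qed

lemma summable_inverse_sq: "summable (\<lambda>m. 1 / (1 + real m)^2)"
proof -
  have "summable (\<lambda>n. inverse (real n ^ 2))" by (rule inverse_power_summable) simp
  hence "summable (\<lambda>n. inverse (real (Suc n) ^ 2))" by (subst summable_Suc_iff)
  thus ?thesis by (simp add: inverse_eq_divide)
qed

lemma gpairing_term:
  assumes g: "gpairing c x M" and h: "\<bar>h\<bar> \<le> K / (1 + real m)^5"
  shows "\<bar>c m * h\<bar> \<le> M * K * (1 / (1 + real m)^2)"
proof -
  have c: "\<bar>c m\<bar> \<le> M * (1 + real m)^3" using g by (simp add: gpairing_def)
  have "\<bar>c m\<bar> * \<bar>h\<bar> \<le> (M * (1 + real m)^3) * (K / (1 + real m)^5)" by (rule mult_mono[OF c h]) (use c in auto)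
  also have "\<dots> = M * K * ((1 + real m)^3 / (1 + real m)^5)" by simp
  also have "(1 + real m)^3 / (1 + real m)^5 = 1 / (1 + real m)^2"
  proof -
    define A where "A = 1 + real m"
    have "A \<noteq> 0" by (simp add: A_def)
    hence "A^3 / (A^3 * A^2) = 1 / A^2" by (intro nonzero_divide_mult_cancel_left) simp
    moreover have "A^5 = A^3 * A^2" by (simp only: power_add[symmetric]) simp
    ultimately have "A^3 / A^5 = 1 / A^2" by (simp only:)
    thus ?thesis unfolding A_def .
  qed
  finally show ?thesis by (simp only: abs_mult)
qed

lemma exp_decay5:
  assumes "t > 0"
  obtains K where "K > 0" "\<And>m. exp (-(t * real m)) \<le> K / (1 + real m)^5"
proof -
  have "(\<lambda>m. (1 + real m)^5 * exp (-(t * real m))) \<longlonglongrightarrow> 0" using assms by real_asymp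
  hence "Bseq (\<lambda>m. (1 + real m)^5 * exp (-(t * real m)))" by (intro convergent_imp_Bseq convergentI)
  then obtain K where K: "K > 0" "\<And>m. norm ((1 + real m)^5 * exp (-(t * real m))) \<le> K" unfolding Bseq_def by blast
  show thesis
  proof (rule that[OF K(1)])
    fix m
    have "(1 + real m)^5 * exp (-(t * real m)) \<le> K" using K(2)[of m] by (simp add: abs_mult)
    thus "exp (-(t * real m)) \<le> K / (1 + real m)^5" by (simp add: field_simps)
  qed
qed

text \<open>The variable v = exp(-pi \<eta> s^2) compactifies the half line s >= 0 to {0..1}, with v
  = 0 at infinity. Polynomials in v are combinations of Gaussians and constants.\<close>

lemma log_chart_continuous:
  fixes b :: "real \<Rightarrow> real"
  assumes b: "continuous_on UNIV b" "(b \<longlongrightarrow> 0) at_top" and \<eta>: "\<eta> > 0"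
  shows "continuous_on {0..1} (\<lambda>v. if v \<le> 0 then 0 else b (sqrt (- ln v / (pi * \<eta>))))"
proof (unfold continuous_on_eq_continuous_within, intro ballI)
  fix v :: real assume v: "v \<in> {0..1}"
  define \<phi> where "\<phi> = (\<lambda>v. if v \<le> 0 then 0 else b (sqrt (- ln v / (pi * \<eta>))))"
  show "continuous (at v within {0..1}) (\<lambda>v. if v \<le> 0 then 0 else b (sqrt (- ln v / (pi * \<eta>))))"
    unfolding \<phi>_def[symmetric]
  proof (cases "v = 0")
    case False
    hence v0: "v > 0" using v by simp
    have "continuous_on {0<..} (\<lambda>v. b (sqrt (- ln v / (pi * \<eta>))))"
      by (intro continuous_on_compose2[OF b(1)] continuous_intros) (use \<eta> in auto)
    hence "continuous_on {0<..} \<phi>" by (rule continuous_on_eq) (auto simp: \<phi>_def)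
    hence "isCont \<phi> v" using v0 by (simp add: continuous_on_eq_continuous_at)
    thus "continuous (at v within {0..1}) \<phi>" by (rule continuous_at_imp_continuous_at_within)
  next
    case True
    have "filterlim (\<lambda>v. sqrt (- ln v / (pi * \<eta>))) at_top (at_right 0)" using \<eta> by real_asymp
    hence "((\<lambda>v. b (sqrt (- ln v / (pi * \<eta>)))) \<longlongrightarrow> 0) (at_right 0)" by (rule filterlim_compose[OF b(2)])
    moreover have "\<forall>\<^sub>F v in at_right 0. b (sqrt (- ln v / (pi * \<eta>))) = \<phi> v"
      unfolding eventually_at_right_field by (intro exI[of _ 1]) (auto simp: \<phi>_def)
    ultimately have "(\<phi> \<longlongrightarrow> 0) (at_right 0)" by (rule Lim_transform_eventually)
    hence "(\<phi> \<longlongrightarrow> 0) (at 0 within {0..1})"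
      using at_within_Icc_at_right[of 0 "1::real"] by simp
    thus "continuous (at v within {0..1}) \<phi>" unfolding True continuous_within by (simp add: \<phi>_def)
  qed
qed

text \<open>In the variable v, b is uniformly close to a polynomial P, so u = b v is close to P(v)
  v, a combination of Gaussians for which the formula holds. The error is at most e times a fixed
  Gaussian; \<open>R\<close> bounds \<open>EE\<close> of such a function and decays exponentially
  along sqrt m, so the defect L is at most a constant times e.\<close>

lemma EE_sums_regularised:
  fixes b :: "real \<Rightarrow> real"
  assumes g: "gpairing c x M" and D: "D > 0" and \<eta>: "\<eta> > 0"
    and b: "continuous_on UNIV b" "(b \<longlongrightarrow> 0) at_top" "\<And>s. b (-s) = b s" "\<And>s. \<bar>b s\<bar> \<le> B"
  defines "u \<equiv> (\<lambda>s. b s * exp (-(pi*\<eta> * s^2)))"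
  shows "(\<lambda>m. c m * EE D u (sqrt (real m))) sums EE D u (sqrt x)"
proof -
  have x: "x \<ge> 0" using g by (simp add: gpairing_def)
  have [measurable]: "b \<in> borel_measurable borel" by (rule borel_measurable_continuous_onI[OF b(1)])
  define \<beta> where "\<beta> = \<eta> * D / (\<eta> + D)"
  have \<beta>: "\<beta> > 0" using \<eta> D by (simp add: \<beta>_def)
  define R where "R = (\<lambda>r. sqrt D * (exp (-(pi * r^2 * \<beta>)) / sqrt (\<eta> + D)) + exp (-(pi * r^2 / D)) * (1 / sqrt \<eta>))"
  have gi: "integrable lborel (\<lambda>s. exp (-(pi*\<eta> * s^2)))" by (rule gauss_integrable[OF \<eta>])
  have wint: "integrable lborel w" if "w \<in> borel_measurable borel" "\<And>s. \<bar>w s\<bar> \<le> e * exp (-(pi*\<eta> * s^2))" for w e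
  proof (rule Bochner_Integration.integrable_bound)
    show "integrable lborel (\<lambda>s. e * exp (-(pi*\<eta> * s^2)))" using gi by simp
    show "w \<in> borel_measurable lborel" using that(1) by simp
    show "AE s in lborel. norm (w s) \<le> norm (e * exp (-(pi*\<eta> * s^2)))"
      using that(2) by (intro AE_I2) (metis abs_ge_self order_trans real_norm_def)
  qed
  have Rb: "\<bar>EE D w r\<bar> \<le> e * R r" if w: "w \<in> borel_measurable borel" "\<And>s. \<bar>w s\<bar> \<le> e * exp (-(pi*\<eta> * s^2))" for w e r
  proof -
    define G where "G = (\<lambda>s. exp (-(pi*\<eta> * s^2)))"
    have sh: "integrable lborel (\<lambda>s. G s * exp (-(pi * D * (r - s)^2)))"
      "(LINT s|lborel. G s * exp (-(pi * D * (r - s)^2))) = exp (-(pi * r^2 * \<beta>)) / sqrt (\<eta> + D)"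
      unfolding G_def \<beta>_def by (rule gauss_shift[OF \<eta> D])+
    have gi': "integrable lborel G" using gi by (simp add: G_def)
    have gint: "(LINT s|lborel. G s) = 1 / sqrt \<eta>" unfolding G_def by (rule gauss_integral[OF \<eta>])
    have i2: "integrable lborel (\<lambda>s. e * (sqrt D * (G s * exp (-(pi * D * (r - s)^2))) + exp (-(pi * r^2 / D)) * G s))"
      using sh(1) gi' by (intro integrable_mult_right Bochner_Integration.integrable_add) auto
    have "\<bar>EE D w r\<bar> \<le> (LINT s|lborel. e * (sqrt D * (G s * exp (-(pi * D * (r - s)^2))) + exp (-(pi * r^2 / D)) * G s))"
      unfolding EE_def
    proof (rule Bochner_Integration.integral_abs_bound_integral[OF EE_integrable[OF D wint[OF w]] i2])
      fix s
      have "\<bar>w s\<bar> * \<bar>Ek D r s\<bar> \<le> (e * G s) * (sqrt D * exp (-(pi * D * (r - s)^2)) + exp (-(pi * r^2 / D)))"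
        unfolding G_def by (rule mult_mono[OF w(2) Ek_bound[OF D]]) (use order_trans[OF abs_ge_zero w(2)] in auto)
      also have "\<dots> = e * (sqrt D * (G s * exp (-(pi * D * (r - s)^2))) + exp (-(pi * r^2 / D)) * G s)"
        by (simp only: distrib_left mult_ac)
      finally show "\<bar>w s * Ek D r s\<bar> \<le> e * (sqrt D * (G s * exp (-(pi * D * (r - s)^2))) + exp (-(pi * r^2 / D)) * G s)"
        by (simp only: abs_mult)
    qed
    also have "\<dots> = e * (sqrt D * (LINT s|lborel. G s * exp (-(pi * D * (r - s)^2))) + exp (-(pi * r^2 / D)) * (LINT s|lborel. G s))"
    proof -
      have "(LINT s|lborel. sqrt D * (G s * exp (-(pi * D * (r - s)^2))) + exp (-(pi * r^2 / D)) * G s) =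
          sqrt D * (LINT s|lborel. G s * exp (-(pi * D * (r - s)^2))) + exp (-(pi * r^2 / D)) * (LINT s|lborel. G s)"
        by (subst Bochner_Integration.integral_add) (use sh(1) gi' in auto)
      thus ?thesis by simp
    qed
    also have "\<dots> = e * R r" unfolding sh(2) gint R_def ..
    finally show ?thesis .
  qed
  obtain K where K: "K > 0" "\<And>m. R (sqrt (real m)) \<le> K / (1 + real m)^5"
  proof -
    have p1: "pi * \<beta> > 0" and p2: "pi / D > 0" using \<beta> D by auto
    obtain K1 where K1: "K1 > 0" "\<And>m. exp (-(pi * \<beta> * real m)) \<le> K1 / (1 + real m)^5" by (rule exp_decay5[OF p1]) blast
    obtain K2 where K2: "K2 > 0" "\<And>m. exp (-(pi / D * real m)) \<le> K2 / (1 + real m)^5" by (rule exp_decay5[OF p2]) blast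
    define K where "K = sqrt D / sqrt (\<eta> + D) * K1 + 1 / sqrt \<eta> * K2"
    have "R (sqrt (real m)) \<le> K / (1 + real m)^5" for m
    proof -
      have "R (sqrt (real m)) = sqrt D / sqrt (\<eta> + D) * exp (-(pi * \<beta> * real m)) + 1 / sqrt \<eta> * exp (-(pi / D * real m))"
        by (simp add: R_def mult_ac)
      also have "\<dots> \<le> sqrt D / sqrt (\<eta> + D) * (K1 / (1 + real m)^5) + 1 / sqrt \<eta> * (K2 / (1 + real m)^5)"
        using D \<eta> by (intro add_mono mult_left_mono K1 K2) auto
      also have "\<dots> = K / (1 + real m)^5" by (simp add: K_def add_divide_distrib)
      finally show ?thesis .
    qed
    moreover have "K > 0" unfolding K_def using K1(1) K2(1) D \<eta> by (intro add_pos_pos mult_pos_pos divide_pos_pos) auto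
    ultimately show thesis using that by blast
  qed
  have R0: "R r \<ge> 0" for r using D \<eta> by (simp add: R_def)
  have sR: "summable (\<lambda>m. \<bar>c m\<bar> * R (sqrt (real m)))"
  proof (rule summable_comparison_test[OF _ summable_mult[OF summable_inverse_sq, of "M * K"]], intro exI allI impI)
    fix m :: nat
    show "norm (\<bar>c m\<bar> * R (sqrt (real m))) \<le> M * K * (1 / (1 + real m)^2)"
      using gpairing_term[OF g, of "R (sqrt (real m))" K m] K(2)[of m] R0[of "sqrt (real m)"] by (simp add: abs_mult)
  qed
  define T where "T = (\<Sum>m. \<bar>c m\<bar> * R (sqrt (real m)))"
  have um [measurable]: "u \<in> borel_measurable borel" unfolding u_def by measurable
  have ub: "\<bar>u s\<bar> \<le> B * exp (-(pi*\<eta> * s^2))" for s unfolding u_def abs_mult using b(4)[of s] by simp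
  have sc: "summable (\<lambda>m. c m * h m)" if "\<And>m. \<bar>h m\<bar> \<le> e * R (sqrt (real m))" for h e
  proof (rule summable_comparison_test[OF _ summable_mult[OF sR, of e]], intro exI allI impI)
    fix m :: nat
    have "\<bar>c m\<bar> * \<bar>h m\<bar> \<le> \<bar>c m\<bar> * (e * R (sqrt (real m)))" using that[of m] by (intro mult_left_mono) auto
    thus "norm (c m * h m) \<le> e * (\<bar>c m\<bar> * R (sqrt (real m)))" by (simp add: abs_mult mult_ac)
  qed
  have su: "summable (\<lambda>m. c m * EE D u (sqrt (real m)))" by (rule sc[OF Rb[OF um ub]])
  define L where "L = (\<Sum>m. c m * EE D u (sqrt (real m))) - EE D u (sqrt x)"
  have small: "\<bar>L\<bar> \<le> e * (T + R (sqrt x))" if e: "e > 0" for e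
  proof -
    define \<phi> where "\<phi> = (\<lambda>v. if v \<le> 0 then 0 else b (sqrt (- ln v / (pi * \<eta>))))"
    have "continuous_on {0..1} \<phi>" unfolding \<phi>_def by (rule log_chart_continuous[OF b(1,2) \<eta>])
    then obtain P where P: "real_polynomial_function P" "\<And>v. v \<in> {0..1} \<Longrightarrow> \<bar>\<phi> v - P v\<bar> < e"
      using Stone_Weierstrass_real_polynomial_function[OF compact_Icc _ e] by metis
    obtain p n where pn: "P = (\<lambda>v. \<Sum>i\<le>n. p i * v ^ i)" using P(1) unfolding real_polynomial_function_iff_sum by blast
    \<comment> \<open>The extra factor v raises every exponent to i + 1, so no constant term, which
      would not be integrable, occurs.\<close>
    define E where "E = (\<lambda>i s. exp (-(pi * (\<eta> * real (Suc i)) * s^2)))"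
    define G where "G = (\<lambda>s. \<Sum>i\<le>(n::nat). p i * E i s)"
    have pos: "\<eta> * real (Suc i) > 0" for i using \<eta> by simp
    have Ei: "integrable lborel (E i)" for i unfolding E_def by (rule gauss_integrable[OF pos])
    have Gi: "integrable lborel G" unfolding G_def by (intro Bochner_Integration.integrable_sum integrable_mult_right Ei)
    have [measurable]: "G \<in> borel_measurable borel" using Gi by auto
    define w where "w = (\<lambda>s. u s - G s)"
    have wm: "w \<in> borel_measurable borel" unfolding w_def by measurable
    have wb: "\<bar>w s\<bar> \<le> e * exp (-(pi*\<eta> * s^2))" for s
    proof -
      define v where "v = exp (-(pi*\<eta> * s^2))"
      have v: "v > 0" "v \<le> 1" using \<eta> by (auto simp: v_def)
      have "sqrt (- ln v / (pi * \<eta>)) = \<bar>s\<bar>" using \<eta> by (simp add: v_def)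
      hence "\<phi> v = b s" using v b(3)[of s] by (cases "s \<ge> 0") (auto simp: \<phi>_def)
      hence us: "u s = \<phi> v * v" by (simp add: u_def v_def)
      have "E i s = v ^ i * v" for i
      proof -
        have "v ^ Suc i = exp (real (Suc i) * (-(pi*\<eta> * s^2)))" unfolding v_def by (rule exp_of_nat_mult[symmetric])
        also have "real (Suc i) * (-(pi*\<eta> * s^2)) = -(pi * (\<eta> * real (Suc i)) * s^2)" by (simp add: mult_ac)
        finally show ?thesis by (simp add: E_def mult.commute)
      qed
      hence "G s = P v * v" by (simp add: G_def pn sum_distrib_right mult.assoc)
      hence "w s = (\<phi> v - P v) * v" using us by (simp add: w_def left_diff_distrib)
      hence "\<bar>w s\<bar> = \<bar>\<phi> v - P v\<bar> * v" using v by (simp add: abs_mult)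
      also have "\<dots> \<le> e * v" using P(2)[of v] v by (intro mult_right_mono) auto
      finally show ?thesis by (simp add: v_def)
    qed
    have EG: "EE D G r = (\<Sum>i\<le>n. p i * EE D (E i) r)" for r
    proof -
      have "EE D G r = (LINT s|lborel. (\<Sum>i\<le>n. p i * (E i s * Ek D r s)))"
        unfolding EE_def G_def by (simp only: sum_distrib_right mult.assoc)
      also have "\<dots> = (\<Sum>i\<le>n. (LINT s|lborel. p i * (E i s * Ek D r s)))"
        by (intro Bochner_Integration.integral_sum integrable_mult_right EE_integrable D Ei)
      finally show ?thesis by (simp add: EE_def)
    qed
    have "(\<lambda>m. \<Sum>i\<le>n. p i * (c m * EE D (E i) (sqrt (real m)))) sums (\<Sum>i\<le>n. p i * EE D (E i) (sqrt x))"
      unfolding E_def by (intro sums_sum sums_mult gpairing_EE_gauss[OF g pos D])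
    hence sG: "(\<lambda>m. c m * EE D G (sqrt (real m))) sums EE D G (sqrt x)"
      unfolding EG by (simp add: sum_distrib_left mult.left_commute)
    have ui: "integrable lborel u" by (rule wint[OF um ub])
    have Ew: "EE D w r = EE D u r - EE D G r" for r
      unfolding EE_def w_def left_diff_distrib by (intro Bochner_Integration.integral_diff EE_integrable D ui Gi)
    have "(\<Sum>m. c m * EE D u (sqrt (real m))) - (\<Sum>m. c m * EE D G (sqrt (real m))) = (\<Sum>m. c m * EE D u (sqrt (real m)) - c m * EE D G (sqrt (real m)))"
      by (rule suminf_diff[OF su sums_summable[OF sG]])
    also have "\<dots> = (\<Sum>m. c m * EE D w (sqrt (real m)))" by (simp only: Ew right_diff_distrib)
    finally have "L = (\<Sum>m. c m * EE D w (sqrt (real m))) - EE D w (sqrt x)"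
      using sums_unique[OF sG] by (simp add: L_def Ew)
    moreover have "\<bar>\<Sum>m. c m * EE D w (sqrt (real m))\<bar> \<le> e * T"
    proof -
      have "norm (\<Sum>m. c m * EE D w (sqrt (real m))) \<le> (\<Sum>m. e * (\<bar>c m\<bar> * R (sqrt (real m))))"
      proof (rule norm_suminf_le[OF _ summable_mult[OF sR]])
        fix m :: nat
        have "\<bar>c m\<bar> * \<bar>EE D w (sqrt (real m))\<bar> \<le> \<bar>c m\<bar> * (e * R (sqrt (real m)))"
          by (intro mult_left_mono Rb[OF wm wb]) simp
        thus "norm (c m * EE D w (sqrt (real m))) \<le> e * (\<bar>c m\<bar> * R (sqrt (real m)))" by (simp add: abs_mult mult_ac)
      qed
      thus ?thesis by (simp add: T_def suminf_mult[OF sR])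
    qed
    moreover have "\<bar>EE D w (sqrt x)\<bar> \<le> e * R (sqrt x)" by (rule Rb[OF wm wb])
    ultimately show ?thesis by (simp add: distrib_left)
  qed
  have "L = 0"
  proof (rule ccontr)
    assume L: "L \<noteq> 0"
    define Q where "Q = T + R (sqrt x) + 1"
    have T0: "T \<ge> 0" unfolding T_def using R0 by (intro suminf_nonneg sR) auto
    have Q: "Q > 0" "T + R (sqrt x) < Q" using T0 R0[of "sqrt x"] by (auto simp: Q_def)
    have "\<bar>L\<bar> \<le> \<bar>L\<bar> / Q * (T + R (sqrt x))" by (rule small) (use L Q in auto)
    also have "\<dots> < \<bar>L\<bar> / Q * Q" using L Q by (intro mult_strict_left_mono) auto
    finally show False using Q by simp
  qed
  thus ?thesis using summable_sums[OF su] by (simp add: L_def)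
qed

section \<open>Decay estimates for the mollification\<close>

lemma integrable_inverse_pow5: "integrable lborel (\<lambda>s::real. 1 / (1 + s^2)^5)"
proof (rule Bochner_Integration.integrable_bound)
  have "einterval (-\<infinity>) \<infinity> = (UNIV :: real set)" by (auto simp: einterval_def)
  thus "integrable lborel (\<lambda>s::real. inverse (1 + s^2))"
    using integrable_inverse_1_plus_square by (simp add: set_integrable_def)
  show "(\<lambda>s::real. 1 / (1 + s^2)^5) \<in> borel_measurable lborel" by measurable
  show "AE s in lborel. norm (1 / (1 + (s::real)^2)^5) \<le> norm (inverse (1 + s^2))"
  proof (rule AE_I2)
    fix s :: real
    have "(1 + s^2)^1 \<le> (1 + s^2)^5" by (rule power_increasing) auto
    thus "norm (1 / (1 + s^2)^5) \<le> norm (inverse (1 + s^2))"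
      by (simp add: divide_simps add_nonneg_eq_0_iff abs_of_nonneg add_pos_nonneg)
  qed
qed

lemma integrable_pow5_gauss: "integrable lborel (\<lambda>v::real. (1 + v^2)^5 * exp (-(pi * v^2)))"
proof (rule Bochner_Integration.integrable_bound)
  show "integrable lborel (\<lambda>v::real. 5^5 * exp (-(pi * (1/2) * v^2)))"
    using gauss_integrable[of "1/2"] by simp
  show "(\<lambda>v::real. (1 + v^2)^5 * exp (-(pi * v^2))) \<in> borel_measurable lborel" by measurable
  show "AE v in lborel. norm ((1 + v^2)^5 * exp (-(pi * v^2))) \<le> norm (5^5 * exp (-(pi * (1/2) * v^2)))"
  proof (rule AE_I2)
    fix v :: real
    have "1 + v^2 \<le> 5 * (1 + v^2/5)" by simp
    also have "\<dots> \<le> 5 * exp (v^2/5)" by (intro mult_left_mono exp_ge_add_one_self) simp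
    finally have "(1 + v^2)^5 \<le> (5 * exp (v^2/5))^5" by (rule power_mono) (simp add: add_nonneg_nonneg)
    also have "\<dots> = 5^5 * exp (v^2)"
      unfolding power_mult_distrib by (simp flip: exp_of_nat_mult)
    also have "v^2 \<le> pi * (1/2) * v^2" using pi_gt3 by (intro mult_right_mono[of 1 _ "v^2", simplified]) auto
    finally have "(1 + v^2)^5 \<le> 5^5 * exp (pi * (1/2) * v^2)" by simp
    hence "(1 + v^2)^5 * exp (-(pi * v^2)) \<le> 5^5 * exp (pi * (1/2) * v^2) * exp (-(pi * v^2))" by (rule mult_right_mono) simp
    also have "\<dots> = 5^5 * exp (-(pi * (1/2) * v^2))"
    proof -
      have "pi * (1/2) * v^2 + -(pi * v^2) = -(pi * (1/2) * v^2)" by simp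
      hence "exp (pi * (1/2) * v^2) * exp (-(pi * v^2)) = exp (-(pi * (1/2) * v^2))" by (simp only: exp_add[symmetric])
      thus ?thesis by simp
    qed
    finally show "norm ((1 + v^2)^5 * exp (-(pi * v^2))) \<le> norm (5^5 * exp (-(pi * (1/2) * v^2)))"
      by (simp add: abs_mult abs_of_nonneg)
  qed
qed

text \<open>The fifth power of Peetre's inequality; before taking powers the difference of the two
  sides is a sum of squares.\<close>

lemma peetre5: "(1 + r^2)^5 \<le> 32 * ((1 + (r + w)^2)^5 * (1 + w^2)^5)" for r w :: real
proof -
  have "1 + r^2 \<le> 2 * ((1 + (r + w)^2) * (1 + w^2))"
  proof -
    have "2 * ((1 + (r + w)^2) * (1 + w^2)) - (1 + r^2) = 1 + (r + 2 * w)^2 + 2 * ((r + w) * w)^2" by algebra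
    moreover have "0 \<le> 1 + (r + 2 * w)^2 + 2 * ((r + w) * w)^2" by simp
    ultimately show ?thesis by linarith
  qed
  hence "(1 + r^2)^5 \<le> (2 * ((1 + (r + w)^2) * (1 + w^2)))^5" by (rule power_mono) simp
  thus ?thesis by (simp add: power_mult_distrib)
qed

context
  fixes w :: "real \<Rightarrow> real" and B :: real
  assumes w: "w \<in> borel_measurable borel" "\<And>s. \<bar>w s\<bar> \<le> B / (1 + s^2)^5"
begin

lemma decay_integrable: "integrable lborel w"
proof (rule Bochner_Integration.integrable_bound)
  show "integrable lborel (\<lambda>s. B * (1 / (1 + s^2)^5))" using integrable_inverse_pow5 by (rule integrable_mult_right)
  show "w \<in> borel_measurable lborel" using w(1) by simp
  show "AE s in lborel. norm (w s) \<le> norm (B * (1 / (1 + s^2)^5))"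
    using w(2) by (intro AE_I2) (metis abs_ge_self order_trans real_norm_def times_divide_eq_right mult.right_neutral)
qed

lemma decay_B_nonneg: "B \<ge> 0" using order_trans[OF abs_ge_zero w(2)[of 0]] by simp

text \<open>By \<open>peetre5\<close> a shift by v / sqrt D costs only a polynomial in v, uniformly
  for D >= 1, and the Gaussian absorbs it.\<close>

lemma mollify_pointwise:
  assumes D: "D \<ge> 1"
  shows "\<bar>w (r + v / sqrt D) * exp (-(pi * v^2))\<bar> \<le> 32 * B / (1 + r^2)^5 * ((1 + v^2)^5 * exp (-(pi * v^2)))"
proof -
  define t where "t = v / sqrt D"
  have "t^2 \<le> v^2"
  proof -
    have "t^2 = v^2 / D" using D by (simp add: t_def power_divide)
    also have "\<dots> \<le> v^2 / 1" using D by (intro divide_left_mono) auto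
    finally show ?thesis by simp
  qed
  hence tv: "(1 + t^2)^5 \<le> (1 + v^2)^5" by (intro power_mono) auto
  define A1 A2 A3 where "A1 = (1 + r^2)^5" and "A2 = (1 + (r + t)^2)^5" and "A3 = (1 + v^2)^5"
  have pos: "A1 > 0" "A2 > 0" "A3 > 0" unfolding A1_def A2_def A3_def by (intro zero_less_power add_pos_nonneg; simp)+
  have "A1 \<le> 32 * (A2 * (1 + t^2)^5)" unfolding A1_def A2_def by (rule peetre5)
  also have "\<dots> \<le> 32 * (A2 * A3)" using tv pos unfolding A3_def by (intro mult_left_mono) auto
  finally have A: "A1 \<le> 32 * A3 * A2" by (simp add: mult_ac)
  have "\<bar>w (r + t)\<bar> \<le> B / A2" using w(2)[of "r + t"] by (simp add: A2_def)
  also have "\<dots> \<le> 32 * B / A1 * A3"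
  proof -
    have "B * A1 \<le> B * (32 * A3 * A2)" by (rule mult_left_mono[OF A decay_B_nonneg])
    thus ?thesis using pos by (simp add: field_simps)
  qed
  finally have "\<bar>w (r + t)\<bar> * exp (-(pi * v^2)) \<le> 32 * B / A1 * A3 * exp (-(pi * v^2))" by (rule mult_right_mono) simp
  thus ?thesis by (simp add: abs_mult A1_def A3_def t_def mult.assoc)
qed

lemma mollify_integrable:
  assumes D: "D \<ge> 1"
  shows "integrable lborel (\<lambda>v. w (r + v / sqrt D) * exp (-(pi * v^2)))"
proof (rule Bochner_Integration.integrable_bound)
  show "integrable lborel (\<lambda>v. 32 * B / (1 + r^2)^5 * ((1 + v^2)^5 * exp (-(pi * v^2))))"
    using integrable_pow5_gauss by (rule integrable_mult_right)
  have [measurable]: "w \<in> borel_measurable borel" by (rule w(1))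
  show "(\<lambda>v. w (r + v / sqrt D) * exp (-(pi * v^2))) \<in> borel_measurable lborel" by measurable
  show "AE v in lborel. norm (w (r + v / sqrt D) * exp (-(pi * v^2))) \<le> norm (32 * B / (1 + r^2)^5 * ((1 + v^2)^5 * exp (-(pi * v^2))))"
    by (rule AE_I2) (simp only: real_norm_def order_trans[OF mollify_pointwise[OF D] abs_ge_self])
qed

text \<open>Substituting s = r + v / sqrt D turns the first part of the kernel into a Gaussian
  average of w at scale 1 / sqrt D, ready for the limit of large D.\<close>

lemma EE_split:
  assumes D: "D \<ge> 1"
  shows "EE D w r = (LINT v|lborel. w (r + v / sqrt D) * exp (-(pi * v^2))) + exp (-(pi * r^2 / D)) * (LINT s|lborel. w s * cos (2 * pi * r * s))"
proof -
  define h where "h = (\<lambda>s. w s * (sqrt D * exp (-(pi * D * (r - s)^2))))"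
  have D0: "D > 0" using D by simp
  have [measurable]: "w \<in> borel_measurable borel" by (rule w(1))
  have wi: "integrable lborel w" by (rule decay_integrable)
  have ic: "integrable lborel (\<lambda>s. w s * cos (2 * pi * r * s))"
  proof (rule Bochner_Integration.integrable_bound[OF wi])
    show "AE s in lborel. norm (w s * cos (2 * pi * r * s)) \<le> norm (w s)"
      by (intro AE_I2) (simp add: abs_mult mult_left_le)
  qed measurable
  have ih: "integrable lborel h"
  proof -
    have "integrable lborel (\<lambda>s. w s * Ek D r s - exp (-(pi * r^2 / D)) * (w s * cos (2 * pi * r * s)))"
      by (intro Bochner_Integration.integrable_diff EE_integrable D0 wi integrable_mult_right ic)
    moreover have "w s * Ek D r s - exp (-(pi * r^2 / D)) * (w s * cos (2 * pi * r * s)) = h s" for s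
      by (simp add: h_def Ek_def algebra_simps)
    ultimately show ?thesis by simp
  qed
  have "EE D w r = (LINT s|lborel. h s + exp (-(pi * r^2 / D)) * (w s * cos (2 * pi * r * s)))"
    unfolding EE_def Ek_def h_def by (simp only: distrib_left mult_ac)
  also have "\<dots> = (LINT s|lborel. h s) + exp (-(pi * r^2 / D)) * (LINT s|lborel. w s * cos (2 * pi * r * s))"
    by (subst Bochner_Integration.integral_add) (use ih ic in auto)
  also have "(LINT s|lborel. h s) = \<bar>1 / sqrt D\<bar> *\<^sub>R (LINT v|lborel. h (r + 1 / sqrt D * v))"
    by (rule lborel_integral_real_affine) (use D in simp)
  also have "\<dots> = (LINT v|lborel. 1 / sqrt D * h (r + 1 / sqrt D * v))" using D by simp
  also have "(\<lambda>v. 1 / sqrt D * h (r + 1 / sqrt D * v)) = (\<lambda>v. w (r + v / sqrt D) * exp (-(pi * v^2)))"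
  proof (rule ext)
    fix v
    have "pi * D * (r - (r + 1 / sqrt D * v))^2 = pi * v^2" using D by (simp add: power_divide)
    thus "1 / sqrt D * h (r + 1 / sqrt D * v) = w (r + v / sqrt D) * exp (-(pi * v^2))" using D by (simp add: h_def)
  qed
  finally show ?thesis .
qed

lemma mollify_bound:
  assumes D: "D \<ge> 1"
  shows "\<bar>LINT v|lborel. w (r + v / sqrt D) * exp (-(pi * v^2))\<bar> \<le> 32 * B / (1 + r^2)^5 * (LINT v|lborel. (1 + v^2)^5 * exp (-(pi * v^2)))"
proof -
  have "\<bar>LINT v|lborel. w (r + v / sqrt D) * exp (-(pi * v^2))\<bar> \<le> (LINT v|lborel. 32 * B / (1 + r^2)^5 * ((1 + v^2)^5 * exp (-(pi * v^2))))"
    by (intro Bochner_Integration.integral_abs_bound_integral mollify_integrable D integrable_mult_right integrable_pow5_gauss mollify_pointwise)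
  thus ?thesis by simp
qed

text \<open>The Fourier part is controlled only through its cut-off exp(-pi r^2 / D), so this decay
  in r is not uniform in D; it serves a limit at fixed D.\<close>

lemma EE_bound:
  assumes D: "D \<ge> 1"
  shows "\<bar>EE D w r\<bar> \<le> 32 * B / (1 + r^2)^5 * (LINT v|lborel. (1 + v^2)^5 * exp (-(pi * v^2)))
           + exp (-(pi * r^2 / D)) * (B * (LINT s|lborel. 1 / (1 + s^2)^5))"
proof -
  have [measurable]: "w \<in> borel_measurable borel" by (rule w(1))
  have pt: "\<bar>w s * cos (2 * pi * r * s)\<bar> \<le> B * (1 / (1 + s^2)^5)" for s
  proof -
    have "\<bar>w s * cos (2 * pi * r * s)\<bar> \<le> \<bar>w s\<bar>" by (simp add: abs_mult mult_left_le)
    thus ?thesis using w(2)[of s] by simp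
  qed
  have ic: "integrable lborel (\<lambda>s. w s * cos (2 * pi * r * s))"
  proof (rule Bochner_Integration.integrable_bound[OF decay_integrable])
    show "AE s in lborel. norm (w s * cos (2 * pi * r * s)) \<le> norm (w s)"
      by (intro AE_I2) (simp add: abs_mult mult_left_le)
  qed measurable
  have "\<bar>LINT s|lborel. w s * cos (2 * pi * r * s)\<bar> \<le> (LINT s|lborel. B * (1 / (1 + s^2)^5))"
    by (rule Bochner_Integration.integral_abs_bound_integral[OF ic integrable_mult_right[OF integrable_inverse_pow5] pt])
  also have "\<dots> = B * (LINT s|lborel. 1 / (1 + s^2)^5)" by (rule integral_mult_right_zero)
  finally have "\<bar>exp (-(pi * r^2 / D)) * (LINT s|lborel. w s * cos (2 * pi * r * s))\<bar> \<le> exp (-(pi * r^2 / D)) * (B * (LINT s|lborel. 1 / (1 + s^2)^5))"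
    unfolding abs_mult by (intro mult_mono) auto
  thus ?thesis unfolding EE_split[OF D] using mollify_bound[OF D, of r] by linarith
qed

end

lemma suminf_limit:
  fixes a :: "nat \<Rightarrow> nat \<Rightarrow> real"
  assumes lim: "\<And>m. (\<lambda>k. a m k) \<longlonglongrightarrow> l m" and bd: "\<And>m k. \<bar>a m k\<bar> \<le> Q m" and Q: "summable Q"
    and s: "\<And>k. (\<lambda>m. a m k) sums S k" and S: "S \<longlonglongrightarrow> T"
  shows "l sums T"
proof -
  have t: "eventually (\<lambda>n. summable (\<lambda>k. norm (a k n))) sequentially \<and> summable (\<lambda>n. norm (l n)) \<and> ((\<lambda>n. suminf (\<lambda>k. a k n)) \<longlongrightarrow> suminf l) sequentially"
    by (rule tannerys_theorem[OF lim _ Q]) (use bd in \<open>auto intro!: always_eventually\<close>)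
  have "(\<lambda>n. suminf (\<lambda>k. a k n)) = S" using s by (auto simp: sums_iff)
  hence "suminf l = T" using t S LIMSEQ_unique by auto
  moreover have "summable l" using t summable_norm_cancel by blast
  ultimately show ?thesis by (simp add: sums_iff)
qed

text \<open>Two limits. At fixed D the Gaussian regularisation of b is removed; then D grows and
  \<open>EE\<close> D b tends to b plus its Fourier transform, that is to 2b. In the second limit
  self-duality supplies domination uniform in D: the Fourier part is b itself times a factor at most
  1.\<close>

lemma gpairing_self_dual:
  fixes b :: "real \<Rightarrow> real"
  assumes g: "gpairing c x M"
    and b: "continuous_on UNIV b" "\<And>s. b (-s) = b s" "\<And>s. \<bar>b s\<bar> \<le> B / (1 + s^2)^5"
    and dual: "\<And>r. (LINT s|lborel. b s * cos (2 * pi * r * s)) = b r"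
  shows "(\<lambda>m. c m * b (sqrt (real m))) sums b (sqrt x)"
proof -
  have x: "x \<ge> 0" using g by (simp add: gpairing_def)
  have bm [measurable]: "b \<in> borel_measurable borel" by (rule borel_measurable_continuous_onI[OF b(1)])
  have B: "B \<ge> 0" using order_trans[OF abs_ge_zero b(3)[of 0]] by simp
  have b0: "(b \<longlongrightarrow> 0) at_top"
  proof (rule Lim_null_comparison)
    show "\<forall>\<^sub>F s in at_top. norm (b s) \<le> B / (1 + s^2)^5" using b(3) by (intro always_eventually) auto
    show "((\<lambda>s. B / (1 + s^2)^5) \<longlongrightarrow> 0) at_top" by real_asymp
  qed
  have bB: "\<bar>b s\<bar> \<le> B" for s
  proof -
    have "B / (1 + s^2)^5 \<le> B / 1" using B by (intro divide_left_mono one_le_power) (auto intro!: zero_less_power add_pos_nonneg)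
    thus ?thesis using b(3)[of s] by simp
  qed
  have bi: "integrable lborel b" by (rule decay_integrable[OF bm b(3)])
  define K0 K1 where "K0 = (LINT v|lborel. (1 + v^2)^5 * exp (-(pi * v^2)))" and "K1 = (LINT s|lborel. 1 / (1 + s^2)^5 :: real)"
  have K0: "K0 \<ge> 0" unfolding K0_def by (intro Bochner_Integration.integral_nonneg) auto
  have step1: "(\<lambda>m. c m * EE D b (sqrt (real m))) sums EE D b (sqrt x)" if D: "D \<ge> 1" for D
  proof -
    have D0: "D > 0" using D by simp
    define \<eta> where "\<eta> = (\<lambda>k. 1 / real (Suc k))"
    define u where "u = (\<lambda>k s. b s * exp (-(pi * \<eta> k * s^2)))"
    have \<eta>: "\<eta> k > 0" for k by (simp add: \<eta>_def)
    have um: "u k \<in> borel_measurable borel" for k unfolding u_def by measurable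
    have ub: "\<bar>u k s\<bar> \<le> \<bar>b s\<bar>" for k s
    proof -
      have "0 \<le> pi * \<eta> k * s^2" using \<eta>[of k] by simp
      hence "exp (-(pi * \<eta> k * s^2)) \<le> 1" by simp
      thus ?thesis unfolding u_def abs_mult by (simp add: mult_left_le)
    qed
    have ub': "\<bar>u k s\<bar> \<le> B / (1 + s^2)^5" for k s using ub b(3) order_trans by blast
    have lim: "(\<lambda>k. EE D (u k) r) \<longlonglongrightarrow> EE D b r" for r
      unfolding EE_def
    proof (rule integral_dominated_convergence)
      show "integrable lborel (\<lambda>s. (sqrt D + 1) * \<bar>b s\<bar>)" using bi by (intro integrable_mult_right integrable_abs)
      show "AE s in lborel. (\<lambda>k. u k s * Ek D r s) \<longlonglongrightarrow> b s * Ek D r s"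
      proof (rule AE_I2)
        fix s
        have "\<eta> \<longlonglongrightarrow> 0" unfolding \<eta>_def by (rule LIMSEQ_divide_realpow_zero[of 2 1, simplified] | real_asymp)
        hence "(\<lambda>k. b s * exp (-(pi * \<eta> k * s^2)) * Ek D r s) \<longlonglongrightarrow> b s * exp (-(pi * 0 * s^2)) * Ek D r s"
          by (intro tendsto_intros)
        thus "(\<lambda>k. u k s * Ek D r s) \<longlonglongrightarrow> b s * Ek D r s" by (simp add: u_def)
      qed
      show "AE s in lborel. norm (u k s * Ek D r s) \<le> (sqrt D + 1) * \<bar>b s\<bar>" for k
      proof (rule AE_I2)
        fix s
        have "\<bar>u k s\<bar> * \<bar>Ek D r s\<bar> \<le> \<bar>b s\<bar> * (sqrt D + 1)" by (rule mult_mono[OF ub Ek_bound'[OF D0]]) auto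
        thus "norm (u k s * Ek D r s) \<le> (sqrt D + 1) * \<bar>b s\<bar>" by (simp add: abs_mult mult.commute)
      qed
    next
      show "(\<lambda>s. b s * Ek D r s) \<in> borel_measurable lborel" by measurable
      show "(\<lambda>s. u k s * Ek D r s) \<in> borel_measurable lborel" for k using um[of k] by measurable
    qed
    have pD: "pi / D > 0" using D0 by simp
    obtain K2 where K2: "K2 > 0" "\<And>m. exp (-(pi / D * real m)) \<le> K2 / (1 + real m)^5" by (rule exp_decay5[OF pD]) blast
    have K1: "K1 \<ge> 0" unfolding K1_def by (intro Bochner_Integration.integral_nonneg) auto
    define K where "K = 32 * B * K0 + K2 * (B * K1)"
    have EB: "\<bar>EE D (u k) (sqrt (real m))\<bar> \<le> K / (1 + real m)^5" for k m
    proof -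
      have "\<bar>EE D (u k) (sqrt (real m))\<bar> \<le> 32 * B / (1 + real m)^5 * K0 + exp (-(pi / D * real m)) * (B * K1)"
        using EE_bound[OF um ub' D, of k "sqrt (real m)"] unfolding K0_def K1_def by simp
      also have "\<dots> \<le> 32 * B / (1 + real m)^5 * K0 + K2 / (1 + real m)^5 * (B * K1)"
        using K1 B by (intro add_left_mono mult_right_mono K2) auto
      also have "\<dots> = K / (1 + real m)^5" by (simp add: K_def add_divide_distrib)
      finally show ?thesis .
    qed
    show ?thesis
    proof (rule suminf_limit)
      show "(\<lambda>k. c m * EE D (u k) (sqrt (real m))) \<longlonglongrightarrow> c m * EE D b (sqrt (real m))" for m
        by (intro tendsto_mult lim tendsto_const)
      show "\<bar>c m * EE D (u k) (sqrt (real m))\<bar> \<le> M * K * (1 / (1 + real m)^2)" for m k by (rule gpairing_term[OF g EB])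
      show "summable (\<lambda>m. M * K * (1 / (1 + real m)^2))" by (rule summable_mult[OF summable_inverse_sq])
      show "(\<lambda>m. c m * EE D (u k) (sqrt (real m))) sums EE D (u k) (sqrt x)" for k
        unfolding u_def by (rule EE_sums_regularised[OF g D0 \<eta> b(1) b0 b(2) bB])
      show "(\<lambda>k. EE D (u k) (sqrt x)) \<longlonglongrightarrow> EE D b (sqrt x)" by (rule lim)
    qed
  qed
  define D where "D = (\<lambda>k. real (Suc k))"
  have D1: "D k \<ge> 1" for k by (simp add: D_def)
  have split: "EE (D k) b r = (LINT v|lborel. b (r + v / sqrt (D k)) * exp (-(pi * v^2))) + exp (-(pi * r^2 / D k)) * b r" for k r
    using EE_split[OF bm b(3) D1, of k r] unfolding dual .
  have lim: "(\<lambda>k. EE (D k) b r) \<longlonglongrightarrow> 2 * b r" for r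
  proof -
    have "(\<lambda>k. LINT v|lborel. b (r + v / sqrt (D k)) * exp (-(pi * v^2))) \<longlonglongrightarrow> (LINT v|lborel. b r * exp (-(pi * v^2)))"
    proof (rule integral_dominated_convergence)
      show "integrable lborel (\<lambda>v. B * exp (-(pi * v^2)))" using gauss_integrable[of 1] by simp
      show "AE v in lborel. (\<lambda>k. b (r + v / sqrt (D k)) * exp (-(pi * v^2))) \<longlonglongrightarrow> b r * exp (-(pi * v^2))"
      proof (rule AE_I2)
        fix v
        have "(\<lambda>k. r + v / sqrt (D k)) \<longlonglongrightarrow> r" unfolding D_def by real_asymp
        moreover have "isCont b r" using b(1) by (simp add: continuous_on_eq_continuous_at)
        ultimately have "(\<lambda>k. b (r + v / sqrt (D k))) \<longlonglongrightarrow> b r" by (metis isCont_tendsto_compose)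
        thus "(\<lambda>k. b (r + v / sqrt (D k)) * exp (-(pi * v^2))) \<longlonglongrightarrow> b r * exp (-(pi * v^2))"
          by (intro tendsto_mult tendsto_const)
      qed
      show "AE v in lborel. norm (b (r + v / sqrt (D k)) * exp (-(pi * v^2))) \<le> B * exp (-(pi * v^2))" for k
        using bB by (intro AE_I2) (simp add: abs_mult)
    next
      show "(\<lambda>v. b r * exp (-(pi * v^2))) \<in> borel_measurable lborel" by measurable
      show "(\<lambda>v. b (r + v / sqrt (D k)) * exp (-(pi * v^2))) \<in> borel_measurable lborel" for k by measurable
    qed
    also have "(LINT v|lborel. b r * exp (-(pi * v^2))) = b r" using gauss_integral[of 1] by simp
    finally have 1: "(\<lambda>k. LINT v|lborel. b (r + v / sqrt (D k)) * exp (-(pi * v^2))) \<longlonglongrightarrow> b r" .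
    have "(\<lambda>k. exp (-(pi * r^2 / D k))) \<longlonglongrightarrow> 1" unfolding D_def by real_asymp
    hence "(\<lambda>k. exp (-(pi * r^2 / D k)) * b r) \<longlonglongrightarrow> 1 * b r" by (intro tendsto_mult tendsto_const)
    from tendsto_add[OF 1 this] show ?thesis unfolding split by simp
  qed
  have EB: "\<bar>EE (D k) b (sqrt (real m))\<bar> \<le> (32 * B * K0 + B) / (1 + real m)^5" for k m
  proof -
    have "\<bar>LINT v|lborel. b (sqrt (real m) + v / sqrt (D k)) * exp (-(pi * v^2))\<bar> \<le> 32 * B / (1 + real m)^5 * K0"
      using mollify_bound[OF bm b(3) D1, of "sqrt (real m)" k] unfolding K0_def by simp
    moreover have "\<bar>exp (-(pi * (sqrt (real m))^2 / D k)) * b (sqrt (real m))\<bar> \<le> B / (1 + real m)^5"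
    proof -
      have "exp (-(pi * (sqrt (real m))^2 / D k)) \<le> 1" using D1[of k] by simp
      hence "exp (-(pi * (sqrt (real m))^2 / D k)) * \<bar>b (sqrt (real m))\<bar> \<le> 1 * \<bar>b (sqrt (real m))\<bar>" by (rule mult_right_mono) simp
      also have "\<dots> \<le> B / (1 + real m)^5" using b(3)[of "sqrt (real m)"] by simp
      finally show ?thesis by (simp add: abs_mult)
    qed
    ultimately show ?thesis unfolding split by (simp add: add_divide_distrib)
  qed
  have "(\<lambda>m. c m * (2 * b (sqrt (real m)))) sums (2 * b (sqrt x))"
  proof (rule suminf_limit)
    show "(\<lambda>k. c m * EE (D k) b (sqrt (real m))) \<longlonglongrightarrow> c m * (2 * b (sqrt (real m)))" for m
      by (intro tendsto_mult lim tendsto_const)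
    show "\<bar>c m * EE (D k) b (sqrt (real m))\<bar> \<le> M * (32 * B * K0 + B) * (1 / (1 + real m)^2)" for m k by (rule gpairing_term[OF g EB])
    show "summable (\<lambda>m. M * (32 * B * K0 + B) * (1 / (1 + real m)^2))" by (rule summable_mult[OF summable_inverse_sq])
    show "(\<lambda>m. c m * EE (D k) b (sqrt (real m))) sums EE (D k) b (sqrt x)" for k by (rule step1[OF D1])
    show "(\<lambda>k. EE (D k) b (sqrt x)) \<longlonglongrightarrow> 2 * b (sqrt x)" by (rule lim)
  qed
  from sums_divide[OF this, of 2] show ?thesis by (simp add: mult.left_commute)
qed

section \<open>Application to the interpolation basis\<close>

lemma schwartz_decay5:
  assumes "schwartz b"
  obtains B where "\<And>s. \<bar>b s\<bar> \<le> B / (1 + s^2)^5"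
proof -
  have bd: "bounded (range (\<lambda>x. x ^ j * b x))" for j
  proof -
    have "bounded (range (\<lambda>x. x ^ j * (deriv ^^ 0) b x))" using assms unfolding schwartz_def by blast
    thus ?thesis by simp
  qed
  obtain B0 where B0: "\<And>s. \<bar>s ^ 0 * b s\<bar> \<le> B0" using bd[of 0] unfolding bounded_iff by auto
  obtain B1 where B1: "\<And>s. \<bar>s ^ 10 * b s\<bar> \<le> B1" using bd[of 10] unfolding bounded_iff by auto
  show thesis
  proof (rule that[of "32 * (B0 + B1)"])
    fix s :: real
    have "(1 + s^2)^5 \<le> 32 * (1 + s^10)"
    proof -
      have "(1 + s^2)^5 \<le> (2 * max 1 (s^2))^5" by (intro power_mono) auto
      also have "\<dots> = 32 * (max 1 (s^2))^5" by (simp add: power_mult_distrib)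
      also have "(max 1 (s^2))^5 \<le> 1 + s^10"
      proof -
        have "(s^2)^5 = s^10" by (simp only: power_mult[symmetric]) simp
        moreover have "0 \<le> (s^2)^5" by simp
        ultimately show ?thesis by (cases "s^2 \<le> 1") (auto simp: max_def)
      qed
      finally show ?thesis by simp
    qed
    hence "\<bar>b s\<bar> * (1 + s^2)^5 \<le> \<bar>b s\<bar> * (32 * (1 + s^10))" by (rule mult_left_mono) simp
    also have "\<dots> = 32 * (\<bar>s ^ 0 * b s\<bar> + \<bar>s ^ 10 * b s\<bar>)" by (simp add: abs_mult algebra_simps)
    also have "\<dots> \<le> 32 * (B0 + B1)" using B0[of s] B1[of s] by simp
    finally have "\<bar>b s\<bar> * (1 + s^2)^5 \<le> 32 * (B0 + B1)" .
    moreover have "(1 + s^2)^5 > 0" by (intro zero_less_power add_pos_nonneg) auto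
    ultimately show "\<bar>b s\<bar> \<le> 32 * (B0 + B1) / (1 + s^2)^5" by (simp add: pos_le_divide_eq)
  qed
qed

lemma cosine_self_dual:
  assumes i: "integrable lborel b"
    and F: "fourier_transform (\<lambda>x. complex_of_real (b x)) = (\<lambda>\<xi>. complex_of_real (b \<xi>))"
  shows "(LINT s|lborel. b s * cos (2 * pi * r * s)) = b r"
proof -
  define f where "f = (\<lambda>s. complex_of_real (b s) * exp (- 2 * complex_of_real pi * \<i> * complex_of_real (r * s)))"
  have e: "exp (- 2 * complex_of_real pi * \<i> * complex_of_real (r * s)) = cis (- (2 * pi * r * s))" for s
    by (simp add: cis_conv_exp mult_ac)
  have [measurable]: "b \<in> borel_measurable borel" using i by auto
  have fi: "integrable lborel f"
  proof (rule Bochner_Integration.integrable_bound[OF i])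
    show "f \<in> borel_measurable lborel" unfolding f_def by measurable
    show "AE s in lborel. norm (f s) \<le> norm (b s)" unfolding f_def e by (simp add: norm_mult)
  qed
  have Re: "Re (f s) = b s * cos (2 * pi * r * s)" for s unfolding f_def e by simp
  have "(LINT s|lborel. b s * cos (2 * pi * r * s)) = Re (LINT s|lborel. f s)"
    unfolding Re[symmetric] by (rule integral_Re[OF fi])
  also have "(LINT s|lborel. f s) = fourier_transform (\<lambda>x. complex_of_real (b x)) r"
    unfolding fourier_transform_def f_def ..
  finally show ?thesis unfolding F by simp
qed

theorem theorem1p1:
  "\<exists>C::real. C > 0 \<and>
     (\<forall>(n::nat) (b :: real \<Rightarrow> real) (f :: complex \<Rightarrow> complex).
        n \<ge> 1 \<longrightarrow>
        interpolation_basis_plus n b \<longrightarrow>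
        entire_exponential_type pi f \<longrightarrow>
        (\<forall>x\<ge>0. f (complex_of_real x) = complex_of_real (b (sqrt x))) \<longrightarrow>
        (\<forall>x::real. 0 \<le> x \<and> x \<le> real n / 8 \<longrightarrow>
           norm (f (complex_of_real x))
             \<le> C * (1 + (ln (real n))\<^sup>2) * real n powr (1/4) * (1 + x) powr (- 1/4)))"
proof -
  obtain C where C: "C > 0"
    "\<And>x. x \<ge> 0 \<Longrightarrow> \<exists>c::nat \<Rightarrow> real.
       (\<forall>n\<ge>1. \<bar>c n\<bar> \<le> C * Nx x * real n powr (1/4) * (1 + ln (real n))^2) \<and>
       (\<forall>a>0. (\<lambda>n. c n * (exp (-(pi * real n * a)) + exp (-(pi * real n * (1/a))) / sqrt a)) sums
                (exp (-(pi * x * a)) + exp (-(pi * x * (1/a))) / sqrt a))"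
    by (rule coeffs_bound) blast
  show ?thesis
  proof (intro exI[of _ "2 * C"] conjI allI impI)
    show "2 * C > 0" using C(1) by simp
    fix n :: nat and b :: "real \<Rightarrow> real" and f :: "complex \<Rightarrow> complex" and x :: real
    assume n: "n \<ge> 1" and b: "interpolation_basis_plus n b"
      and fb: "\<forall>x\<ge>0. f (complex_of_real x) = complex_of_real (b (sqrt x))" and "0 \<le> x \<and> x \<le> real n / 8"
    hence x: "x \<ge> 0" by simp
    obtain c where c: "\<And>n. n \<ge> 1 \<Longrightarrow> \<bar>c n\<bar> \<le> C * Nx x * real n powr (1/4) * (1 + ln (real n))^2"
      "\<And>a. a > 0 \<Longrightarrow> (\<lambda>n. c n * (exp (-(pi * real n * a)) + exp (-(pi * real n * (1/a))) / sqrt a)) sums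
                (exp (-(pi * x * a)) + exp (-(pi * x * (1/a))) / sqrt a)"
      using C(2)[OF x] by blast
    have N: "0 < Nx x" "Nx x \<le> 1" using Nx_pos[OF x] Nx_le1[OF x] by auto
    \<comment> \<open>For m >= 1, m^(1/4) <= m and (1 + ln m)^2 <= m^2 give the cubic growth; m = 0
      is covered by the first summand.\<close>
    define M where "M = \<bar>c 0\<bar> + C"
    have M: "\<bar>c m\<bar> \<le> M * (1 + real m)^3" for m
    proof (cases "m = 0")
      case True thus ?thesis using C(1) by (simp add: M_def)
    next
      case False
      define y where "y = real m"
      have y: "y \<ge> 1" using False by (simp add: y_def)
      have 1: "y powr (1/4) \<le> y" using powr_mono[of "1/4" 1 y] y by simp
      have 2: "(1 + ln y)^2 \<le> y^2" using ln_le_minus_one[of y] y by (intro power_mono) auto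
      have "\<bar>c m\<bar> \<le> C * Nx x * y powr (1/4) * (1 + ln y)^2" using c(1)[of m] False by (simp add: y_def)
      also have "\<dots> \<le> C * 1 * y * y^2" using C(1) N y by (intro mult_mono 1 2) auto
      also have "\<dots> = C * y^3" by (simp add: power3_eq_cube power2_eq_square)
      also have "\<dots> \<le> M * (1 + y)^3" using C(1) y by (intro mult_mono power_mono) (auto simp: M_def)
      finally show ?thesis by (simp add: y_def)
    qed
    have g: "gpairing c x M" using x M c(2) by (simp add: gpairing_def)
    have bS: "schwartz b" and even: "\<And>s. b (-s) = b s"
      and dual: "fourier_transform (\<lambda>x. complex_of_real (b x)) = (\<lambda>\<xi>. complex_of_real (b \<xi>))"
      and delta: "\<And>m::nat. b (sqrt (real m)) = (if m = n then 1 else 0)"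
      using b by (auto simp: interpolation_basis_plus_def)
    have bc: "continuous_on UNIV b"
    proof (rule continuous_at_imp_continuous_on, rule ballI)
      fix s
      have "(deriv ^^ 0) b differentiable (at s)" using bS unfolding schwartz_def by blast
      thus "isCont b s" by (simp add: differentiable_imp_continuous_within)
    qed
    obtain B where B: "\<And>s. \<bar>b s\<bar> \<le> B / (1 + s^2)^5" by (rule schwartz_decay5[OF bS]) blast
    have bi: "integrable lborel b" by (rule decay_integrable[OF borel_measurable_continuous_onI[OF bc] B])
    have s1: "(\<lambda>m. c m * b (sqrt (real m))) sums b (sqrt x)"
      by (rule gpairing_self_dual[OF g bc even B cosine_self_dual[OF bi dual]])
    \<comment> \<open>At the nodes b is a Kronecker delta, so the pairing collapses and b (sqrt x)
      is the single coefficient c n.\<close>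
    have "(\<lambda>m. c m * b (sqrt (real m))) = (\<lambda>m. if m = n then c m else 0)" by (auto simp: delta)
    hence "(\<lambda>m. c m * b (sqrt (real m))) sums c n" using sums_single[of n c] by simp
    hence bx: "b (sqrt x) = c n" using s1 sums_unique2 by blast
    define l where "l = ln (real n)"
    have l: "(1 + l)^2 \<le> 2 * (1 + l^2)"
      using zero_le_power2[of "1 - l"] by (simp add: power2_eq_square algebra_simps)
    have "norm (f (complex_of_real x)) = \<bar>c n\<bar>" using fb x by (simp add: bx)
    also have "\<dots> \<le> C * Nx x * real n powr (1/4) * (1 + l)^2" unfolding l_def by (rule c(1)[OF n])
    also have "\<dots> \<le> C * Nx x * real n powr (1/4) * (2 * (1 + l^2))"
      using C(1) N by (intro mult_left_mono[OF l]) auto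
    also have "\<dots> = 2 * C * (1 + l^2) * real n powr (1/4) * (1 + x) powr (-1/4)"
      by (simp add: Nx_def)
    finally show "norm (f (complex_of_real x)) \<le> 2 * C * (1 + (ln (real n))\<^sup>2) * real n powr (1/4) * (1 + x) powr (- 1/4)"
      unfolding l_def .
  qed
qed

end
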